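(* Let $D$ be a domain in $\mathbb R^n$, $n\ge2$, let $A\subset D$ be a nondegenerate continuum, let $Q:D\to[0,\infty]$ be Lebesgue measurable satisfying the sphere-integrability condition in $D$, and let $\delta,r>0$. Then: (1) if $D$ is bounded, the family $\mathfrak A^{\delta,r}_{A,Q}(D)$ is equi-uniform (hence uniformly light) and uniformly open on every compact set $K\subset D$; (2) if $Q\in L^1(D)$ and $f(x)\ne\infty$ for every $x\in D$ and every $f\in\mathfrak A^{\delta,r}_{A,Q}(D)$, then for every compact $K\subset D$ there exist constants $C,C_1>0$ such that $|f(x)-f(y)|\ge C_1\exp\Big\{-\frac{\|Q\|_{L^1(D)}}{C|x-y|^n}\Big\}$ for all $x,y\in K$ and every $f\in\mathfrak A^{\delta,r}_{A,Q}(D)$.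
   Context: $\overline{\mathbb R^n}$ carries the chordal metric $h(x,y)=\frac{|x-y|}{\sqrt{1+|x|^2}\sqrt{1+|y|^2}}$, $h(x,\infty)=\frac{1}{\sqrt{1+|x|^2}}$; $h(E)=\sup_{x,y\in E}h(x,y)$; $B_h(y_0,r)=\{y:h(y,y_0)<r\}$; $B(x_0,r)$ Euclidean ball; boundaries in $\overline{\mathbb R^n}$. $S(x_0,r)=\{|x-x_0|=r\}$, $A(x_0,r_1,r_2)=\{r_1<|x-x_0|<r_2\}$. $\Gamma(E,F,G)$: paths $\gamma:[a,b]\to\overline{\mathbb R^n}$ with $\gamma(a)\in E$, $\gamma(b)\in F$, $\gamma(t)\in G$ for $a<t<b$; $M$ = conformal $n$-modulus. Ring $Q$-inequality at $x_0$ for radii in $(0,R)$ (with $Q:=0$ outside $D$): $M(f(\Gamma(S(x_0,r_1),S(x_0,r_2),D)))\le\int_{A(x_0,r_1,r_2)\cap D}Q(x)\eta^n(|x-x_0|)\,dm(x)$ for all $0<r_1<r_2<R$ and all measurable $\eta:(r_1,r_2)\to[0,\infty]$ with $\int_{r_1}^{r_2}\eta\,dr\ge1$. Sphere-integrability condition: for each $x_0\in D$ and every $0<r_1<r_2<\sup_{x\in D}|x-x_0|$ there is $E_1\subset[r_1,r_2]$ of positive linear measure such that $Q$ is $\mathcal H^{n-1}$-integrable over $S(x_0,r)$ for every $r\in E_1$. $\mathfrak A^{\delta,r}_{A,Q}(D)$: all homeomorphisms $f:D\to\overline{\mathbb R^n}$ satisfying the ring $Q$-inequality at every $x_0\in D$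 for radii in $(0,\sup_{x\in D}|x-x_0|)$, such that $h(f(A))\ge\delta$ and $h(E)\ge r$ for every connected component $E$ of $\partial f(D)$. Equi-uniform on $K$: for every $\varepsilon>0$ there is $\delta_1>0$ with $h(f(x),f(y))\ge\delta_1$ for all $f$ in the family and all $x,y\in K$ with $h(x,y)\ge\varepsilon$. Uniformly light on $K$: for every $\varepsilon>0$ there is $\delta_1>0$ with $h(f(C))\ge\delta_1$ for all $f$ and all continua $C\subset K$ with $h(C)\ge\varepsilon$. Uniformly open on $K$: for every $\varepsilon_0>0$ there is $r_0>0$ with $B_h(f(x_0),r_0)\subset f(B(x_0,\varepsilon_0))$ for every $f$ and every ball $B(x_0,\varepsilon_0)\subset K$. *)

theory Defs
  imports "HOL-Analysis.Analysis"
begin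

text \<open>Extended space: 'a option, with None playing the role of the point at infinity.\<close>

fun chordal :: "'a::euclidean_space option \<Rightarrow> 'a option \<Rightarrow> real" where
  "chordal (Some x) (Some y) = norm (x - y) / (sqrt (1 + (norm x)^2) * sqrt (1 + (norm y)^2))"
| "chordal (Some x) None = 1 / sqrt (1 + (norm x)^2)"
| "chordal None (Some y) = 1 / sqrt (1 + (norm y)^2)"
| "chordal None None = 0"

definition chordal_diam :: "'a::euclidean_space option set \<Rightarrow> real" where
  "chordal_diam E = (if E = {} then 0 else (SUP pq\<in>E \<times> E. chordal (fst pq) (snd pq)))"

definition chordal_ball :: "'a::euclidean_space option \<Rightarrow> real \<Rightarrow> 'a option set" where
  "chordal_ball y r = {z. chordal z y < r}"

definition chordal_top :: "'a::euclidean_space option topology" where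
  "chordal_top = topology (\<lambda>S. \<forall>p\<in>S. \<exists>e>0. chordal_ball p e \<subseteq> S)"

definition path_var :: "(real \<Rightarrow> 'a::euclidean_space) \<Rightarrow> real \<Rightarrow> real \<Rightarrow> ennreal" where
  "path_var g c d =
     (SUP kt\<in>{(k, t). t 0 = c \<and> t k = d \<and> (\<forall>i<k. t i \<le> t (Suc i))}.
        ennreal (\<Sum>i<fst kt. norm (g (snd kt (Suc i)) - g (snd kt i))))"

text \<open>A path in the extended space is a pair (J, eta) with J an interval of reals.
  Locally rectifiable: every closed subpath avoids infinity and is rectifiable.\<close>
definition loc_rectifiable :: "real set \<Rightarrow> (real \<Rightarrow> 'a::euclidean_space option) \<Rightarrow> bool" where
  "loc_rectifiable J \<eta> \<longleftrightarrow>
     (\<forall>c d. c \<le> d \<and> {c..d} \<subseteq> J \<longrightarrow>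
        (\<forall>t\<in>{c..d}. \<eta> t \<noteq> None) \<and> path_var (the \<circ> \<eta>) c d < \<infinity>)"

definition lineint :: "('a::euclidean_space \<Rightarrow> ennreal) \<Rightarrow> real set \<Rightarrow> (real \<Rightarrow> 'a option) \<Rightarrow> ennreal" where
  "lineint \<rho> J \<eta> =
     (SUP cd\<in>{(c, d). c \<le> d \<and> {c..d} \<subseteq> J}.
        (\<integral>\<^sup>+ t. indicator {fst cd..snd cd} t * \<rho> (the (\<eta> t))
           \<partial>interval_measure (\<lambda>t. enn2real (path_var (the \<circ> \<eta>) (fst cd) (min (snd cd) (max (fst cd) t))))))"

definition modulus :: "(real set \<times> (real \<Rightarrow> 'a::euclidean_space option)) set \<Rightarrow> ennreal" where
  "modulus \<Gamma> =
     (INF \<rho>\<in>{\<rho> :: 'a \<Rightarrow> ennreal. \<rho> \<in> borel_measurable borel \<and>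
              (\<forall>(J, \<eta>)\<in>\<Gamma>. loc_rectifiable J \<eta> \<longrightarrow> 1 \<le> lineint \<rho> J \<eta>)}.
        \<integral>\<^sup>+ x. \<rho> x ^ DIM('a) \<partial>lborel)"

definition curves :: "'a::euclidean_space set \<Rightarrow> 'a set \<Rightarrow> 'a set \<Rightarrow> (real \<times> real \<times> (real \<Rightarrow> 'a)) set" where
  "curves E F G = {(a, b, \<gamma>). a < b \<and> continuous_on {a..b} \<gamma> \<and> \<gamma> a \<in> E \<and> \<gamma> b \<in> F \<and>
                       (\<forall>t\<in>{a<..<b}. \<gamma> t \<in> G)}"

definition image_family :: "('a::euclidean_space \<Rightarrow> 'a option) \<Rightarrow> 'a set \<Rightarrow> (real \<times> real \<times> (real \<Rightarrow> 'a)) set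
     \<Rightarrow> (real set \<times> (real \<Rightarrow> 'a option)) set" where
  "image_family f D \<Gamma> = {({t\<in>{a..b}. \<gamma> t \<in> D}, f \<circ> \<gamma>) | a b \<gamma>. (a, b, \<gamma>) \<in> \<Gamma>}"

definition ring_Q_ineq :: "('a::euclidean_space \<Rightarrow> 'a option) \<Rightarrow> ('a \<Rightarrow> ennreal) \<Rightarrow> 'a set \<Rightarrow> 'a \<Rightarrow> bool" where
  "ring_Q_ineq f Q D x0 \<longleftrightarrow>
     (\<forall>r1 r2. 0 < r1 \<and> r1 < r2 \<and> (\<exists>x\<in>D. r2 < dist x x0) \<longrightarrow>
       (\<forall>\<eta> :: real \<Rightarrow> ennreal. \<eta> \<in> borel_measurable (restrict_space lebesgue {r1<..<r2}) \<and>
            1 \<le> (\<integral>\<^sup>+ t\<in>{r1<..<r2}. \<eta> t \<partial>lebesgue) \<longrightarrow>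
          modulus (image_family f D (curves (sphere x0 r1) (sphere x0 r2) D))
            \<le> (\<integral>\<^sup>+ x\<in>({x. r1 < dist x x0 \<and> dist x x0 < r2} \<inter> D). Q x * \<eta> (dist x x0) ^ DIM('a) \<partial>lebesgue)))"

text \<open>(Unnormalised) s-dimensional Hausdorff measure.\<close>
definition hausdorff_pre :: "nat \<Rightarrow> real \<Rightarrow> 'a::euclidean_space set \<Rightarrow> ennreal" where
  "hausdorff_pre s \<delta> A =
     (INF U\<in>{U :: nat \<Rightarrow> 'a set. A \<subseteq> (\<Union>i. U i) \<and> (\<forall>i. bounded (U i) \<and> diameter (U i) \<le> \<delta>)}.
        (\<Sum>i. ennreal (diameter (U i) ^ s)))"

definition hausdorff_outer :: "nat \<Rightarrow> 'a::euclidean_space set \<Rightarrow> ennreal" where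
  "hausdorff_outer s A = (SUP \<delta>\<in>{0<..}. hausdorff_pre s \<delta> A)"

definition hausdorff_measure :: "nat \<Rightarrow> 'a::euclidean_space measure" where
  "hausdorff_measure s = measure_of UNIV (sets borel) (hausdorff_outer s)"

definition sphere_integrable_at :: "('a::euclidean_space \<Rightarrow> ennreal) \<Rightarrow> 'a set \<Rightarrow> 'a \<Rightarrow> real \<Rightarrow> bool" where
  "sphere_integrable_at Q D x0 r \<longleftrightarrow>
     (let M = completion (hausdorff_measure (DIM('a) - 1));
          Q0 = (\<lambda>x. Q x * indicator D x)
      in Q0 \<in> borel_measurable (restrict_space M (sphere x0 r)) \<and>
         (\<integral>\<^sup>+ x\<in>sphere x0 r. Q0 x \<partial>M) < \<infinity>)"

definition sphere_integrability :: "('a::euclidean_space \<Rightarrow> ennreal) \<Rightarrow> 'a set \<Rightarrow> bool" where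
  "sphere_integrability Q D \<longleftrightarrow>
     (\<forall>x0\<in>D. \<forall>r1 r2. 0 < r1 \<and> r1 < r2 \<and> (\<exists>x\<in>D. r2 < dist x x0) \<longrightarrow>
        (\<exists>E1. E1 \<subseteq> {r1..r2} \<and> E1 \<in> sets lebesgue \<and> 0 < emeasure lebesgue E1 \<and>
              (\<forall>r\<in>E1. sphere_integrable_at Q D x0 r)))"

definition frakA :: "real \<Rightarrow> real \<Rightarrow> 'a::euclidean_space set \<Rightarrow> ('a \<Rightarrow> ennreal) \<Rightarrow> 'a set
     \<Rightarrow> ('a \<Rightarrow> 'a option) set" where
  "frakA \<delta> r A Q D = {f.
     homeomorphic_map (top_of_set D) (subtopology chordal_top (f ` D)) f \<and>
     (\<forall>x0\<in>D. ring_Q_ineq f Q D x0) \<and>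
     \<delta> \<le> chordal_diam (f ` A) \<and>
     (\<forall>E\<in>connected_components_of (subtopology chordal_top (chordal_top frontier_of (f ` D))).
        r \<le> chordal_diam E)}"

definition equi_uniform :: "('a::euclidean_space \<Rightarrow> 'a option) set \<Rightarrow> 'a set \<Rightarrow> bool" where
  "equi_uniform F K \<longleftrightarrow>
     (\<forall>\<epsilon>>0. \<exists>\<delta>1>0. \<forall>f\<in>F. \<forall>x\<in>K. \<forall>y\<in>K.
        \<epsilon> \<le> chordal (Some x) (Some y) \<longrightarrow> \<delta>1 \<le> chordal (f x) (f y))"

definition uniformly_light :: "('a::euclidean_space \<Rightarrow> 'a option) set \<Rightarrow> 'a set \<Rightarrow> bool" where
  "uniformly_light F K \<longleftrightarrow>
     (\<forall>\<epsilon>>0. \<exists>\<delta>1>0. \<forall>f\<in>F. \<forall>C. C \<subseteq> K \<and> C \<noteq> {} \<and> compact C \<and> connected C \<and>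
        \<epsilon> \<le> chordal_diam (Some ` C) \<longrightarrow> \<delta>1 \<le> chordal_diam (f ` C))"

definition uniformly_open :: "('a::euclidean_space \<Rightarrow> 'a option) set \<Rightarrow> 'a set \<Rightarrow> bool" where
  "uniformly_open F K \<longleftrightarrow>
     (\<forall>\<epsilon>0>0. \<exists>r0>0. \<forall>f\<in>F. \<forall>x0. ball x0 \<epsilon>0 \<subseteq> K \<longrightarrow>
        chordal_ball (f x0) r0 \<subseteq> f ` ball x0 \<epsilon>0)"

end

(* Let f be in the class and let x, y be points of D. Through f(x) and f(y) one draws two connected sets that reach
   a fixed chordal distance R from f(x): the images of the rays that leave x and y in opposite directions, or, to
   bound the distance of f(x) from a boundary point of f(D), the image of a path from x into A and a path near a
   boundary component. Small balls around finitely many centres cover the preimage of the first set, and the doubled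
   balls miss the preimage of the second, so a polyline joining the two sets crosses the image of one of the rings. By the
   ring Q-inequality the moduli of the image rings add up to at most some B that does not depend on f, whereas an
   elementary Loewner estimate (averaging the line integral of a density over random polylines in dyadic annuli)
   bounds the total from below by a multiple of log(R / h(f(x), f(y))). Hence
   h(f(x), f(y)) is at least a multiple of exp(- C B).

   For bounded D the centres come from a finite net of D and B is finite by sphere integrability; for integrable Q the
   centres are equally spaced along the ray, the rings have bounded overlap, and B is a multiple of the integral of Q
   divided by |x - y|^n. *)
theory Submission
  imports Defs
begin

section \<open>Line integrals along Lipschitz paths\<close>

text \<open>A map of the class is merely a homeomorphism, so no change of variables is available: it
  enters only through the ring inequality, the openness of its images and the conditions on its
  image. The lower bound therefore has to be proved on the image side, for two curves without any
  regularity. Testing densities on polylines keeps this elementary. Polylines are Lipschitz, so that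
  only an upper bound for \<open>lineint\<close> is required, and four edges suffice to go from any
  face of a cube to any other around its centre. What remains is the question whether a polyline has
  a preimage at all, since it may leave f(D). Either the closed doubled balls lie in D, or the
  polylines are confined to a chordal ball of radius 4R that misses the frontier of f(D); the second
  alternative requires a lower bound, uniform over the class, for the distance to that frontier,
  which is why that bound is proved before the separation of two values. Infinity is absorbed by
  stereographic projection, where chordal distance is Euclidean distance. The exponential comes from
  counting scales: a density of mass at most B + 1 leaves room for at most about (B + 1) / \<kappa>
  annuli of fixed ratio.\<close>

lemma path_var_ge:
  assumes "t 0 = c" "t k = d" "\<And>i. i < k \<Longrightarrow> t i \<le> t (Suc i)"
  shows "ennreal (\<Sum>i<k. norm (g (t (Suc i)) - g (t i))) \<le> path_var g c d"
  unfolding path_var_def by (rule SUP_upper2[of "(k, t)"]) (use assms in auto)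

lemma path_var_leI:
  assumes "\<And>k t. t 0 = c \<Longrightarrow> t k = d \<Longrightarrow> (\<And>i. i < k \<Longrightarrow> t i \<le> t (Suc i)) \<Longrightarrow>
    ennreal (\<Sum>i<k. norm (g (t (Suc i)) - g (t i))) \<le> B"
  shows "path_var g c d \<le> B"
  unfolding path_var_def by (rule SUP_least) (use assms in auto)

lemma partition_mono:
  fixes t :: "nat \<Rightarrow> real"
  assumes "\<And>i. i < k \<Longrightarrow> t i \<le> t (Suc i)" "i \<le> j" "j \<le> k"
  shows "t i \<le> t j"
  using assms(2,3)
proof (induction j rule: dec_induct)
  case (step m)
  then show ?case using assms(1)[of m] by simp
qed simp

lemma path_var_lipschitz:
  fixes g :: "real \<Rightarrow> 'a::euclidean_space"
  assumes lip: "\<And>x y. c \<le> x \<Longrightarrow> x \<le> y \<Longrightarrow> y \<le> d \<Longrightarrow> norm (g y - g x) \<le> L * (y - x)"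
  shows "path_var g c d \<le> ennreal (L * (d - c))"
proof (rule path_var_leI)
  fix k and t :: "nat \<Rightarrow> real"
  assume t: "t 0 = c" "t k = d" "\<And>i. i < k \<Longrightarrow> t i \<le> t (Suc i)"
  have "(\<Sum>i<k. norm (g (t (Suc i)) - g (t i))) \<le> (\<Sum>i<k. L * (t (Suc i) - t i))"
  proof (intro sum_mono lip)
    fix i assume i: "i \<in> {..<k}"
    show "c \<le> t i" using partition_mono[of k t 0 i, OF t(3)] i t by auto
    show "t (Suc i) \<le> d" using partition_mono[of k t "Suc i" k, OF t(3)] i t by auto
    show "t i \<le> t (Suc i)" using t(3) i by auto
  qed
  also have "\<dots> = L * (d - c)"
    using sum_lessThan_telescope[of t k] t by (simp add: sum_distrib_left[symmetric])
  finally show "ennreal (\<Sum>i<k. norm (g (t (Suc i)) - g (t i))) \<le> ennreal (L * (d - c))"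
    by (rule ennreal_leI)
qed

text \<open>Clamping every partition point to \<open>min (t i) s\<close> and to
  \<open>max (t i) s\<close> produces partitions of the two halves over the same index set; only a
  cell containing s is really split, by the triangle inequality through \<open>g s\<close>.\<close>

lemma path_var_triangle:
  fixes g :: "real \<Rightarrow> 'a::euclidean_space"
  assumes "c \<le> s" "s \<le> d"
  shows "path_var g c d \<le> path_var g c s + path_var g s d"
proof (rule path_var_leI)
  fix k and t :: "nat \<Rightarrow> real"
  assume t: "t 0 = c" "t k = d" "\<And>i. i < k \<Longrightarrow> t i \<le> t (Suc i)"
  let ?u = "\<lambda>i. min (t i) s" and ?w = "\<lambda>i. max (t i) s"
  have "(\<Sum>i<k. norm (g (t (Suc i)) - g (t i)))
     \<le> (\<Sum>i<k. norm (g (?u (Suc i)) - g (?u i)) + norm (g (?w (Suc i)) - g (?w i)))"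
  proof (rule sum_mono)
    fix i assume "i \<in> {..<k}"
    then have le: "t i \<le> t (Suc i)" using t by auto
    consider "t (Suc i) \<le> s" | "s \<le> t i" | "t i \<le> s" "s \<le> t (Suc i)" by linarith
    then show "norm (g (t (Suc i)) - g (t i))
       \<le> norm (g (?u (Suc i)) - g (?u i)) + norm (g (?w (Suc i)) - g (?w i))"
    proof cases
      case 3
      have "norm (g (t (Suc i)) - g (t i)) = norm ((g s - g (t i)) + (g (t (Suc i)) - g s))" by simp
      also have "\<dots> \<le> norm (g s - g (t i)) + norm (g (t (Suc i)) - g s)" by (rule norm_triangle_ineq)
      finally show ?thesis using 3 by (simp add: min_def max_def)
    qed (use le in \<open>auto simp: min_def max_def\<close>)
  qed
  also have "\<dots> = (\<Sum>i<k. norm (g (?u (Suc i)) - g (?u i))) + (\<Sum>i<k. norm (g (?w (Suc i)) - g (?w i)))"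
    by (rule sum.distrib)
  finally have "ennreal (\<Sum>i<k. norm (g (t (Suc i)) - g (t i)))
    \<le> ennreal (\<Sum>i<k. norm (g (?u (Suc i)) - g (?u i))) + ennreal (\<Sum>i<k. norm (g (?w (Suc i)) - g (?w i)))"
    by (subst ennreal_plus[symmetric]) (auto intro: ennreal_leI sum_nonneg simp del: ennreal_plus)
  also have "\<dots> \<le> path_var g c s + path_var g s d"
  proof (intro add_mono path_var_ge)
    fix i assume "i < k"
    then have "t i \<le> t (Suc i)" by (rule t)
    then show "?u i \<le> ?u (Suc i)" "?w i \<le> ?w (Suc i)" by linarith+
  qed (use t assms in auto)
  finally show "ennreal (\<Sum>i<k. norm (g (t (Suc i)) - g (t i))) \<le> path_var g c s + path_var g s d" .
qed

lemma path_var_mono: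
  fixes g :: "real \<Rightarrow> 'a::euclidean_space"
  assumes "c \<le> s" "s \<le> d"
  shows "path_var g c s \<le> path_var g c d"
proof (rule path_var_leI)
  fix k and t :: "nat \<Rightarrow> real"
  assume t: "t 0 = c" "t k = s" "\<And>i. i < k \<Longrightarrow> t i \<le> t (Suc i)"
  let ?u = "\<lambda>i. if i \<le> k then t i else d"
  have "ennreal (\<Sum>i<k. norm (g (t (Suc i)) - g (t i))) \<le> ennreal (\<Sum>i<Suc k. norm (g (?u (Suc i)) - g (?u i)))"
    by (intro ennreal_leI) simp
  also have "\<dots> \<le> path_var g c d"
  proof (rule path_var_ge)
    fix i assume "i < Suc k"
    then show "?u i \<le> ?u (Suc i)" using t assms by (cases "i = k") auto
  qed (use t in auto)
  finally show "ennreal (\<Sum>i<k. norm (g (t (Suc i)) - g (t i))) \<le> path_var g c d" .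
qed

text \<open>The defect \<open>L * x - F x\<close> is itself nondecreasing and continuous, so it has
  a Stieltjes measure of its own. The two measures add up to \<open>L\<close> times Lebesgue measure
  on half-open intervals, hence on all Borel sets, and each summand is dominated by the sum.\<close>

lemma interval_measure_le_lborel:
  assumes mono: "\<And>x y. x \<le> y \<Longrightarrow> F x \<le> F y"
    and lip: "\<And>x y. x \<le> y \<Longrightarrow> F y - F x \<le> L * (y - x)" and [measurable]: "A \<in> sets borel"
  shows "emeasure (interval_measure F) A \<le> ennreal L * emeasure lborel A"
proof -
  have L: "0 \<le> L" using mono[of 0 1] lip[of 0 1] by simp
  have contF: "continuous_on UNIV F"
  proof (rule lipschitz_on_continuous_on[of L])
    show "L-lipschitz_on UNIV F"
    proof (rule lipschitz_onI)
      fix x y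
      show "dist (F x) (F y) \<le> L * dist x y"
        using mono[of x y] mono[of y x] lip[of x y] lip[of y x]
        by (cases "x \<le> y") (auto simp: dist_real_def abs_if)
    qed fact
  qed
  define H where "H = (\<lambda>x. L * x - F x)"
  have monoH: "H x \<le> H y" if "x \<le> y" for x y using lip[OF that] by (simp add: H_def algebra_simps)
  have contH: "continuous_on UNIV H" unfolding H_def by (intro continuous_intros contF)
  have rF: "continuous (at_right a) F" and rH: "continuous (at_right a) H" for a
    using contF contH by (auto simp: continuous_on_eq_continuous_at intro: continuous_at_imp_continuous_at_within)
  have eF: "emeasure (interval_measure F) {a<..b} = ennreal (F b - F a)" if "a \<le> b" for a b
    using that mono rF by (intro emeasure_interval_measure_Ioc) auto
  have eH: "emeasure (interval_measure H) {a<..b} = ennreal (H b - H a)" if "a \<le> b" for a b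
    using that monoH rH by (intro emeasure_interval_measure_Ioc) auto
  define N where "N = measure_of (UNIV :: real set) (sets borel) (\<lambda>A. emeasure (interval_measure F) A + emeasure (interval_measure H) A)"
  have N: "emeasure N A = emeasure (interval_measure F) A + emeasure (interval_measure H) A" if "A \<in> sets borel" for A
  proof (rule emeasure_measure_of[OF N_def])
    show "countably_additive (sets N) (\<lambda>A. emeasure (interval_measure F) A + emeasure (interval_measure H) A)"
    proof (rule countably_additiveI)
      fix A :: "nat \<Rightarrow> real set" assume A: "range A \<subseteq> sets N" "disjoint_family A"
      have sb: "sets N = sets borel" unfolding N_def by (simp add: sets.sigma_sets_eq[of borel, simplified])
      show "(\<Sum>i. emeasure (interval_measure F) (A i) + emeasure (interval_measure H) (A i)) =
         emeasure (interval_measure F) (\<Union>i. A i) + emeasure (interval_measure H) (\<Union>i. A i)"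
        using A sb by (subst suminf_add[symmetric]) (auto simp: suminf_emeasure)
    qed
    show "positive (sets N) (\<lambda>A. emeasure (interval_measure F) A + emeasure (interval_measure H) A)"
      by (simp add: positive_def)
    show "A \<in> sets N" using that by (simp add: N_def sets.sigma_sets_eq[of borel, simplified])
  qed simp
  have "N = density lborel (\<lambda>_. ennreal L)"
  proof (rule measure_eqI_generator_eq)
    let ?E = "range (\<lambda>(a, b). {a<..b::real})"
    show "Int_stable ?E"
      by (auto simp: Int_stable_def)
    show "?E \<subseteq> Pow UNIV" by simp
    show "sets N = sigma_sets UNIV ?E"
      by (simp add: N_def borel_sigma_sets_Ioc sigma_sets_sigma_sets_eq)
    show "sets (density lborel (\<lambda>_. ennreal L)) = sigma_sets UNIV ?E"
      by (simp add: borel_sigma_sets_Ioc)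
    show "range (\<lambda>i::nat. {- real i<..real i}) \<subseteq> ?E" by auto
    show "(\<Union>i::nat. {- real i<..real i}) = UNIV"
    proof (intro set_eqI iffI UNIV_I)
      fix x :: real
      obtain i :: nat where "\<bar>x\<bar> < real i" using reals_Archimedean2 by blast
      then show "x \<in> (\<Union>i::nat. {- real i<..real i})" by (intro UN_I[of i]) auto
    qed
    fix X assume "X \<in> ?E"
    then obtain a b where X: "X = {a<..b}" by auto
    show "emeasure N X = emeasure (density lborel (\<lambda>_. ennreal L)) X"
    proof (cases "a \<le> b")
      case True
      have "emeasure N X = ennreal (F b - F a) + ennreal (H b - H a)" using True by (simp add: N X eF eH)
      also have "\<dots> = ennreal (L * (b - a))"
        using mono[OF True] monoH[OF True] by (simp add: ennreal_plus[symmetric] H_def algebra_simps del: ennreal_plus)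
      also have "\<dots> = emeasure (density lborel (\<lambda>_. ennreal L)) X"
        using True L by (simp add: X emeasure_density nn_integral_cmult_indicator ennreal_mult)
      finally show ?thesis .
    qed (simp add: X)
  next
    fix i :: nat
    show "emeasure N {- real i<..real i} \<noteq> \<infinity>" by (simp add: N eF eH)
  qed
  then have "emeasure N A = ennreal L * emeasure lborel A"
    by (simp add: emeasure_density nn_integral_cmult_indicator)
  then have "ennreal L * emeasure lborel A = emeasure (interval_measure F) A + emeasure (interval_measure H) A"
    by (simp add: N)
  then show ?thesis by simp
qed

lemma nn_integral_interval_measure_le:
  assumes mono: "\<And>x y. x \<le> y \<Longrightarrow> F x \<le> F y"
    and lip: "\<And>x y. x \<le> y \<Longrightarrow> F y - F x \<le> L * (y - x)" and [measurable]: "h \<in> borel_measurable borel"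
  shows "(\<integral>\<^sup>+x. h x \<partial>interval_measure F) \<le> ennreal L * (\<integral>\<^sup>+x. h x \<partial>lborel)"
proof -
  have "interval_measure F \<le> density lborel (\<lambda>_. ennreal L)"
  proof (subst le_measure)
    show "\<forall>A\<in>sets (interval_measure F). emeasure (interval_measure F) A \<le> emeasure (density lborel (\<lambda>_. ennreal L)) A"
      using interval_measure_le_lborel[OF mono lip]
      by (auto simp: emeasure_density nn_integral_cmult_indicator)
  qed simp
  then have "(\<integral>\<^sup>+x. h x \<partial>interval_measure F) \<le> (\<integral>\<^sup>+x. h x \<partial>density lborel (\<lambda>_. ennreal L))"
    by (intro nn_integral_mono_measure) auto
  then show ?thesis by (simp add: nn_integral_density nn_integral_cmult)
qed

text \<open>The variation function of a Lipschitz path is \<open>L\<close>-Lipschitz, so its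
  Stieltjes measure is at most \<open>L\<close> times Lebesgue measure. Admissibility bounds
  \<open>lineint\<close> from below; this upper bound transfers it to ordinary integrals in the
  parameter.\<close>

lemma lineint_lipschitz_le:
  fixes p :: "real \<Rightarrow> 'a::euclidean_space"
  assumes lip: "\<And>x y. x \<in> {c0..d0} \<Longrightarrow> y \<in> {c0..d0} \<Longrightarrow> norm (p y - p x) \<le> L * \<bar>y - x\<bar>"
    and \<eta>: "\<And>t. t \<in> {c0..d0} \<Longrightarrow> \<eta> t = Some (p t)"
    and [measurable]: "\<rho> \<in> borel_measurable borel" and L: "0 \<le> L"
  shows "loc_rectifiable {c0..d0} \<eta>"
    and "lineint \<rho> {c0..d0} \<eta> \<le> ennreal L * (\<integral>\<^sup>+t\<in>{c0..d0}. \<rho> (p t) \<partial>lborel)"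
proof -
  have sub: "path_var (the \<circ> \<eta>) x y \<le> ennreal (L * (y - x))" if "c0 \<le> x" "y \<le> d0" for x y
  proof (rule path_var_lipschitz)
    fix u w assume "x \<le> u" "u \<le> w" "w \<le> y"
    then show "norm ((the \<circ> \<eta>) w - (the \<circ> \<eta>) u) \<le> L * (w - u)"
      using that lip[of u w] \<eta>[of u] \<eta>[of w] by auto
  qed
  show "loc_rectifiable {c0..d0} \<eta>"
    unfolding loc_rectifiable_def
  proof (intro allI impI conjI ballI)
    fix c d assume cd: "c \<le> d \<and> {c..d} \<subseteq> {c0..d0}"
    then show "path_var (the \<circ> \<eta>) c d < \<infinity>"
      using sub[of c d] by (auto simp: less_top[symmetric] top_unique)
    fix t assume "t \<in> {c..d}" then show "\<eta> t \<noteq> None" using cd \<eta> by auto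
  qed
  show "lineint \<rho> {c0..d0} \<eta> \<le> ennreal L * (\<integral>\<^sup>+t\<in>{c0..d0}. \<rho> (p t) \<partial>lborel)"
    unfolding lineint_def
  proof (rule SUP_least, clarify)
    fix c d :: real assume cd: "c \<le> d" "{c..d} \<subseteq> {c0..d0}"
    then have cd': "c0 \<le> c" "d \<le> d0" by auto
    let ?cl = "\<lambda>t. min d (max c t)"
    define F where "F = (\<lambda>t. enn2real (path_var (the \<circ> \<eta>) c (?cl t)))"
    have fin: "path_var (the \<circ> \<eta>) x y < top" if "c \<le> x" "y \<le> d" for x y
      using sub[of x y] that cd' by (auto simp: less_top[symmetric] top_unique)
    have clb: "c \<le> ?cl t" "?cl t \<le> d" for t using cd by auto
    have clm: "?cl x \<le> ?cl y" if "x \<le> y" for x y using that by auto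
    have monoF: "F x \<le> F y" if "x \<le> y" for x y
      unfolding F_def using fin clb clm[OF that] by (intro enn2real_mono path_var_mono) auto
    have lipF: "F y - F x \<le> L * (y - x)" if xy: "x \<le> y" for x y
    proof -
      have "path_var (the \<circ> \<eta>) c (?cl y) \<le> path_var (the \<circ> \<eta>) c (?cl x) + path_var (the \<circ> \<eta>) (?cl x) (?cl y)"
        using clb clm[OF xy] by (intro path_var_triangle) auto
      moreover have "path_var (the \<circ> \<eta>) (?cl x) (?cl y) \<le> ennreal (L * (?cl y - ?cl x))"
        using clb[of x] clb[of y] cd' by (intro sub) auto
      moreover have "ennreal (L * (?cl y - ?cl x)) \<le> ennreal (L * (y - x))"
        using L xy by (intro ennreal_leI mult_left_mono) auto
      ultimately have "path_var (the \<circ> \<eta>) c (?cl y) \<le> path_var (the \<circ> \<eta>) c (?cl x) + ennreal (L * (y - x))"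
        by (meson add_left_mono order_trans)
      moreover have "path_var (the \<circ> \<eta>) c (?cl y) = ennreal (F y)" "path_var (the \<circ> \<eta>) c (?cl x) = ennreal (F x)"
        unfolding F_def using fin[of c "?cl x"] fin[of c "?cl y"] clb by (auto simp: ennreal_enn2real_if)
      moreover have "0 \<le> F x" "0 \<le> F y" "0 \<le> L * (y - x)" using L xy by (auto simp: F_def)
      ultimately show ?thesis
        by (simp add: ennreal_plus[symmetric] ennreal_le_iff del: ennreal_plus)
    qed
    have p_cont: "continuous_on {c..d} p"
      using lip cd L by (intro lipschitz_on_continuous_on[of L] lipschitz_onI)
        (auto simp: dist_norm dist_real_def subset_iff norm_minus_commute abs_minus_commute)
    \<comment> \<open>Clamping extends \<open>p\<close> continuously to the whole line. Off the
      interval \<open>\<eta>\<close> is arbitrary, so the integrand is rewritten in terms of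
      \<open>p\<close> to obtain a Borel function.\<close>
    have pcl: "(\<lambda>t. p (?cl t)) \<in> borel_measurable borel"
      using cd by (intro borel_measurable_continuous_onI continuous_on_compose2[OF p_cont] continuous_intros) auto
    have [measurable]: "(\<lambda>t. indicator {c..d} t * \<rho> (p (?cl t))) \<in> borel_measurable borel"
      using pcl by measurable
    have eq: "indicator {c..d} t * \<rho> (the (\<eta> t)) = indicator {c..d} t * \<rho> (p (?cl t))" for t
      using cd \<eta>[of t] by (auto split: split_indicator simp: min_def max_def subset_iff)
    have "(\<integral>\<^sup>+t. indicator {c..d} t * \<rho> (the (\<eta> t)) \<partial>interval_measure F)
        = (\<integral>\<^sup>+t. indicator {c..d} t * \<rho> (p (?cl t)) \<partial>interval_measure F)" by (simp only: eq)
    also have "\<dots> \<le> ennreal L * (\<integral>\<^sup>+t. indicator {c..d} t * \<rho> (p (?cl t)) \<partial>lborel)"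
      by (intro nn_integral_interval_measure_le monoF lipF) auto
    also have "\<dots> \<le> ennreal L * (\<integral>\<^sup>+t\<in>{c0..d0}. \<rho> (p t) \<partial>lborel)"
      using cd by (intro mult_left_mono nn_integral_mono) (auto split: split_indicator simp: min_def max_def subset_iff)
    finally show "(\<integral>\<^sup>+ t. indicator {fst (c, d)..snd (c, d)} t * \<rho> (the (\<eta> t))
           \<partial>interval_measure (\<lambda>t. enn2real (path_var (the \<circ> \<eta>) (fst (c, d)) (min (snd (c, d)) (max (fst (c, d)) t)))))
      \<le> ennreal L * (\<integral>\<^sup>+t\<in>{c0..d0}. \<rho> (p t) \<partial>lborel)"
      by (simp add: F_def)
  qed
qed

text \<open>Takes the place of Holder's inequality: either \<open>x \<le> \<theta>\<close>, or
  \<open>x * \<theta> ^ (n - 1) \<le> x ^ n\<close>. The threshold is free and may later depend on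
  the position along a segment.\<close>

lemma ennreal_le_add_power_div:
  fixes x :: ennreal
  assumes "0 < \<theta>" "1 \<le> n"
  shows "x \<le> ennreal \<theta> + ennreal (1 / \<theta> ^ (n - 1)) * x ^ n"
proof (cases x rule: ennreal_cases)
  case (real r)
  show ?thesis
  proof (cases "r \<le> \<theta>")
    case True
    then show ?thesis using real by (intro add_increasing2) (auto intro: ennreal_leI)
  next
    case False
    have "r * \<theta> ^ (n - 1) \<le> r * r ^ (n - 1)"
      using False assms by (intro mult_left_mono power_mono) auto
    also have "\<dots> = r ^ n" using assms by (metis One_nat_def Suc_pred less_eq_Suc_le power_Suc)
    finally have "r \<le> (1 / \<theta> ^ (n - 1)) * r ^ n" using assms by (simp add: field_simps)
    then have "x \<le> ennreal (1 / \<theta> ^ (n - 1)) * x ^ n"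
      using real assms by (simp add: ennreal_power ennreal_mult[symmetric] ennreal_leI)
    then show ?thesis by (simp add: add_increasing)
  qed
next
  case top
  then show ?thesis using assms by (simp add: ennreal_mult_top power_0_left ennreal_mult_eq_top_iff)
qed

section \<open>Averages over slice segments\<close>

lemma nn_integral_lborel_translate:
  fixes g :: "'a::euclidean_space \<Rightarrow> ennreal"
  assumes [measurable]: "g \<in> borel_measurable borel"
  shows "(\<integral>\<^sup>+x. g (x + c) \<partial>lborel) = (\<integral>\<^sup>+x. g x \<partial>lborel)"
proof -
  have "(\<integral>\<^sup>+x. g x \<partial>lborel) = (\<integral>\<^sup>+x. g x \<partial>distr lborel borel ((+) c))"
    by (simp add: lborel_distr_plus)
  also have "\<dots> = (\<integral>\<^sup>+x. g (x + c) \<partial>lborel)"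
    by (subst nn_integral_distr) (auto simp: add.commute)
  finally show ?thesis by simp
qed

lemma nn_integral_lborel_affine:
  fixes g :: "'a::euclidean_space \<Rightarrow> ennreal"
  assumes [measurable]: "g \<in> borel_measurable borel" and "c \<noteq> 0"
  shows "(\<integral>\<^sup>+x. g (t + c *\<^sub>R x) \<partial>lborel) = ennreal (1 / \<bar>c\<bar> ^ DIM('a)) * (\<integral>\<^sup>+x. g x \<partial>lborel)"
proof -
  have "(\<integral>\<^sup>+x. g x \<partial>lborel) = (\<integral>\<^sup>+x. g x \<partial>density (distr lborel borel (\<lambda>x. t + c *\<^sub>R x)) (\<lambda>_. \<bar>c\<bar>^DIM('a)))"
    using lborel_affine[OF assms(2), of t] by simp
  also have "\<dots> = ennreal (\<bar>c\<bar>^DIM('a)) * (\<integral>\<^sup>+x. g (t + c *\<^sub>R x) \<partial>lborel)"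
    by (simp add: nn_integral_density nn_integral_distr nn_integral_cmult)
  finally have "ennreal (1 / \<bar>c\<bar> ^ DIM('a)) * (\<integral>\<^sup>+x. g x \<partial>lborel)
     = ennreal (1 / \<bar>c\<bar> ^ DIM('a)) * ennreal (\<bar>c\<bar>^DIM('a)) * (\<integral>\<^sup>+x. g (t + c *\<^sub>R x) \<partial>lborel)"
    by (simp add: mult.assoc)
  also have "ennreal (1 / \<bar>c\<bar> ^ DIM('a)) * ennreal (\<bar>c\<bar>^DIM('a)) = 1"
    using assms(2) by (subst ennreal_mult[symmetric]) auto
  finally show ?thesis by simp
qed

text \<open>By outer regularity of Lebesgue measure. Open sets are the right test class for limits
  of maps, because their indicators are lower semicontinuous and Fatou's lemma applies.\<close>

lemma le_measure_if_le_open: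
  fixes M :: "'a::euclidean_space measure"
  assumes sets: "sets M = sets borel"
    and le: "\<And>U. open U \<Longrightarrow> emeasure M U \<le> emeasure lborel U"
  shows "M \<le> lborel"
proof (subst le_measure)
  show "sets M = sets lborel" using sets by simp
  show "\<forall>A\<in>sets M. emeasure M A \<le> emeasure lborel A"
  proof
    fix A assume "A \<in> sets M"
    then have A: "A \<in> sets borel" using sets by simp
    show "emeasure M A \<le> emeasure lborel A"
    proof (rule ennreal_le_epsilon)
      fix e :: real assume e: "0 < e"
      obtain U where U: "open U" "A \<subseteq> U" "emeasure lborel (U - A) < e"
        using outer_regular_lborel[OF A e] by metis
      have "emeasure M A \<le> emeasure M U"
        using U A sets by (intro emeasure_mono) auto
      also have "\<dots> \<le> emeasure lborel U" using le U by auto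
      also have "\<dots> = emeasure lborel A + emeasure lborel (U - A)"
        using U A by (subst plus_emeasure) (auto simp: Un_absorb1)
      also have "\<dots> \<le> emeasure lborel A + ennreal e"
        using U by (intro add_left_mono) auto
      finally show "emeasure M A \<le> emeasure lborel A + ennreal e" .
    qed
  qed
qed

text \<open>On each of the finitely many level sets of \<open>w (x \<bullet> d)\<close> the shear is
  a translation by a vector orthogonal to \<open>d\<close>, which maps the level set to
  itself.\<close>

lemma nn_integral_shear_simple:
  fixes g :: "'a::euclidean_space \<Rightarrow> ennreal" and w :: "real \<Rightarrow> 'a"
  assumes [measurable]: "g \<in> borel_measurable borel" "w \<in> borel_measurable borel"
    and fin: "finite (range w)" and orth: "\<And>t. w t \<bullet> d = 0"
  shows "(\<integral>\<^sup>+x. g (x + w (x \<bullet> d)) \<partial>lborel) = (\<integral>\<^sup>+x. g x \<partial>lborel)"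
proof -
  have split: "h x = (\<Sum>y\<in>range w. h x * indicator {x. w (x \<bullet> d) = y} x)" for h :: "'a \<Rightarrow> ennreal" and x
    using fin by (simp add: indicator_def sum.delta if_distrib cong: if_cong)
  have "(\<integral>\<^sup>+x. g (x + w (x \<bullet> d)) \<partial>lborel)
      = (\<integral>\<^sup>+x. (\<Sum>y\<in>range w. g (x + y) * indicator {x. w (x \<bullet> d) = y} (x + y)) \<partial>lborel)"
  proof (rule nn_integral_cong)
    fix x
    have "g (x + w (x \<bullet> d)) = (\<Sum>y\<in>range w. g (x + w (x \<bullet> d)) * indicator {x. w (x \<bullet> d) = y} x)"
      using split[of "\<lambda>x. g (x + w (x \<bullet> d))"] .
    also have "\<dots> = (\<Sum>y\<in>range w. g (x + y) * indicator {x. w (x \<bullet> d) = y} (x + y))"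
      using orth by (intro sum.cong) (auto simp: indicator_def inner_add_left)
    finally show "g (x + w (x \<bullet> d)) = (\<Sum>y\<in>range w. g (x + y) * indicator {x. w (x \<bullet> d) = y} (x + y))" .
  qed
  also have "\<dots> = (\<Sum>y\<in>range w. \<integral>\<^sup>+x. g (x + y) * indicator {x. w (x \<bullet> d) = y} (x + y) \<partial>lborel)"
    by (intro nn_integral_sum) auto
  also have "\<dots> = (\<Sum>y\<in>range w. \<integral>\<^sup>+x. g x * indicator {x. w (x \<bullet> d) = y} x \<partial>lborel)"
    by (intro sum.cong refl nn_integral_lborel_translate) auto
  also have "\<dots> = (\<integral>\<^sup>+x. (\<Sum>y\<in>range w. g x * indicator {x. w (x \<bullet> d) = y} x) \<partial>lborel)"
    by (intro nn_integral_sum[symmetric]) auto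
  also have "\<dots> = (\<integral>\<^sup>+x. g x \<partial>lborel)" using split[of g] by simp
  finally show ?thesis .
qed

text \<open>Simple shears converge pointwise to the given one, and Fatou's lemma on open sets turns
  their measure preservation into an inequality for the push-forward. This direction is the one that
  the averages require.\<close>

lemma nn_integral_shear_le:
  fixes g :: "'a::euclidean_space \<Rightarrow> ennreal" and v :: "real \<Rightarrow> 'a"
  assumes g[measurable]: "g \<in> borel_measurable borel" and [measurable]: "v \<in> borel_measurable borel"
    and orth: "\<And>t. v t \<bullet> d = 0" and d: "norm d = 1"
  shows "(\<integral>\<^sup>+x. g (x + v (x \<bullet> d)) \<partial>lborel) \<le> (\<integral>\<^sup>+x. g x \<partial>lborel)"
proof -
  define T where "T = (\<lambda>x. x + v (x \<bullet> d))"
  have T[measurable]: "T \<in> borel_measurable borel" unfolding T_def by measurable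
  obtain F where F: "\<And>i. simple_function borel (F i)" "\<And>t. (\<lambda>i. F i t) \<longlonglongrightarrow> v t"
    using borel_measurable_implies_sequence_metric[of v borel 0] by auto
  \<comment> \<open>The approximants are projected onto the hyperplane orthogonal to
    \<open>d\<close>, as the simple case demands; the limit is unaffected because \<open>v\<close>
    is already orthogonal.\<close>
  define w where "w = (\<lambda>i t. F i t - (F i t \<bullet> d) *\<^sub>R d)"
  have w_meas[measurable]: "w i \<in> borel_measurable borel" for i
    using borel_measurable_simple_function[OF F(1)[of i]] unfolding w_def by measurable
  have w_fin: "finite (range (w i))" for i
  proof -
    have "range (w i) \<subseteq> (\<lambda>y. y - (y \<bullet> d) *\<^sub>R d) ` range (F i)" by (auto simp: w_def)
    then show ?thesis using simple_functionD(1)[OF F(1)[of i]] by (simp add: finite_subset)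
  qed
  have w_orth: "w i t \<bullet> d = 0" for i t
    using d by (simp add: w_def inner_diff_left norm_eq_1)
  have w_lim: "(\<lambda>i. w i t) \<longlonglongrightarrow> v t" for t
  proof -
    have "(\<lambda>i. w i t) \<longlonglongrightarrow> v t - (v t \<bullet> d) *\<^sub>R d"
      unfolding w_def by (intro tendsto_intros F)
    then show ?thesis by (simp add: orth)
  qed
  have "distr lborel borel T \<le> lborel"
  proof (rule le_measure_if_le_open)
    fix U :: "'a set" assume U: "open U"
    then have [measurable]: "U \<in> sets borel" by auto
    have "emeasure (distr lborel borel T) U = (\<integral>\<^sup>+x. indicator U x \<partial>distr lborel borel T)"
      by simp
    also have "\<dots> = (\<integral>\<^sup>+x. indicator U (T x) \<partial>lborel)"
      by (subst nn_integral_distr) auto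
    also have "\<dots> \<le> (\<integral>\<^sup>+x. liminf (\<lambda>i. indicator U (x + w i (x \<bullet> d))) \<partial>lborel)"
    proof (rule nn_integral_mono)
      fix x
      show "indicator U (T x) \<le> liminf (\<lambda>i. indicator U (x + w i (x \<bullet> d)) :: ennreal)"
      proof (cases "T x \<in> U")
        case True
        have "(\<lambda>i. x + w i (x \<bullet> d)) \<longlonglongrightarrow> T x" unfolding T_def by (intro tendsto_intros w_lim)
        then have "\<forall>\<^sub>F i in sequentially. x + w i (x \<bullet> d) \<in> U"
          using True U by (simp add: topological_tendstoD)
        then have "\<forall>\<^sub>F i in sequentially. (1::ennreal) \<le> indicator U (x + w i (x \<bullet> d))"
          by eventually_elim auto
        then show ?thesis using True by (auto intro!: Liminf_bounded)
      qed auto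
    qed
    also have "\<dots> \<le> liminf (\<lambda>i. \<integral>\<^sup>+x. indicator U (x + w i (x \<bullet> d)) \<partial>lborel)"
      by (intro nn_integral_liminf) measurable
    also have "\<dots> = liminf (\<lambda>i. emeasure lborel U)"
      by (subst nn_integral_shear_simple[OF _ w_meas w_fin w_orth]) auto
    also have "\<dots> = emeasure lborel U" by (simp add: Liminf_const)
    finally show "emeasure (distr lborel borel T) U \<le> emeasure lborel U" .
  qed simp
  then have "(\<integral>\<^sup>+x. g x \<partial>distr lborel borel T) \<le> (\<integral>\<^sup>+x. g x \<partial>lborel)"
    by (intro nn_integral_mono_measure) auto
  then show ?thesis by (subst (asm) nn_integral_distr) (auto simp: T_def)
qed

text \<open>Vectors \<open>d\<close> with \<open>d\<close> or \<open>- d\<close> in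
  \<open>Basis\<close> label the faces of a cube centred at the origin: the face of radius t is
  where \<open>x \<bullet> d = t\<close> and \<open>infnorm x = t\<close>.\<close>

lemma inner_signed_Basis:
  fixes d :: "'a::euclidean_space"
  assumes "d \<in> Basis \<or> - d \<in> Basis" "j \<in> Basis"
  shows "d \<bullet> j = (if j = d then 1 else if j = - d then -1 else 0)"
proof -
  have nn: "e \<in> Basis \<Longrightarrow> - e \<notin> Basis" for e :: 'a
    using inner_Basis[of e "- e"] by (auto simp: inner_Basis split: if_splits)
  show ?thesis
  proof (cases "d \<in> Basis")
    case True
    then show ?thesis using nn[of d] assms(2) by (auto simp: inner_Basis)
  next
    case False
    then have d: "- d \<in> Basis" using assms by auto
    have "d \<bullet> j = - ((- d) \<bullet> j)" by simp
    also have "\<dots> = - (if - d = j then 1 else 0)" by (subst inner_Basis[OF d assms(2)]) simp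
    finally show ?thesis using False assms(2) by auto
  qed
qed

lemma norm_signed_Basis:
  fixes d :: "'a::euclidean_space"
  assumes "d \<in> Basis \<or> - d \<in> Basis"
  shows "norm d = 1"
  using assms by (metis norm_Basis norm_minus_cancel)

text \<open>The dilation x \<mapsto> (1 - \<sigma>) a + \<sigma> x towards a point a = a(x \<bullet> d) of the hyperplane through x orthogonal to d
  is a linear dilation of that hyperplane followed by a shear.\<close>

lemma nn_integral_slice_dilation_le:
  fixes g :: "'a::euclidean_space \<Rightarrow> ennreal" and a :: "real \<Rightarrow> 'a"
  assumes g[measurable]: "g \<in> borel_measurable borel" and [measurable]: "a \<in> borel_measurable borel"
    and d: "d \<in> Basis \<or> - d \<in> Basis"
    and P: "P \<in> sets borel" "\<And>x. x \<in> P \<Longrightarrow> a (x \<bullet> d) \<bullet> d = x \<bullet> d" and \<sigma>: "0 < \<sigma>"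
  shows "(\<integral>\<^sup>+x\<in>P. g ((1 - \<sigma>) *\<^sub>R a (x \<bullet> d) + \<sigma> *\<^sub>R x) \<partial>lborel)
     \<le> ennreal (1 / \<sigma> ^ (DIM('a) - 1)) * (\<integral>\<^sup>+x. g x \<partial>lborel)"
proof -
  have nd: "norm d = 1" by (rule norm_signed_Basis[OF d])
  then have dd: "d \<bullet> d = 1" by (simp add: norm_eq_1)
  \<comment> \<open>Stretch factors of the linear part: 1 along the axis of \<open>d\<close> and
    \<open>\<sigma>\<close> along the others, whence the determinant
    \<open>\<sigma> ^ (DIM('a) - 1)\<close>.\<close>
  define c where "c = (\<lambda>j. if j = d \<or> j = - d then 1 else \<sigma>)"
  define S where "S = (\<lambda>x::'a. (\<Sum>j\<in>Basis. (c j * (x \<bullet> j)) *\<^sub>R j))"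
  have S_eq: "S x = \<sigma> *\<^sub>R x + ((1 - \<sigma>) * (x \<bullet> d)) *\<^sub>R d" for x
  proof (rule euclidean_eqI)
    fix j :: 'a assume j: "j \<in> Basis"
    have "S x \<bullet> j = c j * (x \<bullet> j)" using j by (simp add: S_def inner_sum_left_Basis)
    also have "\<dots> = (\<sigma> *\<^sub>R x + ((1 - \<sigma>) * (x \<bullet> d)) *\<^sub>R d) \<bullet> j"
      using inner_signed_Basis[OF d j] by (auto simp: c_def inner_add_left algebra_simps)
    finally show "S x \<bullet> j = (\<sigma> *\<^sub>R x + ((1 - \<sigma>) * (x \<bullet> d)) *\<^sub>R d) \<bullet> j" .
  qed
  have S_meas[measurable]: "S \<in> borel_measurable borel" unfolding S_eq by measurable
  have Sd: "S x \<bullet> d = x \<bullet> d" for x using dd by (simp add: S_eq inner_add_left algebra_simps)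
  \<comment> \<open>The component of \<open>(1 - \<sigma>) *\<^sub>R a t\<close> orthogonal to
    \<open>d\<close>; the component along \<open>d\<close> is already supplied by the linear part
    \<open>S\<close>.\<close>
  define v where "v = (\<lambda>t. (1 - \<sigma>) *\<^sub>R (a t - (a t \<bullet> d) *\<^sub>R d))"
  have v_meas[measurable]: "v \<in> borel_measurable borel" unfolding v_def by measurable
  have v_orth: "v t \<bullet> d = 0" for t using dd by (simp add: v_def inner_diff_left)
  define h where "h = (\<lambda>x. g (x + v (x \<bullet> d)))"
  have h_meas[measurable]: "h \<in> borel_measurable borel" unfolding h_def by measurable
  have prod_c: "(\<Prod>j\<in>Basis. \<bar>c j\<bar>) = \<sigma> ^ (DIM('a) - 1)"
  proof -
    obtain e where e: "e \<in> Basis" "e = d \<or> e = - d" using d by blast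
    have "(\<Prod>j\<in>Basis. \<bar>c j\<bar>) = \<bar>c e\<bar> * (\<Prod>j\<in>Basis - {e}. \<bar>c j\<bar>)"
      using e by (simp add: prod.remove)
    also have "(\<Prod>j\<in>Basis - {e}. \<bar>c j\<bar>) = (\<Prod>j\<in>Basis - {e}. \<sigma>)"
    proof (intro prod.cong refl)
      fix j assume j: "j \<in> Basis - {e}"
      then have "d \<bullet> j = 0"
        using e(1) e(2) inner_not_same_Basis[of e j] by (metis DiffD1 DiffD2 inner_minus_left insertCI neg_0_equal_iff_equal equation_minus_iff)
      then have "j \<noteq> d" "j \<noteq> - d" using dd by auto
      then show "\<bar>c j\<bar> = \<sigma>" using \<sigma> by (simp add: c_def)
    qed
    finally show ?thesis using e \<sigma> by (auto simp: c_def)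
  qed
  have lb: "lborel = density (distr lborel borel S) (\<lambda>_. ennreal (\<sigma> ^ (DIM('a) - 1)))"
    using lborel_affine_euclidean[of c 0] \<sigma> prod_c by (simp add: c_def S_def)
  have "(\<integral>\<^sup>+x. h x \<partial>lborel) = ennreal (\<sigma> ^ (DIM('a) - 1)) * (\<integral>\<^sup>+x. h (S x) \<partial>lborel)"
    by (subst lb) (simp add: nn_integral_density nn_integral_distr nn_integral_cmult)
  then have "ennreal (1 / \<sigma> ^ (DIM('a) - 1)) * (\<integral>\<^sup>+x. h x \<partial>lborel)
     = (ennreal (1 / \<sigma> ^ (DIM('a) - 1)) * ennreal (\<sigma> ^ (DIM('a) - 1))) * (\<integral>\<^sup>+x. h (S x) \<partial>lborel)"
    by (simp add: mult.assoc)
  also have "ennreal (1 / \<sigma> ^ (DIM('a) - 1)) * ennreal (\<sigma> ^ (DIM('a) - 1)) = 1"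
    using \<sigma> by (subst ennreal_mult[symmetric]) auto
  finally have hS: "(\<integral>\<^sup>+x. h (S x) \<partial>lborel) = ennreal (1 / \<sigma> ^ (DIM('a) - 1)) * (\<integral>\<^sup>+x. h x \<partial>lborel)"
    by simp
  have "(\<integral>\<^sup>+x\<in>P. g ((1 - \<sigma>) *\<^sub>R a (x \<bullet> d) + \<sigma> *\<^sub>R x) \<partial>lborel) \<le> (\<integral>\<^sup>+x. h (S x) \<partial>lborel)"
  proof (rule nn_integral_mono)
    fix x
    have "x \<in> P \<Longrightarrow> S x + v (S x \<bullet> d) = (1 - \<sigma>) *\<^sub>R a (x \<bullet> d) + \<sigma> *\<^sub>R x"
      using P(2)[of x] unfolding Sd by (simp add: v_def S_eq algebra_simps)
    then show "g ((1 - \<sigma>) *\<^sub>R a (x \<bullet> d) + \<sigma> *\<^sub>R x) * indicator P x \<le> h (S x)"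
      by (auto simp: h_def split: split_indicator)
  qed
  also have "\<dots> = ennreal (1 / \<sigma> ^ (DIM('a) - 1)) * (\<integral>\<^sup>+x. h x \<partial>lborel)" by (rule hS)
  also have "\<dots> \<le> ennreal (1 / \<sigma> ^ (DIM('a) - 1)) * (\<integral>\<^sup>+x. g x \<partial>lborel)"
    unfolding h_def by (intro mult_left_mono nn_integral_shear_le v_orth nd) auto
  finally show ?thesis .
qed

text \<open>This weight is the one for which threshold and dilation factor balance in the slice
  estimate; its exponent exceeds -1, so the integral converges.\<close>

lemma nn_integral_powr_0_1:
  assumes "0 < n"
  shows "(\<integral>\<^sup>+s\<in>{0..1}. ennreal (s powr (1 / real n - 1)) \<partial>lborel) = ennreal (real n)"
proof -
  have "((\<lambda>s::real. s powr (1 / real n - 1)) has_integral (1 powr (1 / real n - 1 + 1) / (1 / real n - 1 + 1))) {0..1}"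
    using assms by (intro has_integral_powr_from_0) (auto simp: field_simps)
  then have "((\<lambda>s::real. if s \<in> {0..1} then s powr (1 / real n - 1) else 0) has_integral real n) UNIV"
    using assms by (subst has_integral_restrict_UNIV) simp
  then have "(\<integral>\<^sup>+s. ennreal (if s \<in> {0..1} then s powr (1 / real n - 1) else 0) \<partial>lborel) = ennreal (real n)"
    by (intro nn_integral_has_integral_lborel) auto
  moreover have "(\<integral>\<^sup>+s. ennreal (if s \<in> {0..1} then s powr (1 / real n - 1) else 0) \<partial>lborel)
     = (\<integral>\<^sup>+s\<in>{0..1}. ennreal (s powr (1 / real n - 1)) \<partial>lborel)"
    by (intro nn_integral_cong) (auto split: split_indicator)
  ultimately show ?thesis by simp
qed

lemma nn_integral_lborel_swap:
  fixes f :: "'a::euclidean_space \<Rightarrow> 'b::euclidean_space \<Rightarrow> ennreal"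
  assumes "case_prod f \<in> borel_measurable borel"
  shows "(\<integral>\<^sup>+x. \<integral>\<^sup>+y. f x y \<partial>lborel \<partial>lborel) = (\<integral>\<^sup>+y. \<integral>\<^sup>+x. f x y \<partial>lborel \<partial>lborel)"
  using assms by (intro lborel_pair.Fubini'[symmetric]) (simp add: lborel_prod)

text \<open>At parameter s the dilation costs a factor \<open>1 / s ^ (DIM('a) - 1)\<close>, which
  is not integrable at 0 in dimension at least 2. With n the dimension, the threshold
  \<open>\<theta> * s powr (1 / n - 1)\<close> in the pointwise splitting makes both terms
  proportional to \<open>s powr (1 / n - 1)\<close>, whose integral over the unit interval is
  n.\<close>

lemma nn_integral_slice_segment_le:
  fixes \<rho> :: "'a::euclidean_space \<Rightarrow> ennreal" and a :: "real \<Rightarrow> 'a"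
  assumes \<rho>[measurable]: "\<rho> \<in> borel_measurable borel" and a[measurable]: "a \<in> borel_measurable borel"
    and d: "d \<in> Basis \<or> - d \<in> Basis"
    and P: "P \<in> sets borel" "\<And>x. x \<in> P \<Longrightarrow> a (x \<bullet> d) \<bullet> d = x \<bullet> d" and \<theta>: "0 < \<theta>"
  shows "(\<integral>\<^sup>+x\<in>P. (\<integral>\<^sup>+s\<in>{0..1}. \<rho> ((1 - s) *\<^sub>R a (x \<bullet> d) + s *\<^sub>R x) \<partial>lborel) \<partial>lborel)
    \<le> ennreal DIM('a) * (ennreal \<theta> * emeasure lborel P
        + ennreal (1 / \<theta> ^ (DIM('a) - 1)) * (\<integral>\<^sup>+x. \<rho> x ^ DIM('a) \<partial>lborel))"
proof -
  note P(1)[measurable]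
  let ?n = "DIM('a)"
  let ?I = "\<integral>\<^sup>+x. \<rho> x ^ ?n \<partial>lborel"
  have n: "1 \<le> ?n" by (simp add: Suc_leI)
  have "(\<integral>\<^sup>+x\<in>P. (\<integral>\<^sup>+s\<in>{0..1}. \<rho> ((1 - s) *\<^sub>R a (x \<bullet> d) + s *\<^sub>R x) \<partial>lborel) \<partial>lborel)
     = (\<integral>\<^sup>+x. (\<integral>\<^sup>+s. \<rho> ((1 - s) *\<^sub>R a (x \<bullet> d) + s *\<^sub>R x) * indicator {0..1} s * indicator P x \<partial>lborel) \<partial>lborel)"
    by (subst nn_integral_multc) auto
  also have "\<dots> = (\<integral>\<^sup>+s. (\<integral>\<^sup>+x. \<rho> ((1 - s) *\<^sub>R a (x \<bullet> d) + s *\<^sub>R x) * indicator {0..1} s * indicator P x \<partial>lborel) \<partial>lborel)"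
    by (intro nn_integral_lborel_swap) (simp add: borel_prod[symmetric])
  also have "\<dots> \<le> (\<integral>\<^sup>+s. (ennreal \<theta> * emeasure lborel P + ennreal (1 / \<theta> ^ (?n - 1)) * ?I) *
      (ennreal (s powr (1 / real ?n - 1)) * indicator {0..1} s) \<partial>lborel)"
  proof (rule nn_integral_mono_AE)
    \<comment> \<open>At s = 0 the dilation degenerates to the base point; this single parameter is
      discarded.\<close>
    have "AE s in lborel. s \<noteq> (0::real)" by (rule AE_lborel_singleton)
    then show "AE s in lborel. (\<integral>\<^sup>+x. \<rho> ((1 - s) *\<^sub>R a (x \<bullet> d) + s *\<^sub>R x) * indicator {0..1} s * indicator P x \<partial>lborel)
       \<le> (ennreal \<theta> * emeasure lborel P + ennreal (1 / \<theta> ^ (?n - 1)) * ?I) *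
      (ennreal (s powr (1 / real ?n - 1)) * indicator {0..1} s)"
    proof eventually_elim
      fix s :: real assume s0: "s \<noteq> 0"
      show "(\<integral>\<^sup>+x. \<rho> ((1 - s) *\<^sub>R a (x \<bullet> d) + s *\<^sub>R x) * indicator {0..1} s * indicator P x \<partial>lborel)
       \<le> (ennreal \<theta> * emeasure lborel P + ennreal (1 / \<theta> ^ (?n - 1)) * ?I) *
      (ennreal (s powr (1 / real ?n - 1)) * indicator {0..1} s)"
      proof (cases "s \<in> {0..1}")
        case True
        then have s: "0 < s" "s \<le> 1" using s0 by auto
        define \<beta> where "\<beta> = 1 / real ?n - 1"
        define w where "w = s powr \<beta>"
        have w: "0 < w" using s by (simp add: w_def)
        \<comment> \<open>The balance of the two costs; it amounts to w^n s^(n-1) = 1 with n the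
          dimension, which determines the exponent \<beta>.\<close>
        have "1 / (\<theta> * w) ^ (?n - 1) * (1 / s ^ (?n - 1)) = 1 / \<theta> ^ (?n - 1) * w"
        proof -
          have "w ^ (?n - 1) * s ^ (?n - 1) * w = w ^ ?n * s ^ (?n - 1)"
            using n by (simp add: power_eq_if)
          also have "w ^ ?n = s powr (\<beta> * real ?n)" using s by (simp add: w_def powr_powr powr_realpow[symmetric])
          also have "\<beta> * real ?n = - real (?n - 1)" using n by (simp add: \<beta>_def field_simps of_nat_diff)
          also have "s powr - real (?n - 1) * s ^ (?n - 1) = 1"
            using s by (subst powr_realpow[symmetric]) (simp_all add: powr_add[symmetric])
          finally have "w ^ (?n - 1) * s ^ (?n - 1) * w = 1" .
          then show ?thesis using w \<theta> s by (simp add: field_simps)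
        qed
        note key = this
        have "(\<integral>\<^sup>+x. \<rho> ((1 - s) *\<^sub>R a (x \<bullet> d) + s *\<^sub>R x) * indicator {0..1} s * indicator P x \<partial>lborel)
          \<le> (\<integral>\<^sup>+x. ennreal (\<theta> * w) * indicator P x
              + ennreal (1 / (\<theta> * w) ^ (?n - 1)) * (\<rho> ((1 - s) *\<^sub>R a (x \<bullet> d) + s *\<^sub>R x) ^ ?n * indicator P x) \<partial>lborel)"
          using True ennreal_le_add_power_div[OF _ n, of "\<theta> * w"] \<theta> w
          by (intro nn_integral_mono) (auto split: split_indicator)
        also have "\<dots> = ennreal (\<theta> * w) * emeasure lborel P
            + ennreal (1 / (\<theta> * w) ^ (?n - 1)) * (\<integral>\<^sup>+x\<in>P. \<rho> ((1 - s) *\<^sub>R a (x \<bullet> d) + s *\<^sub>R x) ^ ?n \<partial>lborel)"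
          by (simp add: nn_integral_add nn_integral_cmult)
        also have "\<dots> \<le> ennreal (\<theta> * w) * emeasure lborel P
            + ennreal (1 / (\<theta> * w) ^ (?n - 1)) * (ennreal (1 / s ^ (?n - 1)) * ?I)"
          using P(2) s d by (intro add_left_mono mult_left_mono nn_integral_slice_dilation_le) auto
        also have "\<dots> = ennreal (\<theta> * w) * emeasure lborel P + ennreal (1 / \<theta> ^ (?n - 1) * w) * ?I"
        proof -
          have "ennreal (1 / (\<theta> * w) ^ (?n - 1)) * ennreal (1 / s ^ (?n - 1)) = ennreal (1 / \<theta> ^ (?n - 1) * w)"
            unfolding key[symmetric] using \<theta> w s by (intro ennreal_mult[symmetric]) auto
          then show ?thesis by (simp add: mult.assoc[symmetric])
        qed
        also have "\<dots> = (ennreal \<theta> * emeasure lborel P + ennreal (1 / \<theta> ^ (?n - 1)) * ?I) * ennreal w"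
        proof -
          have "ennreal (\<theta> * w) = ennreal \<theta> * ennreal w"
            "ennreal (1 / \<theta> ^ (?n - 1) * w) = ennreal (1 / \<theta> ^ (?n - 1)) * ennreal w"
            using \<theta> w by (intro ennreal_mult; simp)+
          then show ?thesis by (simp only: distrib_left distrib_right ac_simps)
        qed
        finally show ?thesis using True by (simp add: w_def \<beta>_def)
      qed simp
    qed
  qed
  also have "\<dots> = (ennreal \<theta> * emeasure lborel P + ennreal (1 / \<theta> ^ (?n - 1)) * ?I) * ennreal (real ?n)"
    by (subst nn_integral_cmult) (use nn_integral_powr_0_1[of ?n] in auto)
  finally show ?thesis by (simp add: mult.commute)
qed

text \<open>For each parameter s one of s and 1 - s is at least 1/2. Integrating over the end point
  that carries this weight is an affine substitution with Jacobian factor at most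
  \<open>2 ^ DIM('a)\<close>, uniformly in the other end point. Since both ends are spread out, no
  singularity arises and a constant threshold works.\<close>

lemma nn_integral_free_segment_le:
  fixes \<rho> :: "'a::euclidean_space \<Rightarrow> ennreal"
  assumes \<rho>[measurable]: "\<rho> \<in> borel_measurable borel"
    and P[measurable]: "P \<in> sets borel" and M[measurable]: "M \<in> sets borel"
    and P1: "emeasure lborel P \<le> 1" and M1: "emeasure lborel M \<le> 1" and \<theta>: "0 < \<theta>"
  shows "(\<integral>\<^sup>+x\<in>P. (\<integral>\<^sup>+y\<in>M. (\<integral>\<^sup>+s\<in>{0..1}. \<rho> ((1 - s) *\<^sub>R x + s *\<^sub>R y) \<partial>lborel) \<partial>lborel) \<partial>lborel)
    \<le> ennreal \<theta> + ennreal (2 ^ DIM('a) / \<theta> ^ (DIM('a) - 1)) * (\<integral>\<^sup>+x. \<rho> x ^ DIM('a) \<partial>lborel)"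
    (is "_ \<le> ?B")
proof -
  let ?n = "DIM('a)"
  have n: "1 \<le> ?n" by (simp add: Suc_leI)
  have half: "(\<integral>\<^sup>+x\<in>X. \<rho> (t + c *\<^sub>R x) \<partial>lborel) \<le> ?B"
    if [measurable]: "X \<in> sets borel" and X1: "emeasure lborel X \<le> 1" and c: "1 / 2 \<le> c" for X t c
  proof -
    have "(\<integral>\<^sup>+x\<in>X. \<rho> (t + c *\<^sub>R x) \<partial>lborel)
        \<le> (\<integral>\<^sup>+x. ennreal \<theta> * indicator X x + ennreal (1 / \<theta> ^ (?n - 1)) * \<rho> (t + c *\<^sub>R x) ^ ?n \<partial>lborel)"
      using ennreal_le_add_power_div[OF \<theta> n]
      by (intro nn_integral_mono) (auto split: split_indicator)
    also have "\<dots> = ennreal \<theta> * emeasure lborel X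
        + ennreal (1 / \<theta> ^ (?n - 1)) * (\<integral>\<^sup>+x. \<rho> (t + c *\<^sub>R x) ^ ?n \<partial>lborel)"
      by (simp add: nn_integral_add nn_integral_cmult)
    also have "(\<integral>\<^sup>+x. \<rho> (t + c *\<^sub>R x) ^ ?n \<partial>lborel) = ennreal (1 / \<bar>c\<bar> ^ ?n) * (\<integral>\<^sup>+x. \<rho> x ^ ?n \<partial>lborel)"
      using c by (intro nn_integral_lborel_affine) auto
    also have "ennreal \<theta> * emeasure lborel X + ennreal (1 / \<theta> ^ (?n - 1)) * \<dots>
       \<le> ennreal \<theta> * 1 + ennreal (1 / \<theta> ^ (?n - 1)) * (ennreal (2 ^ ?n) * (\<integral>\<^sup>+x. \<rho> x ^ ?n \<partial>lborel))"
    proof (intro add_mono mult_left_mono mult_right_mono X1 ennreal_leI)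
      have "1 / \<bar>c\<bar> ^ ?n \<le> 1 / (1 / 2) ^ ?n"
        using c by (intro divide_left_mono power_mono) auto
      then show "1 / \<bar>c\<bar> ^ ?n \<le> 2 ^ ?n" by (simp add: power_divide)
    qed auto
    also have "\<dots> = ?B"
    proof -
      have "ennreal (2 ^ ?n / \<theta> ^ (?n - 1)) = ennreal (1 / \<theta> ^ (?n - 1)) * ennreal (2 ^ ?n)"
        using \<theta> by (subst ennreal_mult[symmetric]) auto
      then show ?thesis by (simp add: mult.assoc)
    qed
    finally show ?thesis .
  qed
  have B1: "(\<integral>\<^sup>+x\<in>X. ?B \<partial>lborel) \<le> ?B" if "X \<in> sets borel" "emeasure lborel X \<le> 1" for X :: "'a set"
    using mult_left_mono[OF that(2), of ?B] that(1) by (simp add: nn_integral_cmult_indicator)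
  have slice: "(\<integral>\<^sup>+x\<in>P. (\<integral>\<^sup>+y\<in>M. \<rho> ((1 - s) *\<^sub>R x + s *\<^sub>R y) \<partial>lborel) \<partial>lborel) \<le> ?B" if s: "s \<in> {0..1}" for s
  proof (cases "1 / 2 \<le> s")
    case True
    have "(\<integral>\<^sup>+x\<in>P. (\<integral>\<^sup>+y\<in>M. \<rho> ((1 - s) *\<^sub>R x + s *\<^sub>R y) \<partial>lborel) \<partial>lborel) \<le> (\<integral>\<^sup>+x\<in>P. ?B \<partial>lborel)"
      using True by (intro nn_integral_mono mult_right_mono half M M1) auto
    then show ?thesis using B1[OF P P1] by simp
  next
    case False
    have "(\<integral>\<^sup>+x\<in>P. (\<integral>\<^sup>+y\<in>M. \<rho> ((1 - s) *\<^sub>R x + s *\<^sub>R y) \<partial>lborel) \<partial>lborel)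
       = (\<integral>\<^sup>+x. (\<integral>\<^sup>+y. \<rho> ((1 - s) *\<^sub>R x + s *\<^sub>R y) * indicator M y * indicator P x \<partial>lborel) \<partial>lborel)"
      by (subst nn_integral_multc) auto
    also have "\<dots> = (\<integral>\<^sup>+y. (\<integral>\<^sup>+x. \<rho> ((1 - s) *\<^sub>R x + s *\<^sub>R y) * indicator M y * indicator P x \<partial>lborel) \<partial>lborel)"
      by (intro nn_integral_lborel_swap) (simp add: borel_prod[symmetric])
    also have "\<dots> = (\<integral>\<^sup>+y. (\<integral>\<^sup>+x\<in>P. \<rho> (s *\<^sub>R y + (1 - s) *\<^sub>R x) \<partial>lborel) * indicator M y \<partial>lborel)"
      by (subst nn_integral_multc[symmetric]) (auto simp: ac_simps)
    also have "\<dots> \<le> (\<integral>\<^sup>+y\<in>M. ?B \<partial>lborel)"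
      using False by (intro nn_integral_mono mult_right_mono half P P1) auto
    finally show ?thesis using B1[OF M M1] by simp
  qed
  have "(\<integral>\<^sup>+x\<in>P. (\<integral>\<^sup>+y\<in>M. (\<integral>\<^sup>+s\<in>{0..1}. \<rho> ((1 - s) *\<^sub>R x + s *\<^sub>R y) \<partial>lborel) \<partial>lborel) \<partial>lborel)
    = (\<integral>\<^sup>+x. (\<integral>\<^sup>+y. (\<integral>\<^sup>+s. \<rho> ((1 - s) *\<^sub>R x + s *\<^sub>R y) * indicator {0..1} s * indicator M y * indicator P x \<partial>lborel) \<partial>lborel) \<partial>lborel)"
    by (simp add: nn_integral_multc)
  also have "\<dots> = (\<integral>\<^sup>+x. (\<integral>\<^sup>+s. (\<integral>\<^sup>+y. \<rho> ((1 - s) *\<^sub>R x + s *\<^sub>R y) * indicator {0..1} s * indicator M y * indicator P x \<partial>lborel) \<partial>lborel) \<partial>lborel)"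
    by (intro nn_integral_cong nn_integral_lborel_swap) (simp add: borel_prod[symmetric])
  also have "\<dots> = (\<integral>\<^sup>+s. (\<integral>\<^sup>+x. (\<integral>\<^sup>+y. \<rho> ((1 - s) *\<^sub>R x + s *\<^sub>R y) * indicator {0..1} s * indicator M y * indicator P x \<partial>lborel) \<partial>lborel) \<partial>lborel)"
    by (intro nn_integral_lborel_swap) (simp add: borel_prod[symmetric])
  also have "\<dots> = (\<integral>\<^sup>+s\<in>{0..1}. (\<integral>\<^sup>+x\<in>P. (\<integral>\<^sup>+y\<in>M. \<rho> ((1 - s) *\<^sub>R x + s *\<^sub>R y) \<partial>lborel) \<partial>lborel) \<partial>lborel)"
    by (intro nn_integral_cong) (auto simp: nn_integral_multc split: split_indicator)
  also have "\<dots> \<le> (\<integral>\<^sup>+s\<in>{0..1}. ?B \<partial>(lborel :: real measure))"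
    using slice by (intro nn_integral_mono) (auto split: split_indicator)
  also have "\<dots> = ?B" by (simp add: nn_integral_cmult_indicator)
  finally show ?thesis .
qed

lemma nn_integral_unit_interval_flip:
  fixes h :: "real \<Rightarrow> ennreal"
  assumes [measurable]: "h \<in> borel_measurable borel"
  shows "(\<integral>\<^sup>+s\<in>{0..1}. h (1 - s) \<partial>lborel) = (\<integral>\<^sup>+s\<in>{0..1}. h s \<partial>lborel)"
proof -
  have "(\<integral>\<^sup>+s\<in>{0..1}. h s \<partial>lborel) = (\<integral>\<^sup>+s. h (1 + - 1 * s) * indicator {0..1} (1 + - 1 * s) \<partial>lborel)"
    by (subst nn_integral_real_affine[of _ "-1" 1]) auto
  also have "\<dots> = (\<integral>\<^sup>+s\<in>{0..1}. h (1 - s) \<partial>lborel)"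
    by (intro nn_integral_cong) (auto split: split_indicator)
  finally show ?thesis by simp
qed

section \<open>A Loewner estimate for polylines\<close>

text \<open>A prism over \<open>T\<close> in direction \<open>d\<close> with cross-section of unit
  volume, so that its volume is the length of \<open>T\<close>. Both \<open>d\<close> and
  \<open>- d\<close> are exempt from the side conditions because \<open>d\<close> may be a negative
  basis vector. The half-width 1/2, smaller than the least height 1 used below, keeps segments
  between prisms of non-opposite directions away from the origin.\<close>

definition slab :: "real set \<Rightarrow> 'a::euclidean_space \<Rightarrow> 'a set" where
  "slab T d = {x. x \<bullet> d \<in> T \<and> (\<forall>k\<in>Basis. k \<noteq> d \<and> k \<noteq> - d \<longrightarrow> \<bar>x \<bullet> k\<bar> < 1 / 2)}"

lemma slab_measurable[measurable]:
  fixes d :: "'a::euclidean_space"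
  assumes [measurable]: "T \<in> sets borel"
  shows "slab T d \<in> sets borel"
proof -
  have "slab T d = {x. x \<bullet> d \<in> T} \<inter> (\<Inter>k\<in>Basis. {x. k \<noteq> d \<and> k \<noteq> - d \<longrightarrow> \<bar>x \<bullet> k\<bar> < 1 / 2})"
    by (auto simp: slab_def)
  also have "\<dots> \<in> sets borel"
    by (intro sets.Int sets.finite_INT) (auto intro: measurable_sets_borel)
  finally show ?thesis .
qed

text \<open>The push-forward of Lebesgue measure on the infinite prism under
  \<open>x \<mapsto> x \<bullet> d\<close> agrees with Lebesgue measure on open intervals, where the
  slab is a box; uniqueness of Lebesgue measure gives all Borel sets.\<close>

lemma emeasure_slab:
  fixes d :: "'a::euclidean_space"
  assumes [measurable]: "T \<in> sets borel" and d: "d \<in> Basis \<or> - d \<in> Basis"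
  shows "emeasure lborel (slab T d) = emeasure lborel T"
proof -
  let ?B = "slab UNIV d"
  define M where "M = distr (density lborel (indicator ?B)) borel (\<lambda>x::'a. x \<bullet> d)"
  have M: "emeasure M T' = emeasure lborel (slab T' d)" if [measurable]: "T' \<in> sets borel" for T'
  proof -
    have [measurable]: "(\<lambda>x::'a. x \<bullet> d) -` T' \<in> sets borel"
      by (rule measurable_sets_borel[OF _ that]) simp
    have "emeasure M T' = (\<integral>\<^sup>+x. indicator ?B x * indicator ((\<lambda>x::'a. x \<bullet> d) -` T') x \<partial>lborel)"
      unfolding M_def by (simp add: emeasure_distr emeasure_density)
    also have "\<dots> = (\<integral>\<^sup>+x. indicator (slab T' d) x \<partial>lborel)"
      by (intro nn_integral_cong) (auto simp: slab_def split: split_indicator)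
    finally show ?thesis by simp
  qed
  have "lborel = M"
  proof (rule lborel_eqI)
    fix l u :: real assume "\<And>b. b \<in> Basis \<Longrightarrow> l \<bullet> b \<le> u \<bullet> b"
    then have lu: "l \<le> u" by simp
    \<comment> \<open>If \<open>d = - e\<close> with \<open>e\<close> in \<open>Basis\<close>, the
      constraint on \<open>x \<bullet> d\<close> is reversed and the bounds for
      \<open>x \<bullet> e\<close> become \<open>- u\<close> and \<open>- l\<close>.\<close>
    define p q :: 'a where "p = (\<Sum>k\<in>Basis. (if k = d then l else if k = - d then - u else - 1 / 2) *\<^sub>R k)"
      and "q = (\<Sum>k\<in>Basis. (if k = d then u else if k = - d then - l else 1 / 2) *\<^sub>R k)"
    obtain e where "e \<in> Basis" "e = d \<or> e = - d" using d by blast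
    then have e: "e \<in> Basis" "d = e \<or> d = - e" by auto
    have ne: "e \<noteq> - e"
    proof
      assume "e = - e"
      then have "e \<bullet> e = - (e \<bullet> e)" by (metis inner_minus_left)
      then show False using e(1) by simp
    qed
    have other: "k \<noteq> d \<and> k \<noteq> - d \<longleftrightarrow> k \<noteq> e" if "k \<in> Basis" for k
    proof -
      have "k \<bullet> e \<ge> 0" using that e(1) by (simp add: inner_Basis)
      then have "k \<noteq> - e" using e(1) by auto
      then show ?thesis using e(2) by auto
    qed
    have "slab {l<..<u} d = box p q"
    proof (rule set_eqI)
      fix x
      have "x \<in> box p q \<longleftrightarrow> (\<forall>k\<in>Basis. p \<bullet> k < x \<bullet> k \<and> x \<bullet> k < q \<bullet> k)" by (simp add: mem_box)
      also have "\<dots> \<longleftrightarrow> (p \<bullet> e < x \<bullet> e \<and> x \<bullet> e < q \<bullet> e) \<and> (\<forall>k\<in>Basis. k \<noteq> e \<longrightarrow> p \<bullet> k < x \<bullet> k \<and> x \<bullet> k < q \<bullet> k)"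
        using e(1) by auto
      also have "(p \<bullet> e < x \<bullet> e \<and> x \<bullet> e < q \<bullet> e) \<longleftrightarrow> x \<bullet> d \<in> {l<..<u}"
        using e ne by (auto simp: p_def q_def inner_sum_left_Basis)
      also have "(\<forall>k\<in>Basis. k \<noteq> e \<longrightarrow> p \<bullet> k < x \<bullet> k \<and> x \<bullet> k < q \<bullet> k) \<longleftrightarrow>
          (\<forall>k\<in>Basis. k \<noteq> d \<and> k \<noteq> - d \<longrightarrow> \<bar>x \<bullet> k\<bar> < 1 / 2)"
      proof (intro ball_cong refl)
        fix k :: 'a assume k: "k \<in> Basis"
        have "k \<noteq> e \<Longrightarrow> p \<bullet> k = - 1 / 2 \<and> q \<bullet> k = 1 / 2"
          using other[OF k] k by (auto simp: p_def q_def inner_sum_left_Basis)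
        then show "(k \<noteq> e \<longrightarrow> p \<bullet> k < x \<bullet> k \<and> x \<bullet> k < q \<bullet> k) = (k \<noteq> d \<and> k \<noteq> - d \<longrightarrow> \<bar>x \<bullet> k\<bar> < 1 / 2)"
          using other[OF k] by (auto simp: abs_less_iff)
      qed
      finally show "x \<in> slab {l<..<u} d \<longleftrightarrow> x \<in> box p q" by (simp add: slab_def)
    qed
    moreover have "emeasure lborel (box p q) = (\<Prod>k\<in>Basis. (q - p) \<bullet> k)"
      using lu by (intro emeasure_lborel_box) (auto simp: p_def q_def inner_sum_left_Basis)
    moreover have "(\<Prod>k\<in>Basis. (q - p) \<bullet> k) = ((q - p) \<bullet> e) * (\<Prod>k\<in>Basis - {e}. (q - p) \<bullet> k)"
      using e by (simp add: prod.remove)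
    moreover have "(\<Prod>k\<in>Basis - {e}. (q - p) \<bullet> k) = 1"
      using other by (intro prod.neutral) (auto simp: p_def q_def inner_sum_left_Basis inner_diff_left)
    moreover have "(q - p) \<bullet> e = u - l"
      using e ne by (auto simp: p_def q_def inner_sum_left_Basis inner_diff_left)
    ultimately show "emeasure M (box l u) = (\<Prod>b\<in>Basis. (u - l) \<bullet> b)"
      using M[of "{l<..<u}"] by (simp add: box_real)
  qed (simp add: M_def)
  then show ?thesis using M[of T] by simp
qed

lemma infnorm_le_iff:
  fixes x :: "'a::euclidean_space"
  shows "infnorm x \<le> c \<longleftrightarrow> (\<forall>b\<in>Basis. \<bar>x \<bullet> b\<bar> \<le> c)"
  by (simp add: infnorm_Max)

lemma infnorm_attained:
  fixes x :: "'a::euclidean_space"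
  shows "\<exists>d. (d \<in> Basis \<or> - d \<in> Basis) \<and> x \<bullet> d = infnorm x"
proof -
  have "infnorm x \<in> (\<lambda>b. \<bar>x \<bullet> b\<bar>) ` Basis"
    unfolding infnorm_Max by (intro Max_in) auto
  then obtain b where b: "b \<in> Basis" "infnorm x = \<bar>x \<bullet> b\<bar>" by auto
  then show ?thesis
    by (intro exI[of _ "if x \<bullet> b \<ge> 0 then b else - b"]) (auto simp: abs_if)
qed

lemma inner_signed_Basis_le_infnorm:
  fixes x :: "'a::euclidean_space"
  assumes "d \<in> Basis \<or> - d \<in> Basis"
  shows "\<bar>x \<bullet> d\<bar> \<le> infnorm x"
  using assms Basis_le_infnorm[of d x] Basis_le_infnorm[of "- d" x] by auto

lemma infnorm_convex_le:
  fixes x y :: "'a::euclidean_space"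
  assumes "infnorm x \<le> c" "infnorm y \<le> c" "s \<in> {0..1}"
  shows "infnorm ((1 - s) *\<^sub>R x + s *\<^sub>R y) \<le> c"
proof -
  have "infnorm ((1 - s) *\<^sub>R x + s *\<^sub>R y) \<le> infnorm ((1 - s) *\<^sub>R x) + infnorm (s *\<^sub>R y)"
    by (rule infnorm_triangle)
  also have "\<dots> = (1 - s) * infnorm x + s * infnorm y" using assms(3) by (simp add: infnorm_mul)
  also have "\<dots> \<le> (1 - s) * c + s * c" using assms by (intro add_mono mult_left_mono) auto
  finally show ?thesis by (simp add: algebra_simps)
qed

text \<open>The last bound is the separation from the origin: in the slab the coordinate along
  \<open>d\<close> is at least 1, whereas every coordinate along another axis has modulus below
  1/2.\<close>

lemma slab_bounds:
  fixes d :: "'a::euclidean_space"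
  assumes x: "x \<in> slab T d" and T: "T \<subseteq> {1..2}" and d: "d \<in> Basis \<or> - d \<in> Basis"
  shows "1 \<le> x \<bullet> d" "infnorm x \<le> 2"
    and "\<And>l. l \<in> Basis \<or> - l \<in> Basis \<Longrightarrow> l \<noteq> - d \<Longrightarrow> 1 / 2 \<le> x \<bullet> d + x \<bullet> l"
proof -
  have xd: "1 \<le> x \<bullet> d" "x \<bullet> d \<le> 2" using x T by (auto simp: slab_def)
  have oth: "k \<in> Basis \<Longrightarrow> k \<noteq> d \<Longrightarrow> k \<noteq> - d \<Longrightarrow> \<bar>x \<bullet> k\<bar> < 1 / 2" for k
    using x by (auto simp: slab_def)
  show "1 \<le> x \<bullet> d" by fact
  show "infnorm x \<le> 2" unfolding infnorm_le_iff
  proof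
    fix b :: 'a assume b: "b \<in> Basis"
    consider "b = d" | "b = - d" | "b \<noteq> d" "b \<noteq> - d" by blast
    then show "\<bar>x \<bullet> b\<bar> \<le> 2" using oth[OF b] xd by cases (auto simp: abs_if)
  qed
  fix l :: 'a assume l: "l \<in> Basis \<or> - l \<in> Basis" "l \<noteq> - d"
  show "1 / 2 \<le> x \<bullet> d + x \<bullet> l"
  proof (cases "l = d")
    case True then show ?thesis using xd by simp
  next
    case False
    have "\<bar>x \<bullet> l\<bar> < 1 / 2"
      using l False oth[of l] oth[of "- l"] by (auto simp: minus_equation_iff)
    then show ?thesis using xd by simp
  qed
qed

text \<open>The functional \<open>z \<mapsto> z \<bullet> d + z \<bullet> l\<close> is at least 1/2
  at both ends, hence on the segment, and it is at most twice \<open>infnorm z\<close>. For opposite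
  faces it would vanish identically, which is why the polylines need an intermediate vertex.\<close>

lemma slab_segment_bounds:
  fixes d l :: "'a::euclidean_space"
  assumes "x \<in> slab T d" "y \<in> slab T' l" "T \<subseteq> {1..2}" "T' \<subseteq> {1..2}"
    and d: "d \<in> Basis \<or> - d \<in> Basis" and l: "l \<in> Basis \<or> - l \<in> Basis" and "l \<noteq> - d" "s \<in> {0..1}"
  shows "infnorm ((1 - s) *\<^sub>R x + s *\<^sub>R y) \<in> {1 / 4..2}"
proof -
  let ?z = "(1 - s) *\<^sub>R x + s *\<^sub>R y"
  have dl: "d \<noteq> - l" using assms by auto
  have x: "1 / 2 \<le> x \<bullet> d + x \<bullet> l" using slab_bounds(3)[of x T d l] assms by auto
  have y: "1 / 2 \<le> y \<bullet> d + y \<bullet> l" using slab_bounds(3)[of y T' l d] assms dl by auto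
  have "1 / 2 = (1 - s) * (1 / 2) + s * (1 / 2)" by (simp add: field_simps)
  also have "\<dots> \<le> (1 - s) * (x \<bullet> d + x \<bullet> l) + s * (y \<bullet> d + y \<bullet> l)"
    using assms x y by (intro add_mono mult_left_mono) auto
  also have "\<dots> = ?z \<bullet> d + ?z \<bullet> l" by (simp add: inner_add_left algebra_simps)
  also have "\<dots> \<le> infnorm ?z + infnorm ?z"
    using inner_signed_Basis_le_infnorm[OF d, of ?z] inner_signed_Basis_le_infnorm[OF l, of ?z] by linarith
  finally have "1 / 4 \<le> infnorm ?z" by simp
  moreover have "infnorm ?z \<le> 2"
    using slab_bounds(2) assms by (intro infnorm_convex_le) blast+
  ultimately show ?thesis by simp
qed

text \<open>The whole segment lies in the hyperplane on which the coordinate along \<open>d\<close>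
  has the constant value \<open>x \<bullet> d\<close>, and this is at least 1.\<close>

lemma slice_segment_bounds:
  fixes d :: "'a::euclidean_space"
  assumes "x \<in> slab T d" "T \<subseteq> {1..2}" and d: "d \<in> Basis \<or> - d \<in> Basis"
    and "infnorm z \<le> 2" "z \<bullet> d = x \<bullet> d" "s \<in> {0..1}"
  shows "infnorm ((1 - s) *\<^sub>R z + s *\<^sub>R x) \<in> {1 / 4..2}"
proof -
  let ?z = "(1 - s) *\<^sub>R z + s *\<^sub>R x"
  have "?z \<bullet> d = x \<bullet> d" using assms by (simp add: inner_add_left algebra_simps)
  then have "1 \<le> infnorm ?z"
    using inner_signed_Basis_le_infnorm[OF d, of ?z] slab_bounds(1)[OF assms(1-3)] by simp
  moreover have "infnorm ?z \<le> 2"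
    using slab_bounds(2)[OF assms(1-3)] assms by (intro infnorm_convex_le) auto
  ultimately show ?thesis by simp
qed

text \<open>Each \<open>a t\<close> lies on a face of its cube, so the sets of radii belonging to
  the at most \<open>2 * DIM('a)\<close> faces cover an interval of length 1. Fixing one face for
  many radii is what allows \<open>a\<close> to be joined to a prism inside hyperplanes.\<close>

lemma infnorm_face_pigeonhole:
  fixes a :: "real \<Rightarrow> 'a::euclidean_space"
  assumes [measurable]: "a \<in> borel_measurable borel" and a: "\<And>t. t \<in> {1..2} \<Longrightarrow> infnorm (a t) = t"
  obtains d where "d \<in> Basis \<or> - d \<in> Basis" "{t\<in>{1..2}. a t \<bullet> d = t} \<in> sets borel"
    "ennreal (1 / (2 * DIM('a))) \<le> emeasure lborel {t\<in>{1..2}. a t \<bullet> d = t}"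
proof -
  let ?S = "Basis \<union> uminus ` Basis :: 'a set"
  let ?T = "\<lambda>d. {t\<in>{1..2}. a t \<bullet> d = t}"
  have meas: "?T d \<in> sets borel" for d by measurable
  have S: "d \<in> ?S \<longleftrightarrow> d \<in> Basis \<or> - d \<in> Basis" for d by force
  have card: "card ?S \<le> 2 * DIM('a)"
    using card_Un_le[of Basis "uminus ` Basis :: 'a set"] card_image_le[of "Basis :: 'a set" uminus] by simp
  define \<mu> where "\<mu> = Max ((\<lambda>d. emeasure lborel (?T d)) ` ?S)"
  have "{1..2} \<subseteq> (\<Union>d\<in>?S. ?T d)"
  proof
    fix t :: real assume t: "t \<in> {1..2}"
    obtain d where "d \<in> Basis \<or> - d \<in> Basis" "a t \<bullet> d = infnorm (a t)" using infnorm_attained by blast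
    then show "t \<in> (\<Union>d\<in>?S. ?T d)" using a[OF t] t S[of d] by auto
  qed
  moreover have "(\<Union>d\<in>?S. ?T d) \<in> sets borel"
    by (rule sets.finite_UN) (use meas in auto)
  ultimately have "emeasure lborel {1..2::real} \<le> emeasure lborel (\<Union>d\<in>?S. ?T d)"
    by (intro emeasure_mono) (simp_all only: sets_lborel)
  also have "\<dots> \<le> (\<Sum>d\<in>?S. emeasure lborel (?T d))"
    using meas by (intro emeasure_subadditive_finite) auto
  also have "\<dots> \<le> (\<Sum>d\<in>?S. \<mu>)"
    unfolding \<mu>_def by (intro sum_mono Max_ge) auto
  also have "\<dots> = of_nat (card ?S) * \<mu>" by simp
  also have "\<dots> \<le> of_nat (2 * DIM('a)) * \<mu>"
    using card by (intro mult_right_mono of_nat_mono) auto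
  also have "of_nat (2 * DIM('a)) = ennreal (real (2 * DIM('a)))" by (rule ennreal_of_nat_eq_real_of_nat)
  finally have "1 \<le> ennreal (real (2 * DIM('a))) * \<mu>" by simp
  then have "ennreal (1 / real (2 * DIM('a))) * 1 \<le> ennreal (1 / real (2 * DIM('a))) * (ennreal (real (2 * DIM('a))) * \<mu>)"
    by (rule mult_left_mono) simp
  also have "\<dots> = ennreal (1 / real (2 * DIM('a)) * real (2 * DIM('a))) * \<mu>"
    by (subst ennreal_mult) (simp_all only: mult.assoc zero_le_divide_1_iff of_nat_0_le_iff)
  also have "1 / real (2 * DIM('a)) * real (2 * DIM('a)) = 1" by simp
  finally have \<mu>: "ennreal (1 / (2 * DIM('a))) \<le> \<mu>" by simp
  have "\<mu> \<in> (\<lambda>d. emeasure lborel (?T d)) ` ?S"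
    unfolding \<mu>_def by (intro Max_in) auto
  then obtain d where d: "\<mu> = emeasure lborel (?T d)" "d \<in> ?S" by (rule imageE)
  show ?thesis
    using \<mu> S[of d] d by (intro that[of d] meas) simp_all
qed

text \<open>Peels one random vertex off an inequality that holds for all its positions; volume at
  most 1 keeps the constant term \<open>c\<close> from growing.\<close>

lemma average_le:
  fixes f :: "'a::euclidean_space \<Rightarrow> ennreal"
  assumes [measurable]: "f \<in> borel_measurable borel" "X \<in> sets borel" and X: "emeasure lborel X \<le> 1"
    and le: "\<And>x. x \<in> X \<Longrightarrow> k \<le> L * (c + f x)"
  shows "k * emeasure lborel X \<le> L * (c + (\<integral>\<^sup>+x\<in>X. f x \<partial>lborel))"
proof -
  have "k * emeasure lborel X = (\<integral>\<^sup>+x\<in>X. k \<partial>lborel)" by (simp add: nn_integral_cmult_indicator)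
  also have "\<dots> \<le> (\<integral>\<^sup>+x. L * (c * indicator X x + f x * indicator X x) \<partial>lborel)"
    using le by (intro nn_integral_mono) (auto split: split_indicator)
  also have "\<dots> = L * (c * emeasure lborel X + (\<integral>\<^sup>+x\<in>X. f x \<partial>lborel))"
    by (simp add: nn_integral_cmult nn_integral_add nn_integral_cmult_indicator)
  also have "\<dots> \<le> L * (c * 1 + (\<integral>\<^sup>+x\<in>X. f x \<partial>lborel))"
    by (intro mult_left_mono add_right_mono X) auto
  finally show ?thesis by simp
qed

text \<open>The parameter integral without the length of the segment as a factor. Lengths are
  accounted for by a separate Lipschitz constant, so the averages need no speed factor.\<close>

definition segment_integral :: "('a::euclidean_space \<Rightarrow> ennreal) \<Rightarrow> 'a \<Rightarrow> 'a \<Rightarrow> ennreal" where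
  "segment_integral \<rho> x y = (\<integral>\<^sup>+s\<in>{0..1}. \<rho> ((1 - s) *\<^sub>R x + s *\<^sub>R y) \<partial>lborel)"

lemma segment_integral_measurable[measurable]:
  fixes \<rho> :: "'a::euclidean_space \<Rightarrow> ennreal"
  assumes [measurable]: "\<rho> \<in> borel_measurable borel" "f \<in> borel_measurable M" "g \<in> borel_measurable M"
  shows "(\<lambda>x. segment_integral \<rho> (f x) (g x)) \<in> borel_measurable M"
  unfolding segment_integral_def by measurable

lemma segment_integral_commute:
  fixes \<rho> :: "'a::euclidean_space \<Rightarrow> ennreal"
  assumes [measurable]: "\<rho> \<in> borel_measurable borel"
  shows "segment_integral \<rho> x y = segment_integral \<rho> y x"
proof -
  have "segment_integral \<rho> x y = (\<integral>\<^sup>+s\<in>{0..1}. \<rho> ((1 - (1 - s)) *\<^sub>R x + (1 - s) *\<^sub>R y) \<partial>lborel)"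
    unfolding segment_integral_def
    by (subst nn_integral_unit_interval_flip[of "\<lambda>s. \<rho> ((1 - s) *\<^sub>R x + s *\<^sub>R y)", symmetric]) auto
  then show ?thesis by (simp add: segment_integral_def add.commute)
qed

text \<open>A random polyline a \<rightarrow> p \<rightarrow> m \<rightarrow> q \<rightarrow> b, with p, m, q uniform in slabs next to faces of the cubes,
  has bounded occupation density except near a and b; there the singularity has order n - 1, because p lies
  in the same hyperplane as a, so that it is integrable against an L^n function.\<close>

lemma loewner_unit_annulus:
  fixes L :: real
  assumes dim: "2 \<le> DIM('a::euclidean_space)" and L: "0 < L"
  shows "\<exists>\<kappa>>0. \<forall>(a :: real \<Rightarrow> 'a) b \<rho>. a \<in> borel_measurable borel \<longrightarrow> b \<in> borel_measurable borel \<longrightarrow>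
    (\<forall>t\<in>{1..2}. infnorm (a t) = t \<and> infnorm (b t) = t) \<longrightarrow> \<rho> \<in> borel_measurable borel \<longrightarrow>
    (\<forall>v. v 0 \<in> a ` {1..2} \<and> v 4 \<in> b ` {1..2} \<and>
         (\<forall>k<4. \<forall>s\<in>{0..1}. infnorm ((1 - s) *\<^sub>R v k + s *\<^sub>R v (Suc k)) \<in> {1 / 4..2}) \<longrightarrow>
       1 \<le> ennreal L * (\<Sum>k<4. segment_integral \<rho> (v k) (v (Suc k)))) \<longrightarrow>
    ennreal \<kappa> \<le> (\<integral>\<^sup>+x. \<rho> x ^ DIM('a) \<partial>lborel)"
proof -
  define n where "n = DIM('a)"
  have n: "2 \<le> n" using dim by (simp add: n_def)
  \<comment> \<open>Splits the budget in half: the volumes of the two outer prisms have product at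
    least \<open>1 / (4 * n ^ 2)\<close>, and the thresholds of the four averaged edges contribute
    \<open>4 * L * n * \<theta> = 1 / (8 * n ^ 2)\<close>. The other half yields
    \<open>\<kappa>\<close> below.\<close>
  define \<theta> where "\<theta> = 1 / (32 * L * real n ^ 3)"
  have \<theta>: "0 < \<theta>" using L n by (simp add: \<theta>_def)
  define J where "J = 2 ^ n / \<theta> ^ (n - 1)"
  have J: "0 < J" using \<theta> by (simp add: J_def)
  define \<kappa> where "\<kappa> = 1 / (8 * real n ^ 2) / (4 * L * real n * J)"
  have \<kappa>: "0 < \<kappa>" using L n J by (simp add: \<kappa>_def)
  show ?thesis
  proof (intro exI[of _ \<kappa>] conjI allI impI \<kappa>)
    fix a b :: "real \<Rightarrow> 'a" and \<rho> :: "'a \<Rightarrow> ennreal"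
    assume a[measurable]: "a \<in> borel_measurable borel" and b[measurable]: "b \<in> borel_measurable borel"
      and ab: "\<forall>t\<in>{1..2}. infnorm (a t) = t \<and> infnorm (b t) = t"
      and \<rho>[measurable]: "\<rho> \<in> borel_measurable borel"
      and adm: "\<forall>v. v 0 \<in> a ` {1..2} \<and> v 4 \<in> b ` {1..2} \<and>
         (\<forall>k<4. \<forall>s\<in>{0..1}. infnorm ((1 - s) *\<^sub>R v k + s *\<^sub>R v (Suc k)) \<in> {1 / 4..2}) \<longrightarrow>
       1 \<le> ennreal L * (\<Sum>k<4. segment_integral \<rho> (v k) (v (Suc k)))"
    define I where "I = (\<integral>\<^sup>+x. \<rho> x ^ DIM('a) \<partial>lborel)"
    obtain d where d: "d \<in> Basis \<or> - d \<in> Basis" and T[measurable]: "{t\<in>{1..2}. a t \<bullet> d = t} \<in> sets borel"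
      and dn: "ennreal (1 / (2 * DIM('a))) \<le> emeasure lborel {t\<in>{1..2}. a t \<bullet> d = t}"
      by (rule infnorm_face_pigeonhole[OF a]) (use ab in blast)+
    obtain d' where d': "d' \<in> Basis \<or> - d' \<in> Basis" and T'[measurable]: "{t\<in>{1..2}. b t \<bullet> d' = t} \<in> sets borel"
      and dn': "ennreal (1 / (2 * DIM('a))) \<le> emeasure lborel {t\<in>{1..2}. b t \<bullet> d' = t}"
      by (rule infnorm_face_pigeonhole[OF b]) (use ab in blast)+
    \<comment> \<open>The middle vertex needs a face opposite to neither of the outer ones. If these
      are opposite to each other, a second axis is used, which exists in dimension at least
      2.\<close>
    have "\<exists>l. (l \<in> Basis \<or> - l \<in> Basis) \<and> l \<noteq> - d \<and> l \<noteq> - d'"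
    proof (cases "d' = - d")
      case False
      have "d \<noteq> - d" using norm_signed_Basis[OF d] by (metis norm_zero scaleR_half_double add.right_inverse scaleR_zero_right zero_neq_one)
      then show ?thesis using False d by (intro exI[of _ d]) auto
    next
      case True
      obtain e where e: "e \<in> Basis" "d = e \<or> d = - e" using d by (metis minus_minus)
      obtain l :: 'a where l: "l \<in> Basis" "l \<noteq> e"
        using dim e(1) by (metis One_nat_def card_1_singleton_iff card_le_Suc0_iff_eq finite_Basis not_less_eq_eq numeral_2_eq_2)
      have "l \<bullet> e = 0" using l e(1) by (simp add: inner_Basis)
      then have "l \<noteq> - e" using e(1) by auto
      then show ?thesis using True l e by (intro exI[of _ l]) auto
    qed
    then obtain l where l: "l \<in> Basis \<or> - l \<in> Basis" "l \<noteq> - d" "l \<noteq> - d'" by blast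
    then have l': "d' \<noteq> - l" by auto
    let ?T = "{t\<in>{1..2}. a t \<bullet> d = t}" and ?T' = "{t\<in>{1..2}. b t \<bullet> d' = t}"
    define P where "P = slab ?T d"
    define P' where "P' = slab ?T' d'"
    define M where "M = slab {1..2} l"
    have [measurable]: "P \<in> sets borel" "P' \<in> sets borel" "M \<in> sets borel"
      by (auto simp: P_def P'_def M_def)
    have le1: "emeasure lborel X \<le> 1" if "X \<subseteq> {1..2::real}" for X
      using emeasure_mono[OF that, of lborel] by simp
    have P1: "emeasure lborel P \<le> 1" "ennreal (1 / (2 * real n)) \<le> emeasure lborel P"
      unfolding P_def emeasure_slab[OF T d] using dn by (auto intro!: le1 simp: n_def)
    have P'1: "emeasure lborel P' \<le> 1" "ennreal (1 / (2 * real n)) \<le> emeasure lborel P'"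
      unfolding P'_def emeasure_slab[OF T' d'] using dn' by (auto intro!: le1 simp: n_def)
    have M1: "emeasure lborel M = 1"
      unfolding M_def by (subst emeasure_slab) (use l in auto)
    have aP: "a (x \<bullet> d) \<bullet> d = x \<bullet> d" "x \<bullet> d \<in> {1..2}" if "x \<in> P" for x
      using that by (auto simp: P_def slab_def)
    have bP: "b (x \<bullet> d') \<bullet> d' = x \<bullet> d'" "x \<bullet> d' \<in> {1..2}" if "x \<in> P'" for x
      using that by (auto simp: P'_def slab_def)
    define A1 where "A1 = (\<lambda>p. segment_integral \<rho> (a (p \<bullet> d)) p)"
    define A2 where "A2 = (\<lambda>p m. segment_integral \<rho> p m)"
    define A4 where "A4 = (\<lambda>q. segment_integral \<rho> (b (q \<bullet> d')) q)"
    have [measurable]: "A1 \<in> borel_measurable borel" "A4 \<in> borel_measurable borel" "case_prod A2 \<in> borel_measurable (borel \<Otimes>\<^sub>M borel)"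
      unfolding A1_def A2_def A4_def by measurable
    have main: "1 \<le> ennreal L * ((A1 p + A2 p m) + (A2 m q + A4 q))" if p: "p \<in> P" and m: "m \<in> M" and q: "q \<in> P'" for p m q
    proof -
      define v where "v = (\<lambda>k::nat. [a (p \<bullet> d), p, m, q, b (q \<bullet> d')] ! k)"
      have bnd: "infnorm ((1 - s) *\<^sub>R v k + s *\<^sub>R v (Suc k)) \<in> {1 / 4..2}" if k: "k < 4" and s: "s \<in> {0..1}" for k s
      proof -
        have T12: "?T \<subseteq> {1..2}" "?T' \<subseteq> {1..2}" by auto
        have in_slab: "p \<in> slab ?T d" "m \<in> slab {1..2} l" "q \<in> slab ?T' d'"
          using p m q by (simp_all add: P_def M_def P'_def)
        have s': "1 - s \<in> {0..1}" using s by auto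
        consider "k = 0" | "k = 1" | "k = 2" | "k = 3" using k by linarith
        then show ?thesis
        proof cases
          case 1
          have "infnorm (a (p \<bullet> d)) \<le> 2" using ab aP[OF p] by auto
          then show ?thesis
            using 1 slice_segment_bounds[OF in_slab(1) T12(1) d _ aP(1)[OF p] s] by (simp add: v_def)
        next
          case 2
          then show ?thesis
            using slab_segment_bounds[OF in_slab(1,2) T12(1) subset_refl d l(1,2) s] by (simp add: v_def)
        next
          case 3
          then show ?thesis
            using slab_segment_bounds[OF in_slab(2,3) subset_refl T12(2) l(1) d' l' s] by (simp add: v_def eval_nat_numeral)
        next
          case 4
          have "infnorm (b (q \<bullet> d')) \<le> 2" using ab bP[OF q] by auto
          then have "infnorm ((1 - (1 - s)) *\<^sub>R b (q \<bullet> d') + (1 - s) *\<^sub>R q) \<in> {1 / 4..2}"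
            by (rule slice_segment_bounds[OF in_slab(3) T12(2) d' _ bP(1)[OF q] s'])
          then show ?thesis using 4 by (simp add: v_def add.commute eval_nat_numeral)
        qed
      qed
      have "v 0 \<in> a ` {1..2}" "v 4 \<in> b ` {1..2}" using aP[OF p] bP[OF q] by (auto simp: v_def)
      then have "1 \<le> ennreal L * (\<Sum>k<4. segment_integral \<rho> (v k) (v (Suc k)))"
        using adm bnd by blast
      also have "(\<Sum>k<4. segment_integral \<rho> (v k) (v (Suc k))) = (A1 p + A2 p m) + (A2 m q + A4 q)"
        using segment_integral_commute[OF \<rho>, of q "b (q \<bullet> d')"]
        by (simp add: eval_nat_numeral v_def A1_def A2_def A4_def add.assoc)
      finally show ?thesis .
    qed
    define B3 where "B3 = (\<lambda>m. \<integral>\<^sup>+q\<in>P'. A2 m q \<partial>lborel)"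
    define B2 where "B2 = (\<lambda>p. \<integral>\<^sup>+m\<in>M. A2 p m \<partial>lborel)"
    define b4 where "b4 = (\<integral>\<^sup>+q\<in>P'. A4 q \<partial>lborel)"
    define b3 where "b3 = (\<integral>\<^sup>+m\<in>M. B3 m \<partial>lborel)"
    define b2 where "b2 = (\<integral>\<^sup>+p\<in>P. B2 p \<partial>lborel)"
    define b1 where "b1 = (\<integral>\<^sup>+p\<in>P. A1 p \<partial>lborel)"
    have [measurable]: "B2 \<in> borel_measurable borel" "B3 \<in> borel_measurable borel"
      unfolding B2_def B3_def by measurable
    \<comment> \<open>The vertices q, m, p are averaged out in this order; each averaging turns the
      edges at that vertex into constants or into functions of the vertices that remain.\<close>
    have s1: "emeasure lborel P' \<le> ennreal L * ((A1 p + b4) + (A2 p m + B3 m))" if "p \<in> P" "m \<in> M" for p m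
    proof -
      have "1 * emeasure lborel P' \<le> ennreal L * ((A1 p + A2 p m) + (\<integral>\<^sup>+q\<in>P'. A2 m q + A4 q \<partial>lborel))"
        using main that by (intro average_le P'1) auto
      also have "(\<integral>\<^sup>+q\<in>P'. A2 m q + A4 q \<partial>lborel) = B3 m + b4"
        unfolding B3_def b4_def by (simp add: distrib_right nn_integral_add)
      finally show ?thesis by (simp add: ac_simps)
    qed
    have s2: "emeasure lborel P' \<le> ennreal L * ((b3 + b4) + (A1 p + B2 p))" if "p \<in> P" for p
    proof -
      have "emeasure lborel P' * emeasure lborel M \<le> ennreal L * ((A1 p + b4) + (\<integral>\<^sup>+m\<in>M. A2 p m + B3 m \<partial>lborel))"
        using s1 that M1 by (intro average_le) auto
      also have "(\<integral>\<^sup>+m\<in>M. A2 p m + B3 m \<partial>lborel) = B2 p + b3"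
        unfolding B2_def b3_def by (simp add: distrib_right nn_integral_add)
      finally show ?thesis by (simp add: ac_simps M1)
    qed
    have "emeasure lborel P' * emeasure lborel P \<le> ennreal L * ((b3 + b4) + (\<integral>\<^sup>+p\<in>P. A1 p + B2 p \<partial>lborel))"
      using s2 P1 by (intro average_le) auto
    also have "(\<integral>\<^sup>+p\<in>P. A1 p + B2 p \<partial>lborel) = b1 + b2"
      unfolding b1_def b2_def by (simp add: distrib_right nn_integral_add)
    finally have s3: "emeasure lborel P' * emeasure lborel P \<le> ennreal L * ((b3 + b4) + (b1 + b2))" .
    \<comment> \<open>A common bound for the four averages: \<open>J\<close> dominates the
      coefficient of the power integral in both the slice and the free estimate.\<close>
    define E where "E = ennreal (real n) * (ennreal \<theta> + ennreal J * I)"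
    have nE: "x \<le> E" if "x \<le> ennreal \<theta> + ennreal J * I" for x
    proof -
      have "x \<le> 1 * (ennreal \<theta> + ennreal J * I)" using that by simp
      also have "\<dots> \<le> E" unfolding E_def using n by (intro mult_right_mono) auto
      finally show ?thesis .
    qed
    have slice: "ennreal DIM('a) * (ennreal \<theta> * x + ennreal (1 / \<theta> ^ (DIM('a) - 1)) * I) \<le> E" if "x \<le> 1" for x
    proof -
      have "ennreal \<theta> * x + ennreal (1 / \<theta> ^ (DIM('a) - 1)) * I \<le> ennreal \<theta> * 1 + ennreal J * I"
        using that \<theta> by (intro add_mono mult_left_mono mult_right_mono ennreal_leI)
          (auto simp: J_def n_def divide_right_mono)
      then show ?thesis unfolding E_def n_def by (intro mult_left_mono) auto
    qed
    have b1: "b1 \<le> E"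
      using nn_integral_slice_segment_le[OF \<rho> a d _ aP(1) \<theta>, of P] slice[OF P1(1)]
      by (auto simp: b1_def A1_def segment_integral_def I_def intro: order_trans)
    have b4: "b4 \<le> E"
      using nn_integral_slice_segment_le[OF \<rho> b d' _ bP(1) \<theta>, of P'] slice[OF P'1(1)]
      by (auto simp: b4_def A4_def segment_integral_def I_def intro: order_trans)
    have b2: "b2 \<le> E"
      using nn_integral_free_segment_le[OF \<rho> _ _ P1(1) _ \<theta>, of M] M1
      by (intro nE) (simp add: b2_def B2_def A2_def segment_integral_def I_def J_def n_def)
    have b3: "b3 \<le> E"
      using nn_integral_free_segment_le[OF \<rho> _ _ _ P'1(1) \<theta>, of M] M1
      by (intro nE) (simp add: b3_def B3_def A2_def segment_integral_def I_def J_def n_def)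
    have "ennreal (1 / (4 * real n ^ 2)) = ennreal (1 / (2 * real n)) * ennreal (1 / (2 * real n))"
      by (subst ennreal_mult[symmetric]) (auto simp: power2_eq_square)
    also have "\<dots> \<le> emeasure lborel P' * emeasure lborel P" using P1 P'1 by (intro mult_mono) auto
    also have "\<dots> \<le> ennreal L * ((E + E) + (E + E))"
      by (rule order_trans[OF s3]) (intro mult_left_mono add_mono b1 b2 b3 b4, simp)
    finally have fin: "ennreal (1 / (4 * real n ^ 2)) \<le> ennreal L * ((E + E) + (E + E))" .
    show "ennreal \<kappa> \<le> (\<integral>\<^sup>+x. \<rho> x ^ DIM('a) \<partial>lborel)" unfolding I_def[symmetric]
    proof (cases I rule: ennreal_cases)
      case (real i)
      have "E = ennreal (real n * (\<theta> + J * i))"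
        unfolding E_def using real \<theta> J by (simp add: ennreal_mult[symmetric] ennreal_plus[symmetric] del: ennreal_plus)
      then have "ennreal L * ((E + E) + (E + E)) = ennreal (L * (4 * (real n * (\<theta> + J * i))))"
        using real \<theta> J L by (simp add: ennreal_mult[symmetric] ennreal_plus[symmetric] del: ennreal_plus)
      then have "1 / (4 * real n ^ 2) \<le> L * (4 * (real n * (\<theta> + J * i)))"
        using fin real \<theta> J L by (simp add: ennreal_le_iff)
      also have "\<dots> = 4 * L * real n * \<theta> + 4 * L * real n * J * i" by (simp add: algebra_simps)
      also have "4 * L * real n * \<theta> = 1 / (8 * real n ^ 2)"
        using L n by (simp add: \<theta>_def field_simps power2_eq_square power3_eq_cube)
      finally have "1 / (8 * real n ^ 2) \<le> 4 * L * real n * J * i" using n by (simp add: field_simps)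
      then have "\<kappa> \<le> i" unfolding \<kappa>_def using L n J by (simp add: pos_divide_le_eq ac_simps)
      then show "ennreal \<kappa> \<le> I" using real by (simp add: ennreal_leI)
    qed simp
  qed
qed

section \<open>Polylines as Lipschitz paths\<close>

definition polyline :: "(nat \<Rightarrow> 'a::euclidean_space) \<Rightarrow> nat \<Rightarrow> real \<Rightarrow> 'a" where
  "polyline v N t = v 0 + (\<Sum>k<N. max 0 (min 1 (t - real k)) *\<^sub>R (v (Suc k) - v k))"

lemma polyline_Suc:
  "polyline v (Suc N) t = polyline v N t + max 0 (min 1 (t - real N)) *\<^sub>R (v (Suc N) - v N)"
  by (simp add: polyline_def)

lemma polyline_ge: "real N \<le> t \<Longrightarrow> polyline v N t = v N"
proof (induction N)
  case 0
  then show ?case by (simp add: polyline_def)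
next
  case (Suc N)
  then show ?case by (simp add: polyline_Suc)
qed

lemma polyline_0: "polyline v N 0 = v 0"
  by (simp add: polyline_def)

lemma polyline_segment:
  assumes "k < N" "real k \<le> t" "t \<le> real k + 1"
  shows "polyline v N t = (1 - (t - real k)) *\<^sub>R v k + (t - real k) *\<^sub>R v (Suc k)"
  using assms(1)
proof (induction N)
  case (Suc N)
  show ?case
  proof (cases "k = N")
    case True
    then show ?thesis using assms by (simp add: polyline_Suc polyline_ge algebra_simps)
  next
    case False
    then have "real k + 1 \<le> real N" using Suc by simp
    then show ?thesis using False Suc assms by (simp add: polyline_Suc)
  qed
qed simp

lemma interval_unit_cell:
  assumes "t \<in> {0..real N}" "0 < N"
  shows "\<exists>k<N. real k \<le> t \<and> t \<le> real k + 1"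
  using assms
proof (induction N)
  case (Suc N)
  show ?case
  proof (cases "t \<le> real N \<and> 0 < N")
    case True
    then have "\<exists>k<N. real k \<le> t \<and> t \<le> real k + 1" using Suc by simp
    then show ?thesis using less_SucI by blast
  next
    case False
    then have "real N \<le> t" using Suc by auto
    then show ?thesis using Suc by (intro exI[of _ N]) simp
  qed
qed simp

lemma polyline_in_segment:
  assumes t: "t \<in> {0..real N}" and N: "0 < N"
  obtains k s where "k < N" "s \<in> {0..1}" "polyline v N t = (1 - s) *\<^sub>R v k + s *\<^sub>R v (Suc k)"
proof -
  obtain k where "k < N" "real k \<le> t" "t \<le> real k + 1"
    using interval_unit_cell[OF t N] by blast
  then show ?thesis using polyline_segment[of k N t v] by (intro that[of k "t - real k"]) auto
qed

lemma sum_clamp: "(\<Sum>k<N. max 0 (min 1 (t - real k))) = max 0 (min (real N) t)"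
  by (induction N) auto

text \<open>This is what the definition by clamped increments is made for: between x and y the
  coefficients of all edges increase, and by \<open>sum_clamp\<close> their total increase is at
  most y - x, regardless of how many cells are crossed.\<close>

lemma polyline_lipschitz:
  fixes v :: "nat \<Rightarrow> 'a::euclidean_space"
  assumes "\<And>k. k < N \<Longrightarrow> norm (v (Suc k) - v k) \<le> L" and L: "0 \<le> L"
  shows "norm (polyline v N y - polyline v N x) \<le> L * \<bar>y - x\<bar>"
proof -
  have le: "norm (polyline v N y - polyline v N x) \<le> L * (y - x)" if xy: "x \<le> y" for x y
  proof -
    let ?c = "\<lambda>t k. max 0 (min 1 (t - real k))"
    have "polyline v N y - polyline v N x = (\<Sum>k<N. (?c y k - ?c x k) *\<^sub>R (v (Suc k) - v k))"
      by (simp add: polyline_def sum_subtractf[symmetric] scaleR_left_diff_distrib)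
    also have "norm \<dots> \<le> (\<Sum>k<N. (?c y k - ?c x k) * L)"
      using assms xy by (intro sum_norm_le) (auto intro!: mult_mono)
    also have "\<dots> = (max 0 (min (real N) y) - max 0 (min (real N) x)) * L"
      by (simp add: sum_distrib_right[symmetric] sum_subtractf sum_clamp)
    also have "\<dots> \<le> (y - x) * L" using xy L by (intro mult_right_mono) auto
    finally show ?thesis by (simp add: mult.commute)
  qed
  show ?thesis
    using le[of x y] le[of y x] by (cases "x \<le> y") (auto simp: norm_minus_commute)
qed

lemma continuous_on_polyline: "continuous_on S (polyline v N)"
  unfolding polyline_def by (intro continuous_intros)

lemma nn_integral_polyline_le:
  fixes \<rho> :: "'a::euclidean_space \<Rightarrow> ennreal"
  assumes [measurable]: "\<rho> \<in> borel_measurable borel"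
  shows "(\<integral>\<^sup>+t\<in>{0..real N}. \<rho> (polyline v N t) \<partial>lborel) \<le> (\<Sum>k<N. segment_integral \<rho> (v k) (v (Suc k)))"
proof (cases "N = 0")
  case True
  have "(\<integral>\<^sup>+t\<in>{0::real}. \<rho> (polyline v N t) \<partial>lborel) = 0"
    by (subst nn_integral_indicator_singleton) auto
  then show ?thesis using True by simp
next
  case False
  let ?S = "\<lambda>k t. \<rho> ((1 - (t - real k)) *\<^sub>R v k + (t - real k) *\<^sub>R v (Suc k)) * indicator {0..1} (t - real k)"
  have "(\<integral>\<^sup>+t\<in>{0..real N}. \<rho> (polyline v N t) \<partial>lborel) \<le> (\<integral>\<^sup>+t. (\<Sum>k<N. ?S k t) \<partial>lborel)"
  proof (rule nn_integral_mono)
    fix t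
    show "\<rho> (polyline v N t) * indicator {0..real N} t \<le> (\<Sum>k<N. ?S k t)"
    proof (cases "t \<in> {0..real N}")
      case True
      obtain k where k: "k < N" "real k \<le> t" "t \<le> real k + 1"
        using interval_unit_cell[OF True] False by blast
      have "\<rho> (polyline v N t) * indicator {0..real N} t = ?S k t"
        using k True polyline_segment[OF k, of v] by (simp add: indicator_def)
      also have "\<dots> \<le> (\<Sum>k<N. ?S k t)" using k by (intro member_le_sum) auto
      finally show ?thesis .
    qed simp
  qed
  also have "\<dots> = (\<Sum>k<N. \<integral>\<^sup>+t. ?S k t \<partial>lborel)" by (intro nn_integral_sum) measurable
  also have "\<dots> = (\<Sum>k<N. segment_integral \<rho> (v k) (v (Suc k)))"
  proof (rule sum.cong[OF refl])
    fix k
    have "(\<integral>\<^sup>+t. ?S k t \<partial>lborel) = (\<integral>\<^sup>+t. ?S k (t + real k) \<partial>lborel)"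
      by (subst nn_integral_lborel_translate[of "?S k" "real k"]) auto
    then show "(\<integral>\<^sup>+t. ?S k t \<partial>lborel) = segment_integral \<rho> (v k) (v (Suc k))"
      by (simp add: segment_integral_def)
  qed
  finally show ?thesis .
qed

text \<open>Four is the number of edges produced by the random construction. \<open>L\<close> is any
  common bound for the edge lengths, hence a Lipschitz constant in the parameter, and
  \<open>W\<close> confines the test curves to the region where their preimages are under
  control.\<close>

definition polyline_admissible ::
  "('a::euclidean_space \<Rightarrow> ennreal) \<Rightarrow> 'a set \<Rightarrow> 'a set \<Rightarrow> 'a set \<Rightarrow> bool" where
  "polyline_admissible \<rho> A B W \<longleftrightarrow>
    (\<forall>v L. v 0 \<in> A \<and> v 4 \<in> B \<and> 0 \<le> L \<and> (\<forall>k<4. norm (v (Suc k) - v k) \<le> L) \<and>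
       (\<forall>k<4. \<forall>s\<in>{0..1}. (1 - s) *\<^sub>R v k + s *\<^sub>R v (Suc k) \<in> W) \<longrightarrow>
       1 \<le> ennreal L * (\<Sum>k<4. segment_integral \<rho> (v k) (v (Suc k))))"

lemma polyline_admissibleD:
  assumes "polyline_admissible \<rho> A B W" "v 0 \<in> A" "v 4 \<in> B" "0 \<le> L"
    and "\<And>k. k < 4 \<Longrightarrow> norm (v (Suc k) - v k) \<le> L"
    and "\<And>k s. k < 4 \<Longrightarrow> s \<in> {0..1} \<Longrightarrow> (1 - s) *\<^sub>R v k + s *\<^sub>R v (Suc k) \<in> W"
  shows "1 \<le> ennreal L * (\<Sum>k<4. segment_integral \<rho> (v k) (v (Suc k)))"
  using assms unfolding polyline_admissible_def by simp

lemma polyline_admissible_mono: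
  assumes "polyline_admissible \<rho> A B W" "A' \<subseteq> A" "B' \<subseteq> B" "W' \<subseteq> W"
  shows "polyline_admissible \<rho> A' B' W'"
  unfolding polyline_admissible_def
proof (intro allI impI, elim conjE)
  fix v :: "nat \<Rightarrow> 'a" and L :: real
  assume v: "v 0 \<in> A'" "v 4 \<in> B'" "0 \<le> L" "\<forall>k<4. norm (v (Suc k) - v k) \<le> L"
    "\<forall>k<4. \<forall>s\<in>{0..1}. (1 - s) *\<^sub>R v k + s *\<^sub>R v (Suc k) \<in> W'"
  show "1 \<le> ennreal L * (\<Sum>k<4. segment_integral \<rho> (v k) (v (Suc k)))"
    by (rule polyline_admissibleD[OF assms(1)]) (use v assms(2-4) in blast)+
qed

text \<open>Each annulus is rescaled to unit size; multiplying the density by the scale keeps the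
  integral of its power \<open>DIM('a)\<close> unchanged. The annuli reach from a quarter of their
  scale to twice their scale, and the ratio 16 between consecutive scales makes them disjoint, so
  the contributions \<open>\<kappa>\<close> add up.\<close>

lemma loewner_annuli:
  assumes dim: "2 \<le> DIM('a::euclidean_space)"
  obtains \<kappa> :: real where "0 < \<kappa>"
    "\<And>(a :: real \<Rightarrow> 'a) b c \<rho> \<alpha> N. a \<in> borel_measurable borel \<Longrightarrow> b \<in> borel_measurable borel \<Longrightarrow> 0 < \<alpha> \<Longrightarrow>
      \<forall>t\<in>{\<alpha>..\<alpha> * 16 ^ N}. infnorm (a t - c) = t \<and> infnorm (b t - c) = t \<Longrightarrow> \<rho> \<in> borel_measurable borel \<Longrightarrow>
      polyline_admissible \<rho> (a ` {\<alpha>..\<alpha> * 16 ^ N}) (b ` {\<alpha>..\<alpha> * 16 ^ N}) {x. infnorm (x - c) \<in> {\<alpha> / 4..\<alpha> * 16 ^ N}} \<Longrightarrow>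
      ennreal (real N * \<kappa>) \<le> (\<integral>\<^sup>+x. \<rho> x ^ DIM('a) \<partial>lborel)"
proof -
  \<comment> \<open>The vertices lie in the cube of radius 2, so an edge has \<open>infnorm\<close>
    at most 4; the square root passes to the Euclidean norm.\<close>
  define L0 where "L0 = 4 * sqrt (real DIM('a))"
  have L0: "0 < L0" by (simp add: L0_def)
  obtain \<kappa> where \<kappa>: "0 < \<kappa>" and all: "\<forall>(a :: real \<Rightarrow> 'a) b \<rho>. a \<in> borel_measurable borel \<longrightarrow> b \<in> borel_measurable borel \<longrightarrow>
    (\<forall>t\<in>{1..2}. infnorm (a t) = t \<and> infnorm (b t) = t) \<longrightarrow> \<rho> \<in> borel_measurable borel \<longrightarrow>
    (\<forall>v. v 0 \<in> a ` {1..2} \<and> v 4 \<in> b ` {1..2} \<and>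
         (\<forall>k<4. \<forall>s\<in>{0..1}. infnorm ((1 - s) *\<^sub>R v k + s *\<^sub>R v (Suc k)) \<in> {1 / 4..2}) \<longrightarrow>
       1 \<le> ennreal L0 * (\<Sum>k<4. segment_integral \<rho> (v k) (v (Suc k)))) \<longrightarrow>
    ennreal \<kappa> \<le> (\<integral>\<^sup>+x. \<rho> x ^ DIM('a) \<partial>lborel)"
    using loewner_unit_annulus[OF dim L0] by (elim exE conjE) (rule that)
  have unit: "ennreal \<kappa> \<le> (\<integral>\<^sup>+x. \<rho> x ^ DIM('a) \<partial>lborel)"
    if "a \<in> borel_measurable borel" "b \<in> borel_measurable borel"
    "\<And>t. t \<in> {1..2} \<Longrightarrow> infnorm (a t) = t \<and> infnorm (b t) = t" "\<rho> \<in> borel_measurable borel"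
    "\<And>v. v 0 \<in> a ` {1..2} \<Longrightarrow> v 4 \<in> b ` {1..2} \<Longrightarrow>
         (\<And>k s. k < 4 \<Longrightarrow> s \<in> {0..1} \<Longrightarrow> infnorm ((1 - s) *\<^sub>R v k + s *\<^sub>R v (Suc k)) \<in> {1 / 4..2}) \<Longrightarrow>
       1 \<le> ennreal L0 * (\<Sum>k<4. segment_integral \<rho> (v k) (v (Suc k)))" for a b :: "real \<Rightarrow> 'a" and \<rho>
  proof (rule all[rule_format])
    fix v :: "nat \<Rightarrow> 'a"
    assume v: "v 0 \<in> a ` {1..2} \<and> v 4 \<in> b ` {1..2} \<and>
      (\<forall>k<4. \<forall>s\<in>{0..1}. infnorm ((1 - s) *\<^sub>R v k + s *\<^sub>R v (Suc k)) \<in> {1 / 4..2})"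
    show "1 \<le> ennreal L0 * (\<Sum>k<4. segment_integral \<rho> (v k) (v (Suc k)))"
    proof (rule that(5))
      show "v 0 \<in> a ` {1..2}" "v 4 \<in> b ` {1..2}" using v by simp_all
      fix k s assume "k < (4::nat)" "s \<in> {0..1::real}"
      then show "infnorm ((1 - s) *\<^sub>R v k + s *\<^sub>R v (Suc k)) \<in> {1 / 4..2}" using v by blast
    qed
  qed (fact that)+
  show ?thesis
  proof (rule that[OF \<kappa>])
    fix a b :: "real \<Rightarrow> 'a" and c :: 'a and \<rho> :: "'a \<Rightarrow> ennreal" and \<alpha> :: real and N
    assume a[measurable]: "a \<in> borel_measurable borel" and b[measurable]: "b \<in> borel_measurable borel" and \<alpha>: "0 < \<alpha>"
      and ab: "\<forall>t\<in>{\<alpha>..\<alpha> * 16 ^ N}. infnorm (a t - c) = t \<and> infnorm (b t - c) = t"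
      and \<rho>[measurable]: "\<rho> \<in> borel_measurable borel"
      and adm: "polyline_admissible \<rho> (a ` {\<alpha>..\<alpha> * 16 ^ N}) (b ` {\<alpha>..\<alpha> * 16 ^ N}) {x. infnorm (x - c) \<in> {\<alpha> / 4..\<alpha> * 16 ^ N}}"
    define \<tau> where "\<tau> = (\<lambda>k::nat. \<alpha> * 16 ^ k)"
    have \<tau>: "0 < \<tau> k" for k using \<alpha> by (simp add: \<tau>_def)
    define Ann where "Ann = (\<lambda>k. {x. infnorm (x - c) \<in> {\<tau> k / 4..2 * \<tau> k}})"
    have infnorm_meas[measurable]: "(infnorm :: 'a \<Rightarrow> real) \<in> borel_measurable borel"
      by (intro borel_measurable_continuous_onI continuous_on_infnorm continuous_on_id)
    have [measurable]: "Ann k \<in> sets borel" for k unfolding Ann_def by measurable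
    have step: "ennreal \<kappa> \<le> (\<integral>\<^sup>+x\<in>Ann k. \<rho> x ^ DIM('a) \<partial>lborel)" if k: "k < N" for k
    proof -
      define t where "t = \<tau> k"
      have t: "0 < t" using \<tau> by (simp add: t_def)
      have tN: "t * 16 \<le> \<alpha> * 16 ^ N" "\<alpha> \<le> t"
      proof -
        have "(16::real) ^ Suc k \<le> 16 ^ N" using k by (intro power_increasing) auto
        then show "t * 16 \<le> \<alpha> * 16 ^ N" using \<alpha> by (simp add: t_def \<tau>_def)
        show "\<alpha> \<le> t" using \<alpha> by (simp add: t_def \<tau>_def)
      qed
      have ran: "t * u \<in> {\<alpha>..\<alpha> * 16 ^ N}" if "u \<in> {1..2}" for u
      proof -
        have "t * 1 \<le> t * u" "t * u \<le> t * 2" using that t by (intro mult_left_mono; simp)+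
        then show ?thesis using tN t unfolding atLeastAtMost_iff by linarith
      qed
      define a' b' where "a' = (\<lambda>u. (1 / t) *\<^sub>R (a (t * u) - c))" and "b' = (\<lambda>u. (1 / t) *\<^sub>R (b (t * u) - c))"
      \<comment> \<open>The factor t compensates for the scaling of edge lengths, and the cut-off
        records that only the mass in the k-th annulus is used.\<close>
      define \<rho>' where "\<rho>' = (\<lambda>x. ennreal t * \<rho> (c + t *\<^sub>R x) * indicator {x. infnorm x \<in> {1 / 4..2}} x)"
      have "ennreal \<kappa> \<le> (\<integral>\<^sup>+x. \<rho>' x ^ DIM('a) \<partial>lborel)"
      proof (rule unit[of a' b' \<rho>'])
        show "a' \<in> borel_measurable borel" "b' \<in> borel_measurable borel" "\<rho>' \<in> borel_measurable borel"
          unfolding a'_def b'_def \<rho>'_def by measurable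
        show "infnorm (a' u) = u \<and> infnorm (b' u) = u" if "u \<in> {1..2}" for u
          using bspec[OF ab ran[OF that]] t by (simp add: a'_def b'_def infnorm_mul)
        fix w :: "nat \<Rightarrow> 'a"
        assume w: "w 0 \<in> a' ` {1..2}" "w 4 \<in> b' ` {1..2}"
          "\<And>k s. k < 4 \<Longrightarrow> s \<in> {0..1} \<Longrightarrow> infnorm ((1 - s) *\<^sub>R w k + s *\<^sub>R w (Suc k)) \<in> {1 / 4..2}"
        define v where "v = (\<lambda>k. c + t *\<^sub>R w k)"
        have vseg: "(1 - s) *\<^sub>R v k + s *\<^sub>R v (Suc k) = c + t *\<^sub>R ((1 - s) *\<^sub>R w k + s *\<^sub>R w (Suc k))" for k s
          by (simp add: v_def algebra_simps)
        have wle: "infnorm (w k) \<le> 2 \<and> infnorm (w (Suc k)) \<le> 2" if "k < 4" for k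
          using w(3)[OF that, of 0] w(3)[OF that, of 1] by auto
        have "1 \<le> ennreal (t * L0) * (\<Sum>k<4. segment_integral \<rho> (v k) (v (Suc k)))"
        proof (rule polyline_admissibleD[OF adm])
          show "v 0 \<in> a ` {\<alpha>..\<alpha> * 16 ^ N}" using w(1) t ran by (auto simp: v_def a'_def intro!: imageI)
          show "v 4 \<in> b ` {\<alpha>..\<alpha> * 16 ^ N}" using w(2) t ran by (auto simp: v_def b'_def intro!: imageI)
          show "0 \<le> t * L0" using t L0 by simp
          fix k :: nat assume k4: "k < 4"
          have "infnorm (w (Suc k) - w k) \<le> infnorm (w (Suc k)) + infnorm (w k)"
            using infnorm_triangle[of "w (Suc k)" "- w k"] by (simp add: infnorm_neg)
          also have "\<dots> \<le> 4" using wle[OF k4] by simp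
          finally have "infnorm (w (Suc k) - w k) \<le> 4" .
          then have "sqrt (real DIM('a)) * infnorm (w (Suc k) - w k) \<le> sqrt (real DIM('a)) * 4"
            by (intro mult_left_mono) auto
          then have "norm (w (Suc k) - w k) \<le> L0"
            using norm_le_infnorm[of "w (Suc k) - w k"] unfolding L0_def by linarith
          then have "t * norm (w (Suc k) - w k) \<le> t * L0" using t by (intro mult_left_mono) auto
          then show "norm (v (Suc k) - v k) \<le> t * L0"
            using t by (simp add: v_def scaleR_diff_right[symmetric])
          fix s :: real assume s: "s \<in> {0..1}"
          have iw: "1 / 4 \<le> infnorm ((1 - s) *\<^sub>R w k + s *\<^sub>R w (Suc k))" "infnorm ((1 - s) *\<^sub>R w k + s *\<^sub>R w (Suc k)) \<le> 2"
            using w(3)[OF k4 s] by auto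
          have "t * (1 / 4) \<le> t * infnorm ((1 - s) *\<^sub>R w k + s *\<^sub>R w (Suc k))"
            "t * infnorm ((1 - s) *\<^sub>R w k + s *\<^sub>R w (Suc k)) \<le> t * 2"
            using iw t by (intro mult_left_mono; simp)+
          moreover have "infnorm ((1 - s) *\<^sub>R v k + s *\<^sub>R v (Suc k) - c) = t * infnorm ((1 - s) *\<^sub>R w k + s *\<^sub>R w (Suc k))"
            unfolding vseg using t by (simp add: infnorm_mul)
          ultimately show "(1 - s) *\<^sub>R v k + s *\<^sub>R v (Suc k) \<in> {x. infnorm (x - c) \<in> {\<alpha> / 4..\<alpha> * 16 ^ N}}"
            using tN t unfolding mem_Collect_eq atLeastAtMost_iff by linarith
        qed
        also have "(\<Sum>k<4. segment_integral \<rho>' (w k) (w (Suc k))) = (\<Sum>k<4. ennreal t * segment_integral \<rho> (v k) (v (Suc k)))"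
        proof (rule sum.cong[OF refl])
          fix k :: nat assume "k \<in> {..<4}"
          then have "segment_integral \<rho>' (w k) (w (Suc k)) = (\<integral>\<^sup>+s. ennreal t * (\<rho> ((1 - s) *\<^sub>R v k + s *\<^sub>R v (Suc k)) * indicator {0..1} s) \<partial>lborel)"
            unfolding segment_integral_def vseg using w(3)[of k]
            by (intro nn_integral_cong) (auto simp: \<rho>'_def split: split_indicator)
          then show "segment_integral \<rho>' (w k) (w (Suc k)) = ennreal t * segment_integral \<rho> (v k) (v (Suc k))"
            unfolding segment_integral_def by (simp add: nn_integral_cmult)
        qed
        then have "ennreal (t * L0) * (\<Sum>k<4. segment_integral \<rho> (v k) (v (Suc k)))
            = ennreal L0 * (\<Sum>k<4. segment_integral \<rho>' (w k) (w (Suc k)))"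
          using t L0 by (simp add: ennreal_mult sum_distrib_left[symmetric] ac_simps)
        finally show "1 \<le> ennreal L0 * (\<Sum>k<4. segment_integral \<rho>' (w k) (w (Suc k)))" .
      qed
      also have "\<dots> = (\<integral>\<^sup>+x. ennreal (t ^ DIM('a)) * (\<rho> (c + t *\<^sub>R x) ^ DIM('a) * indicator (Ann k) (c + t *\<^sub>R x)) \<partial>lborel)"
      proof (rule nn_integral_cong)
        fix x
        have "c + t *\<^sub>R x \<in> Ann k \<longleftrightarrow> infnorm x \<in> {1 / 4..2}"
          using t by (simp add: Ann_def infnorm_mul t_def[symmetric] mult.commute[of t])
        then show "\<rho>' x ^ DIM('a) = ennreal (t ^ DIM('a)) * (\<rho> (c + t *\<^sub>R x) ^ DIM('a) * indicator (Ann k) (c + t *\<^sub>R x))"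
          using t by (auto simp: \<rho>'_def power_mult_distrib ennreal_power split: split_indicator)
      qed
      also have "\<dots> = ennreal (t ^ DIM('a)) * (\<integral>\<^sup>+x. \<rho> (c + t *\<^sub>R x) ^ DIM('a) * indicator (Ann k) (c + t *\<^sub>R x) \<partial>lborel)"
        by (rule nn_integral_cmult) measurable
      also have "(\<integral>\<^sup>+x. \<rho> (c + t *\<^sub>R x) ^ DIM('a) * indicator (Ann k) (c + t *\<^sub>R x) \<partial>lborel)
         = ennreal (1 / \<bar>t\<bar> ^ DIM('a)) * (\<integral>\<^sup>+x\<in>Ann k. \<rho> x ^ DIM('a) \<partial>lborel)"
        by (subst nn_integral_lborel_affine[where g = "\<lambda>x. \<rho> x ^ DIM('a) * indicator (Ann k) x", symmetric]) (use t in auto)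
      also have "ennreal (t ^ DIM('a)) * \<dots> = ennreal (t ^ DIM('a) * (1 / \<bar>t\<bar> ^ DIM('a))) * (\<integral>\<^sup>+x\<in>Ann k. \<rho> x ^ DIM('a) \<partial>lborel)"
        using t by (subst ennreal_mult) (auto simp: mult.assoc)
      also have "t ^ DIM('a) * (1 / \<bar>t\<bar> ^ DIM('a)) = 1" using t by simp
      finally show ?thesis by simp
    qed
    have disj: "k = j" if "x \<in> Ann k" "x \<in> Ann j" for x k j
    proof (rule ccontr)
      assume "k \<noteq> j"
      have *: False if "x \<in> Ann k" "x \<in> Ann j" "k < j" for k j
      proof -
        have "(16::real) ^ Suc k \<le> 16 ^ j" using that by (intro power_increasing) auto
        then have "16 * \<tau> k \<le> \<tau> j" using \<alpha> by (simp add: \<tau>_def)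
        then show False using that \<tau>[of k] by (simp add: Ann_def)
      qed
      show False using *[of k j] *[of j k] that \<open>k \<noteq> j\<close> by (cases "k < j") auto
    qed
    have "ennreal (real N * \<kappa>) = (\<Sum>k<N. ennreal \<kappa>)"
      using \<kappa> by (simp add: ennreal_mult ennreal_of_nat_eq_real_of_nat)
    also have "\<dots> \<le> (\<Sum>k<N. \<integral>\<^sup>+x\<in>Ann k. \<rho> x ^ DIM('a) \<partial>lborel)" by (intro sum_mono step) auto
    also have "\<dots> = (\<integral>\<^sup>+x. (\<Sum>k<N. \<rho> x ^ DIM('a) * indicator (Ann k) x) \<partial>lborel)"
      by (intro nn_integral_sum[symmetric]) measurable
    also have "\<dots> \<le> (\<integral>\<^sup>+x. \<rho> x ^ DIM('a) \<partial>lborel)"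
    proof (rule nn_integral_mono)
      fix x
      show "(\<Sum>k<N. \<rho> x ^ DIM('a) * indicator (Ann k) x) \<le> \<rho> x ^ DIM('a)"
      proof (cases "\<exists>k<N. x \<in> Ann k")
        case True
        then obtain k where k: "k < N" "x \<in> Ann k" by auto
        have "(\<Sum>j<N. \<rho> x ^ DIM('a) * indicator (Ann j) x) = (\<Sum>j<N. if j = k then \<rho> x ^ DIM('a) else 0)"
        proof (rule sum.cong[OF refl])
          fix j
          have "x \<in> Ann j \<longleftrightarrow> j = k" using disj[OF k(2), of j] k(2) by blast
          then show "\<rho> x ^ DIM('a) * indicator (Ann j) x = (if j = k then \<rho> x ^ DIM('a) else 0)"
            by (simp add: indicator_def)
        qed
        then show ?thesis using k by simp
      next
        case False
        then have z: "(\<Sum>j<N. \<rho> x ^ DIM('a) * indicator (Ann j) x) = 0"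
          by (intro sum.neutral) (auto split: split_indicator)
        show ?thesis unfolding z by simp
      qed
    qed
    finally show "ennreal (real N * \<kappa>) \<le> (\<integral>\<^sup>+x. \<rho> x ^ DIM('a) \<partial>lborel)" .
  qed
qed

section \<open>Stereographic projection and the chordal metric\<close>

text \<open>Stereographic projection onto the sphere of radius 1/2 about \<open>(0, 1 / 2)\<close>,
  with infinity at the pole \<open>(0, 1)\<close>. The chordal metric becomes restricted Euclidean
  distance, so metric and topological facts about the extended space come from a Euclidean
  product.\<close>

fun sproj :: "'a::euclidean_space option \<Rightarrow> 'a \<times> real" where
  "sproj (Some x) = (x /\<^sub>R (1 + (norm x)\<^sup>2), (norm x)\<^sup>2 / (1 + (norm x)\<^sup>2))"
| "sproj None = (0, 1)"

lemma one_plus_norm_sq_pos: "0 < 1 + (norm x)\<^sup>2"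
  by (simp add: add_pos_nonneg)

lemma norm_Pair_1: "norm (x, 1::real) = sqrt (1 + (norm x)\<^sup>2)"
  by (simp add: norm_Pair add.commute)

lemma chordal_eq_dist: "chordal p q = dist (sproj p) (sproj q)"
proof -
  have fin_inf: "dist (sproj (Some x)) (0, 1) = 1 / sqrt (1 + (norm x)\<^sup>2)" for x :: 'a
  proof -
    let ?X = "(norm x)\<^sup>2"
    have "dist (sproj (Some x)) (0, 1) = sqrt ((norm (x /\<^sub>R (1 + ?X)))\<^sup>2 + (?X / (1 + ?X) - 1)\<^sup>2)"
      unfolding sproj.simps dist_Pair_Pair by (simp add: dist_norm)
    also have "(norm (x /\<^sub>R (1 + ?X)))\<^sup>2 + (?X / (1 + ?X) - 1)\<^sup>2 = ?X / (1 + ?X)\<^sup>2 + 1 / (1 + ?X)\<^sup>2"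
      using one_plus_norm_sq_pos[of x]
      by (simp add: power_mult_distrib divide_inverse power_inverse diff_divide_eq_iff) (simp add: field_simps)
    also have "\<dots> = 1 / (1 + ?X)"
      using one_plus_norm_sq_pos[of x] by (simp add: add_divide_distrib[symmetric] power2_eq_square add.commute)
    finally show ?thesis by (simp add: real_sqrt_divide)
  qed
  have frac: "X / p\<^sup>2 + Y / q\<^sup>2 - 2 * w / (p * q) + (z / (p * q))\<^sup>2
      = (X * q\<^sup>2 + Y * p\<^sup>2 - 2 * w * (p * q) + z\<^sup>2) / (p * q)\<^sup>2" if "p \<noteq> 0" "q \<noteq> 0" for X Y w z p q :: real
    using that by (simp add: field_simps power2_eq_square)
  have fin_fin: "dist (sproj (Some x)) (sproj (Some y)) = norm (x - y) / (sqrt (1 + (norm x)\<^sup>2) * sqrt (1 + (norm y)\<^sup>2))"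
    for x y :: 'a
  proof -
    define X Y where "X = (norm x)\<^sup>2" and "Y = (norm y)\<^sup>2"
    have pos: "0 < 1 + X" "0 < 1 + Y" using one_plus_norm_sq_pos by (auto simp: X_def Y_def)
    have "(norm (a *\<^sub>R x - b *\<^sub>R y))\<^sup>2 = a\<^sup>2 * X + b\<^sup>2 * Y - 2 * (a * b) * (x \<bullet> y)" for a b
      unfolding X_def Y_def power2_norm_eq_inner
      by (simp add: inner_diff_left inner_diff_right inner_commute power2_eq_square algebra_simps)
    then have "(norm (x /\<^sub>R (1 + X) - y /\<^sub>R (1 + Y)))\<^sup>2 = X / (1 + X)\<^sup>2 + Y / (1 + Y)\<^sup>2 - 2 * (x \<bullet> y) / ((1 + X) * (1 + Y))"
      by (simp add: divide_inverse power_inverse mult.commute)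
    moreover have "(dist (X / (1 + X)) (Y / (1 + Y)))\<^sup>2 = ((X - Y) / ((1 + X) * (1 + Y)))\<^sup>2"
      using pos by (simp add: dist_real_def diff_frac_eq) (simp add: field_simps)
    moreover have "(dist (sproj (Some x)) (sproj (Some y)))\<^sup>2
       = (norm (x /\<^sub>R (1 + X) - y /\<^sub>R (1 + Y)))\<^sup>2 + (dist (X / (1 + X)) (Y / (1 + Y)))\<^sup>2"
      unfolding sproj.simps dist_Pair_Pair X_def[symmetric] Y_def[symmetric] by (simp add: dist_norm)
    ultimately have "(dist (sproj (Some x)) (sproj (Some y)))\<^sup>2 =
       X / (1 + X)\<^sup>2 + Y / (1 + Y)\<^sup>2 - 2 * (x \<bullet> y) / ((1 + X) * (1 + Y)) + ((X - Y) / ((1 + X) * (1 + Y)))\<^sup>2"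
      by simp
    also have "\<dots> = (X + Y - 2 * (x \<bullet> y)) / ((1 + X) * (1 + Y))"
    proof -
      have "X / (1 + X)\<^sup>2 + Y / (1 + Y)\<^sup>2 - 2 * (x \<bullet> y) / ((1 + X) * (1 + Y)) + ((X - Y) / ((1 + X) * (1 + Y)))\<^sup>2
         = (X * (1 + Y)\<^sup>2 + Y * (1 + X)\<^sup>2 - 2 * (x \<bullet> y) * ((1 + X) * (1 + Y)) + (X - Y)\<^sup>2) / ((1 + X) * (1 + Y))\<^sup>2"
        using pos by (intro frac) auto
      also have "X * (1 + Y)\<^sup>2 + Y * (1 + X)\<^sup>2 - 2 * (x \<bullet> y) * ((1 + X) * (1 + Y)) + (X - Y)\<^sup>2
        = (X + Y - 2 * (x \<bullet> y)) * ((1 + X) * (1 + Y))"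
        by (simp add: power2_eq_square algebra_simps)
      finally show ?thesis using pos by (simp add: power2_eq_square)
    qed
    also have "X + Y - 2 * (x \<bullet> y) = (norm (x - y))\<^sup>2"
      by (simp add: X_def Y_def power2_norm_eq_inner inner_diff_left inner_diff_right inner_commute)
    finally have "dist (sproj (Some x)) (sproj (Some y)) = sqrt ((norm (x - y))\<^sup>2 / ((1 + X) * (1 + Y)))"
      by (metis real_sqrt_abs abs_of_nonneg zero_le_dist)
    then show ?thesis by (simp add: real_sqrt_divide real_sqrt_mult X_def Y_def)
  qed
  show ?thesis
    by (cases p; cases q) (simp_all only: chordal.simps fin_fin fin_inf[simplified sproj.simps(1)] sproj.simps(2) dist_commute[of "(0, 1)"] fin_inf dist_self)
qed

lemma chordal_commute: "chordal p q = chordal q p"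
  and chordal_nonneg: "0 \<le> chordal p q"
  by (simp_all add: chordal_eq_dist dist_commute)

lemma chordal_triangle: "chordal p q \<le> chordal p z + chordal z q"
  unfolding chordal_eq_dist by (rule dist_triangle)

lemma chordal_le_norm: "chordal (Some x) (Some y) \<le> norm (x - y)"
proof -
  have "1 * 1 \<le> sqrt (1 + (norm x)\<^sup>2) * sqrt (1 + (norm y)\<^sup>2)" by (intro mult_mono) auto
  then have "norm (x - y) / (sqrt (1 + (norm x)\<^sup>2) * sqrt (1 + (norm y)\<^sup>2)) \<le> norm (x - y) / 1"
    by (intro divide_left_mono) auto
  then show ?thesis by simp
qed

lemma chordal_eq_0_iff: "chordal p q = 0 \<longleftrightarrow> p = q"
proof (cases p; cases q)
  fix x y assume "p = Some x" "q = Some y"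
  then show ?thesis using one_plus_norm_sq_pos[of x] one_plus_norm_sq_pos[of y] by auto
qed (auto simp: add_nonneg_eq_0_iff)

lemma inj_sproj: "inj sproj"
  by (metis chordal_eq_0_iff chordal_eq_dist dist_eq_0_iff injI)

lemma sproj_snd: "snd (sproj p) \<le> 1" "snd (sproj p) = 1 \<longleftrightarrow> p = None"
proof -
  have "(norm x)\<^sup>2 / (1 + (norm x)\<^sup>2) < 1" for x :: 'a
    using one_plus_norm_sq_pos[of x] by simp
  then show "snd (sproj p) \<le> 1" "snd (sproj p) = 1 \<longleftrightarrow> p = None"
    by (cases p; simp add: less_imp_le less_imp_neq)+
qed

lemma sproj_Some_snd: "1 - snd (sproj (Some x)) = 1 / (1 + (norm x)\<^sup>2)"
  using one_plus_norm_sq_pos[of x] by (simp add: diff_divide_eq_iff)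

lemma sproj_Some_fst: "fst (sproj (Some x)) = (1 - snd (sproj (Some x))) *\<^sub>R x"
  unfolding sproj_Some_snd by (simp add: divide_inverse)

text \<open>For each radius t one takes the first parameter after \<open>s0\<close> at which the
  curve reaches the cube of radius t about \<open>c\<close>. This hitting time is monotone in t,
  hence Borel, and so is the point selected. The curve may pass through infinity, but not up to the
  hitting time, because before it the curve stays in a bounded set.\<close>

lemma sphere_selection_forward:
  fixes g :: "real \<Rightarrow> 'a::euclidean_space \<times> real"
  assumes g: "continuous_on {0..1} g" "g ` {0..1} \<subseteq> range sproj" and \<alpha>: "0 < \<alpha>" "\<alpha> \<le> \<beta>"
    and s: "0 \<le> s0" "s0 \<le> s1" "s1 \<le> 1"
    and near: "g s0 = sproj (Some x0)" "infnorm (x0 - c) \<le> \<alpha>"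
    and far: "g s1 = sproj q" "\<And>x. q = Some x \<Longrightarrow> \<beta> \<le> infnorm (x - c)"
  shows "\<exists>a. a \<in> borel_measurable borel \<and>
    (\<forall>t\<in>{\<alpha>..\<beta>}. infnorm (a t - c) = t \<and> sproj (Some (a t)) \<in> g ` {0..1})"
proof -
  \<comment> \<open>Size minus t, multiplied by \<open>1 - snd (g s)\<close>, the factor that
    vanishes at infinity. Clearing this denominator makes the function continuous along curves
    through infinity.\<close>
  define \<psi> where "\<psi> = (\<lambda>t s. infnorm (fst (g s) - (1 - snd (g s)) *\<^sub>R c) - t * (1 - snd (g s)))"
  have gs: "\<exists>p. g s = sproj p" if "s \<in> {0..1}" for s using g(2) that by blast
  have \<psi>_Some: "\<psi> t s = (1 - snd (g s)) * (infnorm (x - c) - t)" if "g s = sproj (Some x)" for t s x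
  proof -
    have *: "fst (g s) - (1 - snd (g s)) *\<^sub>R c = (1 - snd (g s)) *\<^sub>R (x - c)"
      using sproj_Some_fst[of x] unfolding that[symmetric] by (simp add: scaleR_diff_right)
    have "0 \<le> 1 - snd (g s)" using sproj_snd(1)[of "Some x"] unfolding that[symmetric] by simp
    then have "infnorm ((1 - snd (g s)) *\<^sub>R (x - c)) = (1 - snd (g s)) * infnorm (x - c)"
      unfolding infnorm_mul by simp
    then show ?thesis unfolding \<psi>_def * by (simp add: algebra_simps)
  qed
  have \<psi>_None: "\<psi> t s = 0" if "g s = sproj None" for t s
    using that by (simp add: \<psi>_def infnorm_0)
  have \<psi>_cont: "continuous_on {0..1} (\<psi> t)" for t
    unfolding \<psi>_def by (intro continuous_intros g(1))
  define H where "H = (\<lambda>t. {s\<in>{s0..s1}. 0 \<le> \<psi> t s})"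
  have H_compact: "compact (H t)" for t
  proof -
    have "continuous_on {s0..s1} (\<psi> t)" using s by (intro continuous_on_subset[OF \<psi>_cont]) auto
    then have "closedin (top_of_set {s0..s1}) ({s0..s1} \<inter> \<psi> t -` {0..})"
      by (intro continuous_closedin_preimage) auto
    moreover have "{s0..s1} \<inter> \<psi> t -` {0..} = H t" by (auto simp: H_def)
    ultimately show ?thesis using compact_Icc closedin_compact by metis
  qed
  have H_s1: "s1 \<in> H t" if "t \<le> \<beta>" for t
  proof -
    have "0 \<le> \<psi> t s1"
    proof (cases q)
      case None then show ?thesis using far \<psi>_None by simp
    next
      case (Some x)
      then show ?thesis using far \<psi>_Some[of s1 x t] that sproj_snd(1)[of "Some x"] by simp
    qed
    then show ?thesis using s by (simp add: H_def)
  qed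
  \<comment> \<open>Clamping the radius to the range in which the curve is known to cross makes the
    hitting time \<open>T\<close> a total monotone function.\<close>
  define cl where "cl = (\<lambda>t. max \<alpha> (min \<beta> t))"
  have cl: "\<alpha> \<le> cl t" "cl t \<le> \<beta>" for t using \<alpha> by (auto simp: cl_def)
  define T where "T = (\<lambda>t. Inf (H (cl t)))"
  have bdd: "bdd_below (H t)" for t by (rule bdd_belowI[of _ s0]) (auto simp: H_def)
  have T_in: "T t \<in> H (cl t)" for t
    unfolding T_def using H_s1[OF cl(2)] H_compact bdd by (intro closed_contains_Inf compact_imp_closed) auto
  have T_least: "T t \<le> s" if "s \<in> H (cl t)" for s t
    unfolding T_def using that bdd by (rule cInf_lower)
  have T01: "T t \<in> {0..1}" "s0 \<le> T t" "T t \<le> s1" for t using T_in[of t] s by (auto simp: H_def)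
  have "mono T"
  proof (rule monoI)
    fix t t' :: real assume "t \<le> t'"
    then have "cl t \<le> cl t'" by (auto simp: cl_def)
    have "H (cl t') \<subseteq> H (cl t)"
    proof
      fix s' assume s': "s' \<in> H (cl t')"
      then have "s' \<in> {0..1}" using s by (auto simp: H_def)
      then have "0 \<le> 1 - snd (g s')" using gs sproj_snd(1) by force
      then have "\<psi> (cl t') s' \<le> \<psi> (cl t) s'"
        unfolding \<psi>_def using \<open>cl t \<le> cl t'\<close> by (intro diff_left_mono mult_right_mono) auto
      then show "s' \<in> H (cl t)" using s' by (auto simp: H_def)
    qed
    then show "T t \<le> T t'" using T_least T_in by blast
  qed
  then have T_meas[measurable]: "T \<in> borel_measurable borel" by (rule borel_measurable_mono)
  have finite_T: "\<exists>x. g (T t) = sproj (Some x) \<and> infnorm (x - c) = cl t" for t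
  proof -
    let ?c = "cl t"
    have near_before: "\<exists>x. g s = sproj (Some x) \<and> infnorm (x - c) < ?c" if "s0 \<le> s" "s < T t" for s
    proof -
      have "s \<in> {0..1}" using that s T01[of t] by auto
      then obtain p where p: "g s = sproj p" using gs by blast
      have neg: "\<psi> ?c s < 0" using T_least[of s t] that T01[of t] by (force simp: H_def)
      then obtain x where x: "p = Some x" using \<psi>_None[of s] p by (cases p) auto
      have "(1 - snd (g s)) * (infnorm (x - c) - ?c) < 0" using neg \<psi>_Some p x by simp
      moreover have "0 \<le> 1 - snd (g s)" using p sproj_snd(1)[of p] by simp
      ultimately have "infnorm (x - c) < ?c" by (simp add: mult_less_0_iff)
      then show ?thesis using p x by auto
    qed
    have T0: "0 \<le> \<psi> ?c (T t)" using T_in[of t] by (simp add: H_def)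
    show ?thesis
    proof (cases "T t = s0")
      case True
      then have "\<psi> ?c (T t) = (1 - snd (g (T t))) * (infnorm (x0 - c) - ?c)" using near \<psi>_Some by simp
      moreover have "0 < 1 - snd (g (T t))" using True near sproj_Some_snd[of x0] one_plus_norm_sq_pos[of x0] by simp
      ultimately have "?c \<le> infnorm (x0 - c)" using T0 by (simp add: zero_le_mult_iff)
      then show ?thesis using True near cl(1)[of t] by auto
    next
      case False
      then have sT: "s0 < T t" using T01[of t] by simp
      \<comment> \<open>A Euclidean bound for the curve before the hitting time. It bounds
        \<open>1 - snd (g s)\<close> away from 0, a closed condition that persists at the hitting
        time, so that the curve is not at infinity there.\<close>
      define D where "D = sqrt (real DIM('a)) * ?c + norm c"
      have before: "1 / (1 + D\<^sup>2) \<le> 1 - snd (g s) \<and> \<psi> ?c s \<le> 0" if s': "s \<in> {s0<..<T t}" for s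
      proof -
        obtain x where x: "g s = sproj (Some x)" "infnorm (x - c) < ?c" using near_before[of s] s' by auto
        have "norm x \<le> norm (x - c) + norm c" by (metis diff_add_cancel norm_triangle_ineq)
        also have "norm (x - c) \<le> sqrt (real DIM('a)) * infnorm (x - c)" by (rule norm_le_infnorm)
        also have "\<dots> \<le> sqrt (real DIM('a)) * ?c" using x by (intro mult_left_mono) auto
        finally have "norm x \<le> D" by (simp add: D_def)
        then have "1 / (1 + D\<^sup>2) \<le> 1 / (1 + (norm x)\<^sup>2)"
          using one_plus_norm_sq_pos[of x] by (intro divide_left_mono add_left_mono power_mono mult_pos_pos) (auto simp: add_pos_nonneg)
        moreover have "\<psi> ?c s \<le> 0"
          using \<psi>_Some[OF x(1), of ?c] x sproj_snd(1)[of "Some x"] by (simp add: mult_nonneg_nonpos)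
        ultimately show ?thesis using x sproj_Some_snd[of x] by simp
      qed
      have closure: "T t \<in> closure {s0<..<T t}" using sT by simp
      have cont_g: "continuous_on {s0..T t} g" using s T01[of t] by (intro continuous_on_subset[OF g(1)]) auto
      have "1 / (1 + D\<^sup>2) \<le> 1 - snd (g (T t))"
      proof (rule continuous_ge_on_closure[where S = "{s0<..<T t}" and x = "T t" and f = "\<lambda>s. 1 - snd (g s)"])
        show "continuous_on (closure {s0<..<T t}) (\<lambda>s. 1 - snd (g s))"
          using sT by (simp, intro continuous_intros cont_g)
      qed (use closure before in auto)
      moreover have "\<psi> ?c (T t) \<le> 0"
      proof (rule continuous_le_on_closure[where S = "{s0<..<T t}" and x = "T t" and f = "\<psi> ?c"])
        show "continuous_on (closure {s0<..<T t}) (\<psi> ?c)"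
          using sT s T01[of t] by (simp, intro continuous_on_subset[OF \<psi>_cont]) auto
      qed (use closure before in auto)
      moreover have "0 < 1 / (1 + D\<^sup>2)" by (simp add: add_pos_nonneg)
      ultimately have pos: "0 < 1 - snd (g (T t))" and z: "\<psi> ?c (T t) = 0" using T0 by linarith+
      obtain p where p: "g (T t) = sproj p" using gs T01 by blast
      then obtain x where x: "p = Some x" using pos by (cases p) auto
      then have "(1 - snd (g (T t))) * (infnorm (x - c) - ?c) = 0" using z \<psi>_Some p by simp
      then show ?thesis using pos p x by auto
    qed
  qed
  \<comment> \<open>A continuous extension beyond the unit interval, so that its composition with
    \<open>T\<close> is Borel on the line.\<close>
  define g' where "g' = (\<lambda>s. g (max 0 (min 1 s)))"
  have g'_cont: "continuous_on UNIV g'"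
    unfolding g'_def by (intro continuous_on_compose2[OF g(1)] continuous_intros) auto
  then have g'_meas[measurable]: "g' \<in> borel_measurable borel" by (rule borel_measurable_continuous_onI)
  have g'T: "g' (T t) = g (T t)" for t using T01[of t] by (simp add: g'_def)
  define a where "a = (\<lambda>t. fst (g' (T t)) /\<^sub>R (1 - snd (g' (T t))))"
  have a_meas: "a \<in> borel_measurable borel"
  proof -
    have [measurable]: "(\<lambda>t. fst (g' t)) \<in> borel_measurable borel" "(\<lambda>t. snd (g' t)) \<in> borel_measurable borel"
      by (intro borel_measurable_continuous_onI continuous_intros g'_cont)+
    show ?thesis unfolding a_def by measurable
  qed
  have a_eq: "a t = x" if "g (T t) = sproj (Some x)" for t x
  proof -
    have "0 < 1 - snd (g (T t))" using that sproj_Some_snd[of x] one_plus_norm_sq_pos[of x] by simp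
    then show ?thesis unfolding a_def g'T that sproj_Some_fst by (simp del: sproj.simps)
  qed
  show ?thesis
  proof (intro exI[of _ a] conjI a_meas ballI)
    fix t assume t: "t \<in> {\<alpha>..\<beta>}"
    then have "cl t = t" by (auto simp: cl_def)
    obtain x where x: "g (T t) = sproj (Some x)" "infnorm (x - c) = t"
      using finite_T[of t] \<open>cl t = t\<close> by auto
    then show "infnorm (a t - c) = t" "sproj (Some (a t)) \<in> g ` {0..1}"
      using a_eq[OF x(1)] T01(1)[of t] by (auto intro!: image_eqI[of _ _ "T t"])
  qed
qed

text \<open>If the near point comes after the far one, the curve is traversed backwards.\<close>

lemma sphere_selection:
  fixes g :: "real \<Rightarrow> 'a::euclidean_space \<times> real"
  assumes g: "continuous_on {0..1} g" "g ` {0..1} \<subseteq> range sproj" and \<alpha>: "0 < \<alpha>" "\<alpha> \<le> \<beta>"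
    and s: "s0 \<in> {0..1}" "s1 \<in> {0..1}"
    and near: "g s0 = sproj (Some x0)" "infnorm (x0 - c) \<le> \<alpha>"
    and far: "g s1 = sproj q" "\<And>x. q = Some x \<Longrightarrow> \<beta> \<le> infnorm (x - c)"
  obtains a where "a \<in> borel_measurable borel"
    "\<And>t. t \<in> {\<alpha>..\<beta>} \<Longrightarrow> infnorm (a t - c) = t"
    "\<And>t. t \<in> {\<alpha>..\<beta>} \<Longrightarrow> sproj (Some (a t)) \<in> g ` {0..1}"
proof -
  have "\<exists>a. a \<in> borel_measurable borel \<and>
    (\<forall>t\<in>{\<alpha>..\<beta>}. infnorm (a t - c) = t \<and> sproj (Some (a t)) \<in> g ` {0..1})"
  proof (cases "s0 \<le> s1")
    case True
    show ?thesis
      by (rule sphere_selection_forward[OF g \<alpha> _ True _ near far]) (use s in auto)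
  next
    case False
    define h where "h = (\<lambda>s. g (1 - s))"
    have im: "h ` {0..1} = g ` {0..1}"
    proof -
      have "(\<lambda>s::real. 1 - s) ` {0..1} = {0..1}" by simp
      then show ?thesis unfolding h_def by (metis image_image)
    qed
    have hc: "continuous_on {0..1} h"
      unfolding h_def by (intro continuous_on_compose2[OF g(1)] continuous_intros) auto
    have "\<exists>a. a \<in> borel_measurable borel \<and>
      (\<forall>t\<in>{\<alpha>..\<beta>}. infnorm (a t - c) = t \<and> sproj (Some (a t)) \<in> h ` {0..1})"
    proof (rule sphere_selection_forward[OF hc _ \<alpha>])
      show "h ` {0..1} \<subseteq> range sproj" using g(2) im by simp
      show "0 \<le> 1 - s0" "1 - s0 \<le> 1 - s1" "1 - s1 \<le> 1" using s False by auto
      show "h (1 - s0) = sproj (Some x0)" "h (1 - s1) = sproj q" using near far by (simp_all add: h_def)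
      show "infnorm (x0 - c) \<le> \<alpha>" by (rule near)
      show "\<beta> \<le> infnorm (x - c)" if "q = Some x" for x by (rule far(2)[OF that])
    qed
    then show ?thesis unfolding im .
  qed
  then show ?thesis
    by (elim exE conjE) (rule that; blast)
qed

text \<open>The square root is the norm of \<open>(x, 1)\<close>, so this is the triangle inequality
  one dimension higher.\<close>

lemma one_plus_norm_sq_lipschitz: "sqrt (1 + (norm x)\<^sup>2) \<le> sqrt (1 + (norm y)\<^sup>2) + norm (x - y)"
proof -
  have "norm (x, 1::real) \<le> norm (y, 1::real) + norm ((x, 1::real) - (y, 1))"
    by (metis add.commute diff_add_cancel norm_triangle_ineq)
  then show ?thesis unfolding norm_Pair_1 by (simp add: norm_Pair)
qed

lemma chordal_None_le: "x \<noteq> 0 \<Longrightarrow> chordal (Some x) None \<le> 1 / norm x"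
proof -
  assume "x \<noteq> 0"
  moreover have "norm x \<le> sqrt (1 + (norm x)\<^sup>2)" by (rule real_le_rsqrt) simp
  ultimately show ?thesis by (simp add: frac_le)
qed

text \<open>Near \<open>y\<close> the chordal metric is about \<open>w\<^sup>2\<close> times the
  Euclidean one. The bound \<open>R \<le> w / 2\<close> keeps the conformal factor under control: it
  gives \<open>3 / (4 * w) \<le> sqrt (1 + (norm x)\<^sup>2)\<close>, and the chordal distance comes
  out as at most 2/3 of \<open>R\<close>.\<close>

lemma chordal_ball_Some:
  fixes x y :: "'a::euclidean_space"
  defines "w \<equiv> chordal (Some y) None"
  assumes "norm (x - y) \<le> R / (2 * w\<^sup>2)" and R: "0 < R" "R \<le> w / 2"
  shows "chordal (Some x) (Some y) < R"
proof -
  have w: "0 < w" "sqrt (1 + (norm y)\<^sup>2) = 1 / w"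
    using one_plus_norm_sq_pos[of y] by (auto simp: w_def)
  have "norm (x - y) \<le> 1 / (4 * w)"
  proof -
    have "R / (2 * w\<^sup>2) \<le> (w / 2) / (2 * w\<^sup>2)" using R w by (intro divide_right_mono) auto
    also have "\<dots> = 1 / (4 * w)" using w by (simp add: field_simps power2_eq_square)
    finally show ?thesis using assms(2) by simp
  qed
  moreover have "1 / w \<le> sqrt (1 + (norm x)\<^sup>2) + norm (x - y)"
    using one_plus_norm_sq_lipschitz[of y x] w by (simp add: norm_minus_commute)
  moreover have "1 / w = 4 * (1 / (4 * w))" "3 / (4 * w) = 3 * (1 / (4 * w))" using w by simp_all
  ultimately have sx: "3 / (4 * w) \<le> sqrt (1 + (norm x)\<^sup>2)" by linarith
  have "chordal (Some x) (Some y) = norm (x - y) * w / sqrt (1 + (norm x)\<^sup>2)"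
    using w by simp
  also have "\<dots> \<le> (R / (2 * w\<^sup>2)) * w / (3 / (4 * w))"
    using assms(2) w sx R by (intro frac_le mult_right_mono) auto
  also have "\<dots> = R * (2 / 3)" using w by (simp add: field_simps power2_eq_square)
  also have "\<dots> < R" using R by simp
  finally show ?thesis .
qed

lemma norm_le_if_far_from_infinity:
  assumes "q \<le> chordal p None" "0 < q"
  obtains x where "p = Some x" "norm x \<le> 1 / q"
proof (cases p)
  case None
  then show ?thesis using assms by simp
next
  case (Some x)
  have "norm x \<le> sqrt (1 + (norm x)\<^sup>2)" by (rule real_le_rsqrt) simp
  also have "\<dots> \<le> 1 / q"
    using assms Some one_plus_norm_sq_pos[of x] by (simp add: field_simps)
  finally show ?thesis using that Some by blast
qed

lemma norm_ge_if_near_infinity: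
  assumes "chordal (Some x) None \<le> q" "0 < q" "q \<le> 1 / 2"
  shows "1 / (2 * q) \<le> norm x"
proof -
  have "1 / q \<le> sqrt (1 + (norm x)\<^sup>2)"
    using assms one_plus_norm_sq_pos[of x] by (simp add: field_simps)
  also have "\<dots> \<le> 1 + norm x" by (rule real_le_lsqrt) (auto simp: power2_sum)
  finally have "1 / q \<le> 1 + norm x" .
  moreover have "1 \<le> 1 / (2 * q)" using assms by simp
  moreover have "1 / q = 2 * (1 / (2 * q))" using assms by simp
  ultimately show ?thesis by linarith
qed

text \<open>If u is closer to infinity than the geometric mean of s and R, the annuli are taken around 0 (that is, around
  infinity), otherwise around u. In both cases about half of the available scales between s and R is used.\<close>

lemma chordal_loewner:
  assumes dim: "2 \<le> DIM('a::euclidean_space)"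
  obtains \<kappa> C :: real where "0 < \<kappa>" "1 \<le> C"
    "\<And>(g :: real \<Rightarrow> 'a \<times> real) (h :: real \<Rightarrow> 'a \<times> real) (u :: 'a option) v s R N \<rho>. continuous_on {0..1} g \<Longrightarrow> g ` {0..1} \<subseteq> range sproj \<Longrightarrow> g 0 = sproj u \<Longrightarrow>
      continuous_on {0..1} h \<Longrightarrow> h ` {0..1} \<subseteq> range sproj \<Longrightarrow> h 0 = sproj v \<Longrightarrow>
      chordal u v \<le> s \<Longrightarrow> 0 < s \<Longrightarrow> C * 256 ^ N * s \<le> R \<Longrightarrow>
      (\<exists>t\<in>{0..1}. R \<le> dist (g t) (sproj u)) \<Longrightarrow> (\<exists>t\<in>{0..1}. R \<le> dist (h t) (sproj u)) \<Longrightarrow>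
      \<rho> \<in> borel_measurable borel \<Longrightarrow> polyline_admissible \<rho> {x. sproj (Some x) \<in> g ` {0..1}} {x. sproj (Some x) \<in> h ` {0..1}}
        {x. chordal (Some x) u < 4 * R} \<Longrightarrow>
      ennreal (real N * \<kappa>) \<le> (\<integral>\<^sup>+x. \<rho> x ^ DIM('a) \<partial>lborel)"
proof -
  define n m where "n = real DIM('a)" and "m = sqrt n"
  have n: "2 \<le> n" using dim by (simp add: n_def)
  have m: "1 \<le> m" "m\<^sup>2 = n" "0 < m" using n by (auto simp: m_def)
  obtain \<kappa> where \<kappa>: "0 < \<kappa>" and ann:
    "\<And>(a :: real \<Rightarrow> 'a) b c \<rho> \<alpha> N. a \<in> borel_measurable borel \<Longrightarrow> b \<in> borel_measurable borel \<Longrightarrow> 0 < \<alpha> \<Longrightarrow>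
      \<forall>t\<in>{\<alpha>..\<alpha> * 16 ^ N}. infnorm (a t - c) = t \<and> infnorm (b t - c) = t \<Longrightarrow> \<rho> \<in> borel_measurable borel \<Longrightarrow>
      polyline_admissible \<rho> (a ` {\<alpha>..\<alpha> * 16 ^ N}) (b ` {\<alpha>..\<alpha> * 16 ^ N}) {x. infnorm (x - c) \<in> {\<alpha> / 4..\<alpha> * 16 ^ N}} \<Longrightarrow>
      ennreal (real N * \<kappa>) \<le> (\<integral>\<^sup>+x. \<rho> x ^ DIM('a) \<partial>lborel)"
  proof (rule loewner_annuli[OF dim], goal_cases)
    case (1 \<kappa>)
    show thesis by (rule that[OF 1(2)]) (rule 1(3))
  qed
  \<comment> \<open>The constant \<open>64 * n\<close> is the square of \<open>8 * m\<close>, where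
    \<open>m\<close> compares the Euclidean norm with \<open>infnorm\<close>. In both cases below
    only the range up to a geometric mean is used, so the hypothesis on 256 = 16^2 is consumed
    through its square root \<open>8 * m * 16 ^ N\<close>.\<close>
  have C1: "1 \<le> 64 * n" using n by simp
  have main: "ennreal (real N * \<kappa>) \<le> (\<integral>\<^sup>+x. \<rho> x ^ DIM('a) \<partial>lborel)"
    if g: "continuous_on {0..1} g" "g ` {0..1} \<subseteq> range sproj" "g 0 = sproj u"
      and h: "continuous_on {0..1} h" "h ` {0..1} \<subseteq> range sproj" "h 0 = sproj v"
      and uv: "chordal u v \<le> s" and s: "0 < s" and C: "64 * n * 256 ^ N * s \<le> R"
      and g_far: "\<exists>t\<in>{0..1}. R \<le> dist (g t) (sproj u)" and h_far: "\<exists>t\<in>{0..1}. R \<le> dist (h t) (sproj u)"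
      and \<rho>: "\<rho> \<in> borel_measurable borel"
      and adm: "polyline_admissible \<rho> {x. sproj (Some x) \<in> g ` {0..1}} {x. sproj (Some x) \<in> h ` {0..1}}
        {x. chordal (Some x) u < 4 * R}"
    for g h :: "real \<Rightarrow> 'a \<times> real" and u :: "'a option" and v s R N \<rho>
  proof -
    have P: "(1::real) \<le> 16 ^ N" by simp
    have P2: "(256::real) ^ N = (16 ^ N)\<^sup>2" by (simp add: power2_eq_square power_mult_distrib[symmetric])
    have sR: "128 * s \<le> R" "0 < R"
    proof -
      have "128 * s = 64 * 2 * 1 * s" by simp
      also have "\<dots> \<le> 64 * n * 256 ^ N * s" using n s by (intro mult_right_mono mult_mono) auto
      finally show "128 * s \<le> R" using C by linarith
      then show "0 < R" using s by simp
    qed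
    obtain tg p where tg: "tg \<in> {0..1}" "g tg = sproj p" "R \<le> chordal p u"
    proof -
      obtain t where t: "t \<in> {0..1}" "R \<le> dist (g t) (sproj u)" using g_far by blast
      moreover obtain x where "g t = sproj x" using g(2) t(1) by blast
      ultimately show ?thesis using that[of t x] by (simp add: chordal_eq_dist)
    qed
    obtain th q where th: "th \<in> {0..1}" "h th = sproj q" "R \<le> chordal q u"
    proof -
      obtain t where t: "t \<in> {0..1}" "R \<le> dist (h t) (sproj u)" using h_far by blast
      moreover obtain x where "h t = sproj x" using h(2) t(1) by blast
      ultimately show ?thesis using that[of t x] by (simp add: chordal_eq_dist)
    qed
    define w where "w = chordal u None"
    have w0: "0 \<le> w" by (simp add: w_def chordal_nonneg)
    have final: "ennreal (real N * \<kappa>) \<le> (\<integral>\<^sup>+x. \<rho> x ^ DIM('a) \<partial>lborel)"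
      if \<alpha>: "0 < \<alpha>" "\<alpha> * 16 ^ N \<le> \<beta>"
        and ng: "sg \<in> {0..1}" "g sg = sproj (Some xg)" "infnorm (xg - c) \<le> \<alpha>"
        and fg: "sg' \<in> {0..1}" "g sg' = sproj pg" "\<And>x. pg = Some x \<Longrightarrow> \<beta> \<le> infnorm (x - c)"
        and nh: "sh \<in> {0..1}" "h sh = sproj (Some xh)" "infnorm (xh - c) \<le> \<alpha>"
        and fh: "sh' \<in> {0..1}" "h sh' = sproj ph" "\<And>x. ph = Some x \<Longrightarrow> \<beta> \<le> infnorm (x - c)"
        and inside: "\<And>x. \<alpha> / 4 \<le> infnorm (x - c) \<Longrightarrow> infnorm (x - c) \<le> \<alpha> * 16 ^ N \<Longrightarrow> chordal (Some x) u < 4 * R"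
      for \<alpha> \<beta> c sg xg sg' pg sh xh sh' ph
    proof -
      have ab: "\<alpha> \<le> \<alpha> * 16 ^ N" using \<alpha>(1) P by simp
      obtain a where a: "a \<in> borel_measurable borel" "\<And>t. t \<in> {\<alpha>..\<alpha> * 16 ^ N} \<Longrightarrow> infnorm (a t - c) = t"
        "\<And>t. t \<in> {\<alpha>..\<alpha> * 16 ^ N} \<Longrightarrow> sproj (Some (a t)) \<in> g ` {0..1}"
        by (rule sphere_selection[OF g(1,2) \<alpha>(1) ab ng(1) fg(1) ng(2,3) fg(2) order_trans[OF \<alpha>(2) fg(3)]]) (assumption, rule that)
      obtain b where b: "b \<in> borel_measurable borel" "\<And>t. t \<in> {\<alpha>..\<alpha> * 16 ^ N} \<Longrightarrow> infnorm (b t - c) = t"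
        "\<And>t. t \<in> {\<alpha>..\<alpha> * 16 ^ N} \<Longrightarrow> sproj (Some (b t)) \<in> h ` {0..1}"
        by (rule sphere_selection[OF h(1,2) \<alpha>(1) ab nh(1) fh(1) nh(2,3) fh(2) order_trans[OF \<alpha>(2) fh(3)]]) (assumption, rule that)
      show ?thesis
      proof (rule ann[OF a(1) b(1) \<alpha>(1) _ \<rho>])
        show "\<forall>t\<in>{\<alpha>..\<alpha> * 16 ^ N}. infnorm (a t - c) = t \<and> infnorm (b t - c) = t"
          using a(2) b(2) by blast
        show "polyline_admissible \<rho> (a ` {\<alpha>..\<alpha> * 16 ^ N}) (b ` {\<alpha>..\<alpha> * 16 ^ N}) {x. infnorm (x - c) \<in> {\<alpha> / 4..\<alpha> * 16 ^ N}}"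
          by (rule polyline_admissible_mono[OF adm]) (use a(3) b(3) inside in \<open>auto simp del: sproj.simps chordal.simps\<close>)
      qed
    qed
    show "ennreal (real N * \<kappa>) \<le> (\<integral>\<^sup>+x. \<rho> x ^ DIM('a) \<partial>lborel)"
    proof (cases "w\<^sup>2 \<le> s * R")
      case True
      \<comment> \<open>The geometric mean of \<open>s\<close> and \<open>R\<close>; it leaves room
        for N annuli of ratio 16 between \<open>z\<close> and \<open>R\<close>.\<close>
      define z where "z = sqrt (s * R)"
      have z: "0 < z" "z\<^sup>2 = s * R" using s sR by (auto simp: z_def)
      have wz: "w \<le> z" using True w0 by (simp add: z_def real_le_rsqrt)
      have Cz: "8 * m * 16 ^ N * z \<le> R"
      proof (rule power2_le_imp_le)
        have "(8 * m * 16 ^ N * z)\<^sup>2 = (64 * n * 256 ^ N * s) * R"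
          unfolding power_mult_distrib P2 m z by simp
        also have "\<dots> \<le> R * R" using C sR by (intro mult_right_mono) auto
        finally show "(8 * m * 16 ^ N * z)\<^sup>2 \<le> R\<^sup>2" by (simp add: power2_eq_square)
      qed (use sR in auto)
      have z8: "8 * z \<le> R"
      proof -
        have "8 * 1 * 1 * z \<le> 8 * m * 16 ^ N * z" using m P z by (intro mult_right_mono mult_mono) auto
        then show ?thesis using Cz by simp
      qed
      have sz: "s \<le> z"
      proof (rule power2_le_imp_le)
        show "s\<^sup>2 \<le> z\<^sup>2" unfolding z(2) unfolding power2_eq_square using s sR by (intro mult_left_mono) auto
      qed (use z in auto)
      have "chordal p None \<le> 1"
      proof (cases p)
        case (Some a)
        have "1 \<le> sqrt (1 + (norm a)\<^sup>2)" by simp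
        then have "1 / sqrt (1 + (norm a)\<^sup>2) \<le> 1 / 1"
          using one_plus_norm_sq_pos[of a] by (intro divide_left_mono) auto
        then show ?thesis using Some by simp
      qed simp
      then have "R \<le> 1 + w" using chordal_triangle[of p u None] tg by (simp add: w_def chordal_commute)
      then have z2: "2 * z \<le> 1 / 2" using wz z8 by simp
      have near: "\<exists>x. p' = Some x \<and> infnorm (x - 0) \<le> 2 / R" if "R \<le> chordal p' u" for p'
      proof -
        have "R \<le> chordal p' None + w" using chordal_triangle[of p' u None] that by (simp add: w_def chordal_commute)
        then have "R / 2 \<le> chordal p' None" "0 < R / 2" using wz z8 z sR by simp_all
        then obtain x where "p' = Some x" "norm x \<le> 1 / (R / 2)"
          by (rule norm_le_if_far_from_infinity)
        then show ?thesis using infnorm_le_norm[of x] by auto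
      qed
      have far: "1 / (4 * m * z) \<le> infnorm (x - 0)" if "chordal p' None \<le> 2 * z" "p' = Some x" for p' :: "'a option" and x
      proof -
        have "1 / (2 * (2 * z)) \<le> norm x" using that z z2 by (intro norm_ge_if_near_infinity) auto
        also have "\<dots> \<le> m * infnorm x" unfolding m_def n_def by (rule norm_le_infnorm)
        finally show ?thesis using m z by (simp add: field_simps)
      qed
      obtain xg where xg: "p = Some xg" "infnorm (xg - 0) \<le> 2 / R" using near[OF tg(3)] by auto
      obtain xh where xh: "q = Some xh" "infnorm (xh - 0) \<le> 2 / R" using near[OF th(3)] by auto
      have u2: "chordal u None \<le> 2 * z" using wz z by (simp add: w_def)
      have v2: "chordal v None \<le> 2 * z"
        using chordal_triangle[of v None u] uv wz sz by (simp add: w_def chordal_commute)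
      \<comment> \<open>Seen from infinity the roles are exchanged: the far points of the two curves
        have bounded coordinates and lie within the inner radius, while \<open>u\<close> and
        \<open>v\<close> lie beyond the outer one.\<close>
      show ?thesis
      proof (rule final[of "2 / R" "1 / (4 * m * z)" tg xg 0 0 u th xh 0 v])
        show "0 < 2 / R" using sR by simp
        show "2 / R * 16 ^ N \<le> 1 / (4 * m * z)" using Cz sR m z by (simp add: field_simps)
        show "tg \<in> {0..1}" "th \<in> {0..1}" by fact+
        show "(0::real) \<in> {0..1}" "(0::real) \<in> {0..1}" by auto
        show "g tg = sproj (Some xg)" "h th = sproj (Some xh)" using tg th xg xh by auto
        show "infnorm (xg - 0) \<le> 2 / R" "infnorm (xh - 0) \<le> 2 / R" by fact+
        show "g 0 = sproj u" "h 0 = sproj v" by fact+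
        show "1 / (4 * m * z) \<le> infnorm (x - 0)" if "u = Some x" for x using far[OF u2 that] .
        show "1 / (4 * m * z) \<le> infnorm (x - 0)" if "v = Some x" for x using far[OF v2 that] .
        fix x :: 'a assume "2 / R / 4 \<le> infnorm (x - 0)"
        then have nx: "1 / (2 * R) \<le> norm x" using infnorm_le_norm[of x] by simp
        then have x0: "0 < norm x" using sR by (smt (verit) divide_pos_pos)
        then have "chordal (Some x) None \<le> 1 / norm x" by (intro chordal_None_le) auto
        also have "\<dots> \<le> 1 / (1 / (2 * R))" using nx sR x0 by (intro divide_left_mono) auto
        finally have "chordal (Some x) None \<le> 2 * R" by simp
        then show "chordal (Some x) u < 4 * R"
          using chordal_triangle[of "Some x" u None] wz z8 sR by (simp add: w_def chordal_commute)
      qed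
    next
      case False
      then have w2: "s * R < w\<^sup>2" by simp
      have w: "0 < w" using w2 w0 mult_pos_pos[OF s sR(2)] by (cases "w = 0") auto
      obtain x0 where x0: "u = Some x0" using w by (cases u) (auto simp: w_def)
      have ws: "8 * m * 16 ^ N * s \<le> w"
      proof (rule power2_le_imp_le)
        have "(8 * m * 16 ^ N * s)\<^sup>2 = (64 * n * 256 ^ N * s) * s"
          unfolding power_mult_distrib P2 m power2_eq_square[of s] by simp
        also have "\<dots> \<le> R * s" using C s by (intro mult_right_mono) auto
        finally show "(8 * m * 16 ^ N * s)\<^sup>2 \<le> w\<^sup>2" using w2 by (simp add: mult.commute)
      qed (use w in auto)
      have s8: "8 * s \<le> w"
      proof -
        have "8 * 1 * 1 * s \<le> 8 * m * 16 ^ N * s" using m P s by (intro mult_right_mono mult_mono) auto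
        then show ?thesis using ws by simp
      qed
      have hv: "w / 2 \<le> chordal v None"
        using chordal_triangle[of u None v] uv s8 s by (simp add: w_def)
      then obtain y0 where y0: "v = Some y0" using w by (cases v) auto
      have "norm (x0 - y0) * w * chordal v None = chordal u v"
        by (simp add: x0 y0 w_def)
      then have "norm (x0 - y0) * w * chordal v None \<le> s" using uv by simp
      moreover have "norm (x0 - y0) * w * (w / 2) \<le> norm (x0 - y0) * w * chordal v None"
        using hv w by (intro mult_left_mono) auto
      ultimately have "norm (x0 - y0) * w * (w / 2) \<le> s" by linarith
      then have xy: "norm (y0 - x0) \<le> 2 * s / w\<^sup>2"
        using w by (simp add: pos_le_divide_eq power2_eq_square norm_minus_commute[of y0] algebra_simps)
      \<comment> \<open>Half the distance to infinity is the limit up to which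
        \<open>chordal_ball_Some\<close> compares Euclidean and chordal balls about
        \<open>x0\<close>.\<close>
      define R' where "R' = min R (w / 2)"
      have R': "0 < R'" "R' \<le> w / 2" "R' \<le> R" using sR w by (auto simp: R'_def)
      define \<beta> where "\<beta> = R' / (2 * w\<^sup>2 * m)"
      have far: "\<beta> \<le> infnorm (x - x0)" if "R \<le> chordal p' u" "p' = Some x" for p' x
      proof (rule ccontr)
        assume "\<not> ?thesis"
        then have "m * infnorm (x - x0) \<le> m * \<beta>" using m by (intro mult_left_mono) auto
        then have "norm (x - x0) \<le> R' / (2 * w\<^sup>2)"
          using norm_le_infnorm[of "x - x0"] m w by (simp add: m_def[symmetric] n_def[symmetric] \<beta>_def)
        then have "chordal (Some x) u < R'"
          unfolding x0 using R' by (intro chordal_ball_Some) (auto simp: w_def x0)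
        then show False using that R' by simp
      qed
      have smallN: "4 * m * 16 ^ N * s \<le> R'"
      proof -
        have "m * 16 ^ N \<le> n * 256 ^ N"
          unfolding P2 m(2)[symmetric] using m P by (intro mult_mono self_le_power) auto
        moreover have "0 \<le> m * 16 ^ N" using m by simp
        ultimately have "4 * (m * 16 ^ N) \<le> 64 * (n * 256 ^ N)" by linarith
        then have "4 * (m * 16 ^ N) * s \<le> 64 * (n * 256 ^ N) * s"
          by (rule mult_right_mono) (use s in simp)
        then have "4 * m * 16 ^ N * s \<le> 64 * n * 256 ^ N * s" by (simp only: mult.assoc)
        then have "4 * m * 16 ^ N * s \<le> R" using C by linarith
        moreover have "4 * m * 16 ^ N * s \<le> w / 2" using ws by linarith
        ultimately show ?thesis by (simp add: R'_def)
      qed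
      have in\<beta>: "2 * s / w\<^sup>2 * 16 ^ N \<le> \<beta>"
        using smallN w m by (simp add: \<beta>_def field_simps)
      show ?thesis
      proof (rule final[of "2 * s / w\<^sup>2" \<beta> 0 x0 x0 tg p 0 y0 th q])
        show "0 < 2 * s / w\<^sup>2" using s w by simp
        show "2 * s / w\<^sup>2 * 16 ^ N \<le> \<beta>" by fact
        show "tg \<in> {0..1}" "th \<in> {0..1}" by fact+
        show "(0::real) \<in> {0..1}" "(0::real) \<in> {0..1}" by auto
        show "g 0 = sproj (Some x0)" "h 0 = sproj (Some y0)" using g h x0 y0 by auto
        show "infnorm (x0 - x0) \<le> 2 * s / w\<^sup>2" using s w by (simp add: infnorm_0)
        show "infnorm (y0 - x0) \<le> 2 * s / w\<^sup>2" using xy infnorm_le_norm order_trans by blast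
        show "g tg = sproj p" "h th = sproj q" by fact+
        show "\<beta> \<le> infnorm (x - x0)" if "p = Some x" for x using far[OF tg(3) that] .
        show "\<beta> \<le> infnorm (x - x0)" if "q = Some x" for x using far[OF th(3) that] .
        fix x assume "2 * s / w\<^sup>2 / 4 \<le> infnorm (x - x0)" and x: "infnorm (x - x0) \<le> 2 * s / w\<^sup>2 * 16 ^ N"
        from x have "m * infnorm (x - x0) \<le> m * \<beta>" using in\<beta> m by (intro mult_left_mono) auto
        then have "norm (x - x0) \<le> R' / (2 * w\<^sup>2)"
          using norm_le_infnorm[of "x - x0"] m w by (simp add: m_def[symmetric] n_def[symmetric] \<beta>_def)
        then have "chordal (Some x) u < R'"
          unfolding x0 using R' by (intro chordal_ball_Some) (auto simp: w_def x0)
        then show "chordal (Some x) u < 4 * R" using R' by simp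
      qed
    qed
  qed
  show thesis by (rule that[OF \<kappa> C1]) (rule main)
qed

section \<open>Image rings\<close>

lemma continuous_on_sproj_Some: "continuous_on S (\<lambda>x. sproj (Some x))"
proof -
  have "1 + (norm x)\<^sup>2 \<noteq> 0" for x :: 'a using one_plus_norm_sq_pos[of x] by simp
  then show ?thesis by (simp, intro continuous_intros) auto
qed

declare sproj.simps [simp del] chordal.simps [simp del]

text \<open>The pointwise supremum of nearly optimal densities is admissible for every family, and
  its power \<open>DIM('a)\<close> is at most the sum of the powers. The infima need not be
  attained: each is exceeded by at most \<open>e\<close>, in total by at most 1.\<close>

lemma finite_family_admissible:
  fixes \<Gamma> :: "'i \<Rightarrow> (real set \<times> (real \<Rightarrow> 'a::euclidean_space option)) set"
  assumes I: "finite I" and B: "(\<Sum>i\<in>I. modulus (\<Gamma> i)) \<le> ennreal B" "0 \<le> B"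
  obtains \<rho> where "\<rho> \<in> borel_measurable borel" "(\<integral>\<^sup>+x. \<rho> x ^ DIM('a) \<partial>lborel) \<le> ennreal (B + 1)"
    "\<And>i J \<eta>. i \<in> I \<Longrightarrow> (J, \<eta>) \<in> \<Gamma> i \<Longrightarrow> loc_rectifiable J \<eta> \<Longrightarrow> 1 \<le> lineint \<rho> J \<eta>"
proof -
  define e where "e = 1 / (1 + real (card I))"
  have e: "0 < e" "real (card I) * e \<le> 1" by (auto simp: e_def)
  define Q where "Q = (\<lambda>i \<rho>. \<rho> \<in> borel_measurable borel \<and> (\<forall>(J, \<eta>)\<in>\<Gamma> i. loc_rectifiable J \<eta> \<longrightarrow> 1 \<le> lineint \<rho> J \<eta>) \<and>
      (\<integral>\<^sup>+x. \<rho> x ^ DIM('a) \<partial>lborel) \<le> modulus (\<Gamma> i) + ennreal e)"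
  have "\<exists>\<rho>. Q i \<rho>" if "i \<in> I" for i
  proof -
    have "modulus (\<Gamma> i) \<le> (\<Sum>i\<in>I. modulus (\<Gamma> i))" using that I by (intro member_le_sum) auto
    then have fin: "modulus (\<Gamma> i) < top" using B by (metis ennreal_less_top order.strict_trans1)
    then have "modulus (\<Gamma> i) < modulus (\<Gamma> i) + ennreal e" using e by simp
    then obtain \<rho> where "\<rho> \<in> borel_measurable borel" "\<forall>(J, \<eta>)\<in>\<Gamma> i. loc_rectifiable J \<eta> \<longrightarrow> 1 \<le> lineint \<rho> J \<eta>"
      "(\<integral>\<^sup>+x. \<rho> x ^ DIM('a) \<partial>lborel) < modulus (\<Gamma> i) + ennreal e"
      unfolding modulus_def[of "\<Gamma> i"] by (auto simp: INF_less_iff)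
    then show ?thesis unfolding Q_def by (intro exI[of _ \<rho>] conjI) auto
  qed
  then obtain \<rho> where Q: "\<And>i. i \<in> I \<Longrightarrow> Q i (\<rho> i)" by metis
  have \<rho>: "i \<in> I \<Longrightarrow> \<rho> i \<in> borel_measurable borel"
    "i \<in> I \<Longrightarrow> \<forall>(J, \<eta>)\<in>\<Gamma> i. loc_rectifiable J \<eta> \<longrightarrow> 1 \<le> lineint (\<rho> i) J \<eta>"
    "i \<in> I \<Longrightarrow> (\<integral>\<^sup>+x. \<rho> i x ^ DIM('a) \<partial>lborel) \<le> modulus (\<Gamma> i) + ennreal e" for i
    using Q[of i] unfolding Q_def by blast+
  define \<sigma> where "\<sigma> = (\<lambda>x. SUP i\<in>I. \<rho> i x)"
  have \<sigma>: "\<sigma> \<in> borel_measurable borel"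
    unfolding \<sigma>_def using I \<rho>(1) by (intro borel_measurable_SUP) (auto simp: countable_finite)
  have pow: "\<sigma> x ^ DIM('a) \<le> (\<Sum>i\<in>I. \<rho> i x ^ DIM('a))" for x
  proof (cases "I = {}")
    case True
    then show ?thesis by (simp add: \<sigma>_def bot_ennreal power_0_left)
  next
    case False
    have "\<sigma> x = Max ((\<lambda>i. \<rho> i x) ` I)" unfolding \<sigma>_def using I False by (simp add: Max_Sup)
    also have "\<dots> \<in> (\<lambda>i. \<rho> i x) ` I" using I False by (intro Max_in) auto
    finally obtain i where i: "i \<in> I" "\<sigma> x = \<rho> i x" by auto
    have "\<rho> i x ^ DIM('a) \<le> (\<Sum>i\<in>I. \<rho> i x ^ DIM('a))" using i I by (intro member_le_sum) auto
    then show ?thesis using i by simp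
  qed
  have "(\<integral>\<^sup>+x. \<sigma> x ^ DIM('a) \<partial>lborel) \<le> (\<integral>\<^sup>+x. (\<Sum>i\<in>I. \<rho> i x ^ DIM('a)) \<partial>lborel)"
    by (intro nn_integral_mono pow)
  also have "\<dots> = (\<Sum>i\<in>I. \<integral>\<^sup>+x. \<rho> i x ^ DIM('a) \<partial>lborel)"
    using \<rho>(1) by (intro nn_integral_sum) auto
  also have "\<dots> \<le> (\<Sum>i\<in>I. modulus (\<Gamma> i) + ennreal e)" by (intro sum_mono \<rho>(3))
  also have "\<dots> = (\<Sum>i\<in>I. modulus (\<Gamma> i)) + ennreal (real (card I) * e)"
    using e by (simp add: sum.distrib ennreal_mult ennreal_of_nat_eq_real_of_nat)
  also have "\<dots> \<le> ennreal B + ennreal 1" using B e by (intro add_mono ennreal_leI) auto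
  finally have "(\<integral>\<^sup>+x. \<sigma> x ^ DIM('a) \<partial>lborel) \<le> ennreal (B + 1)" using B by simp
  moreover have "1 \<le> lineint \<sigma> J \<eta>" if "i \<in> I" "(J, \<eta>) \<in> \<Gamma> i" "loc_rectifiable J \<eta>" for i J \<eta>
  proof -
    have "1 \<le> lineint (\<rho> i) J \<eta>" using \<rho>(2)[OF that(1)] that(2,3) by auto
    also have "\<dots> \<le> lineint \<sigma> J \<eta>"
      unfolding lineint_def \<sigma>_def using that(1)
      by (intro SUP_mono' nn_integral_mono mult_left_mono SUP_upper) auto
    finally show ?thesis .
  qed
  ultimately show ?thesis by (intro that[OF \<sigma>])
qed

text \<open>What the crossing arguments use of a map, transported to the sphere. Openness of images
  is an assumption here and is later derived from invariance of domain, which separates the two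
  arguments.\<close>

locale sphere_embedding =
  fixes D :: "'a::euclidean_space set" and f :: "'a \<Rightarrow> 'a option"
  assumes open_D: "open D"
    and inj: "inj_on f D"
    and cont: "continuous_on D (\<lambda>x. sproj (f x))"
    and open_map: "\<And>U. open U \<Longrightarrow> U \<subseteq> D \<Longrightarrow> openin (top_of_set (range sproj)) ((\<lambda>x. sproj (f x)) ` U)"
begin

abbreviation F where "F \<equiv> \<lambda>x. sproj (f x)"

lemma inj_F: "inj_on F D"
  using inj inj_sproj by (auto simp: inj_on_def)

lemma F_mem_iff: "U \<subseteq> D \<Longrightarrow> x \<in> D \<Longrightarrow> F x \<in> F ` U \<longleftrightarrow> x \<in> U"
  using inj_F by (auto dest: inj_onD)

lemma sproj_mem_image_iff: "sproj q \<in> F ` U \<longleftrightarrow> q \<in> f ` U"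
  using inj_sproj by (auto dest: injD)

lemma homeo: "homeomorphism D (F ` D) F (inv_into D F)"
proof -
  obtain g where g: "homeomorphism D (F ` D) F g"
  proof (rule homeomorphism_injective_open_map[OF cont refl inj_F])
    fix U assume "openin (top_of_set D) U"
    then have "open U" "U \<subseteq> D" using open_D by (auto simp: openin_open_eq)
    then show "openin (top_of_set (F ` D)) (F ` U)"
      by (intro openin_subset_trans[OF open_map]) auto
  qed
  have eq: "inv_into D F y = g y" if "y \<in> F ` D" for y
    using that g by (auto simp: homeomorphism_def inv_into_f_f[OF inj_F])
  then have "continuous_on (F ` D) (inv_into D F)"
    using g by (subst continuous_on_cong[OF refl eq]) (auto simp: homeomorphism_def)
  then show ?thesis using cont by (intro homeomorphismI) (auto simp: inv_into_f_f[OF inj_F])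
qed

lemma cont_inv: "continuous_on (F ` D) (inv_into D F)"
  using homeo by (simp add: homeomorphism_def)

text \<open>The path leaves the image of the larger ball at a first time \<open>\<tau>\<close>; the
  last earlier time \<open>\<sigma>\<close> at which its preimage is within \<open>r1\<close> of the
  centre begins a subarc whose preimage joins the two spheres inside \<open>D\<close>. The
  hypothesis \<open>inside\<close> excludes an exit through the frontier of f(D), where the preimage
  would break off before reaching the outer sphere.\<close>

lemma ring_crossing:
  assumes r: "0 < r1" "r1 < r2" and \<rho>: "\<rho> \<in> borel_measurable borel"
    and adm: "\<And>J \<eta>. (J, \<eta>) \<in> image_family f D (curves (sphere x0 r1) (sphere x0 r2) D) \<Longrightarrow> loc_rectifiable J \<eta> \<Longrightarrow> 1 \<le> lineint \<rho> J \<eta>"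
    and lip: "\<And>s t. norm (p s - p t) \<le> L * \<bar>s - t\<bar>" and L: "0 \<le> L" and T: "0 \<le> T"
    and start: "Some (p 0) \<in> f ` (cball x0 r1 \<inter> D)"
    and stop: "Some (p T) \<notin> f ` (ball x0 r2 \<inter> D)"
    and inside: "\<And>t. t \<in> {0..T} \<Longrightarrow> sproj (Some (p t)) \<in> closure (F ` (ball x0 r2 \<inter> D)) \<Longrightarrow> Some (p t) \<in> f ` D"
  shows "1 \<le> ennreal L * (\<integral>\<^sup>+t\<in>{0..T}. \<rho> (p t) \<partial>lborel)"
proof -
  define P where "P = (\<lambda>t. sproj (Some (p t)))"
  define U where "U = F ` (ball x0 r2 \<inter> D)"
  have p_cont: "continuous_on S p" for S
    using lip L by (intro lipschitz_on_continuous_on[of L] lipschitz_onI) (auto simp: dist_norm dist_real_def)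
  have P_cont: "continuous_on S P" for S
    unfolding P_def by (intro continuous_on_compose2[OF continuous_on_sproj_Some p_cont]) auto
  have P_iff: "P t \<in> F ` V \<longleftrightarrow> Some (p t) \<in> f ` V" for t V
    unfolding P_def by (rule sproj_mem_image_iff)
  have U_open: "openin (top_of_set (range sproj)) U"
    unfolding U_def using open_D by (intro open_map) auto
  define Z where "Z = {t\<in>{0..T}. P t \<notin> U}"
  have Z_eq: "Z = {0..T} \<inter> P -` (range sproj - U)" by (auto simp: Z_def P_def)
  have "closedin (top_of_set (range sproj)) (range sproj - U)" using U_open by (simp add: closedin_diff)
  then have "closedin (top_of_set {0..T}) Z"
    unfolding Z_eq by (intro continuous_closedin_preimage_gen[OF P_cont]) (auto simp: P_def)
  then have Z_compact: "compact Z" using compact_Icc closedin_compact by blast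
  have TZ: "T \<in> Z" using stop T by (simp add: Z_def U_def P_iff)
  define \<tau> where "\<tau> = Inf Z"
  have bddZ: "bdd_below Z" by (rule bdd_belowI[of _ 0]) (auto simp: Z_def)
  have \<tau>Z: "\<tau> \<in> Z" unfolding \<tau>_def using TZ Z_compact bddZ by (intro closed_contains_Inf compact_imp_closed) auto
  have before: "P t \<in> U" if "0 \<le> t" "t < \<tau>" for t
    using cInf_lower[OF _ bddZ, of t] that \<tau>Z by (force simp: Z_def \<tau>_def)
  have \<tau>T: "\<tau> \<le> T" "0 \<le> \<tau>" using \<tau>Z by (auto simp: Z_def)
  have "P 0 \<in> U"
  proof -
    have "cball x0 r1 \<subseteq> ball x0 r2" using r by auto
    then show ?thesis using start unfolding U_def P_iff by blast
  qed
  then have \<tau>0: "0 < \<tau>" using \<tau>Z \<tau>T by (cases "\<tau> = 0") (auto simp: Z_def)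
  have "P \<tau> \<in> closure U"
  proof -
    have cl: "closure {0..<\<tau>} = {0..\<tau>}" using \<tau>0 by simp
    have "P ` closure {0..<\<tau>} \<subseteq> closure (P ` {0..<\<tau>})"
      by (intro image_closure_subset[OF P_cont] closed_closure closure_subset)
    also have "\<dots> \<subseteq> closure U" using before by (intro closure_mono) auto
    finally show ?thesis using \<tau>0 unfolding cl by auto
  qed
  \<comment> \<open>Before the exit time the path is in the image of the ball; at the exit time it
    is only in the closure, and membership in the image comes from \<open>inside\<close>.\<close>
  then have P\<tau>: "P \<tau> \<in> F ` D" using inside[of \<tau>] \<tau>T unfolding P_iff by (simp add: P_def U_def)
  have PD: "P t \<in> F ` D" if "t \<in> {0..\<tau>}" for t
    using before[of t] P\<tau> that by (cases "t = \<tau>") (auto simp: U_def)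
  define \<gamma> where "\<gamma> = (\<lambda>t. inv_into D F (P t))"
  have \<gamma>D: "\<gamma> t \<in> D" and F\<gamma>: "F (\<gamma> t) = P t" if "t \<in> {0..\<tau>}" for t
    using PD[OF that] unfolding \<gamma>_def by (auto intro: inv_into_into f_inv_into_f)
  have \<gamma>_cont: "continuous_on {0..\<tau>} \<gamma>"
    unfolding \<gamma>_def by (rule continuous_on_compose2[OF cont_inv P_cont]) (use PD in auto)
  have f\<gamma>: "f (\<gamma> t) = Some (p t)" if "t \<in> {0..\<tau>}" for t
    using F\<gamma>[OF that] inj_sproj unfolding P_def by (auto dest: injD)
  define \<delta> where "\<delta> = (\<lambda>t. dist x0 (\<gamma> t))"
  have \<delta>_cont: "continuous_on {0..\<tau>} \<delta>" unfolding \<delta>_def by (intro continuous_intros \<gamma>_cont)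
  have \<delta>_less: "\<delta> t < r2" if "0 \<le> t" "t < \<tau>" for t
    using before[OF that] F_mem_iff[of "ball x0 r2 \<inter> D" "\<gamma> t"] F\<gamma>[of t] \<gamma>D[of t] that
    by (simp add: U_def \<delta>_def)
  have \<delta>\<tau>: "\<delta> \<tau> = r2"
  proof (rule antisym)
    show "\<delta> \<tau> \<le> r2"
      by (rule continuous_le_on_closure[where S = "{0..<\<tau>}" and f = \<delta>])
        (use \<tau>0 \<delta>_cont in \<open>auto dest: \<delta>_less intro: less_imp_le\<close>)
    have "P \<tau> \<notin> U" using \<tau>Z by (simp add: Z_def)
    then have "\<gamma> \<tau> \<notin> ball x0 r2" using F\<gamma>[of \<tau>] \<gamma>D[of \<tau>] \<tau>T unfolding U_def by force
    then show "r2 \<le> \<delta> \<tau>" by (simp add: \<delta>_def)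
  qed
  define W where "W = {t\<in>{0..\<tau>}. \<delta> t \<le> r1}"
  have W_eq: "W = {0..\<tau>} \<inter> \<delta> -` {..r1}" by (auto simp: W_def)
  have "closedin (top_of_set {0..\<tau>}) W"
    unfolding W_eq by (intro continuous_closedin_preimage \<delta>_cont) auto
  then have W_compact: "compact W" using compact_Icc closedin_compact by blast
  have "0 \<in> W"
  proof -
    obtain z where z: "z \<in> cball x0 r1" "z \<in> D" "f z = Some (p 0)" using start by auto
    then have "z = \<gamma> 0" using f\<gamma>[of 0] \<gamma>D[of 0] \<tau>0 inj_onD[OF inj, of z "\<gamma> 0"] by auto
    then show ?thesis using z \<tau>0 by (simp add: W_def \<delta>_def)
  qed
  have bddW: "bdd_above W" by (rule bdd_aboveI[of _ \<tau>]) (auto simp: W_def)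
  define \<sigma> where "\<sigma> = Sup W"
  have \<sigma>W: "\<sigma> \<in> W" unfolding \<sigma>_def using \<open>0 \<in> W\<close> W_compact bddW by (intro closed_contains_Sup compact_imp_closed) auto
  have \<sigma>: "0 \<le> \<sigma>" "\<sigma> \<le> \<tau>" "\<delta> \<sigma> \<le> r1" using \<sigma>W by (auto simp: W_def)
  have \<sigma>\<tau>: "\<sigma> < \<tau>" using \<sigma> \<delta>\<tau> r by (cases "\<sigma> = \<tau>") auto
  have after: "r1 < \<delta> t" if "\<sigma> < t" "t \<le> \<tau>" for t
    using cSup_upper[OF _ bddW, of t] that \<sigma> by (force simp: W_def \<sigma>_def)
  have \<delta>\<sigma>: "\<delta> \<sigma> = r1"
  proof (rule antisym)
    show "r1 \<le> \<delta> \<sigma>"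
      by (rule continuous_ge_on_closure[where S = "{\<sigma><..\<tau>}" and f = \<delta>])
        (use \<sigma>\<tau> \<sigma> \<delta>_cont in \<open>auto dest: after intro: less_imp_le continuous_on_subset\<close>)
  qed (rule \<sigma>)
  have sub: "{\<sigma>..\<tau>} \<subseteq> {0..\<tau>}" using \<sigma> by auto
  have "(\<sigma>, \<tau>, \<gamma>) \<in> curves (sphere x0 r1) (sphere x0 r2) D"
    using \<sigma>\<tau> continuous_on_subset[OF \<gamma>_cont sub] \<delta>\<sigma> \<delta>\<tau> \<gamma>D sub by (auto simp: curves_def \<delta>_def)
  then have "({t\<in>{\<sigma>..\<tau>}. \<gamma> t \<in> D}, f \<circ> \<gamma>) \<in> image_family f D (curves (sphere x0 r1) (sphere x0 r2) D)"
    unfolding image_family_def by blast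
  \<comment> \<open>The end points also lie in \<open>D\<close>, so the parameter set that
    \<open>image_family\<close> attaches to this curve is the full closed interval.\<close>
  moreover have "{t\<in>{\<sigma>..\<tau>}. \<gamma> t \<in> D} = {\<sigma>..\<tau>}" using \<gamma>D sub by auto
  ultimately have fam: "({\<sigma>..\<tau>}, f \<circ> \<gamma>) \<in> image_family f D (curves (sphere x0 r1) (sphere x0 r2) D)" by simp
  have eq: "(f \<circ> \<gamma>) t = Some (p t)" if "t \<in> {\<sigma>..\<tau>}" for t using f\<gamma>[of t] that sub by auto
  have "1 \<le> lineint \<rho> {\<sigma>..\<tau>} (f \<circ> \<gamma>)"
    by (intro adm fam lineint_lipschitz_le(1)[where p = p and L = L]) (use lip eq \<rho> L in auto)
  also have "\<dots> \<le> ennreal L * (\<integral>\<^sup>+t\<in>{\<sigma>..\<tau>}. \<rho> (p t) \<partial>lborel)"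
    by (intro lineint_lipschitz_le(2)) (use lip eq \<rho> L in auto)
  also have "\<dots> \<le> ennreal L * (\<integral>\<^sup>+t\<in>{0..T}. \<rho> (p t) \<partial>lborel)"
    using \<sigma> \<tau>T by (intro mult_left_mono nn_integral_mono) (auto split: split_indicator)
  finally show ?thesis .
qed

lemma polyline_admissible_rings:
  fixes \<rho> :: "'a \<Rightarrow> ennreal"
  assumes r: "0 < r1" "r1 < r2" and \<rho>: "\<rho> \<in> borel_measurable borel"
    and adm: "\<And>i J \<eta>. i \<in> I \<Longrightarrow> (J, \<eta>) \<in> image_family f D (curves (sphere (x i) r1) (sphere (x i) r2) D) \<Longrightarrow>
        loc_rectifiable J \<eta> \<Longrightarrow> 1 \<le> lineint \<rho> J \<eta>"
    and A: "\<And>y. y \<in> A \<Longrightarrow> \<exists>i\<in>I. Some y \<in> f ` (cball (x i) r1 \<inter> D)"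
    and B: "\<And>y i. y \<in> B \<Longrightarrow> i \<in> I \<Longrightarrow> Some y \<notin> f ` (ball (x i) r2 \<inter> D)"
    and inside: "\<And>v i t. v 0 \<in> A \<Longrightarrow> v 4 \<in> B \<Longrightarrow> polyline v 4 ` {0..4} \<subseteq> W \<Longrightarrow> i \<in> I \<Longrightarrow> t \<in> {0..4} \<Longrightarrow>
        sproj (Some (polyline v 4 t)) \<in> closure (F ` (ball (x i) r2 \<inter> D)) \<Longrightarrow> Some (polyline v 4 t) \<in> f ` D"
  shows "polyline_admissible \<rho> A B W"
  unfolding polyline_admissible_def
proof (intro allI impI, elim conjE)
  fix v :: "nat \<Rightarrow> 'a" and L :: real
  assume v: "v 0 \<in> A" "v 4 \<in> B" and L: "0 \<le> L" "\<forall>k<4. norm (v (Suc k) - v k) \<le> L"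
    and W: "\<forall>k<4. \<forall>s\<in>{0..1}. (1 - s) *\<^sub>R v k + s *\<^sub>R v (Suc k) \<in> W"
  have im: "polyline v 4 ` {0..4} \<subseteq> W"
  proof
    fix y assume "y \<in> polyline v 4 ` {0..4}"
    then obtain t where "t \<in> {0..real 4}" "y = polyline v 4 t" by auto
    then obtain k s where "k < 4" "s \<in> {0..1}" "y = (1 - s) *\<^sub>R v k + s *\<^sub>R v (Suc k)"
      using polyline_in_segment[of t 4 v] by auto
    then show "y \<in> W" using W by blast
  qed
  obtain i where i: "i \<in> I" "Some (v 0) \<in> f ` (cball (x i) r1 \<inter> D)" using A v by blast
  have "1 \<le> ennreal L * (\<integral>\<^sup>+t\<in>{0..4}. \<rho> (polyline v 4 t) \<partial>lborel)"
  proof (rule ring_crossing[OF r \<rho> adm[OF i(1)]])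
    show "norm (polyline v 4 s - polyline v 4 t) \<le> L * \<bar>s - t\<bar>" for s t
      using L by (intro polyline_lipschitz) auto
    show "Some (polyline v 4 0) \<in> f ` (cball (x i) r1 \<inter> D)" using i by (simp add: polyline_0)
    show "Some (polyline v 4 4) \<notin> f ` (ball (x i) r2 \<inter> D)"
      using B[OF v(2) i(1)] polyline_ge[where N = 4 and t = 4 and v = v] by simp
    fix t :: real assume "t \<in> {0..4}" "sproj (Some (polyline v 4 t)) \<in> closure (F ` (ball (x i) r2 \<inter> D))"
    then show "Some (polyline v 4 t) \<in> f ` D" using inside[OF v im i(1)] by blast
  qed (use L in auto)
  also have "\<dots> \<le> ennreal L * (\<Sum>k<4. segment_integral \<rho> (v k) (v (Suc k)))"
    using nn_integral_polyline_le[OF \<rho>, where N = 4 and v = v] by (intro mult_left_mono) auto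
  finally show "1 \<le> ennreal L * (\<Sum>k<4. segment_integral \<rho> (v k) (v (Suc k)))" .
qed

end

section \<open>The chordal topology\<close>

text \<open>The sphere is given by |y|^2 = t (1 - t), and off the pole the inverse is x = y / (1 -
  t). Identification with a Euclidean sphere supplies compactness and, later, local path
  connectedness and short arcs.\<close>

lemma range_sproj: "range sproj = sphere ((0 :: 'a::euclidean_space), 1 / 2 :: real) (1 / 2)"
proof (intro equalityI subsetI)
  have mem: "(y, t) \<in> sphere ((0 :: 'a), 1 / 2 :: real) (1 / 2) \<longleftrightarrow> (norm y)\<^sup>2 = t * (1 - t)" for y t
  proof -
    have "(y, t) \<in> sphere ((0 :: 'a), 1 / 2 :: real) (1 / 2) \<longleftrightarrow> (dist ((0 :: 'a), 1 / 2 :: real) (y, t))\<^sup>2 = (1 / 2)\<^sup>2"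
      by (simp add: power2_eq_iff_nonneg)
    also have "(dist ((0 :: 'a), 1 / 2 :: real) (y, t))\<^sup>2 = (norm y)\<^sup>2 + (1 / 2 - t)\<^sup>2"
      unfolding dist_Pair_Pair by (simp add: dist_norm)
    finally show ?thesis by (auto simp: power2_eq_square algebra_simps)
  qed
  fix z :: "'a \<times> real"
  show "z \<in> sphere (0, 1 / 2) (1 / 2)" if zr: "z \<in> range sproj"
  proof -
    obtain p where p: "z = sproj p" using zr by (rule rangeE)
    show ?thesis
    proof (cases p)
      case None
      then show ?thesis using p mem[of 0 1] by (simp add: sproj.simps)
    next
      case (Some x)
      have eq: "1 - (norm x)\<^sup>2 / (1 + (norm x)\<^sup>2) = 1 / (1 + (norm x)\<^sup>2)"
        using one_plus_norm_sq_pos[of x] by (simp add: diff_divide_eq_iff)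
      have "(norm (x /\<^sub>R (1 + (norm x)\<^sup>2)))\<^sup>2 = (norm x)\<^sup>2 / (1 + (norm x)\<^sup>2) * (1 - (norm x)\<^sup>2 / (1 + (norm x)\<^sup>2))"
        unfolding eq using one_plus_norm_sq_pos[of x] by (simp add: power_mult_distrib power2_eq_square divide_inverse)
      then show ?thesis using p Some mem by (simp only: sproj.simps)
    qed
  qed
  show "z \<in> range sproj" if zs: "z \<in> sphere (0, 1 / 2) (1 / 2)"
  proof -
    obtain y t where z: "z = (y, t)" by force
    have yt: "(norm y)\<^sup>2 = t * (1 - t)" using zs mem z by simp
    show ?thesis
    proof (cases "t = 1")
      case True
      then have "z = sproj None" using yt z by (simp add: sproj.simps)
      then show ?thesis by simp
    next
      case False
      have "0 \<le> t * (1 - t)" unfolding yt[symmetric] by simp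
      then have t: "t < 1" using False by (auto simp: zero_le_mult_iff)
      define x where "x = y /\<^sub>R (1 - t)"
      have "(norm x)\<^sup>2 = t * (1 - t) / (1 - t)\<^sup>2"
        unfolding x_def by (simp add: power_mult_distrib yt divide_inverse power_inverse mult.commute)
      also have "\<dots> = t / (1 - t)" using t by (simp add: power2_eq_square)
      finally have nx: "(norm x)\<^sup>2 = t / (1 - t)" .
      then have "1 + (norm x)\<^sup>2 = 1 / (1 - t)" using t by (simp add: field_simps)
      then have "sproj (Some x) = z"
        unfolding sproj.simps nx using t by (simp add: x_def z)
      then show ?thesis by (metis rangeI)
    qed
  qed
qed

lemma compact_range_sproj: "compact (range (sproj :: 'a::euclidean_space option \<Rightarrow> _))"
  by (simp add: range_sproj)

lemma chordal_le_1: "chordal p q \<le> 1"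
proof -
  have "dist (sproj p) (sproj q) \<le> dist (sproj p) (0, 1 / 2) + dist (0, 1 / 2) (sproj q)"
    by (rule dist_triangle)
  moreover have "dist (0, 1 / 2) (sproj p) = 1 / 2" "dist (0, 1 / 2) (sproj q) = 1 / 2"
    using range_sproj by auto
  ultimately show ?thesis by (simp add: chordal_eq_dist dist_commute)
qed

lemma chordal_le_diam: "p \<in> E \<Longrightarrow> q \<in> E \<Longrightarrow> chordal p q \<le> chordal_diam E"
proof -
  assume E: "p \<in> E" "q \<in> E"
  have "bdd_above ((\<lambda>pq. chordal (fst pq) (snd pq)) ` (E \<times> E))"
    by (rule bdd_aboveI[of _ 1]) (auto simp: chordal_le_1)
  then have "chordal (fst (p, q)) (snd (p, q)) \<le> (SUP pq\<in>E \<times> E. chordal (fst pq) (snd pq))"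
    using E by (intro cSUP_upper) auto
  then show ?thesis using E by (auto simp: chordal_diam_def)
qed

text \<open>The supremum need not be attained; giving up a factor 2 avoids the question.\<close>

lemma chordal_diam_half_attained:
  assumes "d \<le> chordal_diam E" "0 < d"
  shows "\<exists>p\<in>E. \<exists>q\<in>E. d / 2 \<le> chordal p q"
proof (rule ccontr)
  assume neg: "\<not> ?thesis"
  have E: "E \<noteq> {}" using assms by (auto simp: chordal_diam_def)
  have "(SUP pq\<in>E \<times> E. chordal (fst pq) (snd pq)) \<le> d / 2"
    using E neg by (intro cSUP_least) force+
  then show False using assms E by (simp add: chordal_diam_def)
qed

lemma openin_chordal_top: "openin chordal_top S \<longleftrightarrow> (\<forall>p\<in>S. \<exists>e>0. chordal_ball p e \<subseteq> S)"
proof -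
  have "istopology (\<lambda>S :: 'a option set. \<forall>p\<in>S. \<exists>e>0. chordal_ball p e \<subseteq> S)"
    unfolding istopology_def
  proof (intro conjI allI impI ballI)
    fix S T :: "'a option set" and p
    assume S: "\<forall>p\<in>S. \<exists>e>0. chordal_ball p e \<subseteq> S" and T: "\<forall>p\<in>T. \<exists>e>0. chordal_ball p e \<subseteq> T" and p: "p \<in> S \<inter> T"
    obtain d e where "0 < d" "chordal_ball p d \<subseteq> S" "0 < e" "chordal_ball p e \<subseteq> T" using S T p by blast
    then show "\<exists>e>0. chordal_ball p e \<subseteq> S \<inter> T"
      by (intro exI[of _ "min d e"]) (auto simp: chordal_ball_def)
  next
    fix K :: "'a option set set" and p
    assume "\<forall>S\<in>K. \<forall>p\<in>S. \<exists>e>0. chordal_ball p e \<subseteq> S" "p \<in> \<Union>K"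
    then show "\<exists>e>0. chordal_ball p e \<subseteq> \<Union>K" by (meson Union_iff Union_upper order_trans)
  qed
  then show ?thesis unfolding chordal_top_def by (simp add: topology_inverse')
qed

lemma topspace_chordal_top: "topspace chordal_top = UNIV"
  using openin_chordal_top[of UNIV] by (metis openin_subset subset_UNIV subset_antisym top_greatest zero_less_one)

text \<open>Chordal balls are the preimages of Euclidean balls, so both topologies have the same
  open sets.\<close>

lemma homeomorphic_map_sproj: "homeomorphic_map chordal_top (top_of_set (range sproj)) sproj"
  unfolding homeomorphic_map_def quotient_map_def
proof (intro conjI allI impI)
  fix U :: "('a \<times> real) set" assume U: "U \<subseteq> topspace (top_of_set (range sproj))"
  show "openin chordal_top {x \<in> topspace chordal_top. sproj x \<in> U} = openin (top_of_set (range sproj)) U"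
    unfolding openin_chordal_top openin_euclidean_subtopology_iff topspace_chordal_top
  proof (intro iffI conjI ballI)
    assume L: "\<forall>p\<in>{x \<in> UNIV. sproj x \<in> U}. \<exists>e>0. chordal_ball p e \<subseteq> {x \<in> UNIV. sproj x \<in> U}"
    show "U \<subseteq> range sproj" using U by simp
    fix z assume z: "z \<in> U"
    then have "z \<in> range sproj" using U by auto
    then obtain p where p: "z = sproj p" by (rule rangeE)
    then obtain e where "0 < e" "chordal_ball p e \<subseteq> {x \<in> UNIV. sproj x \<in> U}" using L z by blast
    then show "\<exists>e>0. \<forall>x'\<in>range sproj. dist x' z < e \<longrightarrow> x' \<in> U"
      unfolding p by (intro exI[of _ e]) (auto simp: chordal_ball_def chordal_eq_dist)
  next
    fix p assume R: "U \<subseteq> range sproj \<and> (\<forall>x\<in>U. \<exists>e>0. \<forall>x'\<in>range sproj. dist x' x < e \<longrightarrow> x' \<in> U)"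
      and "p \<in> {x \<in> UNIV. sproj x \<in> U}"
    then obtain e where "0 < e" "\<forall>x'\<in>range sproj. dist x' (sproj p) < e \<longrightarrow> x' \<in> U" by blast
    then show "\<exists>e>0. chordal_ball p e \<subseteq> {x \<in> UNIV. sproj x \<in> U}"
      by (intro exI[of _ e]) (auto simp: chordal_ball_def chordal_eq_dist)
  qed
qed (use inj_sproj in \<open>auto simp: topspace_chordal_top intro: inj_on_subset\<close>)

text \<open>Off the pole the projection has the continuous inverse
  \<open>(y, t) \<mapsto> y /\<^sub>R (1 - t)\<close>, under which the image of \<open>V\<close> is
  a preimage.\<close>

lemma openin_sproj_Some_image:
  fixes V :: "'a::euclidean_space set"
  assumes "open V"
  shows "openin (top_of_set (range sproj)) ((\<lambda>x. sproj (Some x)) ` V)"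
proof -
  let ?W = "{z :: 'a \<times> real. snd z \<noteq> 1}"
  have "open ?W" by (intro open_Collect_neq continuous_intros)
  moreover have c: "continuous_on ?W (\<lambda>z. fst z /\<^sub>R (1 - snd z))" by (intro continuous_intros) auto
  ultimately have "open (?W \<inter> (\<lambda>z. fst z /\<^sub>R (1 - snd z)) -` V)"
    using assms continuous_open_preimage[OF c] by blast
  then have "openin (top_of_set (range sproj)) (range sproj \<inter> (?W \<inter> (\<lambda>z. fst z /\<^sub>R (1 - snd z)) -` V))"
    by (rule openin_open_Int)
  moreover have "range sproj \<inter> (?W \<inter> (\<lambda>z. fst z /\<^sub>R (1 - snd z)) -` V) = (\<lambda>x. sproj (Some x)) ` V"
  proof -
    have *: "fst (sproj (Some x)) /\<^sub>R (1 - snd (sproj (Some x))) = x" for x :: 'a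
      unfolding sproj_Some_fst using sproj_Some_snd[of x] one_plus_norm_sq_pos[of x] by simp
    show ?thesis
    proof (intro equalityI subsetI)
      fix z assume z: "z \<in> range sproj \<inter> (?W \<inter> (\<lambda>z. fst z /\<^sub>R (1 - snd z)) -` V)"
      then obtain p where p: "z = sproj p" by blast
      then obtain x where "z = sproj (Some x)" using z sproj_snd(2)[of p] by (cases p) auto
      then show "z \<in> (\<lambda>x. sproj (Some x)) ` V" using z * by auto
    next
      fix z assume "z \<in> (\<lambda>x. sproj (Some x)) ` V"
      then show "z \<in> range sproj \<inter> (?W \<inter> (\<lambda>z. fst z /\<^sub>R (1 - snd z)) -` V)"
        using * sproj_snd(2) by auto
    qed
  qed
  ultimately show ?thesis by simp
qed

text \<open>Invariance of domain in Euclidean space, applied in the standard chart.\<close>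

lemma openin_image_finite:
  fixes f :: "'a::euclidean_space \<Rightarrow> 'a option"
  assumes "open U" "continuous_on U (\<lambda>x. sproj (f x))" "inj_on f U" "\<And>x. x \<in> U \<Longrightarrow> f x \<noteq> None"
  shows "openin (top_of_set (range sproj)) ((\<lambda>x. sproj (f x)) ` U)"
proof -
  define g where "g = (\<lambda>x. the (f x))"
  have f: "f x = Some (g x)" if "x \<in> U" for x using assms(4)[OF that] by (simp add: g_def)
  have geq: "g x = fst (sproj (f x)) /\<^sub>R (1 - snd (sproj (f x)))" if "x \<in> U" for x
    unfolding f[OF that] sproj_Some_fst using sproj_Some_snd[of "g x"] one_plus_norm_sq_pos[of "g x"] by simp
  have "continuous_on U (\<lambda>x. fst (sproj (f x)) /\<^sub>R (1 - snd (sproj (f x))))"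
  proof (intro continuous_intros assms(2) ballI)
    fix x assume "x \<in> U"
    then show "1 - snd (sproj (f x)) \<noteq> 0" using assms(4) sproj_snd(2)[of "f x"] by auto
  qed
  then have "continuous_on U g" by (subst continuous_on_cong[OF refl geq]) auto
  moreover have "inj_on g U" using assms(3) f by (metis inj_on_def)
  ultimately have "open (g ` U)" using assms(1) by (intro invariance_of_domain)
  moreover have "(\<lambda>x. sproj (f x)) ` U = (\<lambda>x. sproj (Some x)) ` g ` U" using f by (force simp: image_image)
  ultimately show ?thesis using openin_sproj_Some_image by metis
qed

text \<open>Inversion in the unit sphere, which exchanges 0 and infinity. On the projected sphere it
  is the reflection \<open>t \<mapsto> 1 - t\<close> of the last coordinate, and it provides the
  chart around infinity.\<close>

definition option_inversion :: "'a::euclidean_space option \<Rightarrow> 'a option" where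
  "option_inversion p = (case p of None \<Rightarrow> Some 0 | Some x \<Rightarrow> if x = 0 then None else Some (x /\<^sub>R (norm x)\<^sup>2))"

lemma sproj_option_inversion: "sproj (option_inversion p) = (fst (sproj p), 1 - snd (sproj p))"
proof (cases p)
  case (Some x)
  show ?thesis
  proof (cases "x = 0")
    case False
    define X where "X = (norm x)\<^sup>2"
    have X: "0 < X" using False by (simp add: X_def)
    have n: "(norm (x /\<^sub>R X))\<^sup>2 = 1 / X"
    proof -
      have "(norm (x /\<^sub>R X))\<^sup>2 = (inverse X)\<^sup>2 * (norm x)\<^sup>2" using X by (simp add: power_mult_distrib)
      also have "\<dots> = 1 / X" unfolding X_def[symmetric] using X by (simp add: power2_eq_square field_simps)
      finally show ?thesis .
    qed
    have "sproj (option_inversion p) = ((x /\<^sub>R X) /\<^sub>R (1 + 1 / X), (1 / X) / (1 + 1 / X))"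
    proof -
      have e: "option_inversion p = Some (x /\<^sub>R X)" using Some False by (simp add: option_inversion_def X_def)
      show ?thesis unfolding e sproj.simps n ..
    qed
    also have "(x /\<^sub>R X) /\<^sub>R (1 + 1 / X) = x /\<^sub>R (1 + X)"
    proof -
      have "inverse (1 + 1 / X) * inverse X = inverse (1 + X)" using X by (simp add: field_simps)
      then show ?thesis by simp
    qed
    also have "(1 / X) / (1 + 1 / X) = 1 - X / (1 + X)" using X by (simp add: field_simps)
    finally show ?thesis using Some by (simp add: sproj.simps X_def)
  qed (use Some in \<open>simp add: option_inversion_def sproj.simps\<close>)
qed (simp add: option_inversion_def sproj.simps)

lemma inj_option_inversion: "inj option_inversion"
proof (rule injI)
  fix p q :: "'a option" assume "option_inversion p = option_inversion q"
  then have "sproj p = sproj q"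
    using sproj_option_inversion[of p] sproj_option_inversion[of q] by (simp add: prod_eq_iff)
  then show "p = q" using inj_sproj by (auto dest: injD)
qed

text \<open>Invariance of domain for maps into the sphere: the points not sent to infinity are
  handled in the standard chart, those not sent to 0 after an inversion, and these two open sets
  cover \<open>U\<close>.\<close>

lemma openin_image_sproj:
  fixes f :: "'a::euclidean_space \<Rightarrow> 'a option"
  assumes U: "open U" and cont: "continuous_on U (\<lambda>x. sproj (f x))" and inj: "inj_on f U"
  shows "openin (top_of_set (range sproj)) ((\<lambda>x. sproj (f x)) ` U)"
proof -
  have sub: "openin (top_of_set (range sproj)) ((\<lambda>x. sproj (f x)) ` {x\<in>U. f x \<noteq> p})"
    if p0: "p = None \<or> p = Some 0" for p
  proof -
    have "{x\<in>U. f x \<noteq> p} = U \<inter> (\<lambda>x. sproj (f x)) -` (- {sproj p})" using inj_sproj by (auto dest: injD)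
    then have op: "open {x\<in>U. f x \<noteq> p}"
      using continuous_open_preimage[OF cont U open_Compl[OF closed_singleton], of "sproj p"] by simp
    have cont': "continuous_on {x\<in>U. f x \<noteq> p} (\<lambda>x. sproj (f x))" by (rule continuous_on_subset[OF cont]) auto
    have inj': "inj_on f {x\<in>U. f x \<noteq> p}" using inj by (rule inj_on_subset) auto
    show ?thesis
    proof (cases "p = None")
      case True
      then show ?thesis using op cont' inj' by (intro openin_image_finite) auto
    next
      case False
      then have p: "p = Some 0" using p0 by auto
      let ?h = "\<lambda>x. option_inversion (f x)"
      let ?i = "\<lambda>z :: 'a \<times> real. (fst z, 1 - snd z)"
      let ?H = "(\<lambda>x. sproj (?h x)) ` {x\<in>U. f x \<noteq> p}"
      have "openin (top_of_set (range sproj)) ?H"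
      proof (rule openin_image_finite[OF op])
        show "continuous_on {x\<in>U. f x \<noteq> p} (\<lambda>x. sproj (?h x))"
          unfolding sproj_option_inversion by (intro continuous_intros cont')
        show "inj_on ?h {x\<in>U. f x \<noteq> p}" using inj' inj_option_inversion by (auto simp: inj_on_def)
        show "?h x \<noteq> None" if "x \<in> {x\<in>U. f x \<noteq> p}" for x
          using that p by (auto simp: option_inversion_def split: option.splits)
      qed
      then have "openin (top_of_set (range sproj)) (range sproj \<inter> ?i -` ?H)"
      proof (rule continuous_openin_preimage[rotated 2])
        show "continuous_on (range sproj) ?i" by (intro continuous_intros)
        show "?i \<in> range sproj \<rightarrow> range sproj"
        proof (intro Pi_I)
          fix z :: "'a \<times> real" assume "z \<in> range sproj"
          then obtain p where "z = sproj p" by (rule rangeE)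
          then show "?i z \<in> range sproj" using sproj_option_inversion[of p] by (metis rangeI)
        qed
      qed
      moreover have "range sproj \<inter> ?i -` ?H = (\<lambda>x. sproj (f x)) ` {x\<in>U. f x \<noteq> p}"
      proof -
        have "?i z \<in> ?H \<longleftrightarrow> z \<in> (\<lambda>x. sproj (f x)) ` {x\<in>U. f x \<noteq> p}" for z
          unfolding sproj_option_inversion by (auto simp: prod_eq_iff image_iff)
        then show ?thesis by auto
      qed
      ultimately show ?thesis by simp
    qed
  qed
  have "(\<lambda>x. sproj (f x)) ` U = (\<lambda>x. sproj (f x)) ` {x\<in>U. f x \<noteq> None} \<union> (\<lambda>x. sproj (f x)) ` {x\<in>U. f x \<noteq> Some 0}"
    by auto
  then show ?thesis using sub[of None] sub[of "Some 0"] by (simp add: openin_Un)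
qed

lemma frakA_sphere_embedding:
  assumes "open D" "f \<in> frakA \<delta> r A Q D"
  shows "sphere_embedding D f"
proof
  have hm: "homeomorphic_map (top_of_set D) (subtopology chordal_top (f ` D)) f"
    using assms(2) by (simp add: frakA_def)
  then have "continuous_map (top_of_set D) chordal_top f"
    using homeomorphic_imp_continuous_map continuous_map_in_subtopology by blast
  then have "continuous_map (top_of_set D) (top_of_set (range sproj)) (sproj \<circ> f)"
    using homeomorphic_imp_continuous_map[OF homeomorphic_map_sproj] by (rule continuous_map_compose)
  then show c: "continuous_on D (\<lambda>x. sproj (f x))"
    by (simp add: continuous_map_in_subtopology comp_def)
  show i: "inj_on f D" using homeomorphic_imp_injective_map[OF hm] by simp
  show "openin (top_of_set (range sproj)) ((\<lambda>x. sproj (f x)) ` U)" if "open U" "U \<subseteq> D" for U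
    using that c i by (intro openin_image_sproj) (auto intro: continuous_on_subset inj_on_subset)
qed (use assms in auto)

text \<open>Since f(D) is open, its frontier is the closure minus the image, and the component of
  the frontier through \<open>e\<close> has chordal diameter at least \<open>r\<close> by definition
  of the class. Half of \<open>r\<close> is realised by two points.\<close>

lemma frakA_frontier_continuum:
  assumes D: "open D" and f: "f \<in> frakA \<delta> r A Q D" and r: "0 < r"
    and e: "e \<in> closure ((\<lambda>x. sproj (f x)) ` D) - (\<lambda>x. sproj (f x)) ` D"
  obtains E where "connected E" "e \<in> E" "E \<subseteq> closure ((\<lambda>x. sproj (f x)) ` D) - (\<lambda>x. sproj (f x)) ` D"
    "\<exists>p\<in>E. \<exists>q\<in>E. r / 2 \<le> dist p q"
proof -
  interpret sphere_embedding D f by (rule frakA_sphere_embedding[OF D f])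
  define X where "X = chordal_top frontier_of (f ` D)"
  have "sproj ` X = top_of_set (range sproj) frontier_of (sproj ` f ` D)"
    unfolding X_def by (rule homeomorphic_map_frontier_of[OF homeomorphic_map_sproj, symmetric]) (simp add: topspace_chordal_top)
  also have "\<dots> = closure (F ` D) - F ` D"
  proof -
    have "closure (F ` D) \<subseteq> range sproj"
      by (rule closure_minimal) (auto intro: compact_imp_closed compact_range_sproj)
    then have "top_of_set (range sproj) closure_of (F ` D) = closure (F ` D)"
      by (simp add: closure_of_subtopology Int_absorb1 image_subset_iff)
    moreover have "top_of_set (range sproj) interior_of (F ` D) = F ` D"
      using open_map[OF open_D] by (simp add: interior_of_openin)
    ultimately show ?thesis by (simp add: frontier_of_def image_image)
  qed
  finally have X: "sproj ` X = closure (F ` D) - F ` D" .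
  obtain q where q: "q \<in> X" "e = sproj q" using e X by blast
  define E where "E = connected_component_of_set (subtopology chordal_top X) q"
  have "E \<in> connected_components_of (subtopology chordal_top X)"
    unfolding E_def connected_components_of_def using q by (auto simp: topspace_chordal_top)
  then have "r \<le> chordal_diam E" using f by (simp add: frakA_def X_def)
  then obtain p p' where p: "p \<in> E" "p' \<in> E" "r / 2 \<le> chordal p p'" using chordal_diam_half_attained r by blast
  have cE: "connectedin (subtopology chordal_top X) E" unfolding E_def by (rule connectedin_connected_component_of)
  then have EX: "E \<subseteq> X" by (auto simp: connectedin_subtopology)
  have "connectedin (top_of_set (range sproj)) (sproj ` E)"
    using homeomorphic_imp_continuous_map[OF homeomorphic_map_sproj] cE
    by (intro connectedin_continuous_map_image) (auto simp: connectedin_subtopology)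
  then have "connected (sproj ` E)" by (simp add: connectedin_subtopology connectedin_iff_connected)
  moreover have "e \<in> sproj ` E"
    using q unfolding E_def by (intro image_eqI[of _ _ q]) (auto simp: connected_component_of_refl topspace_chordal_top)
  moreover have "sproj ` E \<subseteq> closure (F ` D) - F ` D" using EX X by blast
  moreover have "\<exists>a\<in>sproj ` E. \<exists>b\<in>sproj ` E. r / 2 \<le> dist a b" using p by (auto simp: chordal_eq_dist)
  ultimately show ?thesis by (rule that)
qed

lemma frakA_diam:
  assumes f: "f \<in> frakA \<delta> r A Q D" and "0 < \<delta>"
  shows "\<exists>a\<in>A. \<exists>b\<in>A. \<delta> / 2 \<le> dist (sproj (f a)) (sproj (f b))"
proof -
  have "\<delta> \<le> chordal_diam (f ` A)" using f by (simp add: frakA_def)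
  from chordal_diam_half_attained[OF this assms(2)] show ?thesis by (simp add: chordal_eq_dist)
qed

section \<open>Hausdorff measure\<close>

text \<open>Caratheodory's criterion for metric outer measures. The points of \<open>A\<close> whose
  distance from \<open>C\<close> is between 1/(k+2) and 1/(k+1) form layer k. Layers of equal parity
  are at positive distance from each other, so the sums over them are bounded by \<open>f A\<close>;
  the series of all layers converges and its tail controls what \<open>B m\<close> misses of
  \<open>A - C\<close>.\<close>

lemma metric_outer_measure_closed:
  fixes f :: "'a::metric_space set \<Rightarrow> ennreal"
  assumes oms: "outer_measure_space (Pow UNIV) f"
    and sep: "\<And>A B e. 0 < e \<Longrightarrow> (\<And>x y. x \<in> A \<Longrightarrow> y \<in> B \<Longrightarrow> e \<le> dist x y) \<Longrightarrow> f A + f B \<le> f (A \<union> B)"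
    and closed: "closed C"
  shows "C \<in> lambda_system UNIV (Pow UNIV) f"
proof -
  have pos: "f {} = 0" and incr: "\<And>A B. A \<subseteq> B \<Longrightarrow> f A \<le> f B"
    using oms by (auto simp: outer_measure_space_def positive_def increasing_def)
  have csub: "f (\<Union>i. A i) \<le> (\<Sum>i. f (A i))" for A :: "nat \<Rightarrow> 'a set"
  proof -
    have A: "range (disjointed A) \<subseteq> Pow UNIV" "disjoint_family (disjointed A)" by (auto simp: disjoint_family_disjointed)
    have "f (\<Union>i. disjointed A i) \<le> (\<Sum>i. f (disjointed A i))"
      using oms A by (auto simp: outer_measure_space_def countably_subadditive_def)
    also have "\<dots> \<le> (\<Sum>i. f (A i))" by (intro suminf_le incr disjointed_subset summableI)
    finally show ?thesis by (simp add: UN_disjointed_eq)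
  qed
  have sub2: "f (A \<union> B) \<le> f A + f B" for A B
  proof -
    have "f (\<Union>i. binaryset A B i) \<le> (\<Sum>i. f (binaryset A B i))" by (rule csub)
    then show ?thesis by (simp add: UN_binaryset_eq suminf_binaryset_eq pos)
  qed
  have main: "f (A \<inter> C) + f (A - C) \<le> f A" for A
  proof (cases "C = {} \<or> f A = top")
    case True
    then show ?thesis using pos by auto
  next
    case False
    then have C: "C \<noteq> {}" and fin: "f A < top" by (auto simp: less_top)
    define B where "B = (\<lambda>k::nat. {x\<in>A. 1 / (real k + 1) \<le> infdist x C})"
    define R where "R = (\<lambda>k. B (Suc k) - B k)"
    have B_mono: "B k \<subseteq> B j" if "k \<le> j" for k j
    proof -
      have "1 / (real j + 1) \<le> 1 / (real k + 1)" using that by (intro divide_left_mono) auto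
      then show ?thesis unfolding B_def by force
    qed
    have sepR: "f (R (Suc k)) + f S \<le> f (R (Suc k) \<union> S)" if S: "S \<subseteq> B k" for k S
    proof (rule sep[of "1 / (real k + 1) - 1 / (real k + 2)"])
      have "1 / (real k + 2) < 1 / (real k + 1)" by (intro divide_strict_left_mono) auto
      then show "0 < 1 / (real k + 1) - 1 / (real k + 2)" by simp
      fix x y assume x: "x \<in> R (Suc k)" and y: "y \<in> S"
      have "infdist x C < 1 / (real k + 2)" using x by (auto simp: R_def B_def add.commute)
      moreover have "1 / (real k + 1) \<le> infdist y C" using y S by (auto simp: B_def)
      moreover have "infdist y C \<le> infdist x C + dist y x" by (rule infdist_triangle)
      ultimately show "1 / (real k + 1) - 1 / (real k + 2) \<le> dist x y" by (simp add: dist_commute)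
    qed
    \<comment> \<open>Even and odd layers (\<open>c = 0\<close> and \<open>c = 1\<close>) are summed
      separately: neighbouring layers may touch, layers two apart do not.\<close>
    have par: "(\<Sum>j<N. f (R (2 * j + c))) \<le> f A" for N c
    proof -
      have RA: "R k \<subseteq> A" "R k \<subseteq> B (Suc k)" for k by (auto simp: R_def B_def)
      have "(\<Sum>j<N. f (R (2 * j + c))) \<le> f (\<Union>j<N. R (2 * j + c))"
      proof (induction N)
        case 0
        then show ?case by simp
      next
        case (Suc N)
        show ?case
        proof (cases "2 * N + c = 0")
          case True
          then show ?thesis by (simp add: lessThan_Suc)
        next
          case False
          then obtain k where k: "2 * N + c = Suc k" using not0_implies_Suc by blast
          have S: "(\<Union>j<N. R (2 * j + c)) \<subseteq> B k"
          proof (rule UN_least)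
            fix j assume "j \<in> {..<N}"
            then have "Suc (2 * j + c) \<le> k" using k by auto
            then show "R (2 * j + c) \<subseteq> B k" using RA(2) B_mono by blast
          qed
          have "(\<Sum>j<Suc N. f (R (2 * j + c))) \<le> f (R (Suc k)) + f (\<Union>j<N. R (2 * j + c))"
            using Suc k by (simp add: add.commute add_left_mono)
          also have "\<dots> \<le> f (R (Suc k) \<union> (\<Union>j<N. R (2 * j + c)))" by (rule sepR[OF S])
          also have "R (Suc k) \<union> (\<Union>j<N. R (2 * j + c)) = (\<Union>j<Suc N. R (2 * j + c))"
            using k by (simp add: lessThan_Suc)
          finally show ?thesis .
        qed
      qed
      also have "\<dots> \<le> f A" using RA by (intro incr) auto
      finally show ?thesis .
    qed
    have double: "(\<Sum>j<2 * N. h j) = (\<Sum>j<N. h (2 * j)) + (\<Sum>j<N. h (2 * j + 1))" for h :: "nat \<Rightarrow> ennreal" and N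
      by (induction N) (simp_all add: ac_simps)
    have "(\<Sum>j<N. f (R j)) \<le> f A + f A" for N
    proof -
      have "(\<Sum>j<N. f (R j)) \<le> (\<Sum>j<2 * N. f (R j))" by (intro sum_mono2) auto
      also have "\<dots> \<le> f A + f A" unfolding double using par[where c = 0] par[where c = 1] by (intro add_mono) auto
      finally show ?thesis .
    qed
    then have "(\<Sum>j. f (R j)) \<le> f A + f A" by (intro suminf_le_const summableI)
    then have finR: "(\<Sum>j. f (R j)) < top" using fin by (meson ennreal_add_less_top le_less_trans)
    have fR: "f (R j) = ennreal (enn2real (f (R j)))" for j
    proof -
      have "f (R j) \<le> f A" by (intro incr) (auto simp: R_def B_def)
      then show ?thesis using fin by (simp add: le_less_trans)
    qed
    have sumR: "summable (\<lambda>j. enn2real (f (R j)))"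
      using finR by (subst (asm) fR) (intro summable_suminf_not_top, auto simp: less_top[symmetric])
    show ?thesis
    proof (rule ennreal_le_epsilon)
      fix e :: real assume e: "0 < e"
      obtain m where m: "norm (\<Sum>j. enn2real (f (R (j + m)))) < e"
        using suminf_exist_split[OF e sumR] by blast
      have tail: "(\<Sum>j. f (R (j + m))) \<le> ennreal e"
      proof -
        have "(\<Sum>j. f (R (j + m))) = (\<Sum>j. ennreal (enn2real (f (R (j + m)))))" by (subst fR) simp
        also have "\<dots> = ennreal (\<Sum>j. enn2real (f (R (j + m))))"
          using sumR summable_iff_shift[of "\<lambda>j. enn2real (f (R j))" m] by (intro suminf_ennreal2) auto
        also have "\<dots> \<le> ennreal e" using m by (intro ennreal_leI) auto
        finally show ?thesis .
      qed
      have cover: "A - C \<subseteq> B m \<union> (\<Union>j. R (j + m))"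
      proof
        fix x assume x: "x \<in> A - C"
        then have "0 < infdist x C" using closed C by (simp add: infdist_pos_not_in_closed)
        then obtain k where "1 / (real k + 1) < infdist x C"
          by (metis nat_approx_posE of_nat_Suc add.commute)
        then have xk: "x \<in> B k" using x by (simp add: B_def)
        show "x \<in> B m \<union> (\<Union>j. R (j + m))"
        proof (cases "x \<in> B m")
          case False
          define l where "l = (LEAST l. x \<in> B (l + m))"
          have "x \<in> B (k + m)" using xk B_mono[of k "k + m"] by auto
          then have l: "x \<in> B (l + m)" unfolding l_def by (rule LeastI)
          then have "l \<noteq> 0" using False by (metis add_0)
          then obtain j where j: "l = Suc j" using not0_implies_Suc by blast
          have "x \<notin> B (j + m)" using not_less_Least[of j "\<lambda>l. x \<in> B (l + m)"] j by (simp add: l_def)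
          then have "x \<in> R (j + m)" using l j by (simp add: R_def)
          then show ?thesis by blast
        qed simp
      qed
      have "f (A - C) \<le> f (B m) + f (\<Union>j. R (j + m))"
        using incr[OF cover] sub2 by (rule order_trans)
      also have "\<dots> \<le> f (B m) + (\<Sum>j. f (R (j + m)))" by (intro add_left_mono csub)
      also have "\<dots> \<le> f (B m) + ennreal e" by (intro add_left_mono tail)
      finally have 1: "f (A - C) \<le> f (B m) + ennreal e" .
      have "f (A \<inter> C) + f (B m) \<le> f (A \<inter> C \<union> B m)"
      proof (rule sep[of "1 / (real m + 1)"])
        fix x y assume "x \<in> A \<inter> C" "y \<in> B m"
        then have "1 / (real m + 1) \<le> infdist y C" "infdist y C \<le> dist y x" by (auto simp: B_def intro: infdist_le)
        then show "1 / (real m + 1) \<le> dist x y" by (simp add: dist_commute)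
      qed simp
      also have "\<dots> \<le> f A" by (intro incr) (auto simp: B_def)
      finally have "f (A \<inter> C) + f (B m) \<le> f A" .
      then have "f (A \<inter> C) + f (B m) + ennreal e \<le> f A + ennreal e" by (rule add_right_mono)
      moreover have "f (A \<inter> C) + f (A - C) \<le> f (A \<inter> C) + (f (B m) + ennreal e)" using 1 by (rule add_left_mono)
      ultimately show "f (A \<inter> C) + f (A - C) \<le> f A + ennreal e"
        unfolding add.assoc by (rule order_trans[rotated])
    qed
  qed
  show ?thesis unfolding lambda_system_def
  proof (intro CollectI conjI ballI)
    fix A
    have "f A \<le> f (C \<inter> A) + f ((UNIV - C) \<inter> A)"
    proof -
      have "A = C \<inter> A \<union> (UNIV - C) \<inter> A" by blast
      then show ?thesis using sub2[of "C \<inter> A" "(UNIV - C) \<inter> A"] by simp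
    qed
    moreover have "f (C \<inter> A) + f ((UNIV - C) \<inter> A) \<le> f A"
    proof -
      have "C \<inter> A = A \<inter> C" "(UNIV - C) \<inter> A = A - C" by blast+
      then show ?thesis using main[of A] by simp
    qed
    ultimately show "f (C \<inter> A) + f ((UNIV - C) \<inter> A) = f A" by (rule antisym[rotated])
  qed simp
qed

lemma hausdorff_pre_le:
  assumes "A \<subseteq> (\<Union>i. U i)" "\<And>i. bounded (U i)" "\<And>i. diameter (U i) \<le> \<delta>"
  shows "hausdorff_pre s \<delta> A \<le> (\<Sum>i. ennreal (diameter (U i) ^ s))"
  unfolding hausdorff_pre_def by (rule INF_lower) (use assms in auto)

lemma hausdorff_pre_mono: "A \<subseteq> B \<Longrightarrow> \<epsilon> \<le> \<delta> \<Longrightarrow> hausdorff_pre s \<delta> A \<le> hausdorff_pre s \<epsilon> B"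
  unfolding hausdorff_pre_def by (rule INF_superset_mono) (auto intro: order_trans)

lemma hausdorff_pre_le_outer: "0 < \<delta> \<Longrightarrow> hausdorff_pre s \<delta> A \<le> hausdorff_outer s A"
  unfolding hausdorff_outer_def by (rule SUP_upper) simp

lemma hausdorff_pre_empty: "0 < s \<Longrightarrow> 0 \<le> \<delta> \<Longrightarrow> hausdorff_pre s \<delta> {} = 0"
  using hausdorff_pre_le[of "{}" "\<lambda>_. {}" \<delta> s] by (simp add: diameter_empty power_0_left)

text \<open>Covers with errors \<open>e * (1 / 2) ^ Suc i\<close> are merged into a single sequence
  through the pairing \<open>prod_decode\<close>.\<close>

lemma hausdorff_pre_UN:
  assumes \<delta>: "0 < \<delta>"
  shows "hausdorff_pre s \<delta> (\<Union>i::nat. A i) \<le> (\<Sum>i. hausdorff_pre s \<delta> (A i))"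
proof (cases "(\<Sum>i. hausdorff_pre s \<delta> (A i)) = top")
  case False
  show ?thesis
  proof (rule ennreal_le_epsilon)
    fix e :: real assume e: "0 < e"
    have fin: "hausdorff_pre s \<delta> (A i) < top" for i
    proof -
      have "hausdorff_pre s \<delta> (A i) = (\<Sum>i\<in>{i}. hausdorff_pre s \<delta> (A i))" by simp
      also have "\<dots> \<le> (\<Sum>i. hausdorff_pre s \<delta> (A i))" by (intro sum_le_suminf summableI) auto
      finally show ?thesis using False by (auto simp: less_top[symmetric] top_unique)
    qed
    have "\<exists>U. A i \<subseteq> (\<Union>j. U j) \<and> (\<forall>j. bounded (U j) \<and> diameter (U j) \<le> \<delta>) \<and>
        (\<Sum>j. ennreal (diameter (U j :: 'a set) ^ s)) \<le> hausdorff_pre s \<delta> (A i) + ennreal (e * (1 / 2) ^ Suc i)" for i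
    proof -
      have "hausdorff_pre s \<delta> (A i) < hausdorff_pre s \<delta> (A i) + ennreal (e * (1 / 2) ^ Suc i)"
        using fin[of i] e by simp
      then show ?thesis
        unfolding hausdorff_pre_def[of s \<delta> "A i"] INF_less_iff by (auto intro: less_imp_le)
    qed
    then obtain U where U: "\<And>i. A i \<subseteq> (\<Union>j. U i j)" "\<And>i j. bounded (U i j) \<and> diameter (U i j) \<le> \<delta>"
      "\<And>i. (\<Sum>j. ennreal (diameter (U i j :: 'a set) ^ s)) \<le> hausdorff_pre s \<delta> (A i) + ennreal (e * (1 / 2) ^ Suc i)"
      by metis
    define V where "V = (\<lambda>k. case_prod U (prod_decode k))"
    have "hausdorff_pre s \<delta> (\<Union>i. A i) \<le> (\<Sum>k. ennreal (diameter (V k) ^ s))"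
    proof (rule hausdorff_pre_le)
      show "(\<Union>i. A i) \<subseteq> (\<Union>k. V k)"
      proof
        fix x assume "x \<in> (\<Union>i. A i)"
        then obtain i j where "x \<in> U i j" using U(1) by blast
        then show "x \<in> (\<Union>k. V k)" by (intro UN_I[of "prod_encode (i, j)"]) (auto simp: V_def)
      qed
    qed (use U(2) in \<open>auto simp: V_def split: prod.split\<close>)
    also have "\<dots> = (\<Sum>k. (\<lambda>(i, j). ennreal (diameter (U i j) ^ s)) (prod_decode k))"
      by (intro suminf_cong) (auto simp: V_def split: prod.split)
    also have "\<dots> = (\<Sum>i. \<Sum>j. ennreal (diameter (U i j) ^ s))"
      by (rule suminf_ennreal_2dimen) simp
    also have "\<dots> \<le> (\<Sum>i. hausdorff_pre s \<delta> (A i) + ennreal (e * (1 / 2) ^ Suc i))"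
      by (intro suminf_le U(3) summableI)
    also have "\<dots> = (\<Sum>i. hausdorff_pre s \<delta> (A i)) + (\<Sum>i. ennreal (e * (1 / 2) ^ Suc i))"
      by (intro suminf_add[symmetric] summableI)
    also have "(\<Sum>i. ennreal (e * (1 / 2) ^ Suc i)) = ennreal e"
      using e sums_mult[OF power_half_series, of e] by (intro suminf_ennreal_eq) auto
    finally show "hausdorff_pre s \<delta> (\<Union>i. A i) \<le> (\<Sum>i. hausdorff_pre s \<delta> (A i)) + ennreal e" .
  qed
qed simp

text \<open>A covering set of diameter below \<open>e\<close> cannot meet both \<open>A\<close> and
  \<open>B\<close>, so a cover of the union splits into covers of the parts. Vacant places are
  filled with the empty set, which contributes nothing since \<open>s\<close> is positive.\<close>

lemma hausdorff_pre_separated: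
  assumes s: "0 < s" and \<delta>: "0 \<le> \<delta>" "\<delta> < e" and sep: "\<And>x y. x \<in> A \<Longrightarrow> y \<in> B \<Longrightarrow> e \<le> dist x y"
  shows "hausdorff_pre s \<delta> A + hausdorff_pre s \<delta> B \<le> hausdorff_pre s \<delta> (A \<union> B)"
  unfolding hausdorff_pre_def[of s \<delta> "A \<union> B"]
proof (rule INF_greatest, clarsimp)
  fix U :: "nat \<Rightarrow> 'a set"
  assume cov: "A \<subseteq> (\<Union>i. U i)" "B \<subseteq> (\<Union>i. U i)" and U: "\<forall>i. bounded (U i) \<and> diameter (U i) \<le> \<delta>"
  define UA where "UA = (\<lambda>i. if U i \<inter> A = {} then {} else U i)"
  define UB where "UB = (\<lambda>i. if U i \<inter> A = {} then U i else {})"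
  have noB: "U i \<inter> B = {}" if UA: "U i \<inter> A \<noteq> {}" for i
  proof (rule ccontr)
    assume "U i \<inter> B \<noteq> {}"
    then obtain x y where xy: "x \<in> U i" "x \<in> A" "y \<in> U i" "y \<in> B" using UA by blast
    then have "dist x y \<le> diameter (U i)" using U diameter_bounded_bound by blast
    then show False using sep[of x y] xy U \<delta> by (metis leD le_less_trans order_trans)
  qed
  have "hausdorff_pre s \<delta> A \<le> (\<Sum>i. ennreal (diameter (UA i) ^ s))"
  proof (rule hausdorff_pre_le)
    show "A \<subseteq> (\<Union>i. UA i)"
    proof
      fix x assume "x \<in> A"
      moreover then obtain i where "x \<in> U i" using cov(1) by blast
      ultimately show "x \<in> (\<Union>i. UA i)" by (intro UN_I[of i]) (auto simp: UA_def)
    qed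
  qed (use U \<delta> in \<open>simp_all add: UA_def diameter_empty\<close>)
  moreover have "hausdorff_pre s \<delta> B \<le> (\<Sum>i. ennreal (diameter (UB i) ^ s))"
  proof (rule hausdorff_pre_le)
    show "B \<subseteq> (\<Union>i. UB i)"
    proof
      fix x assume "x \<in> B"
      moreover then obtain i where "x \<in> U i" using cov(2) by blast
      ultimately show "x \<in> (\<Union>i. UB i)" using noB[of i] by (intro UN_I[of i]) (auto simp: UB_def)
    qed
  qed (use U \<delta> in \<open>simp_all add: UB_def diameter_empty\<close>)
  ultimately have "hausdorff_pre s \<delta> A + hausdorff_pre s \<delta> B
     \<le> (\<Sum>i. ennreal (diameter (UA i) ^ s)) + (\<Sum>i. ennreal (diameter (UB i) ^ s))" by (rule add_mono)
  also have "\<dots> = (\<Sum>i. ennreal (diameter (UA i) ^ s) + ennreal (diameter (UB i) ^ s))"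
    by (intro suminf_add summableI)
  also have "\<dots> = (\<Sum>i. ennreal (diameter (U i) ^ s))"
    using s by (intro suminf_cong) (auto simp: UA_def UB_def diameter_empty power_0_left)
  finally show "hausdorff_pre s \<delta> A + hausdorff_pre s \<delta> B \<le> (\<Sum>i. ennreal (diameter (U i) ^ s))" .
qed

lemma outer_measure_space_hausdorff:
  assumes "0 < s"
  shows "outer_measure_space (Pow UNIV) (hausdorff_outer s)"
  unfolding outer_measure_space_def positive_def increasing_def countably_subadditive_def
proof (intro conjI ballI impI allI)
  show "hausdorff_outer s {} = 0"
    unfolding hausdorff_outer_def using assms by (simp add: hausdorff_pre_empty cong: SUP_cong_simp)
  show "hausdorff_outer s A \<le> hausdorff_outer s B" if "A \<subseteq> B" for A B :: "'a set"
    unfolding hausdorff_outer_def using that by (intro SUP_mono' hausdorff_pre_mono) auto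
  fix A :: "nat \<Rightarrow> 'a set"
  show "hausdorff_outer s (\<Union>i. A i) \<le> (\<Sum>i. hausdorff_outer s (A i))"
    unfolding hausdorff_outer_def[of s "\<Union>i. A i"]
  proof (rule SUP_least)
    fix \<delta> :: real assume "\<delta> \<in> {0<..}"
    then have "hausdorff_pre s \<delta> (\<Union>i. A i) \<le> (\<Sum>i. hausdorff_pre s \<delta> (A i))" by (intro hausdorff_pre_UN) auto
    also have "\<dots> \<le> (\<Sum>i. hausdorff_outer s (A i))"
      using \<open>\<delta> \<in> {0<..}\<close> by (intro suminf_le hausdorff_pre_le_outer summableI) auto
    finally show "hausdorff_pre s \<delta> (\<Union>i. A i) \<le> (\<Sum>i. hausdorff_outer s (A i))" .
  qed
qed

text \<open>The two scales are lowered to a common one below the distance \<open>e\<close>, and the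
  suprema are then taken one after the other.\<close>

lemma hausdorff_outer_separated:
  assumes s: "0 < s" and e: "0 < e" and sep: "\<And>x y. x \<in> A \<Longrightarrow> y \<in> B \<Longrightarrow> e \<le> dist x y"
  shows "hausdorff_outer s A + hausdorff_outer s B \<le> hausdorff_outer s (A \<union> B)"
proof -
  have le: "hausdorff_pre s \<delta> A + hausdorff_pre s \<epsilon> B \<le> hausdorff_outer s (A \<union> B)" if "0 < \<delta>" "0 < \<epsilon>" for \<delta> \<epsilon>
  proof -
    define d where "d = min (min \<delta> \<epsilon>) (e / 2)"
    have d: "0 < d" "d \<le> \<delta>" "d \<le> \<epsilon>" "d < e" using that e by (auto simp: d_def)
    have "hausdorff_pre s \<delta> A + hausdorff_pre s \<epsilon> B \<le> hausdorff_pre s d A + hausdorff_pre s d B"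
      using d by (intro add_mono hausdorff_pre_mono) auto
    also have "\<dots> \<le> hausdorff_pre s d (A \<union> B)"
      using d s sep by (intro hausdorff_pre_separated) auto
    also have "\<dots> \<le> hausdorff_outer s (A \<union> B)" using d by (intro hausdorff_pre_le_outer)
    finally show ?thesis .
  qed
  have "hausdorff_outer s A + hausdorff_outer s B = (SUP \<delta>\<in>{0<..}. hausdorff_pre s \<delta> A + hausdorff_outer s B)"
    unfolding hausdorff_outer_def[of s A] by (intro ennreal_SUP_add_left[symmetric]) auto
  also have "\<dots> \<le> hausdorff_outer s (A \<union> B)"
  proof (rule SUP_least)
    fix \<delta> :: real assume \<delta>: "\<delta> \<in> {0<..}"
    have "hausdorff_pre s \<delta> A + hausdorff_outer s B = (SUP \<epsilon>\<in>{0<..}. hausdorff_pre s \<epsilon> B + hausdorff_pre s \<delta> A)"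
      unfolding hausdorff_outer_def[of s B] by (subst ennreal_SUP_add_left) (auto simp: add.commute)
    also have "\<dots> \<le> hausdorff_outer s (A \<union> B)"
    proof (rule SUP_least)
      fix \<epsilon> :: real assume "\<epsilon> \<in> {0<..}"
      then show "hausdorff_pre s \<epsilon> B + hausdorff_pre s \<delta> A \<le> hausdorff_outer s (A \<union> B)"
        using \<delta> le[of \<delta> \<epsilon>] by (simp add: add.commute)
    qed
    finally show "hausdorff_pre s \<delta> A + hausdorff_outer s B \<le> hausdorff_outer s (A \<union> B)" .
  qed
  finally show ?thesis .
qed

lemma sets_hausdorff_measure[simp, measurable_cong]: "sets (hausdorff_measure s) = sets borel"
  unfolding hausdorff_measure_def by (simp add: sets.sigma_sets_eq[of borel, simplified])

text \<open>A measure introduced by \<open>measure_of\<close> has the prescribed values only if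
  these are countably additive on the sigma-algebra. Caratheodory's lemma provides this on the sets
  measurable for the outer measure; these contain the closed sets by the metric criterion, hence all
  Borel sets.\<close>

lemma emeasure_hausdorff_measure:
  fixes A :: "'a::euclidean_space set"
  assumes s: "0 < s" and A: "A \<in> sets borel"
  shows "emeasure (hausdorff_measure s) A = hausdorff_outer s A"
proof -
  let ?L = "lambda_system UNIV (Pow UNIV) (hausdorff_outer s) :: 'a set set"
  interpret P: sigma_algebra "UNIV :: 'a set" "Pow UNIV" by (rule sigma_algebra_Pow)
  have ms: "measure_space UNIV ?L (hausdorff_outer s)"
    by (rule P.caratheodory_lemma[OF outer_measure_space_hausdorff[OF s]])
  then interpret L: sigma_algebra UNIV ?L by (simp add: measure_space_def)
  have closed: "C \<in> ?L" if "closed C" for C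
    using that by (intro metric_outer_measure_closed outer_measure_space_hausdorff hausdorff_outer_separated s) auto
  have "sigma_sets UNIV (Collect closed) \<subseteq> ?L"
    by (rule L.sigma_sets_subset) (use closed in blast)
  then have sub: "sets borel \<subseteq> ?L" by (simp add: borel_eq_closed)
  show ?thesis
  proof (rule emeasure_measure_of[OF hausdorff_measure_def])
    show "positive (sets (hausdorff_measure s :: 'a measure)) (hausdorff_outer s)"
      using outer_measure_space_hausdorff[OF s] by (auto simp: positive_def outer_measure_space_def)
    show "countably_additive (sets (hausdorff_measure s :: 'a measure)) (hausdorff_outer s)"
    proof (rule countably_additiveI)
      fix A :: "nat \<Rightarrow> 'a set"
      assume A: "range A \<subseteq> sets (hausdorff_measure s)" "disjoint_family A"
      then have U: "(\<Union>i. A i) \<in> sets (hausdorff_measure s)" by auto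
      have "range A \<subseteq> ?L" using A(1) sub unfolding sets_hausdorff_measure by (rule order_trans)
      moreover have "(\<Union>i. A i) \<in> ?L" using sub U unfolding sets_hausdorff_measure by (rule subsetD)
      moreover have "countably_additive ?L (hausdorff_outer s)" using ms by (simp add: measure_space_def)
      ultimately show "(\<Sum>i. hausdorff_outer s (A i)) = hausdorff_outer s (\<Union>i. A i)"
        using A(2) unfolding countably_additive_def by simp
    qed
  qed (use A in auto)
qed

section \<open>Polar coordinates and sphere integrability\<close>

text \<open>The point at distance \<open>t\<close> from \<open>c\<close> in the direction of
  \<open>x\<close>. At \<open>x = 0\<close> the quotient is 0 by convention and the value is
  \<open>c\<close>; this point is a null set and is excluded where it matters.\<close>

definition radial :: "'a::euclidean_space \<Rightarrow> real \<Rightarrow> 'a \<Rightarrow> 'a" where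
  "radial c t x = c + (t / norm x) *\<^sub>R x"

lemma radial_measurable[measurable]:
  assumes [measurable]: "f \<in> borel_measurable M" "g \<in> borel_measurable M"
  shows "(\<lambda>z. radial c (f z) (g z)) \<in> borel_measurable M"
  unfolding radial_def by measurable

lemma dist_radial: "x \<noteq> 0 \<Longrightarrow> 0 \<le> t \<Longrightarrow> dist (radial c t x) c = t"
  by (simp add: radial_def dist_norm)

lemma nn_integral_power_tail:
  assumes "0 < r" "0 < n"
  shows "(\<integral>\<^sup>+s\<in>{r..}. ennreal (real n / s ^ Suc n) \<partial>lborel) = ennreal (1 / r ^ n)"
proof -
  let ?f = "\<lambda>s::real. if r \<le> s then real n / s ^ Suc n else 0"
  have lim: "((\<lambda>s::real. - (1 / s ^ n)) \<longlongrightarrow> - 0) at_top"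
    using assms by (intro tendsto_minus tendsto_divide_0[OF tendsto_const] filterlim_at_top_imp_at_infinity filterlim_pow_at_top filterlim_ident) auto
  have "(\<integral>\<^sup>+s. ennreal (?f s) * indicator {r..} s \<partial>lborel) = - 0 - (- (1 / r ^ n))"
  proof (rule nn_integral_FTC_atLeast[OF _ _ _ lim])
    fix s assume s: "r \<le> s"
    have "((\<lambda>s::real. - (1 / s ^ n)) has_real_derivative real n / s ^ Suc n) (at s)"
    proof -
      have d: "((\<lambda>s::real. - inverse (s ^ n)) has_real_derivative - (- (inverse (s ^ n) * (real n * s ^ (n - 1)) * inverse (s ^ n)))) (at s)"
        using s assms by (auto intro!: derivative_eq_intros)
      have eq: "- (- (inverse (s ^ n) * (real n * s ^ (n - 1)) * inverse (s ^ n))) = real n / s ^ Suc n"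
      proof -
        obtain m where m: "n = Suc m" using assms(2) gr0_conv_Suc by blast
        show ?thesis using s assms unfolding m by (simp add: field_simps)
      qed
      show ?thesis using d unfolding eq by (simp only: inverse_eq_divide)
    qed
    then show "((\<lambda>s::real. - (1 / s ^ n)) has_real_derivative ?f s) (at s)" using s by simp
    show "0 \<le> ?f s" using s assms by auto
  qed measurable
  moreover have "(\<integral>\<^sup>+s. ennreal (?f s) * indicator {r..} s \<partial>lborel) = (\<integral>\<^sup>+s\<in>{r..}. ennreal (real n / s ^ Suc n) \<partial>lborel)"
    by (intro nn_integral_cong) (auto split: split_indicator)
  ultimately show ?thesis by simp
qed

text \<open>Polar coordinates without surface measure: the sphere average is taken over the unit ball, and the formula follows
  from Tonelli's theorem by the substitutions t = s |x| for fixed x and y = s x for fixed s.\<close>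

lemma nn_integral_polar:
  fixes g :: "'a::euclidean_space \<Rightarrow> ennreal"
  assumes g[measurable]: "g \<in> borel_measurable borel"
  shows "(\<integral>\<^sup>+t\<in>{0<..}. ennreal (real DIM('a) * t ^ (DIM('a) - 1)) * (\<integral>\<^sup>+x\<in>ball 0 1. g (radial c t x) \<partial>lborel) \<partial>lborel)
    = (\<integral>\<^sup>+x. g x \<partial>lborel)"
proof -
  have [measurable]: "ball (0 :: 'a) 1 \<in> sets borel" by simp
  define n where "n = DIM('a)"
  have n: "0 < n" by (simp add: n_def)
  obtain m where m: "n = Suc m" using n gr0_conv_Suc by blast
  let ?w = "\<lambda>t::real. ennreal (real n * t ^ (n - 1))"
  have AE0: "AE x in lborel. x \<noteq> (0::'a)" by (rule AE_lborel_singleton)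
  have "(\<integral>\<^sup>+t\<in>{0<..}. ?w t * (\<integral>\<^sup>+x\<in>ball 0 1. g (radial c t x) \<partial>lborel) \<partial>lborel)
    = (\<integral>\<^sup>+t. (\<integral>\<^sup>+x. ?w t * indicator {0<..} t * (g (radial c t x) * indicator (ball 0 1) x) \<partial>lborel) \<partial>lborel)"
  proof (rule nn_integral_cong)
    fix t :: real
    have "(\<lambda>x. g (radial c t x) * indicator (ball 0 1) x) \<in> borel_measurable lborel" by measurable
    from nn_integral_cmult[OF this, of "?w t * indicator {0<..} t"]
    show "?w t * (\<integral>\<^sup>+x\<in>ball 0 1. g (radial c t x) \<partial>lborel) * indicator {0<..} t
      = (\<integral>\<^sup>+x. ?w t * indicator {0<..} t * (g (radial c t x) * indicator (ball 0 1) x) \<partial>lborel)"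
      by (simp only: ac_simps)
  qed
  also have "\<dots> = (\<integral>\<^sup>+x. (\<integral>\<^sup>+t. ?w t * indicator {0<..} t * (g (radial c t x) * indicator (ball 0 1) x) \<partial>lborel) \<partial>lborel)"
    by (intro nn_integral_lborel_swap) (simp add: borel_prod[symmetric])
  also have "\<dots> = (\<integral>\<^sup>+x. (\<integral>\<^sup>+s. ?w s * ennreal (norm x ^ n) * indicator {0<..} s * (g (c + s *\<^sub>R x) * indicator (ball 0 1) x) \<partial>lborel) \<partial>lborel)"
  proof (rule nn_integral_cong_AE)
    show "AE x in lborel. (\<integral>\<^sup>+t. ?w t * indicator {0<..} t * (g (radial c t x) * indicator (ball 0 1) x) \<partial>lborel)
      = (\<integral>\<^sup>+s. ?w s * ennreal (norm x ^ n) * indicator {0<..} s * (g (c + s *\<^sub>R x) * indicator (ball 0 1) x) \<partial>lborel)"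
      using AE0
    proof eventually_elim
      fix x :: 'a assume x: "x \<noteq> 0"
      have "(\<integral>\<^sup>+t. ?w t * indicator {0<..} t * (g (radial c t x) * indicator (ball 0 1) x) \<partial>lborel)
        = ennreal \<bar>norm x\<bar> * (\<integral>\<^sup>+s. ?w (0 + norm x * s) * indicator {0<..} (0 + norm x * s) * (g (radial c (0 + norm x * s) x) * indicator (ball 0 1) x) \<partial>lborel)"
        using x by (intro nn_integral_real_affine) auto
      also have "\<dots> = (\<integral>\<^sup>+s. ennreal (norm x) * (?w (norm x * s) * indicator {0<..} (norm x * s) * (g (radial c (norm x * s) x) * indicator (ball 0 1) x)) \<partial>lborel)"
        by (simp add: nn_integral_cmult)
      also have "\<dots> = (\<integral>\<^sup>+s. ?w s * ennreal (norm x ^ n) * indicator {0<..} s * (g (c + s *\<^sub>R x) * indicator (ball 0 1) x) \<partial>lborel)"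
      proof (rule nn_integral_cong)
        fix s :: real
        show "ennreal (norm x) * (?w (norm x * s) * indicator {0<..} (norm x * s) * (g (radial c (norm x * s) x) * indicator (ball 0 1) x))
          = ?w s * ennreal (norm x ^ n) * indicator {0<..} s * (g (c + s *\<^sub>R x) * indicator (ball 0 1) x)"
        proof (cases "0 < s")
          case True
          have "ennreal (norm x) * ?w (norm x * s) = ennreal (norm x * (real n * (norm x * s) ^ (n - 1)))"
            using True by (intro ennreal_mult[symmetric]) auto
          also have "norm x * (real n * (norm x * s) ^ (n - 1)) = (real n * s ^ (n - 1)) * norm x ^ n"
            unfolding m by (simp add: power_mult_distrib)
          also have "ennreal \<dots> = ?w s * ennreal (norm x ^ n)"
            using True by (intro ennreal_mult) auto
          finally have 1: "ennreal (norm x) * ?w (norm x * s) = ?w s * ennreal (norm x ^ n)" .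
          have 2: "radial c (norm x * s) x = c + s *\<^sub>R x" using x by (simp add: radial_def)
          have 3: "0 < norm x * s" using True x by simp
          have "ennreal (norm x) * (?w (norm x * s) * indicator {0<..} (norm x * s) * (g (radial c (norm x * s) x) * indicator (ball 0 1) x))
            = (ennreal (norm x) * ?w (norm x * s)) * (g (c + s *\<^sub>R x) * indicator (ball 0 1) x)"
            using 3 by (simp add: 2 mult.assoc)
          then show ?thesis unfolding 1 using True by simp
        next
          case False
          then have "\<not> 0 < norm x * s" using x by (simp add: zero_less_mult_iff)
          then show ?thesis using False by simp
        qed
      qed
      finally show "(\<integral>\<^sup>+t. ?w t * indicator {0<..} t * (g (radial c t x) * indicator (ball 0 1) x) \<partial>lborel)
        = (\<integral>\<^sup>+s. ?w s * ennreal (norm x ^ n) * indicator {0<..} s * (g (c + s *\<^sub>R x) * indicator (ball 0 1) x) \<partial>lborel)" .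
    qed
  qed
  also have "\<dots> = (\<integral>\<^sup>+s. (\<integral>\<^sup>+x. ?w s * ennreal (norm x ^ n) * indicator {0<..} s * (g (c + s *\<^sub>R x) * indicator (ball 0 1) x) \<partial>lborel) \<partial>lborel)"
    by (intro nn_integral_lborel_swap) (simp add: borel_prod[symmetric])
  also have "\<dots> = (\<integral>\<^sup>+s. (\<integral>\<^sup>+y. g y * ennreal (norm (y - c) ^ n) * (ennreal (real n / s ^ Suc n) * indicator {norm (y - c)<..} s) \<partial>lborel) \<partial>lborel)"
  proof (rule nn_integral_cong)
    fix s :: real
    show "(\<integral>\<^sup>+x. ?w s * ennreal (norm x ^ n) * indicator {0<..} s * (g (c + s *\<^sub>R x) * indicator (ball 0 1) x) \<partial>lborel)
      = (\<integral>\<^sup>+y. g y * ennreal (norm (y - c) ^ n) * (ennreal (real n / s ^ Suc n) * indicator {norm (y - c)<..} s) \<partial>lborel)"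
    proof (cases "0 < s")
      case False
      then have "indicator {norm (y - c)<..} s = (0::ennreal)" for y
        using norm_ge_zero[of "y - c"] by (auto simp del: norm_ge_zero)
      then show ?thesis using False by simp
    next
      case True
      have ind: "(\<lambda>y. indicator {norm (y - c)<..} s) = (\<lambda>y. if norm (y - c) < s then 1 else 0 :: ennreal)"
        by (auto simp: indicator_def fun_eq_iff)
      have [measurable]: "(\<lambda>y. indicator {norm (y - c)<..} s :: ennreal) \<in> borel_measurable borel"
        unfolding ind by measurable
      let ?h = "\<lambda>y. g y * ennreal (norm (y - c) ^ n) * (ennreal (real n / s ^ Suc n) * indicator {norm (y - c)<..} s)"
      have "(\<integral>\<^sup>+y. ?h y \<partial>lborel) = ennreal (s ^ n) * (ennreal (1 / \<bar>s\<bar> ^ DIM('a)) * (\<integral>\<^sup>+y. ?h y \<partial>lborel))"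
      proof -
        have "ennreal (s ^ n) * ennreal (1 / \<bar>s\<bar> ^ DIM('a)) = 1"
          using True by (subst ennreal_mult[symmetric]) (auto simp: n_def)
        then show ?thesis by (simp add: mult.assoc[symmetric])
      qed
      also have "ennreal (1 / \<bar>s\<bar> ^ DIM('a)) * (\<integral>\<^sup>+y. ?h y \<partial>lborel) = (\<integral>\<^sup>+x. ?h (c + s *\<^sub>R x) \<partial>lborel)"
        using True by (intro nn_integral_lborel_affine[symmetric]) auto
      also have "ennreal (s ^ n) * \<dots> = (\<integral>\<^sup>+x. ennreal (s ^ n) * ?h (c + s *\<^sub>R x) \<partial>lborel)"
      proof (rule nn_integral_cmult[symmetric])
        have "?h \<in> borel_measurable borel" by measurable
        then show "(\<lambda>x. ?h (c + s *\<^sub>R x)) \<in> borel_measurable lborel"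
          by (rule measurable_compose[rotated]) measurable
      qed
      also have "\<dots> = (\<integral>\<^sup>+x. ?w s * ennreal (norm x ^ n) * indicator {0<..} s * (g (c + s *\<^sub>R x) * indicator (ball 0 1) x) \<partial>lborel)"
      proof (rule nn_integral_cong)
        fix x :: 'a
        have i: "indicator {norm (c + s *\<^sub>R x - c)<..} s = (indicator (ball 0 1) x :: ennreal)"
          using True by (simp add: indicator_def)
        have a: "0 \<le> s ^ n" "0 \<le> norm (c + s *\<^sub>R x - c) ^ n" "0 \<le> real n / s ^ Suc n" using True by auto
        have "ennreal (s ^ n) * (ennreal (norm (c + s *\<^sub>R x - c) ^ n) * ennreal (real n / s ^ Suc n))
           = ennreal (s ^ n * (norm (c + s *\<^sub>R x - c) ^ n * (real n / s ^ Suc n)))"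
          by (simp only: ennreal_mult[OF a(1) mult_nonneg_nonneg[OF a(2,3)]] ennreal_mult[OF a(2,3)])
        also have "s ^ n * (norm (c + s *\<^sub>R x - c) ^ n * (real n / s ^ Suc n)) = (real n * s ^ (n - 1)) * norm x ^ n"
          using True unfolding m by (simp add: power_mult_distrib)
        also have "ennreal \<dots> = ?w s * ennreal (norm x ^ n)" using True by (intro ennreal_mult) auto
        finally have e: "ennreal (s ^ n) * (ennreal (norm (c + s *\<^sub>R x - c) ^ n) * ennreal (real n / s ^ Suc n)) = ?w s * ennreal (norm x ^ n)" .
        have "ennreal (s ^ n) * ?h (c + s *\<^sub>R x)
          = (ennreal (s ^ n) * (ennreal (norm (c + s *\<^sub>R x - c) ^ n) * ennreal (real n / s ^ Suc n))) * (g (c + s *\<^sub>R x) * indicator {norm (c + s *\<^sub>R x - c)<..} s)"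
          by (simp only: ac_simps)
        then show "ennreal (s ^ n) * ?h (c + s *\<^sub>R x) = ?w s * ennreal (norm x ^ n) * indicator {0<..} s * (g (c + s *\<^sub>R x) * indicator (ball 0 1) x)"
          unfolding e i using True by simp
      qed
      finally show ?thesis by simp
    qed
  qed
  also have "\<dots> = (\<integral>\<^sup>+y. (\<integral>\<^sup>+s. g y * ennreal (norm (y - c) ^ n) * (ennreal (real n / s ^ Suc n) * indicator {norm (y - c)<..} s) \<partial>lborel) \<partial>lborel)"
  proof (rule nn_integral_lborel_swap)
    have ind: "indicator {norm (y - c)<..} s = (if norm (y - c) < s then 1 else 0 :: ennreal)" for s y
      by (simp add: indicator_def)
    show "(\<lambda>(s, y). g y * ennreal (norm (y - c) ^ n) * (ennreal (real n / s ^ Suc n) * indicator {norm (y - c)<..} s)) \<in> borel_measurable borel"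
      unfolding ind borel_prod[symmetric] by measurable
  qed
  also have "\<dots> = (\<integral>\<^sup>+y. g y \<partial>lborel)"
  proof (rule nn_integral_cong_AE)
    have "AE y in lborel. y \<noteq> c" by (rule AE_lborel_singleton)
    then show "AE y in lborel. (\<integral>\<^sup>+s. g y * ennreal (norm (y - c) ^ n) * (ennreal (real n / s ^ Suc n) * indicator {norm (y - c)<..} s) \<partial>lborel) = g y"
    proof eventually_elim
      \<comment> \<open>The weight accumulated at a point is |y - c|^n times the integral of n /
        s^(n+1) over s > |y - c|, which is exactly 1.\<close>
      fix y :: 'a assume y: "y \<noteq> c"
      have "(\<integral>\<^sup>+s. ennreal (real n / s ^ Suc n) * indicator {norm (y - c)<..} s \<partial>lborel)
        = (\<integral>\<^sup>+s\<in>{norm (y - c)..}. ennreal (real n / s ^ Suc n) \<partial>lborel)"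
      proof (rule nn_integral_cong_AE)
        have "AE s in lborel. s \<noteq> norm (y - c)" by (rule AE_lborel_singleton)
        then show "AE s in lborel. ennreal (real n / s ^ Suc n) * indicator {norm (y - c)<..} s = ennreal (real n / s ^ Suc n) * indicator {norm (y - c)..} s"
          by eventually_elim (auto split: split_indicator)
      qed
      also have "\<dots> = ennreal (1 / norm (y - c) ^ n)" using y n by (intro nn_integral_power_tail) auto
      finally have t: "(\<integral>\<^sup>+s. ennreal (real n / s ^ Suc n) * indicator {norm (y - c)<..} s \<partial>lborel) = ennreal (1 / norm (y - c) ^ n)" .
      have "ennreal (norm (y - c) ^ n) * ennreal (1 / norm (y - c) ^ n) = 1"
        using y by (subst ennreal_mult[symmetric]) auto
      moreover have "(\<integral>\<^sup>+s. g y * ennreal (norm (y - c) ^ n) * (ennreal (real n / s ^ Suc n) * indicator {norm (y - c)<..} s) \<partial>lborel)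
        = g y * ennreal (norm (y - c) ^ n) * ennreal (1 / norm (y - c) ^ n)"
        unfolding t[symmetric] by (rule nn_integral_cmult) measurable
      ultimately show "(\<integral>\<^sup>+s. g y * ennreal (norm (y - c) ^ n) * (ennreal (real n / s ^ Suc n) * indicator {norm (y - c)<..} s) \<partial>lborel) = g y"
        by (simp only: mult.assoc mult_1_right)
    qed
  qed
  finally show ?thesis by (simp add: n_def)
qed

text \<open>For a unit vector \<open>w\<close> it contains the nonzero points of the unit ball whose
  radial projection to the unit sphere is within \<open>e\<close> of \<open>w\<close>.\<close>

definition tube :: "'a::euclidean_space \<Rightarrow> real \<Rightarrow> 'a set" where
  "tube w e = {x. infdist x (closed_segment 0 w) \<le> e}"

lemma tube_measurable[measurable]: "tube w e \<in> sets borel"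
proof -
  have "closed (tube w e)" unfolding tube_def by (intro closed_Collect_le continuous_intros)
  then show ?thesis by simp
qed

text \<open>Cubes of side \<open>4 * e\<close> centred at the points
  \<open>(real j * e) *\<^sub>R w\<close> cover the tube; at most \<open>3 / e\<close> of them are
  used, which costs one power of \<open>e\<close>.\<close>

lemma emeasure_tube_le_pos:
  fixes w :: "'a::euclidean_space"
  assumes w: "norm w = 1" and e: "0 < e" "e \<le> 1"
  shows "emeasure lborel (tube w e) \<le> ennreal (3 * 4 ^ DIM('a) * e ^ (DIM('a) - 1))"
proof -
  define k where "k = nat \<lceil>1 / e\<rceil>"
  have k: "1 / e \<le> real k" "real k \<le> 1 / e + 1"
    using e unfolding k_def by (simp_all add: of_nat_ceiling le_of_int_ceiling ceiling_correct)
  let ?C = "\<lambda>j::nat. cbox ((real j * e) *\<^sub>R w - (2 * e) *\<^sub>R One) ((real j * e) *\<^sub>R w + (2 * e) *\<^sub>R One)"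
  have "tube w e \<subseteq> (\<Union>j\<in>{..k}. ?C j)"
  proof
    fix x assume "x \<in> tube w e"
    then have inf: "infdist x (closed_segment 0 w) \<le> e" by (simp add: tube_def)
    obtain y where y: "y \<in> closed_segment 0 w" "infdist x (closed_segment 0 w) = dist x y"
      using infdist_attains_inf[of "closed_segment 0 w" x] by auto
    obtain s where s: "0 \<le> s" "s \<le> 1" "y = s *\<^sub>R w" using y(1) by (auto simp: in_segment)
    define j where "j = nat \<lfloor>s / e\<rfloor>"
    have j: "real j \<le> s / e" "s / e \<le> real j + 1"
      using s e by (auto simp: j_def)
    have jk: "j \<le> k"
    proof -
      have "s / e \<le> 1 / e" using s e by (intro divide_right_mono) auto
      then have "real j \<le> real k" using j k by linarith
      then show ?thesis by simp
    qed
    have "\<bar>s - real j * e\<bar> \<le> e" using j e by (simp add: field_simps abs_le_iff)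
    then have "norm (y - (real j * e) *\<^sub>R w) \<le> e"
      using w by (simp add: s(3) scaleR_left_diff_distrib[symmetric])
    moreover have "norm (x - y) \<le> e" using inf y by (simp add: dist_norm)
    ultimately have "norm (x - (real j * e) *\<^sub>R w) \<le> 2 * e"
      using norm_triangle_ineq[of "x - y" "y - (real j * e) *\<^sub>R w"] by simp
    then have "\<bar>(x - (real j * e) *\<^sub>R w) \<bullet> b\<bar> \<le> 2 * e" if "b \<in> Basis" for b
      using Basis_le_norm[OF that, of "x - (real j * e) *\<^sub>R w"] by linarith
    then have "x \<in> ?C j"
      by (auto simp: mem_box inner_diff_left inner_add_left abs_le_iff algebra_simps)
    then show "x \<in> (\<Union>j\<in>{..k}. ?C j)" using jk by blast
  qed
  then have "emeasure lborel (tube w e) \<le> emeasure lborel (\<Union>j\<in>{..k}. ?C j)"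
    by (intro emeasure_mono) auto
  also have "\<dots> \<le> (\<Sum>j\<in>{..k}. emeasure lborel (?C j))"
    by (intro emeasure_subadditive_finite) auto
  also have "\<dots> = (\<Sum>j\<in>{..k}. ennreal ((4 * e) ^ DIM('a)))"
  proof (rule sum.cong[OF refl])
    fix j
    have "emeasure lborel (?C j) = ennreal (\<Prod>b\<in>Basis. (((real j * e) *\<^sub>R w + (2 * e) *\<^sub>R One) - ((real j * e) *\<^sub>R w - (2 * e) *\<^sub>R One)) \<bullet> (b :: 'a))"
      using e by (intro emeasure_lborel_cbox) (auto simp: inner_diff_left inner_add_left)
    also have "(\<Prod>b\<in>Basis. (((real j * e) *\<^sub>R w + (2 * e) *\<^sub>R One) - ((real j * e) *\<^sub>R w - (2 * e) *\<^sub>R One)) \<bullet> (b :: 'a)) = (\<Prod>b\<in>(Basis :: 'a set). 4 * e)"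
      by (intro prod.cong refl) (simp add: inner_diff_left inner_add_left)
    finally show "emeasure lborel (?C j) = ennreal ((4 * e) ^ DIM('a))" by simp
  qed
  also have "\<dots> = ennreal ((real k + 1) * (4 * e) ^ DIM('a))"
    using e by (simp add: ennreal_mult ennreal_of_nat_eq_real_of_nat ennreal_plus[symmetric] add.commute del: ennreal_plus)
  also have "\<dots> \<le> ennreal (3 * 4 ^ DIM('a) * e ^ (DIM('a) - 1))"
  proof (rule ennreal_leI)
    obtain m where m: "DIM('a) = Suc m" using DIM_positive gr0_conv_Suc by blast
    have "(real k + 1) * e \<le> 3"
    proof -
      have "(real k + 1) * e \<le> (1 / e + 2) * e" using k e by (intro mult_right_mono) auto
      also have "\<dots> = 1 + 2 * e" using e by (simp add: field_simps)
      finally show ?thesis using e by simp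
    qed
    then have "((real k + 1) * e) * (4 ^ Suc m * e ^ m) \<le> 3 * (4 ^ Suc m * e ^ m)"
      using e by (intro mult_right_mono) auto
    then show "(real k + 1) * (4 * e) ^ DIM('a) \<le> 3 * 4 ^ DIM('a) * e ^ (DIM('a) - 1)"
      unfolding m by (simp add: power_mult_distrib ac_simps)
  qed
  finally show ?thesis .
qed

text \<open>Radius 0 occurs for covering sets of diameter 0. Comparison with small positive radii
  gives measure 0, since in dimension at least 2 the bound vanishes in the limit.\<close>

lemma emeasure_tube_le:
  fixes w :: "'a::euclidean_space"
  assumes dim: "2 \<le> DIM('a)" and w: "norm w = 1" and e: "0 \<le> e" "e \<le> 1"
  shows "emeasure lborel (tube w e) \<le> ennreal (3 * 4 ^ DIM('a) * e ^ (DIM('a) - 1))"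
proof (cases "e = 0")
  case False
  then show ?thesis using emeasure_tube_le_pos[OF w] e by simp
next
  case True
  let ?K = "3 * 4 ^ DIM('a) :: real"
  have "emeasure lborel (tube w e) \<le> 0 + ennreal \<epsilon>" if \<epsilon>: "0 < \<epsilon>" for \<epsilon> :: real
  proof -
    define d where "d = min 1 (\<epsilon> / ?K)"
    have d: "0 < d" "d \<le> 1" "?K * d \<le> \<epsilon>" using \<epsilon> by (auto simp: d_def min_def field_simps)
    have "emeasure lborel (tube w e) \<le> emeasure lborel (tube w d)"
    proof (rule emeasure_mono)
      show "tube w e \<subseteq> tube w d" using d True by (auto simp: tube_def)
    qed simp
    also have "\<dots> \<le> ennreal (?K * d ^ (DIM('a) - 1))" by (rule emeasure_tube_le_pos[OF w d(1,2)])
    also have "\<dots> \<le> ennreal (?K * d)"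
    proof (intro ennreal_leI mult_left_mono)
      have "d ^ (DIM('a) - 1) \<le> d ^ 1" using d dim by (intro power_decreasing) auto
      then show "d ^ (DIM('a) - 1) \<le> d" by simp
    qed auto
    also have "\<dots> \<le> ennreal \<epsilon>" using d by (intro ennreal_leI)
    finally show ?thesis by simp
  qed
  then have "emeasure lborel (tube w e) \<le> 0" by (rule ennreal_le_epsilon)
  then show ?thesis by simp
qed

text \<open>The radial projection of the unit ball pushes Lebesgue measure forward to a multiple of surface measure; a set of
  diameter d on the sphere is covered by the shadow of a tube of radius d / t around a radius, of volume at most a
  multiple of d^(n - 1).\<close>

lemma emeasure_radial_le_hausdorff:
  fixes c :: "'a::euclidean_space"
  assumes dim: "2 \<le> DIM('a)" and t: "0 < t" and B[measurable]: "B \<in> sets borel"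
  shows "emeasure lborel (ball 0 1 \<inter> radial c t -` B)
    \<le> ennreal (3 * 4 ^ DIM('a) / t ^ (DIM('a) - 1)) * emeasure (hausdorff_measure (DIM('a) - 1)) B"
proof -
  define s where "s = DIM('a) - 1"
  have s: "0 < s" using dim by (simp add: s_def)
  define K where "K = 3 * 4 ^ DIM('a) / t ^ s"
  have K: "0 < K" using t by (simp add: K_def)
  define X where "X = ball 0 1 \<inter> radial c t -` B"
  have cover: "emeasure lborel X * ennreal (1 / K) \<le> (\<Sum>i. ennreal (diameter (U i) ^ s))"
    if U: "B \<subseteq> (\<Union>i. U i)" "\<And>i. bounded (U i)" "\<And>i. diameter (U i) \<le> t" for U :: "nat \<Rightarrow> 'a set"
  proof -
    \<comment> \<open>A reference point on the sphere for each covering set that meets it; a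
      covering set that misses the sphere gets the empty tube.\<close>
    define w where "w = (\<lambda>i. SOME w. w \<in> U i \<inter> sphere c t)"
    define W where "W = (\<lambda>i. if U i \<inter> sphere c t = {} then {} else tube ((w i - c) /\<^sub>R t) (diameter (U i) / t))"
    have w: "w i \<in> U i" "w i \<in> sphere c t" if "U i \<inter> sphere c t \<noteq> {}" for i
    proof -
      have "\<exists>w. w \<in> U i \<inter> sphere c t" using that by blast
      then have "w i \<in> U i \<inter> sphere c t" unfolding w_def by (rule someI_ex)
      then show "w i \<in> U i" "w i \<in> sphere c t" by blast+
    qed
    have W_meas[measurable]: "W i \<in> sets borel" for i by (simp add: W_def)
    have W_le: "emeasure lborel (W i) \<le> ennreal K * ennreal (diameter (U i) ^ s)" for i
    proof (cases "U i \<inter> sphere c t = {}")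
      case False
      have d: "0 \<le> diameter (U i)" using U(2) by (rule diameter_ge_0)
      have "norm ((w i - c) /\<^sub>R t) = 1" using w(2)[OF False] t by (simp add: dist_norm norm_minus_commute)
      moreover have "0 \<le> diameter (U i) / t" "diameter (U i) / t \<le> 1" using U(3)[of i] t d by auto
      moreover have "W i = tube ((w i - c) /\<^sub>R t) (diameter (U i) / t)" unfolding W_def using False by (rule if_not_P)
      ultimately have "emeasure lborel (W i) \<le> ennreal (3 * 4 ^ DIM('a) * (diameter (U i) / t) ^ s)"
        unfolding s_def using emeasure_tube_le[OF dim] by simp
      also have "3 * 4 ^ DIM('a) * (diameter (U i) / t) ^ s = K * diameter (U i) ^ s"
        by (simp add: K_def power_divide)
      also have "ennreal \<dots> = ennreal K * ennreal (diameter (U i) ^ s)"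
        using K d by (intro ennreal_mult) auto
      finally show ?thesis .
    qed (simp add: W_def)
    have "X \<subseteq> {0} \<union> (\<Union>i. W i)"
    proof
      fix x assume x: "x \<in> X"
      show "x \<in> {0} \<union> (\<Union>i. W i)"
      proof (cases "x = 0")
        case False
        define y where "y = radial c t x"
        have "y \<in> B" using x by (simp add: X_def y_def)
        then obtain i where i: "y \<in> U i" using U(1) by blast
        have ys: "y \<in> sphere c t" using dist_radial[OF False, of t c] t by (simp add: y_def dist_commute)
        then have ne: "U i \<inter> sphere c t \<noteq> {}" using i by blast
        have dy: "dist y (w i) \<le> diameter (U i)" using diameter_bounded_bound[OF U(2) i w(1)[OF ne]] .
        have x1: "norm x < 1" using x by (simp add: X_def)
        define z where "z = norm x *\<^sub>R ((w i - c) /\<^sub>R t)"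
        have "z \<in> closed_segment 0 ((w i - c) /\<^sub>R t)"
          using x1 unfolding z_def in_segment by (intro exI[of _ "norm x"]) auto
        then have "infdist x (closed_segment 0 ((w i - c) /\<^sub>R t)) \<le> dist x z" by (rule infdist_le)
        also have "dist x z = norm x / t * dist y (w i)"
        proof -
          have "x - z = (norm x / t) *\<^sub>R (y - w i)"
            using False t by (simp add: z_def y_def radial_def algebra_simps divide_inverse)
          then show ?thesis using t by (simp add: dist_norm)
        qed
        also have "\<dots> \<le> 1 / t * diameter (U i)"
          using x1 t dy by (intro mult_mono divide_right_mono) auto
        finally have "x \<in> W i" using ne by (simp add: W_def tube_def)
        then show ?thesis by blast
      qed simp
    qed
    then have "emeasure lborel X \<le> emeasure lborel ({0} \<union> (\<Union>i. W i))" by (intro emeasure_mono) auto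
    also have "\<dots> \<le> emeasure lborel {0 :: 'a} + emeasure lborel (\<Union>i. W i)" by (rule emeasure_subadditive) auto
    also have "\<dots> \<le> 0 + (\<Sum>i. emeasure lborel (W i))"
      by (intro add_mono emeasure_subadditive_countably) auto
    also have "\<dots> \<le> 0 + (\<Sum>i. ennreal K * ennreal (diameter (U i) ^ s))"
      by (intro add_mono suminf_le W_le summableI) auto
    also have "\<dots> = ennreal K * (\<Sum>i. ennreal (diameter (U i) ^ s))" by simp
    finally have "emeasure lborel X * ennreal (1 / K) \<le> ennreal K * (\<Sum>i. ennreal (diameter (U i) ^ s)) * ennreal (1 / K)"
      by (rule mult_right_mono) simp
    also have "\<dots> = (ennreal K * ennreal (1 / K)) * (\<Sum>i. ennreal (diameter (U i) ^ s))" by (simp only: ac_simps)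
    also have "ennreal K * ennreal (1 / K) = 1" using K by (subst ennreal_mult[symmetric]) auto
    finally show ?thesis by simp
  qed
  \<comment> \<open>Scale \<open>t\<close> is enough: it makes the tube radii at most 1, and the
    premeasure at any positive scale is below the Hausdorff measure. With the constant on the left,
    the infimum over covers can be taken directly.\<close>
  have "emeasure lborel X * ennreal (1 / K) \<le> hausdorff_pre s t B"
    unfolding hausdorff_pre_def by (rule INF_greatest) (use cover in blast)
  also have "\<dots> \<le> hausdorff_outer s B" using t by (rule hausdorff_pre_le_outer)
  also have "\<dots> = emeasure (hausdorff_measure s) B" using s B by (rule emeasure_hausdorff_measure[symmetric])
  finally have "ennreal K * (emeasure lborel X * ennreal (1 / K)) \<le> ennreal K * emeasure (hausdorff_measure s) B"
    by (rule mult_left_mono) simp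
  moreover have "ennreal K * (emeasure lborel X * ennreal (1 / K)) = (ennreal K * ennreal (1 / K)) * emeasure lborel X"
    by (simp only: ac_simps)
  moreover have "ennreal K * ennreal (1 / K) = 1" using K by (subst ennreal_mult[symmetric]) auto
  ultimately show ?thesis by (simp add: X_def K_def s_def)
qed

text \<open>Integrability on the sphere refers to the completed Hausdorff measure, so the integrand
  is first replaced by a Borel function \<open>h\<close> off a Hausdorff null set. The push-forward
  of Lebesgue measure on the unit ball under the radial projection is dominated by a multiple of
  Hausdorff measure: it ignores that null set and bounds the average by the sphere integral.
  \<open>Q'\<close> stands for a Borel version of \<open>Q\<close> extended by zero.\<close>

lemma sphere_integrable_radial_finite:
  fixes Q :: "'a::euclidean_space \<Rightarrow> ennreal"
  assumes dim: "2 \<le> DIM('a)" and t: "0 < t" and Q: "sphere_integrable_at Q D c t"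
    and Q'[measurable]: "Q' \<in> borel_measurable borel"
    and ae: "AE x in lborel. x \<in> ball 0 1 \<longrightarrow> Q' (radial c t x) = Q (radial c t x) * indicator D (radial c t x)"
  shows "(\<integral>\<^sup>+x\<in>ball 0 1. Q' (radial c t x) \<partial>lborel) < \<infinity>"
proof -
  let ?H = "hausdorff_measure (DIM('a) - 1) :: 'a measure"
  have [measurable]: "ball (0 :: 'a) 1 \<in> sets borel" by simp
  define Q0 where "Q0 = (\<lambda>x. Q x * indicator D x)"
  have S: "sphere c t \<in> sets (completion ?H)"
    by (rule sets_completionI_sets) simp
  have "Q0 \<in> borel_measurable (restrict_space (completion ?H) (sphere c t))"
    and fin: "(\<integral>\<^sup>+x\<in>sphere c t. Q0 x \<partial>completion ?H) < \<infinity>"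
    using Q by (auto simp: sphere_integrable_at_def Let_def Q0_def)
  then have "(\<lambda>x. Q0 x * indicator (sphere c t) x) \<in> borel_measurable (completion ?H)"
    using S by (subst (asm) borel_measurable_restrict_space_iff_ennreal) (auto simp: sets.Int_space_eq2)
  then obtain h where h: "h \<in> borel_measurable ?H" and hae: "AE x in ?H. Q0 x * indicator (sphere c t) x = h x"
    using completion_ex_borel_measurable by blast
  have h_meas[measurable]: "h \<in> borel_measurable borel"
    using h by (simp add: measurable_cong_sets[OF sets_hausdorff_measure refl])
  have "(\<integral>\<^sup>+x. h x \<partial>?H) = (\<integral>\<^sup>+x. h x \<partial>completion ?H)" by (simp add: nn_integral_completion)
  also have "\<dots> = (\<integral>\<^sup>+x\<in>sphere c t. Q0 x \<partial>completion ?H)"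
    using AE_completion[OF hae] by (intro nn_integral_cong_AE) auto
  finally have fin': "(\<integral>\<^sup>+x. h x \<partial>?H) < \<infinity>" using fin by simp
  define K where "K = 3 * 4 ^ DIM('a) / t ^ (DIM('a) - 1)"
  define M where "M = distr (density lborel (indicator (ball 0 1))) borel (radial c t)"
  have M: "emeasure M A = emeasure lborel (ball 0 1 \<inter> radial c t -` A)" if [measurable]: "A \<in> sets borel" for A
  proof -
    have [measurable]: "radial c t -` A \<in> sets borel"
      by (rule measurable_sets_borel[OF _ that]) measurable
    have [measurable]: "ball (0 :: 'a) 1 \<in> sets borel" by simp
    show ?thesis unfolding M_def by (simp add: emeasure_distr emeasure_density indicator_inter_arith[symmetric])
  qed
  have "M \<le> density ?H (\<lambda>_. ennreal K)"
  proof (subst le_measure)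
    show "\<forall>A\<in>sets M. emeasure M A \<le> emeasure (density ?H (\<lambda>_. ennreal K)) A"
    proof
      fix A assume "A \<in> sets M"
      then have A: "A \<in> sets borel" by (simp add: M_def)
      show "emeasure M A \<le> emeasure (density ?H (\<lambda>_. ennreal K)) A"
        using emeasure_radial_le_hausdorff[OF dim t A, of c] A
        unfolding M[OF A] by (simp add: emeasure_density nn_integral_cmult_indicator K_def)
    qed
  qed (simp add: M_def)
  then have le: "(\<integral>\<^sup>+x. k x \<partial>M) \<le> ennreal K * (\<integral>\<^sup>+x. k x \<partial>?H)" if k[measurable]: "k \<in> borel_measurable borel" for k
  proof -
    have k': "k \<in> borel_measurable ?H" using k by (simp add: measurable_cong_sets[OF sets_hausdorff_measure refl])
    have "(\<integral>\<^sup>+x. k x \<partial>M) \<le> (\<integral>\<^sup>+x. k x \<partial>density ?H (\<lambda>_. ennreal K))"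
      using \<open>M \<le> density ?H (\<lambda>_. ennreal K)\<close> by (intro nn_integral_mono_measure) (auto simp: M_def)
    then show ?thesis using k' by (simp add: nn_integral_density nn_integral_cmult)
  qed
  have M_int: "(\<integral>\<^sup>+x. k x \<partial>M) = (\<integral>\<^sup>+x\<in>ball 0 1. k (radial c t x) \<partial>lborel)" if [measurable]: "k \<in> borel_measurable borel" for k
  proof -
    have [measurable]: "(\<lambda>x. k (radial c t x)) \<in> borel_measurable borel" by measurable
    have [measurable]: "ball (0 :: 'a) 1 \<in> sets borel" by simp
    have "(\<integral>\<^sup>+x. k x \<partial>M) = (\<integral>\<^sup>+x. k (radial c t x) \<partial>density lborel (indicator (ball 0 1)))"
      unfolding M_def by (intro nn_integral_distr) measurable
    also have "\<dots> = (\<integral>\<^sup>+x. indicator (ball 0 1) x * k (radial c t x) \<partial>lborel)"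
      by (intro nn_integral_density) measurable
    finally show ?thesis by (simp add: mult.commute)
  qed
  obtain N where N: "{x\<in>space ?H. Q0 x * indicator (sphere c t) x \<noteq> h x} \<subseteq> N" "emeasure ?H N = 0" "N \<in> sets ?H"
    using AE_E[OF hae] by blast
  have N_meas[measurable]: "N \<in> sets borel" using N(3) by simp
  have N_sub: "Q0 x * indicator (sphere c t) x = h x" if "x \<notin> N" for x
    using that N(1) sets_eq_imp_space_eq[OF sets_hausdorff_measure[of "DIM('a) - 1"]] by auto
  have "(\<integral>\<^sup>+x. indicator N x \<partial>M) \<le> ennreal K * (\<integral>\<^sup>+x. indicator N x \<partial>?H)" by (rule le) measurable
  then have "(\<integral>\<^sup>+x\<in>ball 0 1. indicator N (radial c t x) \<partial>lborel) = 0"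
    using N by (simp add: M_int)
  then have aeN: "AE x in lborel. indicator N (radial c t x) * indicator (ball 0 1) x = (0 :: ennreal)"
    by (subst (asm) nn_integral_0_iff_AE) auto
  have "(\<integral>\<^sup>+x\<in>ball 0 1. Q' (radial c t x) \<partial>lborel) = (\<integral>\<^sup>+x\<in>ball 0 1. h (radial c t x) \<partial>lborel)"
  proof (rule nn_integral_cong_AE)
    have "AE x in lborel. x \<noteq> (0::'a)" by (rule AE_lborel_singleton)
    with ae aeN show "AE x in lborel. Q' (radial c t x) * indicator (ball 0 1) x = h (radial c t x) * indicator (ball 0 1) x"
    proof eventually_elim
      fix x :: 'a
      assume 1: "x \<in> ball 0 1 \<longrightarrow> Q' (radial c t x) = Q (radial c t x) * indicator D (radial c t x)"
        and 2: "indicator N (radial c t x) * indicator (ball 0 1) x = (0 :: ennreal)" and 3: "x \<noteq> 0"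
      show "Q' (radial c t x) * indicator (ball 0 1) x = h (radial c t x) * indicator (ball 0 1) x"
      proof (cases "x \<in> ball 0 1")
        case True
        then have "radial c t x \<notin> N" using 2 by (auto split: split_indicator_asm)
        moreover have "radial c t x \<in> sphere c t" using dist_radial[OF 3, of t c] t by (simp add: dist_commute)
        ultimately have "h (radial c t x) = Q0 (radial c t x)" using N_sub[of "radial c t x"] by simp
        then show ?thesis using True 1 by (simp add: Q0_def)
      qed simp
    qed
  qed
  also have "\<dots> = (\<integral>\<^sup>+x. h x \<partial>M)" by (simp add: M_int)
  also have "\<dots> \<le> ennreal K * (\<integral>\<^sup>+x. h x \<partial>?H)" by (rule le) measurable
  also have "\<dots> < \<infinity>" using fin' by (simp add: ennreal_mult_less_top)
  finally show ?thesis .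
qed

text \<open>Some weight admissible in the ring inequality makes its right-hand side finite. The map
  does not occur, so the resulting bound is common to the whole class.\<close>

definition ring_finite :: "('a::euclidean_space \<Rightarrow> ennreal) \<Rightarrow> 'a set \<Rightarrow> 'a \<Rightarrow> real \<Rightarrow> real \<Rightarrow> bool" where
  "ring_finite Q D c r1 r2 \<longleftrightarrow> (\<exists>\<eta> :: real \<Rightarrow> ennreal. \<eta> \<in> borel_measurable (restrict_space lebesgue {r1<..<r2}) \<and>
    1 \<le> (\<integral>\<^sup>+t\<in>{r1<..<r2}. \<eta> t \<partial>lebesgue) \<and>
    (\<integral>\<^sup>+x\<in>({x. r1 < dist x c \<and> dist x c < r2} \<inter> D). Q x * \<eta> (dist x c) ^ DIM('a) \<partial>lebesgue) < \<infinity>)"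

text \<open>\<open>E\<close> is only Lebesgue measurable; its Borel main part has the same measure.
  The sublevel sets of \<open>q\<close> exhaust it up to a null set, so one of them meets it in
  positive measure.\<close>

lemma positive_measure_bounded_subset:
  fixes q :: "real \<Rightarrow> ennreal"
  assumes [measurable]: "q \<in> borel_measurable borel" and E: "E \<in> sets lebesgue" "0 < emeasure lebesgue E"
    and fin: "AE t in lborel. t \<in> E \<longrightarrow> q t < \<infinity>"
  obtains E' k where "E' \<in> sets borel" "E' \<subseteq> E" "0 < emeasure lborel E'" "\<And>t. t \<in> E' \<Longrightarrow> q t \<le> ennreal (real k)"
proof -
  define S where "S = (\<lambda>k::nat. {t. q t \<le> ennreal (real k)})"
  have [measurable]: "S k \<in> sets borel" for k unfolding S_def by measurable
  define E0 where "E0 = main_part lborel E"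
  have E0[measurable]: "E0 \<in> sets borel" using main_part_sets[OF E(1)] by (simp add: E0_def)
  have E0E: "E0 \<subseteq> E" using main_part_null_part_Un[OF E(1)] unfolding E0_def by blast
  have pos: "0 < emeasure lborel E0" using E(2) emeasure_completion[OF E(1)] by (simp add: E0_def)
  have "\<exists>k. 0 < emeasure lborel (E0 \<inter> S k)"
  proof (rule ccontr)
    assume "\<not> ?thesis"
    then have "E0 \<inter> S k \<in> null_sets lborel" for k by (auto simp: null_sets_def)
    then have "(\<Union>k. E0 \<inter> S k) \<in> null_sets lborel" by (rule null_sets_UN)
    then have "AE t in lborel. t \<notin> (\<Union>k. E0 \<inter> S k)" by (rule AE_not_in)
    with fin have "AE t in lborel. t \<notin> E0"
    proof eventually_elim
      fix t assume 1: "t \<in> E \<longrightarrow> q t < \<infinity>" and 2: "t \<notin> (\<Union>k. E0 \<inter> S k)"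
      show "t \<notin> E0"
      proof
        assume t: "t \<in> E0"
        then have "q t < top" using 1 E0E by auto
        then obtain r where r: "q t = ennreal r" "0 \<le> r" by (cases "q t" rule: ennreal_cases) auto
        obtain k :: nat where "r \<le> real k" using real_arch_simple by blast
        then have "t \<in> S k" using r by (simp add: S_def ennreal_leI)
        then show False using 2 t by blast
      qed
    qed
    then have "emeasure lborel E0 = 0" by (simp add: AE_iff_measurable[OF _ refl] AE_iff_null_sets null_sets_def)
    then show False using pos by simp
  qed
  then obtain k where "0 < emeasure lborel (E0 \<inter> S k)" by blast
  then show ?thesis using E0E by (intro that[of "E0 \<inter> S k" k]) (auto simp: S_def)
qed

text \<open>The weight is the normalised indicator of a set of radii, of positive measure, on which
  the sphere averages of \<open>Q\<close> are bounded; polar coordinates then bound the weighted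
  integral. Two kinds of null sets have to be reconciled: a Borel version of \<open>Q\<close>
  differs from it on a Lebesgue null set, which by polar coordinates is invisible on almost every
  sphere.\<close>

lemma sphere_integrability_ring_finite:
  fixes Q :: "'a::euclidean_space \<Rightarrow> ennreal"
  assumes dim: "2 \<le> DIM('a)" and D: "open D" and Q: "Q \<in> borel_measurable (restrict_space lebesgue D)"
    and SI: "sphere_integrability Q D" and c: "c \<in> D" and r: "0 < r1" "r1 < r2" and far: "\<exists>x\<in>D. r2 < dist x c"
  shows "ring_finite Q D c r1 r2"
proof -
  define n where "n = DIM('a)"
  have n: "2 \<le> n" using dim by (simp add: n_def)
  have [measurable]: "ball (0 :: 'a) 1 \<in> sets borel" by simp
  define Q0 where "Q0 = (\<lambda>x. Q x * indicator D x)"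
  have "D \<in> sets lebesgue" using D by (intro sets_completionI_sets) auto
  then have Q0: "Q0 \<in> borel_measurable lebesgue"
    using Q unfolding Q0_def by (subst (asm) borel_measurable_restrict_space_iff_ennreal) auto
  obtain Q' where Q'[measurable]: "Q' \<in> borel_measurable borel" and ae: "AE x in lborel. Q0 x = Q' x"
    using completion_ex_borel_measurable[OF Q0] by auto
  obtain N where N: "{x\<in>space lborel. Q0 x \<noteq> Q' x} \<subseteq> N" "emeasure lborel N = 0" "N \<in> sets lborel"
    using AE_E[OF ae] by blast
  have [measurable]: "N \<in> sets borel" using N(3) by simp
  have N_sub: "Q0 x = Q' x" if "x \<notin> N" for x using N(1) that by auto
  define q where "q = (\<lambda>t. \<integral>\<^sup>+x\<in>ball 0 1. Q' (radial c t x) \<partial>lborel)"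
  have q_meas[measurable]: "q \<in> borel_measurable borel" unfolding q_def by measurable
  have "(\<integral>\<^sup>+t\<in>{0<..}. ennreal (real n * t ^ (n - 1)) * (\<integral>\<^sup>+x\<in>ball 0 1. indicator N (radial c t x) \<partial>lborel) \<partial>lborel)
    = (\<integral>\<^sup>+x. indicator N x \<partial>lborel)"
    unfolding n_def by (rule nn_integral_polar) measurable
  also have "\<dots> = 0" using N by simp
  finally have "AE t in lborel. ennreal (real n * t ^ (n - 1)) * (\<integral>\<^sup>+x\<in>ball 0 1. indicator N (radial c t x) \<partial>lborel) * indicator {0<..} t = 0"
    by (subst (asm) nn_integral_0_iff_AE) measurable
  then have aeN: "AE t in lborel. 0 < t \<longrightarrow> (AE x in lborel. x \<in> ball 0 1 \<longrightarrow> radial c t x \<notin> N)"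
  proof eventually_elim
    fix t :: real
    assume z: "ennreal (real n * t ^ (n - 1)) * (\<integral>\<^sup>+x\<in>ball 0 1. indicator N (radial c t x) \<partial>lborel) * indicator {0<..} t = 0"
    show "0 < t \<longrightarrow> (AE x in lborel. x \<in> ball 0 1 \<longrightarrow> radial c t x \<notin> N)"
    proof
      assume t: "0 < t"
      then have "0 < real n * t ^ (n - 1)" using n by simp
      then have "(\<integral>\<^sup>+x\<in>ball 0 1. indicator N (radial c t x) \<partial>lborel) = 0" using z t n by simp
      then have "AE x in lborel. indicator N (radial c t x) * indicator (ball 0 1) x = (0::ennreal)"
        by (subst (asm) nn_integral_0_iff_AE) measurable
      then show "AE x in lborel. x \<in> ball 0 1 \<longrightarrow> radial c t x \<notin> N"
        by eventually_elim (auto split: split_indicator_asm)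
    qed
  qed
  have "0 < r1 \<and> r1 < r2 \<and> (\<exists>x\<in>D. r2 < dist x c)" using r far by simp
  from SI[unfolded sphere_integrability_def, rule_format, OF c this]
  obtain E1 where E1: "E1 \<subseteq> {r1..r2}" "E1 \<in> sets lebesgue" "0 < emeasure lebesgue E1"
    and E1_int: "\<forall>t\<in>E1. sphere_integrable_at Q D c t"
    by (elim exE conjE)
  have "AE t in lborel. t \<in> E1 \<longrightarrow> q t < \<infinity>" using aeN
  proof eventually_elim
    fix t :: real
    assume H: "0 < t \<longrightarrow> (AE x in lborel. x \<in> ball 0 1 \<longrightarrow> radial c t x \<notin> N)"
    show "t \<in> E1 \<longrightarrow> q t < \<infinity>"
    proof
      assume t: "t \<in> E1"
      then have t0: "0 < t" using E1(1) r by force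
      have "AE x in lborel. x \<in> ball 0 1 \<longrightarrow> radial c t x \<notin> N" using H t0 by blast
      then have "AE x in lborel. x \<in> ball 0 1 \<longrightarrow> Q' (radial c t x) = Q (radial c t x) * indicator D (radial c t x)"
      proof eventually_elim
        fix x :: 'a assume "x \<in> ball 0 1 \<longrightarrow> radial c t x \<notin> N"
        then show "x \<in> ball 0 1 \<longrightarrow> Q' (radial c t x) = Q (radial c t x) * indicator D (radial c t x)"
          using N_sub[of "radial c t x"] by (simp add: Q0_def)
      qed
      then show "q t < \<infinity>"
        unfolding q_def by (rule sphere_integrable_radial_finite[OF dim t0 bspec[OF E1_int t] Q'])
    qed
  qed
  from positive_measure_bounded_subset[OF q_meas E1(2,3) this]
  obtain E k where E[measurable]: "E \<in> sets borel" and E': "E \<subseteq> E1" "0 < emeasure lborel E" "\<And>t. t \<in> E \<Longrightarrow> q t \<le> ennreal (real k)"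
    by blast
  have E_sub: "E \<subseteq> {r1..r2}" using E' E1 by blast
  then have "emeasure lborel E \<le> emeasure lborel {r1..r2}" by (intro emeasure_mono) auto
  then have E_fin: "emeasure lborel E < top" using r by (simp add: le_less_trans)
  define m where "m = enn2real (emeasure lborel E)"
  have m: "0 < m" "emeasure lborel E = ennreal m"
    using E'(2) E_fin by (auto simp: m_def enn2real_positive_iff)
  \<comment> \<open>Normalised to integral 1. \<open>E\<close> may contain the end points r1 and r2,
    which are removed as null sets.\<close>
  define \<eta> where "\<eta> = (\<lambda>t. ennreal (1 / m) * indicator E t)"
  have "(\<integral>\<^sup>+t\<in>{r1<..<r2}. \<eta> t \<partial>lebesgue) = (\<integral>\<^sup>+t\<in>{r1<..<r2}. \<eta> t \<partial>lborel)"
    unfolding \<eta>_def by (subst nn_integral_completion) auto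
  also have "\<dots> = (\<integral>\<^sup>+t. \<eta> t \<partial>lborel)"
  proof (rule nn_integral_cong_AE)
    have "AE t in lborel. t \<noteq> r1" "AE t in lborel. t \<noteq> r2" by (rule AE_lborel_singleton)+
    then show "AE t in lborel. \<eta> t * indicator {r1<..<r2} t = \<eta> t"
      by eventually_elim (use E_sub in \<open>auto simp: \<eta>_def split: split_indicator\<close>)
  qed
  also have "\<dots> = ennreal (1 / m) * ennreal m" unfolding \<eta>_def m(2)[symmetric] by (simp add: nn_integral_cmult_indicator)
  also have "\<dots> = 1" using m(1) by (subst ennreal_mult[symmetric]) auto
  finally have int1: "1 \<le> (\<integral>\<^sup>+t\<in>{r1<..<r2}. \<eta> t \<partial>lebesgue)" by simp
  have "\<eta> \<in> borel_measurable borel" unfolding \<eta>_def by measurable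
  then have "\<eta> \<in> borel_measurable lebesgue" by (rule measurable_completion[of \<eta> lborel, simplified])
  then have meas: "\<eta> \<in> borel_measurable (restrict_space lebesgue {r1<..<r2})" by (rule measurable_restrict_space1)
  define g where "g = (\<lambda>y. Q' y * indicator E (dist y c))"
  have [measurable]: "g \<in> borel_measurable borel" unfolding g_def by measurable
  have g_rad: "(\<integral>\<^sup>+x\<in>ball 0 1. g (radial c t x) \<partial>lborel) = indicator E t * q t" if "0 < t" for t
  proof -
    have "(\<integral>\<^sup>+x\<in>ball 0 1. g (radial c t x) \<partial>lborel) = (\<integral>\<^sup>+x. indicator E t * (Q' (radial c t x) * indicator (ball 0 1) x) \<partial>lborel)"
    proof (rule nn_integral_cong_AE)
      have "AE x in lborel. x \<noteq> (0::'a)" by (rule AE_lborel_singleton)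
      then show "AE x in lborel. g (radial c t x) * indicator (ball 0 1) x = indicator E t * (Q' (radial c t x) * indicator (ball 0 1) x)"
        by eventually_elim (use that in \<open>simp add: g_def dist_radial ac_simps\<close>)
    qed
    also have "\<dots> = indicator E t * q t" unfolding q_def by (rule nn_integral_cmult) measurable
    finally show ?thesis .
  qed
  have "(\<integral>\<^sup>+x. g x \<partial>lborel)
    = (\<integral>\<^sup>+t\<in>{0<..}. ennreal (real n * t ^ (n - 1)) * (\<integral>\<^sup>+x\<in>ball 0 1. g (radial c t x) \<partial>lborel) \<partial>lborel)"
    unfolding n_def by (rule nn_integral_polar[symmetric]) measurable
  also have "\<dots> \<le> (\<integral>\<^sup>+t. ennreal (real n * r2 ^ (n - 1)) * ennreal (real k) * indicator E t \<partial>lborel)"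
  proof (rule nn_integral_mono)
    fix t :: real
    show "ennreal (real n * t ^ (n - 1)) * (\<integral>\<^sup>+x\<in>ball 0 1. g (radial c t x) \<partial>lborel) * indicator {0<..} t
      \<le> ennreal (real n * r2 ^ (n - 1)) * ennreal (real k) * indicator E t"
    proof (cases "0 < t \<and> t \<in> E")
      case True
      then have "t \<le> r2" using E_sub by auto
      then have "ennreal (real n * t ^ (n - 1)) \<le> ennreal (real n * r2 ^ (n - 1))"
        using True by (intro ennreal_leI mult_left_mono power_mono) auto
      then show ?thesis using True E'(3)[of t] g_rad[of t] by (simp add: mult_mono)
    next
      case False
      then show ?thesis using g_rad[of t] by (auto split: split_indicator)
    qed
  qed
  also have "\<dots> = ennreal (real n * r2 ^ (n - 1)) * ennreal (real k) * emeasure lborel E"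
    by (simp add: nn_integral_cmult_indicator)
  also have "\<dots> < top" using E_fin by (simp add: ennreal_mult_less_top)
  finally have g_fin: "(\<integral>\<^sup>+x. g x \<partial>lborel) < top" .
  have "(\<integral>\<^sup>+x\<in>({x. r1 < dist x c \<and> dist x c < r2} \<inter> D). Q x * \<eta> (dist x c) ^ DIM('a) \<partial>lebesgue)
    \<le> (\<integral>\<^sup>+x. ennreal (1 / m) ^ DIM('a) * g x \<partial>lebesgue)"
  proof (rule nn_integral_mono_AE)
    have "AE x in lebesgue. Q0 x = Q' x" by (rule AE_completion[OF ae])
    then show "AE x in lebesgue. Q x * \<eta> (dist x c) ^ DIM('a) * indicator ({x. r1 < dist x c \<and> dist x c < r2} \<inter> D) x
      \<le> ennreal (1 / m) ^ DIM('a) * g x"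
    proof eventually_elim
      fix x assume x: "Q0 x = Q' x"
      show "Q x * \<eta> (dist x c) ^ DIM('a) * indicator ({x. r1 < dist x c \<and> dist x c < r2} \<inter> D) x \<le> ennreal (1 / m) ^ DIM('a) * g x"
      proof (cases "x \<in> D \<and> dist x c \<in> E")
        case True
        then have "Q' x = Q x" using x by (simp add: Q0_def)
        then show ?thesis using True by (auto simp: g_def \<eta>_def ac_simps split: split_indicator)
      next
        case False
        then show ?thesis by (auto simp: \<eta>_def power_0_left split: split_indicator)
      qed
    qed
  qed
  also have "\<dots> = (\<integral>\<^sup>+x. ennreal (1 / m) ^ DIM('a) * g x \<partial>lborel)" by (rule nn_integral_completion)
  also have "\<dots> = ennreal (1 / m) ^ DIM('a) * (\<integral>\<^sup>+x. g x \<partial>lborel)" by (rule nn_integral_cmult) measurable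
  also have "\<dots> < \<infinity>" using g_fin m(1) by (simp add: ennreal_mult_less_top ennreal_power)
  finally show ?thesis unfolding ring_finite_def using meas int1 by blast
qed

lemma integrable_ring_weight:
  fixes Q :: "'a::euclidean_space \<Rightarrow> ennreal"
  assumes r: "0 < r1" "r1 < r2"
  defines "\<eta> \<equiv> \<lambda>_::real. ennreal (1 / (r2 - r1))"
  shows "\<eta> \<in> borel_measurable (restrict_space lebesgue {r1<..<r2})"
    and "1 \<le> (\<integral>\<^sup>+t\<in>{r1<..<r2}. \<eta> t \<partial>lebesgue)"
proof -
  show "\<eta> \<in> borel_measurable (restrict_space lebesgue {r1<..<r2})" unfolding \<eta>_def by measurable
  have "(\<integral>\<^sup>+t\<in>{r1<..<r2}. \<eta> t \<partial>lebesgue) = ennreal (1 / (r2 - r1)) * emeasure lebesgue {r1<..<r2}"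
    unfolding \<eta>_def by (intro nn_integral_cmult_indicator) auto
  also have "\<dots> = ennreal (1 / (r2 - r1)) * ennreal (r2 - r1)" using r by simp
  also have "\<dots> = 1" using r by (subst ennreal_mult[symmetric]) auto
  finally show "1 \<le> (\<integral>\<^sup>+t\<in>{r1<..<r2}. \<eta> t \<partial>lebesgue)" by simp
qed

section \<open>Lower distance bounds\<close>

context sphere_embedding
begin

lemma image_subset_range: "F ` U \<subseteq> range sproj"
  by auto

lemma closure_image_subset_range: "closure (F ` U) \<subseteq> range sproj"
  by (rule closure_minimal[OF image_subset_range]) (rule compact_imp_closed[OF compact_range_sproj])

lemma closure_image_ball:
  assumes "cball c r \<subseteq> D"
  shows "closure (F ` (ball c r \<inter> D)) \<subseteq> F ` D"
proof -
  have "compact (F ` cball c r)"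
    using assms by (intro compact_continuous_image continuous_on_subset[OF cont]) auto
  then have "closure (F ` (ball c r \<inter> D)) \<subseteq> F ` cball c r"
    by (intro closure_minimal compact_imp_closed image_mono) auto
  then show ?thesis using assms by blast
qed

text \<open>The part of \<open>T\<close> in the image is open in \<open>T\<close> because the image
  is open in the sphere, and closed in \<open>T\<close> because \<open>T\<close> avoids the
  frontier.\<close>

lemma connected_subset_open_image:
  assumes U: "open U" "U \<subseteq> D" and T: "connected T" "T \<subseteq> range sproj" "T \<inter> F ` U \<noteq> {}"
    and frontier: "T \<inter> (closure (F ` U) - F ` U) = {}"
  shows "T \<subseteq> F ` U"
proof -
  have "openin (top_of_set T) (T \<inter> F ` U)"
  proof -
    obtain O' where "open O'" "F ` U = range sproj \<inter> O'" using open_map[OF U] unfolding openin_open by blast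
    then have "T \<inter> F ` U = T \<inter> O'" using T(2) by auto
    then show ?thesis using \<open>open O'\<close> by (simp add: openin_open_Int)
  qed
  moreover have "closedin (top_of_set T) (T \<inter> F ` U)"
  proof -
    have "T \<inter> F ` U = T \<inter> closure (F ` U)" using frontier closure_subset[of "F ` U"] by auto
    then show ?thesis by (simp add: closedin_closed_Int)
  qed
  ultimately have "T \<inter> F ` U = T" using T(1,3) unfolding connected_clopen by metis
  then show ?thesis by blast
qed

text \<open>Two ways to ensure that a polyline leaves the image of a ball inside f(D). If the closed
  balls lie in \<open>D\<close>, compactness puts the closure of the image of the ball into f(D);
  this serves when one of the curves runs near the frontier. If the frontier is far from
  \<open>u\<close>, the whole polyline stays in f(D) by connectedness; this serves when the rings
  may stick out of \<open>D\<close>.\<close>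

lemma polyline_admissible_curves:
  fixes \<rho> :: "'a \<Rightarrow> ennreal"
  assumes r: "0 < r1" "r1 < r2" and \<rho>: "\<rho> \<in> borel_measurable borel"
    and adm: "\<And>c J \<eta>. c \<in> I \<Longrightarrow> (J, \<eta>) \<in> image_family f D (curves (sphere c r1) (sphere c r2) D) \<Longrightarrow>
        loc_rectifiable J \<eta> \<Longrightarrow> 1 \<le> lineint \<rho> J \<eta>"
    and G: "\<And>p. sproj p \<in> G \<Longrightarrow> \<exists>c\<in>I. p \<in> f ` (cball c r1 \<inter> D)"
    and H: "\<And>p c. sproj p \<in> H \<Longrightarrow> c \<in> I \<Longrightarrow> p \<notin> f ` (ball c r2 \<inter> D)"
    and inside: "(\<forall>c\<in>I. cball c r2 \<subseteq> D) \<or> (\<forall>e\<in>closure (F ` D) - F ` D. R \<le> dist e (sproj u))"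
  shows "polyline_admissible \<rho> {x. sproj (Some x) \<in> G} {x. sproj (Some x) \<in> H} {x. chordal (Some x) u < R}"
proof (rule polyline_admissible_rings[OF r \<rho>, where x = "\<lambda>c. c" and I = I])
  show "1 \<le> lineint \<rho> J \<eta>" if "c \<in> I" "(J, \<eta>) \<in> image_family f D (curves (sphere c r1) (sphere c r2) D)" "loc_rectifiable J \<eta>" for c J \<eta>
    using adm that .
  show "\<exists>c\<in>I. Some y \<in> f ` (cball c r1 \<inter> D)" if "y \<in> {x. sproj (Some x) \<in> G}" for y using G that by simp
  show "Some y \<notin> f ` (ball c r2 \<inter> D)" if "y \<in> {x. sproj (Some x) \<in> H}" "c \<in> I" for y c using H that by simp
  fix v :: "nat \<Rightarrow> 'a" and c and t :: real
  assume v: "v 0 \<in> {x. sproj (Some x) \<in> G}" and W: "polyline v 4 ` {0..4} \<subseteq> {x. chordal (Some x) u < R}"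
    and c: "c \<in> I" and t: "t \<in> {0..4}" and cl: "sproj (Some (polyline v 4 t)) \<in> closure (F ` (ball c r2 \<inter> D))"
  have "sproj (Some (polyline v 4 t)) \<in> F ` D"
    using inside
  proof
    assume "\<forall>c\<in>I. cball c r2 \<subseteq> D"
    then show ?thesis using closure_image_ball cl c by blast
  next
    assume far: "\<forall>e\<in>closure (F ` D) - F ` D. R \<le> dist e (sproj u)"
    let ?T = "(\<lambda>t. sproj (Some (polyline v 4 t))) ` {0..4}"
    have "?T \<subseteq> F ` D"
    proof (rule connected_subset_open_image[OF open_D order_refl])
      have "continuous_on {0..4} (\<lambda>t. sproj (Some (polyline v 4 t)))"
        by (rule continuous_on_compose2[OF continuous_on_sproj_Some continuous_on_polyline]) auto
      then show "connected ?T" by (rule connected_continuous_image) simp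
      show "?T \<subseteq> range sproj" by auto
      have "Some (v 0) \<in> f ` D" using G[of "Some (v 0)"] v by auto
      then have "sproj (Some (polyline v 4 0)) \<in> F ` D" by (simp add: polyline_0 sproj_mem_image_iff)
      then show "?T \<inter> F ` D \<noteq> {}" by force
      show "?T \<inter> (closure (F ` D) - F ` D) = {}"
      proof (rule ccontr)
        assume "\<not> ?thesis"
        then obtain t' where t': "t' \<in> {0..4}" "sproj (Some (polyline v 4 t')) \<in> closure (F ` D) - F ` D" by blast
        then have "R \<le> dist (sproj (Some (polyline v 4 t'))) (sproj u)" using far by blast
        moreover have "chordal (Some (polyline v 4 t')) u < R" using W t'(1) by blast
        ultimately show False by (simp add: chordal_eq_dist)
      qed
    qed
    then show ?thesis using t by blast
  qed
  then show "Some (polyline v 4 t) \<in> f ` D" by (simp only: sproj_mem_image_iff)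
qed

end

text \<open>If more than \<open>(B + 1) / \<kappa>\<close> scales fitted between
  \<open>chordal u v\<close> and \<open>R\<close>, the density that is admissible for all image
  rings, of mass at most \<open>B + 1\<close>, would violate the Loewner estimate. So
  \<open>R\<close> is less than \<open>C * 256 ^ N * chordal u v\<close> for the first integer
  \<open>N\<close> above this quotient.\<close>

lemma sphere_embedding_lower_bound:
  assumes dim: "2 \<le> DIM('a::euclidean_space)"
  obtains C1 C2 :: real where "1 \<le> C1" "0 < C2"
    "\<And>(D :: 'a set) f I r1 r2 B g h u v R. sphere_embedding D f \<Longrightarrow> 0 < r1 \<Longrightarrow> r1 < r2 \<Longrightarrow> finite I \<Longrightarrow> 0 \<le> B \<Longrightarrow>
      (\<Sum>c\<in>I. modulus (image_family f D (curves (sphere c r1) (sphere c r2) D))) \<le> ennreal B \<Longrightarrow>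
      continuous_on {0..1::real} g \<Longrightarrow> g ` {0..1} \<subseteq> range sproj \<Longrightarrow> g 0 = sproj u \<Longrightarrow>
      continuous_on {0..1::real} h \<Longrightarrow> h ` {0..1} \<subseteq> range sproj \<Longrightarrow> h 0 = sproj v \<Longrightarrow> u \<noteq> v \<Longrightarrow>
      \<exists>t\<in>{0..1}. R \<le> dist (g t) (sproj u) \<Longrightarrow> \<exists>t\<in>{0..1}. R \<le> dist (h t) (sproj u) \<Longrightarrow>
      \<forall>p. sproj p \<in> g ` {0..1} \<longrightarrow> (\<exists>c\<in>I. p \<in> f ` (cball c r1 \<inter> D)) \<Longrightarrow>
      \<forall>p c. sproj p \<in> h ` {0..1} \<longrightarrow> c \<in> I \<longrightarrow> p \<notin> f ` (ball c r2 \<inter> D) \<Longrightarrow>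
      (\<forall>c\<in>I. cball c r2 \<subseteq> D) \<or> (\<forall>e\<in>closure ((\<lambda>x. sproj (f x)) ` D) - (\<lambda>x. sproj (f x)) ` D. 4 * R \<le> dist e (sproj u)) \<Longrightarrow>
      R \<le> C1 * exp (C2 * B) * chordal u v"
proof (rule chordal_loewner[OF dim])
  fix \<kappa> C :: real
  assume \<kappa>: "0 < \<kappa>" and C: "1 \<le> C" and
    L: "\<And>(g :: real \<Rightarrow> 'a \<times> real) (h :: real \<Rightarrow> 'a \<times> real) (u :: 'a option) v s R N \<rho>. continuous_on {0..1} g \<Longrightarrow> g ` {0..1} \<subseteq> range sproj \<Longrightarrow> g 0 = sproj u \<Longrightarrow>
      continuous_on {0..1} h \<Longrightarrow> h ` {0..1} \<subseteq> range sproj \<Longrightarrow> h 0 = sproj v \<Longrightarrow>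
      chordal u v \<le> s \<Longrightarrow> 0 < s \<Longrightarrow> C * 256 ^ N * s \<le> R \<Longrightarrow>
      (\<exists>t\<in>{0..1}. R \<le> dist (g t) (sproj u)) \<Longrightarrow> (\<exists>t\<in>{0..1}. R \<le> dist (h t) (sproj u)) \<Longrightarrow>
      \<rho> \<in> borel_measurable borel \<Longrightarrow> polyline_admissible \<rho> {x. sproj (Some x) \<in> g ` {0..1}} {x. sproj (Some x) \<in> h ` {0..1}}
        {x. chordal (Some x) u < 4 * R} \<Longrightarrow>
      ennreal (real N * \<kappa>) \<le> (\<integral>\<^sup>+x. \<rho> x ^ DIM('a) \<partial>lborel)"
  \<comment> \<open>From \<open>256 ^ N = exp (N * ln 256)\<close> with
    \<open>N \<le> (B + 1) / \<kappa> + 1\<close>; the terms not proportional to \<open>B\<close> go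
    into \<open>C1\<close>.\<close>
  define C2 where "C2 = ln 256 / \<kappa>"
  define C1 where "C1 = C * 256 * exp C2"
  have C2: "0 < C2" using \<kappa> by (simp add: C2_def)
  have C1: "1 \<le> C1"
  proof -
    have "1 * 1 * 1 \<le> C * 256 * exp C2" using C C2 by (intro mult_mono) auto
    then show ?thesis by (simp add: C1_def)
  qed
  have main: "R \<le> C1 * exp (C2 * B) * chordal u v"
    if emb: "sphere_embedding D f" and r: "0 < r1" "r1 < r2" and I: "finite I" and B: "0 \<le> B"
      and mod: "(\<Sum>c\<in>I. modulus (image_family f D (curves (sphere c r1) (sphere c r2) D))) \<le> ennreal B"
      and g: "continuous_on {0..1::real} g" "g ` {0..1} \<subseteq> range sproj" "g 0 = sproj u"
      and h: "continuous_on {0..1::real} h" "h ` {0..1} \<subseteq> range sproj" "h 0 = sproj v" and uv: "u \<noteq> v"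
      and gf: "\<exists>t\<in>{0..1}. R \<le> dist (g t) (sproj u)" and hf: "\<exists>t\<in>{0..1}. R \<le> dist (h t) (sproj u)"
      and G: "\<forall>p. sproj p \<in> g ` {0..1} \<longrightarrow> (\<exists>c\<in>I. p \<in> f ` (cball c r1 \<inter> D))"
      and H: "\<forall>p c. sproj p \<in> h ` {0..1} \<longrightarrow> c \<in> I \<longrightarrow> p \<notin> f ` (ball c r2 \<inter> D)"
      and inside: "(\<forall>c\<in>I. cball c r2 \<subseteq> D) \<or> (\<forall>e\<in>closure ((\<lambda>x. sproj (f x)) ` D) - (\<lambda>x. sproj (f x)) ` D. 4 * R \<le> dist e (sproj u))"
    for D :: "'a set" and f I r1 r2 B g h u v R
  proof -
    interpret sphere_embedding D f by (rule emb)
    have s: "0 < chordal u v" using uv chordal_eq_0_iff[of u v] chordal_nonneg[of u v] by simp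
    \<comment> \<open>The least integer strictly above \<open>(B + 1) / \<kappa>\<close>; strictness
      produces the contradiction.\<close>
    define N where "N = Suc (nat \<lfloor>(B + 1) / \<kappa>\<rfloor>)"
    have N: "(B + 1) / \<kappa> < real N" "real N \<le> (B + 1) / \<kappa> + 1"
    proof -
      have "0 \<le> (B + 1) / \<kappa>" using B \<kappa> by simp
      then have "real N = real_of_int \<lfloor>(B + 1) / \<kappa>\<rfloor> + 1" by (simp add: N_def)
      then show "(B + 1) / \<kappa> < real N" "real N \<le> (B + 1) / \<kappa> + 1"
        using floor_correct[of "(B + 1) / \<kappa>"] by linarith+
    qed
    have "\<not> C * 256 ^ N * chordal u v \<le> R"
    proof
      assume le: "C * 256 ^ N * chordal u v \<le> R"
      obtain \<rho> where \<rho>: "\<rho> \<in> borel_measurable borel" "(\<integral>\<^sup>+x. \<rho> x ^ DIM('a) \<partial>lborel) \<le> ennreal (B + 1)"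
        "\<And>c J \<eta>. c \<in> I \<Longrightarrow> (J, \<eta>) \<in> image_family f D (curves (sphere c r1) (sphere c r2) D) \<Longrightarrow> loc_rectifiable J \<eta> \<Longrightarrow> 1 \<le> lineint \<rho> J \<eta>"
        using finite_family_admissible[OF I mod B] by blast
      have "polyline_admissible \<rho> {x. sproj (Some x) \<in> g ` {0..1}} {x. sproj (Some x) \<in> h ` {0..1}} {x. chordal (Some x) u < 4 * R}"
        using G H inside by (intro polyline_admissible_curves[OF r \<rho>(1,3)]) blast+
      then have "ennreal (real N * \<kappa>) \<le> (\<integral>\<^sup>+x. \<rho> x ^ DIM('a) \<partial>lborel)"
        by (rule L[OF g h order_refl s le gf hf \<rho>(1)])
      also have "\<dots> \<le> ennreal (B + 1)" by (rule \<rho>(2))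
      finally have "real N * \<kappa> \<le> B + 1" using B by (subst (asm) ennreal_le_iff) auto
      then show False using N(1) \<kappa> by (simp add: divide_less_eq)
    qed
    then have "R \<le> C * 256 ^ N * chordal u v" by simp
    also have "\<dots> \<le> C1 * exp (C2 * B) * chordal u v"
    proof (rule mult_right_mono)
      have "(256::real) ^ N = exp (real N * ln 256)" by (simp add: exp_of_nat_mult)
      also have "\<dots> \<le> exp (((B + 1) / \<kappa> + 1) * ln 256)" using N(2) by simp
      also have "((B + 1) / \<kappa> + 1) * ln 256 = C2 * B + C2 + ln 256"
        using \<kappa> by (simp add: C2_def field_simps)
      also have "exp (C2 * B + C2 + ln 256) = 256 * exp C2 * exp (C2 * B)" by (simp add: exp_add)
      finally have "C * 256 ^ N \<le> C * (256 * exp C2 * exp (C2 * B))" using C by (intro mult_left_mono) auto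
      then show "C * 256 ^ N \<le> C1 * exp (C2 * B)" by (simp add: C1_def mult.assoc)
    qed (use s in simp)
    finally show ?thesis .
  qed
  show thesis by (rule that[OF C1 C2]) (erule (17) main)
qed

section \<open>Distance of interior values from the frontier of the image\<close>

lemma compact_path_connected_superset:
  fixes D :: "'a::euclidean_space set"
  assumes D: "open D" "connected D" and K: "compact K" "K \<subseteq> D" and ne: "K \<noteq> {}"
  obtains T where "compact T" "path_connected T" "K \<subseteq> T" "T \<subseteq> D"
proof -
  obtain a where a: "a \<in> K" using ne by blast
  have pc: "path_connected D" using D by (simp add: connected_open_path_connected)
  have "\<exists>r>0. cball x r \<subseteq> D" if "x \<in> D" for x using D(1) that open_contains_cball by blast
  then obtain r where r: "\<And>x. x \<in> D \<Longrightarrow> 0 < r x" "\<And>x. x \<in> D \<Longrightarrow> cball x (r x) \<subseteq> D" by metis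
  have "\<exists>g. path g \<and> path_image g \<subseteq> D \<and> pathstart g = a \<and> pathfinish g = x" if "x \<in> D" for x
    using pc that a K(2) unfolding path_connected_def by blast
  then obtain g where g: "\<And>x. x \<in> D \<Longrightarrow> path (g x) \<and> path_image (g x) \<subseteq> D \<and> pathstart (g x) = a \<and> pathfinish (g x) = x"
    by metis
  have "K \<subseteq> (\<Union>x\<in>K. ball x (r x))" using r K(2) by force
  then obtain S where S: "S \<subseteq> K" "finite S" "K \<subseteq> (\<Union>x\<in>S. ball x (r x))"
    by (rule compactE_image[OF K(1), rotated]) auto
  \<comment> \<open>A path from the base point together with a closed ball about its end. All these
    sets contain \<open>a\<close>, so their finite union is path connected.\<close>
  define P where "P = (\<lambda>x. path_image (g x) \<union> cball x (r x))"
  have SD: "x \<in> D" if "x \<in> S" for x using that S(1) K(2) by blast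
  have P: "path_connected (P x)" "compact (P x)" "a \<in> P x" "P x \<subseteq> D" if "x \<in> S" for x
  proof -
    note gx = g[OF SD[OF that]]
    have "x \<in> path_image (g x)" using gx pathfinish_in_path_image[of "g x"] by simp
    moreover have "x \<in> cball x (r x)" using r(1)[OF SD[OF that]] by simp
    ultimately show "path_connected (P x)"
      unfolding P_def using gx by (intro path_connected_Un path_connected_path_image convex_imp_path_connected) auto
    show "compact (P x)" unfolding P_def using gx by (intro compact_Un compact_path_image) auto
    show "a \<in> P x" unfolding P_def using gx pathstart_in_path_image[of "g x"] by simp
    show "P x \<subseteq> D" unfolding P_def using gx r(2)[OF SD[OF that]] by blast
  qed
  show ?thesis
  proof
    show "compact (\<Union>x\<in>S. P x)" using S(2) P(2) by (intro compact_UN) auto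
    have to_a: "path_component (\<Union>x\<in>S. P x) y a" if y: "y \<in> (\<Union>x\<in>S. P x)" for y
    proof -
      obtain x where x: "x \<in> S" "y \<in> P x" using y by blast
      then have "path_component (P x) y a" using P(1,3) unfolding path_connected_component by blast
      then show ?thesis by (rule path_component_of_subset[rotated]) (use x in blast)
    qed
    show "path_connected (\<Union>x\<in>S. P x)"
      unfolding path_connected_component
    proof (intro ballI)
      fix y z assume "y \<in> (\<Union>x\<in>S. P x)" "z \<in> (\<Union>x\<in>S. P x)"
      then show "path_component (\<Union>x\<in>S. P x) y z"
        by (blast intro: path_component_trans[OF to_a path_component_sym[OF to_a]])
    qed
    show "K \<subseteq> (\<Union>x\<in>S. P x)" using S(3) by (force simp: P_def)
    show "(\<Union>x\<in>S. P x) \<subseteq> D" using P(4) by blast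
  qed
qed

text \<open>The weight is fixed before the map, so one \<open>B\<close> serves all maps that satisfy
  the ring inequality at \<open>c\<close>.\<close>

lemma ring_finite_modulus_bound:
  assumes "ring_finite Q D c r1 r2" "0 < r1" "r1 < r2" "\<exists>x\<in>D. r2 < dist x c"
  obtains B where "0 \<le> B"
    "\<And>f. ring_Q_ineq f Q D c \<Longrightarrow> modulus (image_family f D (curves (sphere c r1) (sphere c r2) D)) \<le> ennreal B"
proof -
  obtain \<eta> :: "real \<Rightarrow> ennreal" where \<eta>: "\<eta> \<in> borel_measurable (restrict_space lebesgue {r1<..<r2})"
    "1 \<le> (\<integral>\<^sup>+t\<in>{r1<..<r2}. \<eta> t \<partial>lebesgue)"
    "(\<integral>\<^sup>+x\<in>({x. r1 < dist x c \<and> dist x c < r2} \<inter> D). Q x * \<eta> (dist x c) ^ DIM('a) \<partial>lebesgue) < \<infinity>"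
    using assms(1) unfolding ring_finite_def by blast
  define I where "I = (\<integral>\<^sup>+x\<in>({x. r1 < dist x c \<and> dist x c < r2} \<inter> D). Q x * \<eta> (dist x c) ^ DIM('a) \<partial>lebesgue)"
  have I: "I = ennreal (enn2real I)" using \<eta>(3) by (simp add: I_def)
  show ?thesis
  proof (rule that[of "enn2real I"])
    fix f assume f: "ring_Q_ineq f Q D c"
    have "modulus (image_family f D (curves (sphere c r1) (sphere c r2) D)) \<le> I"
      unfolding I_def
    proof (rule f[unfolded ring_Q_ineq_def, rule_format])
      show "0 < r1 \<and> r1 < r2 \<and> (\<exists>x\<in>D. r2 < dist x c)" using assms(2-4) by simp
      show "\<eta> \<in> borel_measurable (restrict_space lebesgue {r1<..<r2}) \<and> 1 \<le> (\<integral>\<^sup>+t\<in>{r1<..<r2}. \<eta> t \<partial>lebesgue)"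
        using \<eta>(1,2) by simp
    qed
    then show "modulus (image_family f D (curves (sphere c r1) (sphere c r2) D)) \<le> ennreal (enn2real I)"
      using I by simp
  qed simp
qed

lemma ring_finite_modulus_sum_bound:
  assumes "finite I" and r: "0 < r1" "r1 < r2"
    and I: "\<And>c. c \<in> I \<Longrightarrow> ring_finite Q D c r1 r2" "\<And>c. c \<in> I \<Longrightarrow> \<exists>x\<in>D. r2 < dist x c"
  obtains B where "0 \<le> B"
    "\<And>f J. J \<subseteq> I \<Longrightarrow> \<forall>c\<in>I. ring_Q_ineq f Q D c \<Longrightarrow>
      (\<Sum>c\<in>J. modulus (image_family f D (curves (sphere c r1) (sphere c r2) D))) \<le> ennreal B"
proof -
  let ?m = "\<lambda>f c. modulus (image_family f D (curves (sphere c r1) (sphere c r2) D))"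
  have "\<exists>B\<ge>0. \<forall>f. ring_Q_ineq f Q D c \<longrightarrow> ?m f c \<le> ennreal B" if "c \<in> I" for c
    using ring_finite_modulus_bound[OF I(1)[OF that] r I(2)[OF that]] by metis
  then obtain B where B: "\<And>c. c \<in> I \<Longrightarrow> 0 \<le> B c"
    "\<And>c f. c \<in> I \<Longrightarrow> ring_Q_ineq f Q D c \<Longrightarrow> ?m f c \<le> ennreal (B c)" by metis
  show ?thesis
  proof (rule that[of "sum B I"])
    show "0 \<le> sum B I" by (intro sum_nonneg B(1))
    fix f J assume J: "J \<subseteq> I" and f: "\<forall>c\<in>I. ring_Q_ineq f Q D c"
    have "sum (?m f) J \<le> sum (?m f) I" by (rule sum_mono2[OF \<open>finite I\<close> J]) simp
    also have "\<dots> \<le> (\<Sum>c\<in>I. ennreal (B c))" using f by (intro sum_mono B(2)) auto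
    also have "\<dots> = ennreal (sum B I)" by (rule sum_ennreal) (rule B(1))
    finally show "sum (?m f) J \<le> ennreal (sum B I)" .
  qed
qed

text \<open>The centres form a finite net of a compact path connected set containing
  \<open>K\<close> and \<open>A\<close>. Their closed doubled balls lie in \<open>D\<close>, so the
  images of these balls miss the frontier component through \<open>e\<close>. That component is
  merely connected, whereas the crossing argument needs a path; it is replaced by a path in the open
  complement of the images of the balls.\<close>

lemma frakA_frontier_distance:
  fixes D A K :: "'a::euclidean_space set"
  assumes dim: "2 \<le> DIM('a)" and D: "open D" "connected D"
    and A: "compact A" "A \<subseteq> D" "A \<noteq> {}" and K: "compact K" "K \<subseteq> D"
    and fin: "\<And>c r1 r2. c \<in> D \<Longrightarrow> 0 < r1 \<Longrightarrow> r1 < r2 \<Longrightarrow> \<exists>x\<in>D. r2 < dist x c \<Longrightarrow> ring_finite Q D c r1 r2"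
    and pos: "0 < \<delta>" "0 < r"
  obtains r0 where "0 < r0"
    "\<And>f x e. f \<in> frakA \<delta> r A Q D \<Longrightarrow> x \<in> K \<Longrightarrow> e \<in> closure ((\<lambda>x. sproj (f x)) ` D) - (\<lambda>x. sproj (f x)) ` D \<Longrightarrow>
      r0 \<le> dist e (sproj (f x))"
proof -
  have KA: "compact (K \<union> A)" "K \<union> A \<subseteq> D" "K \<union> A \<noteq> {}" using A K by auto
  obtain T where T: "compact T" "path_connected T" "K \<union> A \<subseteq> T" "T \<subseteq> D"
    using compact_path_connected_superset[OF D KA] .
  obtain d0 where d0: "0 < d0" "(\<Union>x\<in>T. ball x d0) \<subseteq> D"
    using compact_subset_open_imp_ball_epsilon_subset[OF T(1) D(1) T(4)] .
  \<comment> \<open>A third leaves room in \<open>D\<close> for closed balls of radius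
    \<open>2 * d\<close> and for a point at distance \<open>5/2 * d\<close> from the centre, which
    makes \<open>2 * d\<close> a legitimate outer radius in the ring inequality.\<close>
  define d where "d = d0 / 3"
  have d: "0 < d" using d0 by (simp add: d_def)
  have cball_d: "cball c (2 * d) \<subseteq> D" if "c \<in> T" for c
  proof -
    have "cball c (2 * d) \<subseteq> ball c d0" using d0(1) by (auto simp: d_def)
    then show ?thesis using d0(2) that by blast
  qed
  have far: "\<exists>x\<in>D. 2 * d < dist x c" if "c \<in> T" for c
  proof -
    obtain b :: 'a where b: "b \<in> Basis" using nonempty_Basis by blast
    have dist: "dist (c + (5/2 * d) *\<^sub>R b) c = 5/2 * d" using b d by (simp add: dist_norm)
    then have "c + (5/2 * d) *\<^sub>R b \<in> ball c d0" using d0(1) by (simp add: dist_commute d_def)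
    then have "c + (5/2 * d) *\<^sub>R b \<in> D" using d0(2) that by blast
    moreover have "2 * d < dist (c + (5/2 * d) *\<^sub>R b) c" unfolding dist using d by simp
    ultimately show ?thesis by blast
  qed
  have "T \<subseteq> (\<Union>c\<in>T. ball c d)" using d by auto
  then obtain I where I: "I \<subseteq> T" "finite I" "T \<subseteq> (\<Union>c\<in>I. ball c d)"
    by (rule compactE_image[OF T(1), rotated]) auto
  have d2: "0 < d" "d < 2 * d" using d by auto
  obtain B where B: "0 \<le> B" "\<And>f J. J \<subseteq> I \<Longrightarrow> \<forall>c\<in>I. ring_Q_ineq f Q D c \<Longrightarrow>
      (\<Sum>c\<in>J. modulus (image_family f D (curves (sphere c d) (sphere c (2 * d)) D))) \<le> ennreal B"
  proof (rule ring_finite_modulus_sum_bound[OF I(2) d2, where Q = Q and D = D])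
    fix c assume "c \<in> I"
    then have c: "c \<in> T" using I(1) by blast
    show "\<exists>x\<in>D. 2 * d < dist x c" by (rule far[OF c])
    show "ring_finite Q D c d (2 * d)" using fin[OF _ d2 far[OF c]] c T(4) by blast
  qed blast
  obtain C1 C2 :: real where C: "1 \<le> C1" "0 < C2" and
    L: "\<And>(D :: 'a set) f I r1 r2 B g h u v R. sphere_embedding D f \<Longrightarrow> 0 < r1 \<Longrightarrow> r1 < r2 \<Longrightarrow> finite I \<Longrightarrow> 0 \<le> B \<Longrightarrow>
      (\<Sum>c\<in>I. modulus (image_family f D (curves (sphere c r1) (sphere c r2) D))) \<le> ennreal B \<Longrightarrow>
      continuous_on {0..1::real} g \<Longrightarrow> g ` {0..1} \<subseteq> range sproj \<Longrightarrow> g 0 = sproj u \<Longrightarrow>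
      continuous_on {0..1::real} h \<Longrightarrow> h ` {0..1} \<subseteq> range sproj \<Longrightarrow> h 0 = sproj v \<Longrightarrow> u \<noteq> v \<Longrightarrow>
      \<exists>t\<in>{0..1}. R \<le> dist (g t) (sproj u) \<Longrightarrow> \<exists>t\<in>{0..1}. R \<le> dist (h t) (sproj u) \<Longrightarrow>
      \<forall>p. sproj p \<in> g ` {0..1} \<longrightarrow> (\<exists>c\<in>I. p \<in> f ` (cball c r1 \<inter> D)) \<Longrightarrow>
      \<forall>p c. sproj p \<in> h ` {0..1} \<longrightarrow> c \<in> I \<longrightarrow> p \<notin> f ` (ball c r2 \<inter> D) \<Longrightarrow>
      (\<forall>c\<in>I. cball c r2 \<subseteq> D) \<or> (\<forall>e\<in>closure ((\<lambda>x. sproj (f x)) ` D) - (\<lambda>x. sproj (f x)) ` D. 4 * R \<le> dist e (sproj u)) \<Longrightarrow>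
      R \<le> C1 * exp (C2 * B) * chordal u v"
    by (rule sphere_embedding_lower_bound[OF dim]) (rule that)
  \<comment> \<open>One factor 1/2 pays for diameters that need not be attained, the other for the
    triangle inequality: of two points at distance \<open>\<delta> / 2\<close> one is at least
    \<open>\<delta> / 4\<close> away from the value at x, and likewise for \<open>r\<close>.\<close>
  define R where "R = min \<delta> r / 4"
  have R: "0 < R" "R \<le> \<delta> / 4" "R \<le> r / 4" using pos by (auto simp: R_def)
  define W where "W = (\<Union>c\<in>I. cball c (2 * d))"
  have W: "compact W" "W \<subseteq> D" using I(1,2) cball_d by (auto simp: W_def)
  have key: "R / (C1 * exp (C2 * B)) \<le> dist e (sproj (f x))"
    if f: "f \<in> frakA \<delta> r A Q D" and x: "x \<in> K" and e: "e \<in> closure ((\<lambda>x. sproj (f x)) ` D) - (\<lambda>x. sproj (f x)) ` D" for f x e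
  proof -
    interpret sphere_embedding D f by (rule frakA_sphere_embedding[OF D(1) f])
    have rQ: "\<forall>c\<in>I. ring_Q_ineq f Q D c" using f I(1) T(4) by (auto simp: frakA_def)
    obtain v where v: "e = sproj v" using e closure_image_subset_range by blast
    obtain a b where ab: "a \<in> A" "b \<in> A" "\<delta> / 2 \<le> dist (F a) (F b)" using frakA_diam[OF f pos(1)] by blast
    have "dist (F a) (F b) \<le> dist (F a) (F x) + dist (F b) (F x)" by (rule dist_triangle2)
    then have "R \<le> dist (F a) (F x) \<or> R \<le> dist (F b) (F x)" using ab(3) R(2) by linarith
    then obtain p where p: "p \<in> A" "R \<le> dist (F p) (F x)" using ab(1,2) by blast
    have "x \<in> T" "p \<in> T" using x p(1) T(3) by auto
    then obtain \<gamma> where \<gamma>: "path \<gamma>" "path_image \<gamma> \<subseteq> T" "pathstart \<gamma> = x" "pathfinish \<gamma> = p"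
      using T(2) unfolding path_connected_def by blast
    define g where "g = (\<lambda>t. F (\<gamma> t))"
    have \<gamma>D: "\<gamma> ` {0..1} \<subseteq> T" using \<gamma>(2) by (simp add: path_image_def)
    have g: "continuous_on {0..1} g" unfolding g_def
      using \<gamma>(1) \<gamma>D T(4) by (intro continuous_on_compose2[OF cont]) (auto simp: path_def)
    have g0: "g 0 = sproj (f x)" using \<gamma>(3) by (simp add: g_def pathstart_def)
    have g1: "R \<le> dist (g 1) (sproj (f x))" using \<gamma>(4) p(2) by (simp add: g_def pathfinish_def)
    obtain E where E: "connected E" "e \<in> E" "E \<subseteq> closure (F ` D) - F ` D" "\<exists>p\<in>E. \<exists>q\<in>E. r / 2 \<le> dist p q"
      using frakA_frontier_continuum[OF D(1) f pos(2) e] .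
    obtain p0 q0 where pq: "p0 \<in> E" "q0 \<in> E" "r / 2 \<le> dist p0 q0" using E(4) by blast
    have "dist p0 q0 \<le> dist p0 (F x) + dist q0 (F x)" by (rule dist_triangle2)
    then have "R \<le> dist p0 (F x) \<or> R \<le> dist q0 (F x)" using pq(3) R(3) by linarith
    then obtain p1 where p1: "p1 \<in> E" "R \<le> dist p1 (F x)" using pq(1,2) by blast
    \<comment> \<open>Open in the sphere, which is locally path connected; inside it the
      connectedness of \<open>E\<close> is upgraded to a path.\<close>
    define V where "V = range (sproj :: 'a option \<Rightarrow> 'a \<times> real) - F ` W"
    have "compact (F ` W)" using W by (intro compact_continuous_image continuous_on_subset[OF cont])
    then have "openin (top_of_set (range sproj)) V"
      unfolding V_def by (intro openin_diff) (auto intro!: closed_subset compact_imp_closed)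
    moreover have "locally path_connected (range (sproj :: 'a option \<Rightarrow> 'a \<times> real))"
      unfolding range_sproj by (rule locally_path_connected_sphere)
    ultimately have "path_component V e = connected_component V e"
      by (intro path_component_eq_connected_component) (rule locally_open_subset)
    moreover have "E \<subseteq> V" using E(3) W(2) closure_image_subset_range[of D] unfolding V_def by auto
    then have "connected_component V e p1" unfolding connected_component_def using E(1,2) p1(1) by blast
    ultimately have "path_component V e p1" by simp
    then obtain h where h: "path h" "path_image h \<subseteq> V" "pathstart h = e" "pathfinish h = p1"
      unfolding path_component_def by blast
    have hV: "h ` {0..1} \<subseteq> V" using h(2) by (simp add: path_image_def)
    have uv: "f x \<noteq> v" using e v x K(2) by auto
    have "R \<le> C1 * exp (C2 * B) * chordal (f x) v"
    proof (rule L[OF sphere_embedding_axioms d2 I(2) B(1) B(2)[OF order_refl rQ] g _ g0 _ _ _ uv])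
      show "g ` {0..1} \<subseteq> range sproj" by (auto simp: g_def)
      show "continuous_on {0..1} h" using h(1) by (simp add: path_def)
      show "h ` {0..1} \<subseteq> range sproj" using hV by (auto simp: V_def)
      show "h 0 = sproj v" using h(3) v by (simp add: pathstart_def)
      show "\<exists>t\<in>{0..1}. R \<le> dist (g t) (sproj (f x))" using g1 by (intro bexI[of _ 1]) auto
      show "\<exists>t\<in>{0..1}. R \<le> dist (h t) (sproj (f x))" using h(4) p1(2) by (intro bexI[of _ 1]) (auto simp: pathfinish_def)
      show "\<forall>p. sproj p \<in> g ` {0..1} \<longrightarrow> (\<exists>c\<in>I. p \<in> f ` (cball c d \<inter> D))"
      proof (intro allI impI)
        fix q assume "sproj q \<in> g ` {0..1}"
        then obtain t where t: "t \<in> {0..1}" "sproj q = sproj (f (\<gamma> t))" by (auto simp: g_def)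
        have "q = f (\<gamma> t)" by (rule injD[OF inj_sproj t(2)])
        moreover have "\<gamma> t \<in> T" using \<gamma>D t(1) by blast
        moreover from this obtain c where "c \<in> I" "\<gamma> t \<in> ball c d" using I(3) by blast
        ultimately show "\<exists>c\<in>I. q \<in> f ` (cball c d \<inter> D)" using T(4) ball_subset_cball by blast
      qed
      show "\<forall>p c. sproj p \<in> h ` {0..1} \<longrightarrow> c \<in> I \<longrightarrow> p \<notin> f ` (ball c (2 * d) \<inter> D)"
      proof (intro allI impI)
        fix q c assume q: "sproj q \<in> h ` {0..1}" and c: "c \<in> I"
        have "sproj q \<notin> F ` W" using q hV by (auto simp: V_def)
        then have "q \<notin> f ` W" by (simp add: sproj_mem_image_iff)
        moreover have "ball c (2 * d) \<subseteq> W" using c by (auto simp: W_def)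
        ultimately show "q \<notin> f ` (ball c (2 * d) \<inter> D)" by blast
      qed
      show "(\<forall>c\<in>I. cball c (2 * d) \<subseteq> D) \<or> (\<forall>e\<in>closure (F ` D) - F ` D. 4 * R \<le> dist e (sproj (f x)))"
        using cball_d I(1) by blast
    qed
    then show ?thesis using C(1) v by (simp add: chordal_eq_dist dist_commute divide_le_eq mult.commute)
  qed
  show ?thesis
  proof (rule that[of "R / (C1 * exp (C2 * B))"])
    show "0 < R / (C1 * exp (C2 * B))" using R(1) C(1) by simp
  qed (rule key)
qed

section \<open>Separation of two values by opposite rays\<close>

context sphere_embedding
begin

text \<open>As the frontier is farther than \<open>R\<close> from \<open>p\<close>, the image and
  its closure have the same points within distance \<open>R\<close> of \<open>p\<close>; this part
  of the image is compact, and the inverse map is continuous.\<close>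

lemma compact_sublevel:
  assumes "\<And>e. e \<in> closure (F ` D) - F ` D \<Longrightarrow> R < dist e p"
  shows "compact {w \<in> D. dist (F w) p \<le> R}"
proof -
  have "F ` D \<inter> cball p R = closure (F ` D) \<inter> cball p R"
  proof
    show "closure (F ` D) \<inter> cball p R \<subseteq> F ` D \<inter> cball p R"
    proof (rule subsetI, rule IntI)
      fix q assume q: "q \<in> closure (F ` D) \<inter> cball p R"
      show "q \<in> F ` D"
      proof (rule ccontr)
        assume "q \<notin> F ` D"
        then have "R < dist q p" using q by (intro assms) auto
        then show False using q by (simp add: dist_commute)
      qed
    qed simp
  qed (use closure_subset[of "F ` D"] in blast)
  then have "compact (F ` D \<inter> cball p R)" by (simp add: closed_Int_compact)
  then have "compact (inv_into D F ` (F ` D \<inter> cball p R))"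
    by (intro compact_continuous_image continuous_on_subset[OF cont_inv]) auto
  moreover have "inv_into D F ` (F ` D \<inter> cball p R) = {w \<in> D. dist (F w) p \<le> R}"
  proof
    show "inv_into D F ` (F ` D \<inter> cball p R) \<subseteq> {w \<in> D. dist (F w) p \<le> R}"
    proof
      fix w assume "w \<in> inv_into D F ` (F ` D \<inter> cball p R)"
      then obtain x where "x \<in> D" "F x \<in> cball p R" "w = inv_into D F (F x)" by blast
      then show "w \<in> {w \<in> D. dist (F w) p \<le> R}" by (simp add: inv_into_f_f[OF inj_F] dist_commute)
    qed
    show "{w \<in> D. dist (F w) p \<le> R} \<subseteq> inv_into D F ` (F ` D \<inter> cball p R)"
    proof
      fix w assume w: "w \<in> {w \<in> D. dist (F w) p \<le> R}"
      then have "F w \<in> F ` D \<inter> cball p R" by (simp add: dist_commute)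
      moreover have "w = inv_into D F (F w)" using w by (simp add: inv_into_f_f[OF inj_F])
      ultimately show "w \<in> inv_into D F ` (F ` D \<inter> cball p R)" by (rule rev_image_eqI)
    qed
  qed
  ultimately show ?thesis by simp
qed

text \<open>The sublevel set is a compact subset of \<open>D\<close>, while the ray is unbounded.
  The ray thus leaves the open sublevel set while still inside \<open>D\<close>, and at the first
  such moment the value is at distance at least \<open>R\<close>. The boundary of \<open>D\<close>
  plays no part, so \<open>D\<close> may be unbounded.\<close>

lemma ray_exit:
  assumes far: "\<And>e. e \<in> closure (F ` D) - F ` D \<Longrightarrow> R < dist e p"
    and z: "z \<in> D" "dist (F z) p < R" and v: "v \<noteq> 0"
  obtains T where "0 \<le> T" "\<And>t. t \<in> {0..T} \<Longrightarrow> z + t *\<^sub>R v \<in> D" "R \<le> dist (F (z + T *\<^sub>R v)) p"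
proof -
  define L where "L = {w \<in> D. dist (F w) p \<le> R}"
  define U where "U = {w \<in> D. dist (F w) p < R}"
  have L: "compact L" unfolding L_def by (rule compact_sublevel[OF far])
  have UL: "U \<subseteq> L" by (auto simp: U_def L_def)
  have U: "open U"
  proof -
    have "continuous_on D (\<lambda>w. dist (F w) p)" by (intro continuous_intros cont)
    then have "open (D \<inter> (\<lambda>w. dist (F w) p) -` {..<R})" using open_D by (simp add: continuous_on_open_vimage Int_commute)
    moreover have "D \<inter> (\<lambda>w. dist (F w) p) -` {..<R} = U" by (auto simp: U_def)
    ultimately show ?thesis by simp
  qed
  define X where "X = {t. 0 \<le> t \<and> z + t *\<^sub>R v \<notin> U}"
  have c: "continuous_on UNIV (\<lambda>t. z + t *\<^sub>R v)" by (intro continuous_intros)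
  have "closed ({0..} \<inter> (\<lambda>t. z + t *\<^sub>R v) -` (- U))"
    using U c by (intro closed_Int closed_vimage) auto
  moreover have "{0..} \<inter> (\<lambda>t. z + t *\<^sub>R v) -` (- U) = X" by (auto simp: X_def)
  ultimately have X: "closed X" by simp
  obtain b where b: "\<And>w. w \<in> L \<Longrightarrow> norm w \<le> b" using compact_imp_bounded[OF L] unfolding bounded_iff by blast
  \<comment> \<open>A parameter at which the ray is certainly outside the bounded sublevel
    set.\<close>
  define s where "s = (\<bar>b\<bar> + norm z + 1) / norm v"
  have "0 \<le> s" by (simp add: s_def)
  have "z + s *\<^sub>R v \<notin> U"
  proof
    assume "z + s *\<^sub>R v \<in> U"
    then have "norm (z + s *\<^sub>R v) \<le> b" using b UL by blast
    moreover have "norm (s *\<^sub>R v) \<le> norm (z + s *\<^sub>R v) + norm z" using norm_triangle_ineq4[of "z + s *\<^sub>R v" z] by simp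
    moreover have "norm (s *\<^sub>R v) = \<bar>b\<bar> + norm z + 1" using v by (simp add: s_def)
    ultimately show False by linarith
  qed
  then have ne: "s \<in> X" using \<open>0 \<le> s\<close> by (simp add: X_def)
  define T where "T = Inf X"
  have bdd: "bdd_below X" by (rule bdd_belowI[of _ 0]) (simp add: X_def)
  have TX: "T \<in> X" unfolding T_def using ne by (intro closed_contains_Inf bdd X) auto
  have "z + 0 *\<^sub>R v \<in> U" using z by (simp add: U_def)
  then have "T \<noteq> 0" using TX unfolding X_def by blast
  then have T: "0 < T" using TX by (simp add: X_def)
  have below: "z + t *\<^sub>R v \<in> U" if "0 \<le> t" "t < T" for t
  proof (rule ccontr)
    assume "\<not> ?thesis"
    then have "t \<in> X" using that(1) by (simp add: X_def)
    then have "T \<le> t" unfolding T_def by (rule cInf_lower[OF _ bdd])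
    then show False using that(2) by simp
  qed
  have "closed ((\<lambda>t. z + t *\<^sub>R v) -` L)" using compact_imp_closed[OF L] c by (rule closed_vimage)
  then have "closure {0..<T} \<subseteq> (\<lambda>t. z + t *\<^sub>R v) -` L"
    by (intro closure_minimal subsetI vimageI2 subsetD[OF UL] below) auto
  then have TL: "z + t *\<^sub>R v \<in> L" if "t \<in> {0..T}" for t using that T by auto
  show ?thesis
  proof
    show "0 \<le> T" using T by simp
    show "z + t *\<^sub>R v \<in> D" if "t \<in> {0..T}" for t using TL[OF that] by (simp add: L_def)
    have "z + T *\<^sub>R v \<in> D" using TL[of T] T by (simp add: L_def)
    then show "R \<le> dist (F (z + T *\<^sub>R v)) p" using TX by (simp add: X_def U_def not_less)
  qed
qed

end

text \<open>The difference of the two points is \<open>(1 + s + t) *\<^sub>R (x - y)\<close>. This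
  keeps the balls around the first ray off the second one.\<close>

lemma dist_opposite_rays:
  fixes x y :: "'a::real_normed_vector"
  assumes "0 \<le> s" "0 \<le> t"
  shows "dist x y \<le> dist (x + s *\<^sub>R (x - y)) (y + t *\<^sub>R (y - x))"
proof -
  have "(x + s *\<^sub>R (x - y)) - (y + t *\<^sub>R (y - x)) = (1 + s + t) *\<^sub>R (x - y)" by (simp add: algebra_simps)
  then have "dist (x + s *\<^sub>R (x - y)) (y + t *\<^sub>R (y - x)) = (1 + s + t) * dist x y"
    using assms by (simp only: dist_norm norm_scaleR)
  moreover have "1 * dist x y \<le> (1 + s + t) * dist x y" using assms by (intro mult_right_mono) auto
  ultimately show ?thesis by simp
qed

text \<open>A cover is requested for every \<open>T\<close>, since the exit time of the ray depends
  on the map while \<open>B\<close> must not. The balls of radius \<open>r2\<close> about centres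
  within \<open>r1\<close> of the first ray miss the second because
  \<open>r1 + r2 \<le> dist x y\<close>. If the values are already at distance \<open>R\<close>, the
  claim is immediate from \<open>C1 \<ge> 1\<close>.\<close>

lemma sphere_embedding_separation:
  assumes dim: "2 \<le> DIM('a::euclidean_space)"
  obtains C1 C2 :: real where "1 \<le> C1" "0 < C2"
    "\<And>(D :: 'a set) f x y r1 r2 B R. sphere_embedding D f \<Longrightarrow> x \<in> D \<Longrightarrow> y \<in> D \<Longrightarrow> 0 < r1 \<Longrightarrow> r1 < r2 \<Longrightarrow>
      r1 + r2 \<le> dist x y \<Longrightarrow> 0 \<le> B \<Longrightarrow> 0 < R \<Longrightarrow>
      \<forall>e\<in>closure ((\<lambda>x. sproj (f x)) ` D) - (\<lambda>x. sproj (f x)) ` D. 4 * R \<le> dist e (sproj (f x)) \<Longrightarrow>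
      \<forall>T\<ge>0. (\<forall>t\<in>{0..T}. x + t *\<^sub>R (x - y) \<in> D) \<longrightarrow>
        (\<exists>I. finite I \<and> (\<forall>t\<in>{0..T}. \<exists>c\<in>I. dist (x + t *\<^sub>R (x - y)) c \<le> r1) \<and>
             (\<forall>c\<in>I. \<exists>t\<in>{0..T}. dist (x + t *\<^sub>R (x - y)) c \<le> r1) \<and>
             (\<Sum>c\<in>I. modulus (image_family f D (curves (sphere c r1) (sphere c r2) D))) \<le> ennreal B) \<Longrightarrow>
      R \<le> C1 * exp (C2 * B) * chordal (f x) (f y)"
proof -
  obtain C1 C2 :: real where C: "1 \<le> C1" "0 < C2" and
    L: "\<And>(D :: 'a set) f I r1 r2 B g h u v R. sphere_embedding D f \<Longrightarrow> 0 < r1 \<Longrightarrow> r1 < r2 \<Longrightarrow> finite I \<Longrightarrow> 0 \<le> B \<Longrightarrow>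
      (\<Sum>c\<in>I. modulus (image_family f D (curves (sphere c r1) (sphere c r2) D))) \<le> ennreal B \<Longrightarrow>
      continuous_on {0..1::real} g \<Longrightarrow> g ` {0..1} \<subseteq> range sproj \<Longrightarrow> g 0 = sproj u \<Longrightarrow>
      continuous_on {0..1::real} h \<Longrightarrow> h ` {0..1} \<subseteq> range sproj \<Longrightarrow> h 0 = sproj v \<Longrightarrow> u \<noteq> v \<Longrightarrow>
      \<exists>t\<in>{0..1}. R \<le> dist (g t) (sproj u) \<Longrightarrow> \<exists>t\<in>{0..1}. R \<le> dist (h t) (sproj u) \<Longrightarrow>
      \<forall>p. sproj p \<in> g ` {0..1} \<longrightarrow> (\<exists>c\<in>I. p \<in> f ` (cball c r1 \<inter> D)) \<Longrightarrow>
      \<forall>p c. sproj p \<in> h ` {0..1} \<longrightarrow> c \<in> I \<longrightarrow> p \<notin> f ` (ball c r2 \<inter> D) \<Longrightarrow>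
      (\<forall>c\<in>I. cball c r2 \<subseteq> D) \<or> (\<forall>e\<in>closure ((\<lambda>x. sproj (f x)) ` D) - (\<lambda>x. sproj (f x)) ` D. 4 * R \<le> dist e (sproj u)) \<Longrightarrow>
      R \<le> C1 * exp (C2 * B) * chordal u v"
    by (rule sphere_embedding_lower_bound[OF dim]) (rule that)
  have main: "R \<le> C1 * exp (C2 * B) * chordal (f x) (f y)"
    if emb: "sphere_embedding D f" and x: "x \<in> D" and y: "y \<in> D" and r: "0 < r1" "r1 < r2" "r1 + r2 \<le> dist x y"
      and B: "0 \<le> B" and R: "0 < R"
      and far: "\<forall>e\<in>closure ((\<lambda>x. sproj (f x)) ` D) - (\<lambda>x. sproj (f x)) ` D. 4 * R \<le> dist e (sproj (f x))"
      and cover: "\<forall>T\<ge>0. (\<forall>t\<in>{0..T}. x + t *\<^sub>R (x - y) \<in> D) \<longrightarrow>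
        (\<exists>I. finite I \<and> (\<forall>t\<in>{0..T}. \<exists>c\<in>I. dist (x + t *\<^sub>R (x - y)) c \<le> r1) \<and>
             (\<forall>c\<in>I. \<exists>t\<in>{0..T}. dist (x + t *\<^sub>R (x - y)) c \<le> r1) \<and>
             (\<Sum>c\<in>I. modulus (image_family f D (curves (sphere c r1) (sphere c r2) D))) \<le> ennreal B)"
    for D :: "'a set" and f x y r1 r2 B R
  proof (cases "R \<le> chordal (f x) (f y)")
    case True
    have "1 * 1 \<le> C1 * exp (C2 * B)" using C B by (intro mult_mono) auto
    then have "1 * chordal (f x) (f y) \<le> C1 * exp (C2 * B) * chordal (f x) (f y)"
      by (intro mult_right_mono) (auto simp: chordal_nonneg)
    then show ?thesis using True by simp
  next
    case False
    interpret sphere_embedding D f by (rule emb)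
    have xy: "x \<noteq> y" using r by auto
    have far': "R < dist e (F x)" if "e \<in> closure (F ` D) - F ` D" for e using far that R by force
    have near: "dist (F x) (F x) < R" "dist (F y) (F x) < R"
      using False R by (auto simp: chordal_eq_dist dist_commute)
    obtain T1 where T1: "0 \<le> T1" "\<And>t. t \<in> {0..T1} \<Longrightarrow> x + t *\<^sub>R (x - y) \<in> D" "R \<le> dist (F (x + T1 *\<^sub>R (x - y))) (F x)"
      by (rule ray_exit[OF far' x near(1), where v = "x - y"]) (use xy in auto)
    obtain T2 where T2: "0 \<le> T2" "\<And>t. t \<in> {0..T2} \<Longrightarrow> y + t *\<^sub>R (y - x) \<in> D" "R \<le> dist (F (y + T2 *\<^sub>R (y - x))) (F x)"
      by (rule ray_exit[OF far' y near(2), where v = "y - x"]) (use xy in auto)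
    obtain I where I: "finite I" "\<forall>t\<in>{0..T1}. \<exists>c\<in>I. dist (x + t *\<^sub>R (x - y)) c \<le> r1"
       "\<forall>c\<in>I. \<exists>t\<in>{0..T1}. dist (x + t *\<^sub>R (x - y)) c \<le> r1"
       "(\<Sum>c\<in>I. modulus (image_family f D (curves (sphere c r1) (sphere c r2) D))) \<le> ennreal B"
      using cover T1(1,2) by meson
    define g where "g = (\<lambda>t. F (x + (t * T1) *\<^sub>R (x - y)))"
    define h where "h = (\<lambda>t. F (y + (t * T2) *\<^sub>R (y - x)))"
    have m1: "t * T1 \<in> {0..T1}" and m2: "t * T2 \<in> {0..T2}" if "t \<in> {0..1}" for t
      using that T1(1) T2(1) by (auto intro: mult_left_le_one_le)
    have uv: "f x \<noteq> f y" using xy inj_F x y by (metis inj_onD)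
    show ?thesis
    proof (rule L[OF emb r(1,2) I(1) B I(4), of g "f x" h "f y"])
      show "continuous_on {0..1} g" unfolding g_def
        using T1(2) m1 by (intro continuous_on_compose2[OF cont] continuous_intros) blast
      show "continuous_on {0..1} h" unfolding h_def
        using T2(2) m2 by (intro continuous_on_compose2[OF cont] continuous_intros) blast
      show "\<exists>t\<in>{0..1}. R \<le> dist (g t) (sproj (f x))" using T1(3) by (intro bexI[of _ 1]) (auto simp: g_def)
      show "\<exists>t\<in>{0..1}. R \<le> dist (h t) (sproj (f x))" using T2(3) by (intro bexI[of _ 1]) (auto simp: h_def)
      show "\<forall>p. sproj p \<in> g ` {0..1} \<longrightarrow> (\<exists>c\<in>I. p \<in> f ` (cball c r1 \<inter> D))"
      proof (intro allI impI)
        fix q assume "sproj q \<in> g ` {0..1}"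
        then obtain t where t: "t \<in> {0..1}" "sproj q = sproj (f (x + (t * T1) *\<^sub>R (x - y)))" by (auto simp: g_def)
        have "q = f (x + (t * T1) *\<^sub>R (x - y))" by (rule injD[OF inj_sproj t(2)])
        moreover have "x + (t * T1) *\<^sub>R (x - y) \<in> D" by (rule T1(2)[OF m1[OF t(1)]])
        moreover obtain c where c: "c \<in> I" "dist (x + (t * T1) *\<^sub>R (x - y)) c \<le> r1" using I(2) m1[OF t(1)] by blast
        moreover have "x + (t * T1) *\<^sub>R (x - y) \<in> cball c r1" using c(2) by (simp add: dist_commute)
        ultimately show "\<exists>c\<in>I. q \<in> f ` (cball c r1 \<inter> D)" by blast
      qed
      show "\<forall>p c. sproj p \<in> h ` {0..1} \<longrightarrow> c \<in> I \<longrightarrow> p \<notin> f ` (ball c r2 \<inter> D)"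
      proof (intro allI impI notI)
        fix q c assume q: "sproj q \<in> h ` {0..1}" and c: "c \<in> I" and mem: "q \<in> f ` (ball c r2 \<inter> D)"
        obtain t where t: "t \<in> {0..1}" "sproj q = F (y + (t * T2) *\<^sub>R (y - x))" using q by (auto simp: h_def)
        let ?w = "y + (t * T2) *\<^sub>R (y - x)"
        have wD: "?w \<in> D" by (rule T2(2)[OF m2[OF t(1)]])
        have "F ?w \<in> F ` (ball c r2 \<inter> D)" using mem t(2) by (metis sproj_mem_image_iff)
        then have "?w \<in> ball c r2 \<inter> D" using wD by (subst (asm) F_mem_iff) auto
        then have w: "dist c ?w < r2" by simp
        obtain s where s: "s \<in> {0..T1}" "dist (x + s *\<^sub>R (x - y)) c \<le> r1" using I(3) c by blast
        have "dist x y \<le> dist (x + s *\<^sub>R (x - y)) ?w" using s(1) m2[OF t(1)] by (intro dist_opposite_rays) auto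
        also have "\<dots> \<le> dist (x + s *\<^sub>R (x - y)) c + dist c ?w" by (rule dist_triangle)
        also have "\<dots> < r1 + r2" using s(2) w by simp
        finally show False using r(3) by simp
      qed
    qed (use uv far in \<open>auto simp: g_def h_def\<close>)
  qed
  show thesis by (rule that[OF C]) (erule (9) main)
qed

section \<open>Equi-uniformity, lightness and openness\<close>

lemma equi_uniform_frakA:
  fixes D K :: "'a::euclidean_space set"
  assumes dim: "2 \<le> DIM('a)" and D: "open D" "bounded D" and K: "K \<subseteq> D"
    and fin: "\<And>c r1 r2. c \<in> D \<Longrightarrow> 0 < r1 \<Longrightarrow> r1 < r2 \<Longrightarrow> \<exists>x\<in>D. r2 < dist x c \<Longrightarrow> ring_finite Q D c r1 r2"
    and r0: "0 < r0" "\<And>f x e. f \<in> frakA \<delta> r A Q D \<Longrightarrow> x \<in> K \<Longrightarrow>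
      e \<in> closure ((\<lambda>x. sproj (f x)) ` D) - (\<lambda>x. sproj (f x)) ` D \<Longrightarrow> r0 \<le> dist e (sproj (f x))"
  shows "equi_uniform (frakA \<delta> r A Q D) K"
  unfolding equi_uniform_def
proof (intro allI impI)
  fix \<epsilon> :: real assume \<epsilon>: "0 < \<epsilon>"
  obtain C1 C2 :: real where C: "1 \<le> C1" "0 < C2" and
    S: "\<And>(D :: 'a set) f x y r1 r2 B R. sphere_embedding D f \<Longrightarrow> x \<in> D \<Longrightarrow> y \<in> D \<Longrightarrow> 0 < r1 \<Longrightarrow> r1 < r2 \<Longrightarrow>
      r1 + r2 \<le> dist x y \<Longrightarrow> 0 \<le> B \<Longrightarrow> 0 < R \<Longrightarrow>
      \<forall>e\<in>closure ((\<lambda>x. sproj (f x)) ` D) - (\<lambda>x. sproj (f x)) ` D. 4 * R \<le> dist e (sproj (f x)) \<Longrightarrow>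
      \<forall>T\<ge>0. (\<forall>t\<in>{0..T}. x + t *\<^sub>R (x - y) \<in> D) \<longrightarrow>
        (\<exists>I. finite I \<and> (\<forall>t\<in>{0..T}. \<exists>c\<in>I. dist (x + t *\<^sub>R (x - y)) c \<le> r1) \<and>
             (\<forall>c\<in>I. \<exists>t\<in>{0..T}. dist (x + t *\<^sub>R (x - y)) c \<le> r1) \<and>
             (\<Sum>c\<in>I. modulus (image_family f D (curves (sphere c r1) (sphere c r2) D))) \<le> ennreal B) \<Longrightarrow>
      R \<le> C1 * exp (C2 * B) * chordal (f x) (f y)"
    by (rule sphere_embedding_separation[OF dim]) (rule that)
  have cl: "compact (closure D)" using D(2) by simp
  \<comment> \<open>Boundedness of \<open>D\<close> gives one finite net for all maps and all rays.
    The radii \<open>\<epsilon>/8\<close> and \<open>\<epsilon>/4\<close> add up to less than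
    \<open>\<epsilon>\<close>, as the separation requires.\<close>
  have "closure D \<subseteq> (\<Union>c\<in>D. ball c (\<epsilon>/8))"
  proof
    fix x assume "x \<in> closure D"
    then obtain c where "c \<in> D" "dist c x < \<epsilon>/8" using \<epsilon> closure_approachable by (metis divide_pos_pos zero_less_numeral)
    then show "x \<in> (\<Union>c\<in>D. ball c (\<epsilon>/8))" by auto
  qed
  then obtain I0 where I0: "I0 \<subseteq> D" "finite I0" "closure D \<subseteq> (\<Union>c\<in>I0. ball c (\<epsilon>/8))"
    by (rule compactE_image[OF cl, rotated]) auto
  \<comment> \<open>The centres for which \<open>\<epsilon>/4\<close> is a legitimate outer radius.
    Only these are used, because y itself is farther than \<open>\<epsilon>/4\<close> from every
    centre close to the ray.\<close>
  define I1 where "I1 = {c \<in> I0. \<exists>w\<in>D. \<epsilon>/4 < dist w c}"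
  have I1: "finite I1" "I1 \<subseteq> D" using I0 by (auto simp: I1_def)
  have e8: "0 < \<epsilon>/8" "\<epsilon>/8 < \<epsilon>/4" using \<epsilon> by auto
  obtain B where B: "0 \<le> B" "\<And>f J. J \<subseteq> I1 \<Longrightarrow> \<forall>c\<in>I1. ring_Q_ineq f Q D c \<Longrightarrow>
      (\<Sum>c\<in>J. modulus (image_family f D (curves (sphere c (\<epsilon>/8)) (sphere c (\<epsilon>/4)) D))) \<le> ennreal B"
  proof (rule ring_finite_modulus_sum_bound[OF I1(1) e8, where Q = Q and D = D])
    fix c assume c: "c \<in> I1"
    show far: "\<exists>x\<in>D. \<epsilon>/4 < dist x c" using c by (auto simp: I1_def)
    show "ring_finite Q D c (\<epsilon>/8) (\<epsilon>/4)" using fin[OF _ e8 far] c I1(2) by blast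
  qed blast
  define R where "R = r0 / 4"
  have R: "0 < R" using r0(1) by (simp add: R_def)
  show "\<exists>\<delta>1>0. \<forall>f\<in>frakA \<delta> r A Q D. \<forall>x\<in>K. \<forall>y\<in>K. \<epsilon> \<le> chordal (Some x) (Some y) \<longrightarrow> \<delta>1 \<le> chordal (f x) (f y)"
  proof (intro exI[of _ "R / (C1 * exp (C2 * B))"] conjI ballI impI)
    show "0 < R / (C1 * exp (C2 * B))" using R C(1) by simp
    fix f x y
    assume f: "f \<in> frakA \<delta> r A Q D" and x: "x \<in> K" and y: "y \<in> K" and far: "\<epsilon> \<le> chordal (Some x) (Some y)"
    have eps: "\<epsilon> \<le> dist x y" using far chordal_le_norm[of x y] by (simp add: dist_norm)
    have xD: "x \<in> D" and yD: "y \<in> D" using x y K by auto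
    have "R \<le> C1 * exp (C2 * B) * chordal (f x) (f y)"
    proof (rule S[OF frakA_sphere_embedding[OF D(1) f] xD yD e8 _ B(1) R])
      show "\<epsilon>/8 + \<epsilon>/4 \<le> dist x y" using eps \<epsilon> by simp
      show "\<forall>e\<in>closure ((\<lambda>x. sproj (f x)) ` D) - (\<lambda>x. sproj (f x)) ` D. 4 * R \<le> dist e (sproj (f x))"
        using r0(2)[OF f x] by (simp add: R_def)
      show "\<forall>T\<ge>0. (\<forall>t\<in>{0..T}. x + t *\<^sub>R (x - y) \<in> D) \<longrightarrow>
        (\<exists>I. finite I \<and> (\<forall>t\<in>{0..T}. \<exists>c\<in>I. dist (x + t *\<^sub>R (x - y)) c \<le> \<epsilon>/8) \<and>
             (\<forall>c\<in>I. \<exists>t\<in>{0..T}. dist (x + t *\<^sub>R (x - y)) c \<le> \<epsilon>/8) \<and>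
             (\<Sum>c\<in>I. modulus (image_family f D (curves (sphere c (\<epsilon>/8)) (sphere c (\<epsilon>/4)) D))) \<le> ennreal B)"
      proof (intro allI impI)
        fix T :: real assume T: "0 \<le> T" "\<forall>t\<in>{0..T}. x + t *\<^sub>R (x - y) \<in> D"
        define I where "I = {c \<in> I0. \<exists>t\<in>{0..T}. dist (x + t *\<^sub>R (x - y)) c \<le> \<epsilon>/8}"
        have "I \<subseteq> I1"
        proof
          fix c assume "c \<in> I"
          then obtain t where t: "c \<in> I0" "t \<in> {0..T}" "dist (x + t *\<^sub>R (x - y)) c \<le> \<epsilon>/8" by (auto simp: I_def)
          have "dist x y \<le> dist (x + t *\<^sub>R (x - y)) y" using dist_opposite_rays[of t 0 x y] t(2) by simp
          also have "\<dots> \<le> dist (x + t *\<^sub>R (x - y)) c + dist y c" by (rule dist_triangle2)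
          finally have "\<epsilon>/4 < dist y c" using t(3) eps \<epsilon> by linarith
          then show "c \<in> I1" using t(1) yD by (auto simp: I1_def)
        qed
        moreover have "\<forall>c\<in>I1. ring_Q_ineq f Q D c" using f I1(2) by (auto simp: frakA_def)
        ultimately have "(\<Sum>c\<in>I. modulus (image_family f D (curves (sphere c (\<epsilon>/8)) (sphere c (\<epsilon>/4)) D))) \<le> ennreal B"
          by (rule B(2))
        moreover have "\<exists>c\<in>I. dist (x + t *\<^sub>R (x - y)) c \<le> \<epsilon>/8" if t: "t \<in> {0..T}" for t
        proof -
          have "x + t *\<^sub>R (x - y) \<in> closure D" using T(2) t closure_subset[of D] by blast
          then obtain c where c: "c \<in> I0" "x + t *\<^sub>R (x - y) \<in> ball c (\<epsilon>/8)" using I0(3) by blast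
          then have "dist (x + t *\<^sub>R (x - y)) c \<le> \<epsilon>/8" by (simp add: dist_commute)
          moreover from this have "c \<in> I" using c(1) t unfolding I_def by blast
          ultimately show ?thesis by blast
        qed
        moreover have "finite I" using I0(2) by (simp add: I_def)
        ultimately show "\<exists>I. finite I \<and> (\<forall>t\<in>{0..T}. \<exists>c\<in>I. dist (x + t *\<^sub>R (x - y)) c \<le> \<epsilon>/8) \<and>
             (\<forall>c\<in>I. \<exists>t\<in>{0..T}. dist (x + t *\<^sub>R (x - y)) c \<le> \<epsilon>/8) \<and>
             (\<Sum>c\<in>I. modulus (image_family f D (curves (sphere c (\<epsilon>/8)) (sphere c (\<epsilon>/4)) D))) \<le> ennreal B"
          by (intro exI[of _ I] conjI) (simp_all add: I_def)
      qed
    qed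
    then show "R / (C1 * exp (C2 * B)) \<le> chordal (f x) (f y)" using C(1) by (simp add: divide_le_eq mult.commute)
  qed
qed

lemma equi_uniform_imp_uniformly_light:
  assumes "equi_uniform \<F> K"
  shows "uniformly_light \<F> K"
  unfolding uniformly_light_def
proof (intro allI impI)
  fix \<epsilon> :: real assume \<epsilon>: "0 < \<epsilon>"
  then obtain \<delta>1 where \<delta>1: "0 < \<delta>1" "\<forall>f\<in>\<F>. \<forall>x\<in>K. \<forall>y\<in>K. \<epsilon>/2 \<le> chordal (Some x) (Some y) \<longrightarrow> \<delta>1 \<le> chordal (f x) (f y)"
    using assms unfolding equi_uniform_def by (meson half_gt_zero)
  have "\<delta>1 \<le> chordal_diam (f ` C)" if f: "f \<in> \<F>" and C: "C \<subseteq> K" "\<epsilon> \<le> chordal_diam (Some ` C)" for f C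
  proof -
    obtain x y where xy: "x \<in> C" "y \<in> C" "\<epsilon>/2 \<le> chordal (Some x) (Some y)"
      using chordal_diam_half_attained[OF C(2) \<epsilon>] by blast
    then have "\<delta>1 \<le> chordal (f x) (f y)" using \<delta>1(2) f C(1) by blast
    also have "\<dots> \<le> chordal_diam (f ` C)" using xy(1,2) by (intro chordal_le_diam) auto
    finally show ?thesis .
  qed
  then show "\<exists>\<delta>1>0. \<forall>f\<in>\<F>. \<forall>C. C \<subseteq> K \<and> C \<noteq> {} \<and> compact C \<and> connected C \<and>
      \<epsilon> \<le> chordal_diam (Some ` C) \<longrightarrow> \<delta>1 \<le> chordal_diam (f ` C)" using \<delta>1(1) by auto
qed

text \<open>The arc is the radial projection of the chord. The chord misses the centre because its
  length is below the radius, and the projection moves a point y, taken relative to the centre, by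
  \<open>\<bar>s - norm y\<bar>\<close>, which is at most its distance from the end
  \<open>p\<close>; hence the factor 2.\<close>

lemma sphere_short_arc:
  fixes m p q :: "'a::real_normed_vector"
  assumes s: "0 < s" and p: "p \<in> sphere m s" and q: "q \<in> sphere m s" and pq: "dist p q < s"
  obtains T where "connected T" "T \<subseteq> sphere m s" "p \<in> T" "q \<in> T" "\<And>z. z \<in> T \<Longrightarrow> dist z p \<le> 2 * dist p q"
proof -
  define a b where "a = p - m" and "b = q - m"
  have norm: "norm a = s" "norm b = s" using p q by (auto simp: a_def b_def dist_norm norm_minus_commute)
  have ab: "dist p q = norm (b - a)" by (simp add: a_def b_def dist_norm norm_minus_commute)
  define \<phi> where "\<phi> = (\<lambda>y. m + (s / norm y) *\<^sub>R y)"
  have near: "norm (y - a) \<le> norm (b - a)" if "y \<in> closed_segment a b" for y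
    using segment_bound1[OF that] by (simp add: norm_minus_commute)
  have nz: "y \<noteq> 0" if "y \<in> closed_segment a b" for y
    using near[OF that] pq ab norm(1) by auto
  show ?thesis
  proof (rule that[of "\<phi> ` closed_segment a b"])
    have "continuous_on (closed_segment a b) \<phi>" unfolding \<phi>_def using nz by (intro continuous_intros) auto
    then show "connected (\<phi> ` closed_segment a b)" by (rule connected_continuous_image) simp
    show "\<phi> ` closed_segment a b \<subseteq> sphere m s" using nz s by (auto simp: \<phi>_def dist_norm)
    have "\<phi> a = p" "\<phi> b = q" using norm s by (simp_all add: \<phi>_def) (simp_all add: a_def b_def)
    then show "p \<in> \<phi> ` closed_segment a b" "q \<in> \<phi> ` closed_segment a b" by force+
    fix z assume "z \<in> \<phi> ` closed_segment a b"
    then obtain y where y: "y \<in> closed_segment a b" "z = \<phi> y" by blast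
    have "z - p = ((s / norm y) *\<^sub>R y - y) + (y - a)" by (simp add: y(2) \<phi>_def a_def)
    then have "dist z p \<le> norm ((s / norm y) *\<^sub>R y - y) + norm (y - a)" by (metis dist_norm norm_triangle_ineq)
    moreover have "norm ((s / norm y) *\<^sub>R y - y) = \<bar>s - norm y\<bar>"
    proof -
      have "(s / norm y) *\<^sub>R y - y = ((s - norm y) / norm y) *\<^sub>R y" using nz[OF y(1)] by (simp add: diff_divide_distrib scaleR_left_diff_distrib)
      then show ?thesis using nz[OF y(1)] by simp
    qed
    moreover have "\<bar>s - norm y\<bar> \<le> norm (y - a)" using norm_triangle_ineq3[of y a] norm(1) by (simp add: abs_minus_commute)
    ultimately show "dist z p \<le> 2 * dist p q" using near[OF y(1)] ab by linarith
  qed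
qed

lemma chordal_ge_norm:
  assumes "norm x \<le> M" "norm y \<le> M"
  shows "norm (x - y) / (1 + M\<^sup>2) \<le> chordal (Some x) (Some y)"
proof -
  have "sqrt (1 + (norm x)\<^sup>2) * sqrt (1 + (norm y)\<^sup>2) \<le> sqrt (1 + M\<^sup>2) * sqrt (1 + M\<^sup>2)"
    using assms by (intro mult_mono) (auto intro: power_mono)
  also have "\<dots> = 1 + M\<^sup>2" by (simp add: add_nonneg_nonneg)
  finally have "norm (x - y) / (1 + M\<^sup>2) \<le> norm (x - y) / (sqrt (1 + (norm x)\<^sup>2) * sqrt (1 + (norm y)\<^sup>2))"
    using one_plus_norm_sq_pos[of x] one_plus_norm_sq_pos[of y]
    by (intro divide_left_mono mult_pos_pos add_pos_nonneg) auto
  then show ?thesis by (simp add: chordal.simps)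
qed

text \<open>The sphere of radius \<open>\<epsilon>/2\<close> about \<open>x0\<close> is sent to
  distance at least \<open>\<delta>1\<close> from \<open>f x0\<close>. A short arc from
  \<open>f x0\<close> to a point within \<open>r0\<close> stays within \<open>2 * r0\<close>, less
  than \<open>\<delta>1\<close>, so it cannot cross the frontier of the image of the ball and must
  end inside it.\<close>

lemma equi_uniform_imp_uniformly_open:
  fixes D K :: "'a::euclidean_space set"
  assumes emb: "\<And>f. f \<in> \<F> \<Longrightarrow> sphere_embedding D f" and K: "compact K" "K \<subseteq> D" and eu: "equi_uniform \<F> K"
  shows "uniformly_open \<F> K"
  unfolding uniformly_open_def
proof (intro allI impI)
  fix \<epsilon> :: real assume \<epsilon>: "0 < \<epsilon>"
  obtain M where M: "\<And>z. z \<in> K \<Longrightarrow> norm z \<le> M" using compact_imp_bounded[OF K(1)] unfolding bounded_iff by blast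
  have pos: "0 < 1 + M\<^sup>2" by (simp add: add_pos_nonneg)
  then have "0 < (\<epsilon>/2) / (1 + M\<^sup>2)" using \<epsilon> by simp
  then obtain \<delta>1 where \<delta>1: "0 < \<delta>1" "\<forall>f\<in>\<F>. \<forall>x\<in>K. \<forall>y\<in>K. (\<epsilon>/2) / (1 + M\<^sup>2) \<le> chordal (Some x) (Some y) \<longrightarrow> \<delta>1 \<le> chordal (f x) (f y)"
    using eu unfolding equi_uniform_def by meson
  \<comment> \<open>\<open>1/2\<close> is the radius of the projected sphere, below which short arcs
    exist; \<open>\<delta>1/3\<close> makes the doubled distance smaller than
    \<open>\<delta>1\<close>.\<close>
  define r0 where "r0 = min (1/2) (\<delta>1/3)"
  have r0: "0 < r0" "r0 \<le> 1/2" "2 * r0 < \<delta>1" using \<delta>1(1) by (auto simp: r0_def)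
  have "chordal_ball (f x0) r0 \<subseteq> f ` ball x0 \<epsilon>" if f: "f \<in> \<F>" and x0: "ball x0 \<epsilon> \<subseteq> K" for f x0
  proof
    interpret sphere_embedding D f by (rule emb[OF f])
    fix w assume "w \<in> chordal_ball (f x0) r0"
    then have w: "dist (F x0) (sproj w) < r0" by (simp add: chordal_ball_def chordal_eq_dist dist_commute)
    \<comment> \<open>Half the radius, because only the open ball of radius \<epsilon> is known to
      lie in \<open>K\<close>, while a closed ball is needed for compactness of the image.\<close>
    let ?U = "ball x0 (\<epsilon>/2)"
    have cb: "cball x0 (\<epsilon>/2) \<subseteq> ball x0 \<epsilon>" using \<epsilon> by auto
    then have cbK: "cball x0 (\<epsilon>/2) \<subseteq> K" using x0 by blast
    have S: "range (sproj :: 'a option \<Rightarrow> 'a \<times> real) = sphere (0, 1/2) (1/2)" by (rule range_sproj)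
    have half: "(0::real) < 1/2" by simp
    obtain T where T: "connected T" "T \<subseteq> sphere (0, 1/2) (1/2)" "F x0 \<in> T" "sproj w \<in> T"
      "\<And>z. z \<in> T \<Longrightarrow> dist z (F x0) \<le> 2 * dist (F x0) (sproj w)"
    proof (rule sphere_short_arc[OF half])
      show "F x0 \<in> sphere (0, 1/2) (1/2)" "sproj w \<in> sphere (0, 1/2) (1/2)" unfolding S[symmetric] by auto
      show "dist (F x0) (sproj w) < 1/2" using w r0(2) by linarith
    qed blast
    have "T \<subseteq> F ` ?U"
    proof (rule connected_subset_open_image)
      show "?U \<subseteq> D" using cbK K(2) ball_subset_cball by blast
      show "T \<subseteq> range sproj" unfolding S by (rule T(2))
      have "x0 \<in> ?U" using \<epsilon> by simp
      then show "T \<inter> F ` ?U \<noteq> {}" using T(3) by blast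
      show "T \<inter> (closure (F ` ?U) - F ` ?U) = {}"
      proof (rule ccontr)
        assume "\<not> ?thesis"
        then obtain z where z: "z \<in> T" "z \<in> closure (F ` ?U)" "z \<notin> F ` ?U" by blast
        have "compact (F ` cball x0 (\<epsilon>/2))"
          using cbK K(2) by (intro compact_continuous_image continuous_on_subset[OF cont]) auto
        then have "closure (F ` ?U) \<subseteq> F ` cball x0 (\<epsilon>/2)"
          by (intro closure_minimal compact_imp_closed image_mono ball_subset_cball)
        then obtain y where y: "y \<in> cball x0 (\<epsilon>/2)" "z = F y" using z(2) by blast
        have "y \<notin> ?U" using y(2) z(3) by blast
        then have dist: "norm (y - x0) = \<epsilon>/2" using y(1) by (simp add: dist_norm norm_minus_commute)
        have yK: "y \<in> K" "x0 \<in> K" using y(1) cbK \<epsilon> by auto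
        have "(\<epsilon>/2) / (1 + M\<^sup>2) \<le> chordal (Some y) (Some x0)"
          using chordal_ge_norm[OF M[OF yK(1)] M[OF yK(2)]] by (simp only: dist)
        then have "\<delta>1 \<le> chordal (f y) (f x0)" using \<delta>1(2) f yK by blast
        moreover have "dist z (F x0) \<le> 2 * dist (F x0) (sproj w)" by (rule T(5)[OF z(1)])
        ultimately show False using w r0(3) y(2) by (simp add: chordal_eq_dist)
      qed
    qed (use T(1) in auto)
    then have "w \<in> f ` ?U" using T(4) sproj_mem_image_iff by blast
    then show "w \<in> f ` ball x0 \<epsilon>" using cb ball_subset_cball by blast
  qed
  then show "\<exists>r0>0. \<forall>f\<in>\<F>. \<forall>x0. ball x0 \<epsilon> \<subseteq> K \<longrightarrow> chordal_ball (f x0) r0 \<subseteq> f ` ball x0 \<epsilon>" using r0(1) by blast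
qed

section \<open>The exponential bound for integrable Q\<close>

lemma card_le_of_close:
  fixes S :: "nat set"
  assumes "finite S" and close: "\<And>i j. i \<in> S \<Longrightarrow> j \<in> S \<Longrightarrow> i \<le> j \<Longrightarrow> j < i + k"
  shows "card S \<le> k"
proof (cases "S = {}")
  case False
  have "Min S \<in> S" using False assms(1) by simp
  then have "S \<subseteq> {Min S..<Min S + k}" using close assms(1) by auto
  then have "card S \<le> card {Min S..<Min S + k}" by (intro card_mono) auto
  then show ?thesis by simp
qed simp

text \<open>Consecutive centres are \<open>dist x y / 8\<close> apart and the balls have radius
  \<open>dist x y / 4\<close>, so the indices of the balls containing a given point differ by less
  than 4.\<close>

lemma sum_ring_indicator_le:
  fixes x y z :: "'a::real_normed_vector"
  assumes "x \<noteq> y"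
  shows "(\<Sum>i\<le>N. indicator {z. dist z (x + (real i / 8) *\<^sub>R (x - y)) < dist x y / 4} z :: ennreal) \<le> 4"
proof -
  define c where "c = (\<lambda>i. x + (real i / 8) *\<^sub>R (x - y))"
  define S where "S = {i \<in> {..N}. dist z (c i) < dist x y / 4}"
  have "j < i + 4" if "i \<in> S" "j \<in> S" "i \<le> j" for i j
  proof -
    have "c j - c i = ((real j - real i) / 8) *\<^sub>R (x - y)" by (simp add: c_def algebra_simps diff_divide_distrib)
    then have "dist (c j) (c i) = (real j - real i) / 8 * dist x y" using that(3) by (simp add: dist_norm)
    moreover have "dist (c j) (c i) < dist x y / 4 + dist x y / 4"
      using dist_triangle3[of "c j" "c i" z] that(1,2) by (simp add: S_def)
    ultimately have "(real j - real i) / 8 * dist x y < 1/2 * dist x y" by linarith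
    then have "(real j - real i) / 8 < 1/2" using assms by (simp only: mult_less_cancel_right) auto
    then have "real j < real (i + 4)" by simp
    then show ?thesis by (simp only: of_nat_less_iff)
  qed
  then have "card S \<le> 4" by (intro card_le_of_close) (auto simp: S_def)
  moreover have "(\<Sum>i\<le>N. indicator {z. dist z (c i) < dist x y / 4} z :: ennreal) = of_nat (card S)"
  proof -
    have "(\<Sum>i\<le>N. indicator {z. dist z (c i) < dist x y / 4} z :: ennreal) = (\<Sum>i\<in>{..N}. if i \<in> S then 1 else 0)"
      by (intro sum.cong) (auto simp: S_def indicator_def)
    also have "\<dots> = of_nat (card ({..N} \<inter> S))" by (simp add: sum.If_cases)
    also have "{..N} \<inter> S = S" by (auto simp: S_def)
    finally show ?thesis .
  qed
  moreover have "(of_nat (card S) :: ennreal) \<le> of_nat 4" using \<open>card S \<le> 4\<close> by (simp only: of_nat_le_iff)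
  ultimately show ?thesis by (simp add: c_def)
qed

text \<open>Each ring has width \<open>dist x y / 8\<close>, so the constant weight
  \<open>8 / dist x y\<close> is admissible. After summation under the integral the overlap bound 4
  makes the estimate independent of the number of rings. The point y certifies that the outer radius
  is legitimate at every centre.\<close>

lemma modulus_sum_ray_le:
  fixes D :: "'a::euclidean_space set"
  assumes D: "open D" and Q: "Q \<in> borel_measurable (restrict_space lebesgue D)"
    and fin: "(\<integral>\<^sup>+x\<in>D. Q x \<partial>lebesgue) < \<infinity>"
    and f: "\<forall>c\<in>D. ring_Q_ineq f Q D c" and xy: "x \<noteq> y" "y \<in> D"
    and c: "\<forall>i\<le>N. x + (real i / 8) *\<^sub>R (x - y) \<in> D"
  shows "(\<Sum>i\<le>N. modulus (image_family f D (curves (sphere (x + (real i / 8) *\<^sub>R (x - y)) (dist x y / 8))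
      (sphere (x + (real i / 8) *\<^sub>R (x - y)) (dist x y / 4)) D)))
    \<le> ennreal (4 * (8 / dist x y) ^ DIM('a) * enn2real (\<integral>\<^sup>+x\<in>D. Q x \<partial>lebesgue))"
proof -
  define \<epsilon> where "\<epsilon> = dist x y"
  define k where "k = ennreal (8 / \<epsilon>) ^ DIM('a)"
  define p where "p = (\<lambda>i. x + (real i / 8) *\<^sub>R (x - y))"
  have \<epsilon>: "0 < \<epsilon>" "0 < \<epsilon>/8" "\<epsilon>/8 < \<epsilon>/4" using xy(1) by (auto simp: \<epsilon>_def)
  have "D \<in> sets lebesgue" using D by (intro sets_completionI_sets) auto
  then have m: "(\<lambda>x. Q x * indicator D x) \<in> borel_measurable lebesgue"
    using Q by (subst (asm) borel_measurable_restrict_space_iff_ennreal) auto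
  have ball: "{z. dist z (p i) < \<epsilon>/4} \<in> sets lebesgue" for i
  proof -
    have "{z. dist z (p i) < \<epsilon>/4} = ball (p i) (\<epsilon>/4)" by (auto simp: dist_commute)
    then show ?thesis by (simp add: sets_completionI_sets)
  qed
  have w: "1 / (\<epsilon>/4 - \<epsilon>/8) = 8 / \<epsilon>" using \<epsilon> by (simp add: field_simps)
  have "modulus (image_family f D (curves (sphere (p i) (\<epsilon>/8)) (sphere (p i) (\<epsilon>/4)) D))
      \<le> (\<integral>\<^sup>+z. k * (Q z * indicator D z) * indicator {z. dist z (p i) < \<epsilon>/4} z \<partial>lebesgue)" if i: "i \<in> {..N}" for i
  proof -
    have "\<epsilon> \<le> dist y (p i)" using dist_opposite_rays[of "real i / 8" 0 x y] by (simp add: p_def \<epsilon>_def dist_commute)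
    then have far: "\<exists>w\<in>D. \<epsilon>/4 < dist w (p i)" using xy(2) \<epsilon> by (intro bexI[of _ y]) auto
    have "p i \<in> D" using c i by (simp add: p_def)
    then have "ring_Q_ineq f Q D (p i)" using f by blast
    then have "modulus (image_family f D (curves (sphere (p i) (\<epsilon>/8)) (sphere (p i) (\<epsilon>/4)) D)) \<le>
        (\<integral>\<^sup>+z\<in>({z. \<epsilon>/8 < dist z (p i) \<and> dist z (p i) < \<epsilon>/4} \<inter> D). Q z * ennreal (1 / (\<epsilon>/4 - \<epsilon>/8)) ^ DIM('a) \<partial>lebesgue)"
      unfolding ring_Q_ineq_def using far \<epsilon>(2,3) integrable_ring_weight[OF \<epsilon>(2,3)] by blast
    also have "\<dots> \<le> (\<integral>\<^sup>+z. k * (Q z * indicator D z) * indicator {z. dist z (p i) < \<epsilon>/4} z \<partial>lebesgue)"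
      unfolding w k_def[symmetric] by (intro nn_integral_mono) (auto split: split_indicator simp: mult.commute)
    finally show ?thesis .
  qed
  then have "(\<Sum>i\<le>N. modulus (image_family f D (curves (sphere (p i) (\<epsilon>/8)) (sphere (p i) (\<epsilon>/4)) D)))
      \<le> (\<Sum>i\<le>N. \<integral>\<^sup>+z. k * (Q z * indicator D z) * indicator {z. dist z (p i) < \<epsilon>/4} z \<partial>lebesgue)"
    by (rule sum_mono)
  also have "\<dots> = (\<integral>\<^sup>+z. (\<Sum>i\<le>N. k * (Q z * indicator D z) * indicator {z. dist z (p i) < \<epsilon>/4} z) \<partial>lebesgue)"
    by (intro nn_integral_sum[symmetric] borel_measurable_times_ennreal borel_measurable_const borel_measurable_indicator m ball)
  also have "\<dots> \<le> (\<integral>\<^sup>+z. (4 * k) * (Q z * indicator D z) \<partial>lebesgue)"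
  proof (rule nn_integral_mono)
    fix z :: 'a
    have "(\<Sum>i\<le>N. k * (Q z * indicator D z) * indicator {z. dist z (p i) < \<epsilon>/4} z)
        = k * (Q z * indicator D z) * (\<Sum>i\<le>N. indicator {z. dist z (p i) < \<epsilon>/4} z)"
      by (rule sum_distrib_left[symmetric])
    also have "\<dots> \<le> k * (Q z * indicator D z) * 4"
      unfolding p_def \<epsilon>_def by (intro mult_left_mono sum_ring_indicator_le xy(1)) simp
    also have "\<dots> = (4 * k) * (Q z * indicator D z)" by (simp add: mult_ac)
    finally show "(\<Sum>i\<le>N. k * (Q z * indicator D z) * indicator {z. dist z (p i) < \<epsilon>/4} z) \<le> (4 * k) * (Q z * indicator D z)" .
  qed
  also have "\<dots> = (4 * k) * (\<integral>\<^sup>+x\<in>D. Q x \<partial>lebesgue)" by (rule nn_integral_cmult[OF m])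
  also have "\<dots> = ennreal (4 * (8 / \<epsilon>) ^ DIM('a) * enn2real (\<integral>\<^sup>+x\<in>D. Q x \<partial>lebesgue))"
  proof -
    have "(\<integral>\<^sup>+x\<in>D. Q x \<partial>lebesgue) = ennreal (enn2real (\<integral>\<^sup>+x\<in>D. Q x \<partial>lebesgue))" using fin by simp
    moreover have "4 * k = ennreal (4 * (8 / \<epsilon>) ^ DIM('a))"
      using \<epsilon>(1) by (simp add: k_def ennreal_power ennreal_mult)
    ultimately have "4 * k * (\<integral>\<^sup>+x\<in>D. Q x \<partial>lebesgue)
        = ennreal (4 * (8 / \<epsilon>) ^ DIM('a)) * ennreal (enn2real (\<integral>\<^sup>+x\<in>D. Q x \<partial>lebesgue))" by simp
    also have "\<dots> = ennreal (4 * (8 / \<epsilon>) ^ DIM('a) * enn2real (\<integral>\<^sup>+x\<in>D. Q x \<partial>lebesgue))"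
      using \<epsilon>(1) by (intro ennreal_mult[symmetric]) auto
    finally show ?thesis .
  qed
  finally show ?thesis by (simp only: p_def \<epsilon>_def)
qed

text \<open>The frontier bound provides one \<open>R\<close> for all points of \<open>K\<close>.
  Centres are placed at parameter steps of 1/8 along the ray; their number depends on the exit time,
  the modulus bound does not.\<close>

lemma frakA_exp_lower_bound:
  fixes D K :: "'a::euclidean_space set"
  assumes dim: "2 \<le> DIM('a)" and D: "open D" and K: "K \<subseteq> D"
    and Q: "Q \<in> borel_measurable (restrict_space lebesgue D)" "(\<integral>\<^sup>+x\<in>D. Q x \<partial>lebesgue) < \<infinity>"
    and r0: "0 < r0" "\<And>f x e. f \<in> frakA \<delta> r A Q D \<Longrightarrow> x \<in> K \<Longrightarrow>
      e \<in> closure ((\<lambda>x. sproj (f x)) ` D) - (\<lambda>x. sproj (f x)) ` D \<Longrightarrow> r0 \<le> dist e (sproj (f x))"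
  obtains C C1 :: real where "0 < C" "0 < C1"
    "\<And>f x y. f \<in> frakA \<delta> r A Q D \<Longrightarrow> x \<in> K \<Longrightarrow> y \<in> K \<Longrightarrow> x \<noteq> y \<Longrightarrow>
      C1 * exp (- (enn2real (\<integral>\<^sup>+ z\<in>D. Q z \<partial>lebesgue) / (C * dist x y ^ DIM('a)))) \<le> chordal (f x) (f y)"
proof -
  obtain C1 C2 :: real where C: "1 \<le> C1" "0 < C2" and
    S: "\<And>(D :: 'a set) f x y r1 r2 B R. sphere_embedding D f \<Longrightarrow> x \<in> D \<Longrightarrow> y \<in> D \<Longrightarrow> 0 < r1 \<Longrightarrow> r1 < r2 \<Longrightarrow>
      r1 + r2 \<le> dist x y \<Longrightarrow> 0 \<le> B \<Longrightarrow> 0 < R \<Longrightarrow>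
      \<forall>e\<in>closure ((\<lambda>x. sproj (f x)) ` D) - (\<lambda>x. sproj (f x)) ` D. 4 * R \<le> dist e (sproj (f x)) \<Longrightarrow>
      \<forall>T\<ge>0. (\<forall>t\<in>{0..T}. x + t *\<^sub>R (x - y) \<in> D) \<longrightarrow>
        (\<exists>I. finite I \<and> (\<forall>t\<in>{0..T}. \<exists>c\<in>I. dist (x + t *\<^sub>R (x - y)) c \<le> r1) \<and>
             (\<forall>c\<in>I. \<exists>t\<in>{0..T}. dist (x + t *\<^sub>R (x - y)) c \<le> r1) \<and>
             (\<Sum>c\<in>I. modulus (image_family f D (curves (sphere c r1) (sphere c r2) D))) \<le> ennreal B) \<Longrightarrow>
      R \<le> C1 * exp (C2 * B) * chordal (f x) (f y)"
    by (rule sphere_embedding_separation[OF dim]) (rule that)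
  define q where "q = enn2real (\<integral>\<^sup>+ z\<in>D. Q z \<partial>lebesgue)"
  define R where "R = r0 / 4"
  have R: "0 < R" using r0(1) by (simp add: R_def)
  \<comment> \<open>Chosen so that \<open>C2 * B\<close> equals
    \<open>q / (C3 * dist x y ^ DIM('a))\<close> for the modulus bound \<open>B\<close> of the
    ray.\<close>
  define C3 where "C3 = 1 / (C2 * 4 * 8 ^ DIM('a))"
  have C3: "0 < C3" using C(2) by (simp add: C3_def)
  have main: "R / C1 * exp (- (q / (C3 * dist x y ^ DIM('a)))) \<le> chordal (f x) (f y)"
    if f: "f \<in> frakA \<delta> r A Q D" and x: "x \<in> K" and y: "y \<in> K" and xy: "x \<noteq> y" for f x y
  proof -
    define B where "B = 4 * (8 / dist x y) ^ DIM('a) * q"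
    have B: "0 \<le> B" by (simp add: B_def q_def)
    have xD: "x \<in> D" and yD: "y \<in> D" using x y K by auto
    have e8: "0 < dist x y / 8" "dist x y / 8 < dist x y / 4" "dist x y / 8 + dist x y / 4 \<le> dist x y" using xy by auto
    define p where "p = (\<lambda>i. x + (real i / 8) *\<^sub>R (x - y))"
    have "inj p" using xy by (auto simp: p_def inj_on_def)
    have "R \<le> C1 * exp (C2 * B) * chordal (f x) (f y)"
    proof (rule S[OF frakA_sphere_embedding[OF D f] xD yD e8 B R])
      show "\<forall>e\<in>closure ((\<lambda>x. sproj (f x)) ` D) - (\<lambda>x. sproj (f x)) ` D. 4 * R \<le> dist e (sproj (f x))"
        using r0(2)[OF f x] by (simp add: R_def)
      show "\<forall>T\<ge>0. (\<forall>t\<in>{0..T}. x + t *\<^sub>R (x - y) \<in> D) \<longrightarrow>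
        (\<exists>I. finite I \<and> (\<forall>t\<in>{0..T}. \<exists>c\<in>I. dist (x + t *\<^sub>R (x - y)) c \<le> dist x y / 8) \<and>
             (\<forall>c\<in>I. \<exists>t\<in>{0..T}. dist (x + t *\<^sub>R (x - y)) c \<le> dist x y / 8) \<and>
             (\<Sum>c\<in>I. modulus (image_family f D (curves (sphere c (dist x y / 8)) (sphere c (dist x y / 4)) D))) \<le> ennreal B)"
      proof (intro allI impI)
        fix T :: real assume T: "0 \<le> T" "\<forall>t\<in>{0..T}. x + t *\<^sub>R (x - y) \<in> D"
        \<comment> \<open>The last step of length 1/8 that does not pass \<open>T\<close>, so that
          all centres lie on the part of the ray inside \<open>D\<close>.\<close>
        define N where "N = nat \<lfloor>8 * T\<rfloor>"
        have pT: "real i / 8 \<in> {0..T}" if "i \<le> N" for i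
        proof -
          have "real N \<le> 8 * T" using T(1) by (simp add: N_def)
          then have "real i \<le> 8 * T" using that by linarith
          then show ?thesis by simp
        qed
        have cover: "\<exists>c\<in>p ` {..N}. dist (x + t *\<^sub>R (x - y)) c \<le> dist x y / 8" if t: "t \<in> {0..T}" for t
        proof (intro bexI[of _ "p (nat \<lfloor>8 * t\<rfloor>)"] imageI)
          let ?i = "nat \<lfloor>8 * t\<rfloor>"
          have "\<lfloor>8 * t\<rfloor> \<le> \<lfloor>8 * T\<rfloor>" using t by (intro floor_mono) simp
          then show "?i \<in> {..N}" by (simp add: N_def nat_mono)
          have i: "real ?i = real_of_int \<lfloor>8 * t\<rfloor>" using t by simp
          have "\<bar>t - real ?i / 8\<bar> \<le> 1/8" unfolding i using floor_correct[of "8 * t"] by linarith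
          then have "\<bar>t - real ?i / 8\<bar> * dist x y \<le> 1/8 * dist x y" by (rule mult_right_mono) simp
          moreover have "(x + t *\<^sub>R (x - y)) - p ?i = (t - real ?i / 8) *\<^sub>R (x - y)" by (simp add: p_def scaleR_left_diff_distrib)
          then have "dist (x + t *\<^sub>R (x - y)) (p ?i) = \<bar>t - real ?i / 8\<bar> * dist x y" by (simp only: dist_norm norm_scaleR real_norm_def)
          ultimately show "dist (x + t *\<^sub>R (x - y)) (p ?i) \<le> dist x y / 8" by simp
        qed
        have near: "\<exists>t\<in>{0..T}. dist (x + t *\<^sub>R (x - y)) c \<le> dist x y / 8" if c: "c \<in> p ` {..N}" for c
        proof -
          obtain i where i: "i \<le> N" "c = p i" using c by blast
          show ?thesis using pT[OF i(1)] i(2) by (intro bexI[of _ "real i / 8"]) (auto simp: p_def)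
        qed
        have "(\<Sum>c\<in>p ` {..N}. modulus (image_family f D (curves (sphere c (dist x y / 8)) (sphere c (dist x y / 4)) D)))
          = (\<Sum>i\<le>N. modulus (image_family f D (curves (sphere (p i) (dist x y / 8)) (sphere (p i) (dist x y / 4)) D)))"
          by (rule sum.reindex_cong[OF inj_on_subset[OF \<open>inj p\<close> subset_UNIV] refl refl])
        also have "\<dots> \<le> ennreal B" unfolding B_def q_def p_def
        proof (rule modulus_sum_ray_le[OF D Q _ xy yD])
          show "\<forall>c\<in>D. ring_Q_ineq f Q D c" using f by (simp add: frakA_def)
          show "\<forall>i\<le>N. x + (real i / 8) *\<^sub>R (x - y) \<in> D" using T(2) pT by blast
        qed
        finally show "\<exists>I. finite I \<and> (\<forall>t\<in>{0..T}. \<exists>c\<in>I. dist (x + t *\<^sub>R (x - y)) c \<le> dist x y / 8) \<and>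
             (\<forall>c\<in>I. \<exists>t\<in>{0..T}. dist (x + t *\<^sub>R (x - y)) c \<le> dist x y / 8) \<and>
             (\<Sum>c\<in>I. modulus (image_family f D (curves (sphere c (dist x y / 8)) (sphere c (dist x y / 4)) D))) \<le> ennreal B"
          using cover near by (intro exI[of _ "p ` {..N}"] conjI ballI) auto
      qed
    qed
    then have "R * exp (- (C2 * B)) \<le> C1 * exp (C2 * B) * chordal (f x) (f y) * exp (- (C2 * B))"
      by (rule mult_right_mono) simp
    also have "\<dots> = C1 * chordal (f x) (f y)" by (simp add: exp_minus)
    finally have "R / C1 * exp (- (C2 * B)) \<le> chordal (f x) (f y)" using C(1) by (simp add: field_simps)
    moreover have "C2 * B = q / (C3 * dist x y ^ DIM('a))"
      using C(2) xy by (simp add: B_def C3_def power_divide)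
    ultimately show ?thesis by simp
  qed
  show ?thesis
  proof (rule that[OF C3])
    show "0 < R / C1" using R C(1) by simp
  qed (rule main[unfolded q_def])
qed

text \<open>The case x = y is left out of the exponential bound: its right-hand side is then to be
  read as 0, whereas division by zero evaluates to 0 and would turn it into
  \<open>C1\<close>.\<close>

theorem theorem4:
  fixes D A :: "'a::euclidean_space set" and Q :: "'a \<Rightarrow> ennreal" and \<delta> r :: real
  assumes "2 \<le> DIM('a)"
    and "open D" and "connected D" and "D \<noteq> {}"
    and "A \<subseteq> D" and "compact A" and "connected A" and "\<exists>a\<in>A. \<exists>b\<in>A. a \<noteq> b"
    and "Q \<in> borel_measurable (restrict_space lebesgue D)"
    and "sphere_integrability Q D"
    and "0 < \<delta>" and "0 < r"
  shows "(bounded D \<longrightarrow>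
            (\<forall>K. compact K \<and> K \<subseteq> D \<longrightarrow>
               equi_uniform (frakA \<delta> r A Q D) K \<and> uniformly_light (frakA \<delta> r A Q D) K \<and>
               uniformly_open (frakA \<delta> r A Q D) K))
       \<and> ((\<integral>\<^sup>+ x\<in>D. Q x \<partial>lebesgue) < \<infinity> \<and> (\<forall>f\<in>frakA \<delta> r A Q D. \<forall>x\<in>D. f x \<noteq> None) \<longrightarrow>
            (\<forall>K. compact K \<and> K \<subseteq> D \<longrightarrow>
               (\<exists>C>0. \<exists>C1>0. \<forall>f\<in>frakA \<delta> r A Q D. \<forall>x\<in>K. \<forall>y\<in>K. x \<noteq> y \<longrightarrow>
                  C1 * exp (- (enn2real (\<integral>\<^sup>+ z\<in>D. Q z \<partial>lebesgue) / (C * dist x y ^ DIM('a))))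
                    \<le> norm (the (f x) - the (f y)))))"
proof -
  note D = \<open>open D\<close> \<open>connected D\<close>
  have A: "A \<noteq> {}" using assms(8) by blast
  \<comment> \<open>Finite ring weights yield the frontier bound in both parts, and for bounded
    \<open>D\<close> the bound for the net of rings as well.\<close>
  have fin: "ring_finite Q D c r1 r2" if "c \<in> D" "0 < r1" "r1 < r2" "\<exists>x\<in>D. r2 < dist x c" for c r1 r2
    by (rule sphere_integrability_ring_finite[OF assms(1) D(1) assms(9,10) that])
  show ?thesis
  proof (intro conjI impI allI; (elim conjE)?)
    fix K assume "bounded D" and K: "compact K" "K \<subseteq> D"
    obtain r0 where r0: "0 < r0" "\<And>f x e. f \<in> frakA \<delta> r A Q D \<Longrightarrow> x \<in> K \<Longrightarrow>
        e \<in> closure ((\<lambda>x. sproj (f x)) ` D) - (\<lambda>x. sproj (f x)) ` D \<Longrightarrow> r0 \<le> dist e (sproj (f x))"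
      by (rule frakA_frontier_distance[OF assms(1) D assms(6,5) A K fin assms(11,12)]) (assumption+, rule that)
    show eu: "equi_uniform (frakA \<delta> r A Q D) K"
      by (rule equi_uniform_frakA[OF assms(1) D(1) \<open>bounded D\<close> K(2) _ r0(1)]) (rule fin, assumption+, rule r0(2))
    show "uniformly_light (frakA \<delta> r A Q D) K" by (rule equi_uniform_imp_uniformly_light[OF eu])
    show "uniformly_open (frakA \<delta> r A Q D) K"
      by (rule equi_uniform_imp_uniformly_open[OF frakA_sphere_embedding[OF D(1)] K eu])
  next
    fix K assume Q: "(\<integral>\<^sup>+ x\<in>D. Q x \<partial>lebesgue) < \<infinity>" and finite: "\<forall>f\<in>frakA \<delta> r A Q D. \<forall>x\<in>D. f x \<noteq> None"
      and K: "compact K" "K \<subseteq> D"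
    obtain r0 where r0: "0 < r0" "\<And>f x e. f \<in> frakA \<delta> r A Q D \<Longrightarrow> x \<in> K \<Longrightarrow>
        e \<in> closure ((\<lambda>x. sproj (f x)) ` D) - (\<lambda>x. sproj (f x)) ` D \<Longrightarrow> r0 \<le> dist e (sproj (f x))"
      by (rule frakA_frontier_distance[OF assms(1) D assms(6,5) A K fin assms(11,12)]) (assumption+, rule that)
    obtain C C1 :: real where C: "0 < C" "0 < C1" and
      le: "\<And>f x y. f \<in> frakA \<delta> r A Q D \<Longrightarrow> x \<in> K \<Longrightarrow> y \<in> K \<Longrightarrow> x \<noteq> y \<Longrightarrow>
        C1 * exp (- (enn2real (\<integral>\<^sup>+ z\<in>D. Q z \<partial>lebesgue) / (C * dist x y ^ DIM('a)))) \<le> chordal (f x) (f y)"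
      by (rule frakA_exp_lower_bound[OF assms(1) D(1) K(2) assms(9) Q r0(1)]) (rule r0(2), assumption+, rule that)
    show "\<exists>C>0. \<exists>C1>0. \<forall>f\<in>frakA \<delta> r A Q D. \<forall>x\<in>K. \<forall>y\<in>K. x \<noteq> y \<longrightarrow>
        C1 * exp (- (enn2real (\<integral>\<^sup>+ z\<in>D. Q z \<partial>lebesgue) / (C * dist x y ^ DIM('a)))) \<le> norm (the (f x) - the (f y))"
    proof (rule exI[of _ C], rule conjI[OF C(1)], rule exI[of _ C1], rule conjI[OF C(2)], intro ballI impI)
      fix f x y assume f: "f \<in> frakA \<delta> r A Q D" and xy: "x \<in> K" "y \<in> K" "x \<noteq> y"
      have "f x \<noteq> None" "f y \<noteq> None" using finite f xy K(2) by auto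
      then have "chordal (f x) (f y) \<le> norm (the (f x) - the (f y))" using chordal_le_norm by fastforce
      with le[OF f xy]
      show "C1 * exp (- (enn2real (\<integral>\<^sup>+ z\<in>D. Q z \<partial>lebesgue) / (C * dist x y ^ DIM('a)))) \<le> norm (the (f x) - the (f y))"
        by (rule order_trans)
    qed
  qed
qed

end
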